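(* Let $k\ge 1$ and let $f_\eta$, $\eta\in(\mathbb R^k,0)$, be a germ of generic $k$-parameter family unfolding an antiholomorphic parabolic germ, of the form $$f_\eta(z)=\overline z+\sum_{j=0}^{k+1}a_j(\eta)\overline z^{\,j}+\tfrac12\overline z^{\,k+1}+o(\overline z^{\,k+1}),\qquad a_j(0)=0,$$ with $f_0(z)=\overline z+\frac12\overline z^{\,k+1}+\left(\frac{k+1}{8}-\frac b2\right)\overline z^{\,2k+1}+o(\overline z^{\,2k+1})$, $b\in\mathbb R$. Then there exists a mix analytic (fibered) change of coordinate and parameters $(z,\eta)\mapsto(Z,\varepsilon)$ transforming $f_\eta$ to $$F_\varepsilon(Z)=\overline Z+P_\varepsilon(\overline Z)\left(\tfrac12+Q_\varepsilon(\overline Z)+P_\varepsilon(\overline Z)R_\varepsilon(\overline Z)\right),$$ where (i) $P_\varepsilon(\overline Z)=\overline Z^{\,k+1}+\sum_{j=0}^{k-1}\varepsilon_j\overline Z^{\,j}$, with $\varepsilon=(\varepsilon_0,\dots,\varepsilon_{k-1})$, and $Q_\varepsilon$ is a polynomial of degree at most $k$ with coefficients real analytic in $\varepsilon$; (ii) if $Z_1,\dots,Z_{k+1}$ are the fixed points and periodic points of period $2$ of $F_\varepsilon$, i.e. the fixed points of $G_\varepsilon=F_\varepsilon\circ F_\varepsilon$, then $b(\varepsilon):=\sum_{s=1}^{k+1}\frac1{\log G_\varepsilon'(Z_s)}$ is real analytic in $\varepsilon$ with real values; (iii) if $v_\varepsilon=\frac{P_\varepsilon(Z)}{1+b(\varepsilon)Z^k}\frac{\partial}{\partial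 Z}$, then $\log F_\varepsilon'(Z_s)=\frac12\,\overline{v_\varepsilon'(Z_s)}$ for $s=1,\dots,k+1$.
   Context: A map $f$ on a domain of $\mathbb C$ is antiholomorphic if $\partial f/\partial z=0$; then $f'$ denotes $\partial f/\partial\overline z$. For a holomorphic map $G$, $G'$ is the usual derivative. For a vector field $v_\varepsilon=V(Z)\frac{\partial}{\partial Z}$, $v_\varepsilon'$ denotes $dV/dZ$. The family $f_\eta$ consists of germs of antiholomorphic diffeomorphisms in $z$ near $0$, depending real-analytically on $\eta=(\eta_0,\dots,\eta_{k-1})\in(\mathbb R^k,0)$. It is generic if the change of parameters $\eta\mapsto(\mathrm{Re}(a_0),\dots,\mathrm{Re}(a_{k-1}))$ is invertible (a local real-analytic diffeomorphism at $0$). A change $(z,\eta)\mapsto(Z,\varepsilon)=(H(z,\eta),\phi(\eta))$ is mix analytic if it is a diffeomorphism on a neighborhood $\mathbb D_r\times\prod_{\ell=0}^{k-1}(-\delta_\ell,\delta_\ell)$ of $0\in\mathbb C\times\mathbb R^k$, $\phi$ is real-analytic in $\eta$, and $H$ is holomorphic in $z$ and real-analytic in $\eta$. It transforms $f_\eta$ to $F_\varepsilon$ when $H(f_\eta(z),\eta)=F_{\phi(\eta)}(H(z,\eta))$. Here $R_\varepsilon(\overline Z)$ is holomorphic in $\overline Z$ and real-analytic in $\varepsilon$. The fixed points and period-2 points considered are those near $0$ (merging to $0$ when $\varepsilon=0$), counted with multiplicity; $\log$ is the branch with $\log 1=0$. The sum defining $b(\varepsilon)$ is taken for simple fixed points and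 extended by continuity to parameter values where fixed points coincide. *)

theory Defs
  imports "HOL-Complex_Analysis.Complex_Analysis" "HOL-Library.Landau_Symbols" "HOL-Library.Multiset"
begin

text \<open>
  Real-analytic maps: around every point of \<open>U\<close> the map is the sum of an (unconditionally)
  convergent power series in the coordinates. The multi-indices are the functions
  \<open>Basis \<rightarrow>\<^sub>E UNIV\<close>, so \<open>\<alpha> b\<close> is the exponent of the coordinate \<open>(x - a) \<bullet> b\<close>.
\<close>

definition real_analytic_on ::
    "('a::euclidean_space \<Rightarrow> 'b::real_normed_vector) \<Rightarrow> 'a set \<Rightarrow> bool" where
  "real_analytic_on f U \<longleftrightarrow>
     (\<forall>a\<in>U. \<exists>c. \<exists>r>0. \<forall>x\<in>ball a r.
        ((\<lambda>\<alpha>. (\<Prod>b\<in>Basis. ((x - a) \<bullet> b) ^ \<alpha> b) *\<^sub>R c \<alpha>) has_sum f x)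
          (Basis \<rightarrow>\<^sub>E (UNIV :: nat set)))"

definition real_analytic_diffeo ::
    "('a::euclidean_space \<Rightarrow> 'b::euclidean_space) \<Rightarrow> 'a set \<Rightarrow> 'b set \<Rightarrow> bool" where
  "real_analytic_diffeo f U V \<longleftrightarrow>
     open U \<and> open V \<and> bij_betw f U V \<and>
     real_analytic_on f U \<and> real_analytic_on (the_inv_into U f) V"

text \<open>The Wirtinger derivatives of \<open>f\<close> with respect to \<open>z\<close> and to \<open>cnj z\<close>.\<close>

definition d_z :: "(complex \<Rightarrow> complex) \<Rightarrow> complex \<Rightarrow> complex" where
  "d_z f z = (frechet_derivative f (at z) 1 - \<i> * frechet_derivative f (at z) \<i>) / 2"

definition d_zbar :: "(complex \<Rightarrow> complex) \<Rightarrow> complex \<Rightarrow> complex" where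
  "d_zbar f z = (frechet_derivative f (at z) 1 + \<i> * frechet_derivative f (at z) \<i>) / 2"

text \<open>The set \<open>S\<close> is meant to be open here.\<close>

definition antiholomorphic_on :: "(complex \<Rightarrow> complex) \<Rightarrow> complex set \<Rightarrow> bool" where
  "antiholomorphic_on f S \<longleftrightarrow> (\<forall>z\<in>S. f differentiable (at z) \<and> d_z f z = 0)"

definition antiholomorphic_diffeo_on :: "(complex \<Rightarrow> complex) \<Rightarrow> complex set \<Rightarrow> bool" where
  "antiholomorphic_diffeo_on f S \<longleftrightarrow>
     antiholomorphic_on f S \<and> inj_on f S \<and> (\<forall>z\<in>S. d_zbar f z \<noteq> 0)"

text \<open>
  Families are written \<open>f \<eta> z\<close> with the parameter first. Analytic dependence on the
  parameter is joint analyticity in \<open>(z, \<eta>)\<close>.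
\<close>

definition antiholomorphic_family ::
    "(real^'k \<Rightarrow> complex \<Rightarrow> complex) \<Rightarrow> real \<Rightarrow> (real^'k) set \<Rightarrow> bool" where
  "antiholomorphic_family f r U \<longleftrightarrow>
     real_analytic_on (\<lambda>(z, \<eta>). f \<eta> z) (ball 0 r \<times> U) \<and>
     (\<forall>\<eta>\<in>U. antiholomorphic_diffeo_on (f \<eta>) (ball 0 r))"

definition mix_analytic_on ::
    "(real^'k \<Rightarrow> complex \<Rightarrow> complex) \<Rightarrow> real \<Rightarrow> (real^'k) set \<Rightarrow> bool" where
  "mix_analytic_on h r U \<longleftrightarrow>
     real_analytic_on (\<lambda>(z, \<eta>). h \<eta> z) (ball 0 r \<times> U) \<and>
     (\<forall>\<eta>\<in>U. h \<eta> holomorphic_on ball 0 r)"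

definition param_box :: "real^'k \<Rightarrow> (real^'k) set" where
  "param_box \<delta> = {\<eta>. \<forall>i. \<bar>\<eta> $ i\<bar> < \<delta> $ i}"

definition mix_analytic_change ::
    "(real^'k \<Rightarrow> complex \<Rightarrow> complex) \<Rightarrow> (real^'k \<Rightarrow> real^'k) \<Rightarrow> real \<Rightarrow> real^'k \<Rightarrow> bool" where
  "mix_analytic_change H \<phi> r \<delta> \<longleftrightarrow>
     0 < r \<and> (\<forall>i. 0 < \<delta> $ i) \<and> H 0 0 = 0 \<and> \<phi> 0 = 0 \<and>
     mix_analytic_on H r (param_box \<delta>) \<and>
     real_analytic_on \<phi> (param_box \<delta>) \<and>
     (let \<Psi> = (\<lambda>(z, \<eta>). (H \<eta> z, \<phi> \<eta>)); D = ball 0 r \<times> param_box \<delta>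
      in real_analytic_diffeo \<Psi> D (\<Psi> ` D))"

definition transforms_family ::
    "(real^'k \<Rightarrow> complex \<Rightarrow> complex) \<Rightarrow> (real^'k \<Rightarrow> real^'k) \<Rightarrow> real \<Rightarrow> real^'k \<Rightarrow>
     (real^'k \<Rightarrow> complex \<Rightarrow> complex) \<Rightarrow> (real^'k \<Rightarrow> complex \<Rightarrow> complex) \<Rightarrow> bool" where
  "transforms_family H \<phi> r \<delta> f F \<longleftrightarrow>
     (\<forall>\<eta>\<in>param_box \<delta>. \<forall>z\<in>ball 0 r. f \<eta> z \<in> ball 0 r \<longrightarrow>
        H \<eta> (f \<eta> z) = F (\<phi> \<eta>) (H \<eta> z))"

text \<open>
  The parameter space is \<open>real^'k\<close>; a bijection \<open>\<iota>\<close> from \<open>'k\<close> onto \<open>{..<k}\<close> numbers the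
  coordinates, so that \<open>\<epsilon> $ i\<close> is the component with number \<open>\<iota> i\<close>.
\<close>

definition generic_family :: "('k::finite \<Rightarrow> nat) \<Rightarrow> (nat \<Rightarrow> real^'k \<Rightarrow> complex) \<Rightarrow> bool" where
  "generic_family \<iota> a \<longleftrightarrow>
     (\<exists>U V. 0 \<in> U \<and> real_analytic_diffeo (\<lambda>\<eta>. \<chi> i. Re (a (\<iota> i) \<eta>)) U V)"

definition P_poly :: "('k::finite \<Rightarrow> nat) \<Rightarrow> real^'k \<Rightarrow> complex poly" where
  "P_poly \<iota> \<epsilon> =
     monom 1 (CARD('k) + 1) + (\<Sum>i\<in>UNIV. monom (complex_of_real (\<epsilon> $ i)) (\<iota> i))"

definition prepared_family ::
    "('k::finite \<Rightarrow> nat) \<Rightarrow> (real^'k \<Rightarrow> complex poly) \<Rightarrow> (real^'k \<Rightarrow> complex \<Rightarrow> complex) \<Rightarrow>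
     real^'k \<Rightarrow> complex \<Rightarrow> complex" where
  "prepared_family \<iota> Q R \<epsilon> Z =
     cnj Z + poly (P_poly \<iota> \<epsilon>) (cnj Z) *
       (1/2 + poly (Q \<epsilon>) (cnj Z) + poly (P_poly \<iota> \<epsilon>) (cnj Z) * R \<epsilon> (cnj Z))"

text \<open>\<open>M\<close> lists the fixed points of \<open>G\<close> in \<open>S\<close>, each with its multiplicity as a zero of \<open>G w - w\<close>.\<close>

definition is_fixed_point_mset ::
    "(complex \<Rightarrow> complex) \<Rightarrow> complex set \<Rightarrow> complex multiset \<Rightarrow> bool" where
  "is_fixed_point_mset G S M \<longleftrightarrow>
     set_mset M = {z\<in>S. G z = z} \<and>
     (\<forall>z\<in>#M. int (count M z) = zorder (\<lambda>w. G w - w) z)"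

definition simple_params ::
    "(real^'k \<Rightarrow> complex \<Rightarrow> complex) \<Rightarrow> complex set \<Rightarrow> (real^'k) set \<Rightarrow> (real^'k) set" where
  "simple_params G S V =
     {\<epsilon>\<in>V. \<forall>z\<in>S. G \<epsilon> z = z \<longrightarrow> zorder (\<lambda>w. G \<epsilon> w - w) z = 1}"

definition inverse_log_sum :: "(complex \<Rightarrow> complex) \<Rightarrow> complex set \<Rightarrow> complex" where
  "inverse_log_sum G S = (\<Sum>z | z \<in> S \<and> G z = z. 1 / Ln (deriv G z))"

text \<open>
  The function \<open>b(\<epsilon>)\<close>: the sum of \<open>1 / log G'(Z\<^sub>s)\<close> where the fixed points are simple, extended
  by continuity (as a limit along the parameters with simple fixed points) elsewhere.
\<close>

definition b_fun ::
    "(real^'k \<Rightarrow> complex \<Rightarrow> complex) \<Rightarrow> complex set \<Rightarrow> (real^'k) set \<Rightarrow> real^'k \<Rightarrow> complex" where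
  "b_fun G S V \<epsilon> =
     (if \<epsilon> \<in> simple_params G S V then inverse_log_sum (G \<epsilon>) S
      else Lim (at \<epsilon> within simple_params G S V) (\<lambda>\<epsilon>'. inverse_log_sum (G \<epsilon>') S))"

end

theory Submission
  imports Defs "HOL-Computational_Algebra.Fundamental_Theorem_Algebra"
begin

unbundle no fps_syntax

text \<open>
  The parameters are complexified: \<open>f\<^sub>\<eta> z = g (cnj z, \<eta>)\<close> with \<open>g\<close> holomorphic near the origin, and
  \<open>cc F\<close> is \<open>F\<close> conjugated in source and target, so that \<open>F\<close> is real for real arguments iff \<open>cc F = F\<close>.

  The midpoints \<open>(w + g w) / 2\<close> serve as a chart in which \<open>f\<close> is \<open>y \<mapsto> cnj y + e (cnj y)\<close> with
  \<open>cc e - e = o(e)\<close>. Hence \<open>e\<close> vanishes exactly at the fixed points of \<open>f \<circ> f\<close>, and there the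
  function \<open>X = e log(1 + e') / e' + its conjugate\<close> vanishes with \<open>X'\<close> equal to the logarithm of the
  multiplier. One looks for a polynomial change \<open>T\<close>, the polynomial \<open>P\<^sub>\<epsilon>\<close> and the number \<open>\<beta>\<close> such that
  \<open>P\<^sub>\<epsilon>\<^sup>2\<close> divides \<open>(1 + \<beta> Z^k) X(T Z) - T'(Z) P\<^sub>\<epsilon>(Z)\<close>. This amounts to the vanishing of \<open>2 k + 2\<close>
  moments, with as many unknowns, and the implicit function theorem applies. At the roots of \<open>P\<^sub>\<epsilon>\<close> it
  gives \<open>X'(T Z) = P\<^sub>\<epsilon>'(Z) / (1 + \<beta> Z^k)\<close>, so that \<open>\<beta>\<close> is the sum of the inverse logarithms by Lagrange
  interpolation. The change \<open>y \<mapsto> y + e s(e')\<close> with \<open>1 + u s(u) = (1 + u)\<^bsup>-1/2\<^esup>\<close> splits the multiplier of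
  \<open>f \<circ> f\<close> evenly between the two factors. Finally \<open>Q\<close> and \<open>R\<close> are obtained from a division by \<open>P\<^sub>\<epsilon>\<close>.
  Genericity makes \<open>\<eta> \<mapsto> \<epsilon>\<close> invertible: along a direction in which \<open>\<epsilon>\<close> is stationary the derivative of
  \<open>X\<close>, which is \<open>2 \<Sum> Re(da\<^sub>j) z^j\<close> modulo \<open>z^k\<close>, is \<open>O(z^k)\<close>.
\<close>

section \<open>Holomorphic germs of several variables\<close>

text \<open>Two obstacles shape the proof. Only the multiplier of \<open>f \<circ> f\<close> along a
  2-cycle is invariant under changes of coordinate, while (iii) prescribes both derivatives of
  \<open>f\<close>; hence the even splitting. And the zeros of \<open>g w - w\<close> are the points
  with \<open>f (cnj w) = w\<close>, so a 2-cycle is seen there only when its points are conjugate.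
  In the coordinate \<open>(z + cnj (f z)) / 2\<close> this always happens: on a 2-cycle, replacing
  \<open>z\<close> by \<open>f z\<close> conjugates it. Divisibility by
  \<open>P\<^sub>\<epsilon>\<close> alone would only place the fixed points; the square also matches
  the logarithms of the multipliers and keeps its meaning when points collide. The unknowns are
  \<open>k\<close> coefficients of \<open>P\<^sub>\<epsilon>\<close>, \<open>k + 1\<close> of
  \<open>T\<close>, and \<open>\<beta>\<close>; the translation in \<open>T\<close> is what allows
  \<open>P\<^sub>\<epsilon>\<close> to have no term in \<open>Z^k\<close>. At
  \<open>\<eta> = 0\<close> the identity, \<open>Z^(k + 1)\<close> and \<open>b\<close> are a
  solution, because the constant in the hypothesis makes
  \<open>(1 + b z^k) X = z^(k + 1) + O(z^(2 k + 2))\<close>. Moments are contour integrals,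
  holomorphic in the parameters where the roots themselves are not. Reality of
  \<open>\<epsilon>\<close> and \<open>\<beta>\<close> follows from uniqueness of the
  solution.\<close>

text \<open>
  Complex vector spaces of finite dimension are Euclidean spaces with a multiplication \<open>cs\<close> by
  complex scalars; \<open>cj\<close> is a complex conjugation.
\<close>

class cvec = euclidean_space +
  fixes cs :: "complex \<Rightarrow> 'a \<Rightarrow> 'a"
    and cj :: "'a \<Rightarrow> 'a"
  assumes cs_add_right: "cs c (x + y) = cs c x + cs c y"
    and cs_add_left: "cs (c + d) x = cs c x + cs d x"
    and cs_cs: "cs c (cs d x) = cs (c * d) x"
    and cs_of_real: "cs (complex_of_real r) x = r *\<^sub>R x"
    and norm_cs: "norm (cs c x) = cmod c * norm x"
    and cj_add: "cj (x + y) = cj x + cj y"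
    and cj_cs: "cj (cs c x) = cs (cnj c) (cj x)"
    and cj_cj [simp]: "cj (cj x) = x"
    and norm_cj [simp]: "norm (cj x) = norm x"

instantiation complex :: cvec
begin
definition cs_complex :: "complex \<Rightarrow> complex \<Rightarrow> complex" where "cs_complex c x = c * x"
definition cj_complex :: "complex \<Rightarrow> complex" where "cj_complex x = cnj x"
instance
  by standard (auto simp: cs_complex_def cj_complex_def algebra_simps scaleR_conv_of_real norm_mult)
end

instantiation prod :: (cvec, cvec) cvec
begin
definition cs_prod :: "complex \<Rightarrow> 'a \<times> 'b \<Rightarrow> 'a \<times> 'b" where
  "cs_prod c x = (cs c (fst x), cs c (snd x))"
definition cj_prod :: "'a \<times> 'b \<Rightarrow> 'a \<times> 'b" where
  "cj_prod x = (cj (fst x), cj (snd x))"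
instance
  by standard
    (auto simp: cs_prod_def cj_prod_def cs_add_right cs_add_left cs_cs cs_of_real norm_cs cj_add cj_cs
      norm_prod_def power_mult_distrib real_sqrt_mult simp flip: distrib_left)
end

instantiation vec :: (cvec, finite) cvec
begin
definition cs_vec :: "complex \<Rightarrow> 'a ^ 'b \<Rightarrow> 'a ^ 'b" where
  "cs_vec c x = (\<chi> i. cs c (x $ i))"
definition cj_vec :: "'a ^ 'b \<Rightarrow> 'a ^ 'b" where
  "cj_vec x = (\<chi> i. cj (x $ i))"
instance
  by standard
    (auto simp: cs_vec_def cj_vec_def vec_eq_iff cs_add_right cs_add_left cs_cs cs_of_real norm_cs cj_add cj_cs
      norm_vec_def L2_set_def power_mult_distrib real_sqrt_mult simp flip: sum_distrib_left)
end

lemma cs_complex [simp]: "cs c x = c * x" for x :: complex by (simp add: cs_complex_def)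
lemma cj_complex [simp]: "cj x = cnj x" for x :: complex by (simp add: cj_complex_def)
lemma cs_Pair [simp]: "cs c (x, y) = (cs c x, cs c y)" by (simp add: cs_prod_def)
lemma cj_Pair [simp]: "cj (x, y) = (cj x, cj y)" by (simp add: cj_prod_def)
lemma fst_cs [simp]: "fst (cs c x) = cs c (fst x)" by (simp add: cs_prod_def)
lemma snd_cs [simp]: "snd (cs c x) = cs c (snd x)" by (simp add: cs_prod_def)
lemma fst_cj [simp]: "fst (cj x) = cj (fst x)" by (simp add: cj_prod_def)
lemma snd_cj [simp]: "snd (cj x) = cj (snd x)" by (simp add: cj_prod_def)
lemma vec_nth_cs [simp]: "cs c x $ i = cs c (x $ i)" by (simp add: cs_vec_def)
lemma vec_nth_cj [simp]: "cj x $ i = cj (x $ i)" by (simp add: cj_vec_def)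

lemma cs_scaleR: "cs c (r *\<^sub>R x) = r *\<^sub>R cs c x"
  by (simp add: cs_cs mult.commute flip: cs_of_real)

lemma cs_zero_right [simp]: "cs c (0 :: 'a :: cvec) = 0"
  using cs_add_right[of c "0::'a" 0] by simp

lemma cs_zero_left [simp]: "cs 0 x = 0"
  using cs_of_real[of 0 x] by simp

lemma cs_one [simp]: "cs 1 x = x"
  using cs_of_real[of 1 x] by simp

lemma cs_minus_right: "cs c (- x) = - cs c x"
  using cs_add_right[of c x "-x"] by (simp add: minus_unique)

lemma cj_zero [simp]: "cj (0 :: 'a :: cvec) = 0"
  using cj_add[of "0::'a" 0] by simp

lemma cj_scaleR: "cj (r *\<^sub>R x) = r *\<^sub>R cj x"
  using cj_cs[of "of_real r" x] by (simp add: cs_of_real)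

lemma linear_cs: "linear (cs c :: 'a \<Rightarrow> 'a::cvec)"
  by (rule linearI) (auto simp: cs_add_right cs_scaleR)

lemma linear_cs_left: "linear (\<lambda>c. cs c (x::'a::cvec))"
  by (rule linearI) (auto simp: cs_add_left scaleR_conv_of_real simp flip: cs_cs cs_of_real)

lemma linear_cj: "linear (cj :: 'a \<Rightarrow> 'a::cvec)"
  by (rule linearI) (auto simp: cj_add cj_scaleR)

lemma bounded_linear_cs: "bounded_linear (cs c :: 'a \<Rightarrow> 'a::cvec)"
  by (simp add: linear_cs linear_conv_bounded_linear[symmetric])

lemma bounded_linear_cs_left: "bounded_linear (\<lambda>c. cs c (x::'a::cvec))"
  by (simp add: linear_cs_left linear_conv_bounded_linear[symmetric])

lemma bounded_linear_cj: "bounded_linear (cj :: 'a \<Rightarrow> 'a::cvec)"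
  by (simp add: linear_cj linear_conv_bounded_linear[symmetric])

lemma bounded_bilinear_cs: "bounded_bilinear (cs :: complex \<Rightarrow> 'a \<Rightarrow> 'a::cvec)"
  by (rule bounded_bilinear.intro)
    (auto simp: cs_add_left cs_add_right norm_cs scaleR_conv_of_real cs_cs mult.commute intro!: exI[of _ 1]
      simp flip: cs_of_real)

lemma continuous_on_cs [continuous_intros]:
  "continuous_on S f \<Longrightarrow> continuous_on S g \<Longrightarrow> continuous_on S (\<lambda>x. cs (f x) (g x :: 'a :: cvec))"
  by (rule bounded_bilinear.continuous_on[OF bounded_bilinear_cs])

lemma tendsto_cj [tendsto_intros]: "(f \<longlongrightarrow> l) F \<Longrightarrow> ((\<lambda>x. cj (f x :: 'a::cvec)) \<longlongrightarrow> cj l) F"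
  by (rule bounded_linear.tendsto[OF bounded_linear_cj])

definition cdiff :: "('a::cvec \<Rightarrow> 'b::cvec) \<Rightarrow> 'a \<Rightarrow> bool" where
  "cdiff F x \<longleftrightarrow> (\<exists>D. (F has_derivative D) (at x) \<and> (\<forall>c v. D (cs c v) = cs c (D v)))"

text \<open>A predicate on germs: conditions that hold near a point are combined as filters, and
  explicit radii appear only where a contour or a domain has to be fixed.\<close>

definition hol :: "('a::cvec \<Rightarrow> 'b::cvec) \<Rightarrow> 'a \<Rightarrow> bool" where
  "hol F x \<longleftrightarrow> (\<forall>\<^sub>F y in nhds x. cdiff F y)"

text \<open>Later on, direction \<open>(1, 0)\<close> gives the derivative in the variable and
  \<open>(0, v)\<close> the derivative in the parameters. The value carries information only
  together with \<open>cdiff\<close>.\<close>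

definition ddir :: "('a::cvec \<Rightarrow> 'b::cvec) \<Rightarrow> 'a \<Rightarrow> 'a \<Rightarrow> 'b" where
  "ddir F x v = frechet_derivative F (at x) v"

lemma cdiff_has_derivative: "cdiff F x \<Longrightarrow> (F has_derivative ddir F x) (at x)"
  unfolding cdiff_def ddir_def using frechet_derivative_at by force

lemma ddir_eq: "(F has_derivative D) (at x) \<Longrightarrow> ddir F x = D"
  unfolding ddir_def by (metis frechet_derivative_at)

lemma ddir_cs: "cdiff F x \<Longrightarrow> ddir F x (cs c v) = cs c (ddir F x v)"
  unfolding cdiff_def using ddir_eq by metis

lemma ddir_linear: "cdiff F x \<Longrightarrow> linear (ddir F x)"
  using cdiff_has_derivative has_derivative_linear by blast

lemma ddir_add: "cdiff F x \<Longrightarrow> ddir F x (v + w) = ddir F x v + ddir F x w"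
  using ddir_linear linear_add by blast

lemma ddir_zero [simp]: "cdiff F x \<Longrightarrow> ddir F x 0 = 0"
  using ddir_linear linear_0 by blast

lemma cdiffI: "(F has_derivative D) (at x) \<Longrightarrow> (\<And>c v. D (cs c v) = cs c (D v)) \<Longrightarrow> cdiff F x"
  unfolding cdiff_def by blast

lemma cdiff_isCont: "cdiff F x \<Longrightarrow> isCont F x"
  unfolding cdiff_def using has_derivative_continuous by blast

lemma cdiff_cong: "\<forall>\<^sub>F y in nhds x. F y = G y \<Longrightarrow> cdiff F x \<Longrightarrow> cdiff G x"
proof -
  assume a: "\<forall>\<^sub>F y in nhds x. F y = G y" "cdiff F x"
  then obtain D where D: "(F has_derivative D) (at x)" "\<forall>c v. D (cs c v) = cs c (D v)"
    by (auto simp: cdiff_def)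
  have "\<forall>\<^sub>F y in at x. F y = G y" "F x = G x"
    using a(1) eventually_nhds_x_imp_x by (auto simp: eventually_at_filter elim: eventually_mono)
  with D show "cdiff G x"
    using has_derivative_transform_eventually[OF D(1)] by (auto simp: cdiff_def)
qed

lemma cdiff_compose:
  assumes "cdiff F (G x)" "cdiff G x"
  shows "cdiff (\<lambda>y. F (G y)) x"
proof -
  have "((\<lambda>y. F (G y)) has_derivative (\<lambda>v. ddir F (G x) (ddir G x v))) (at x)"
    using has_derivative_compose[OF cdiff_has_derivative[OF assms(2)] cdiff_has_derivative[OF assms(1)]] by simp
  thus ?thesis by (rule cdiffI) (simp add: ddir_cs assms)
qed

lemma ddir_compose:
  assumes "cdiff F (G x)" "cdiff G x"
  shows "ddir (\<lambda>y. F (G y)) x v = ddir F (G x) (ddir G x v)"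
proof -
  have "((\<lambda>y. F (G y)) has_derivative (\<lambda>v. ddir F (G x) (ddir G x v))) (at x)"
    using has_derivative_compose[OF cdiff_has_derivative[OF assms(2)] cdiff_has_derivative[OF assms(1)]] by simp
  thus ?thesis by (simp add: ddir_eq)
qed

lemma cdiff_complex_iff: "cdiff f z \<longleftrightarrow> f field_differentiable at z" for f :: "complex \<Rightarrow> complex"
proof
  assume "cdiff f z"
  then obtain D where D: "(f has_derivative D) (at z)" "\<And>c v. D (c * v) = c * D v"
    by (auto simp: cdiff_def)
  have "D = (\<lambda>v. D 1 * v)"
  proof
    show "D v = D 1 * v" for v using D(2)[of v 1] unfolding mult_1_right by (rule trans) (rule mult.commute)
  qed
  thus "f field_differentiable at z"
    using D(1) unfolding field_differentiable_def has_field_derivative_def by metis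
next
  assume "f field_differentiable at z"
  thus "cdiff f z" unfolding field_differentiable_def has_field_derivative_def
    by (auto simp: cdiff_def algebra_simps)
qed

lemma ddir_complex: "f field_differentiable at z \<Longrightarrow> ddir f z v = deriv f z * v"
  using DERIV_deriv_iff_field_differentiable[of f z] by (auto simp: has_field_derivative_def dest: ddir_eq)

lemma cdiff_linear:
  assumes "bounded_linear L" "\<And>c v. L (cs c v) = cs c (L v)"
  shows "cdiff L x"
  using assms by (auto intro!: cdiffI bounded_linear_imp_has_derivative)

lemma hol_imp_cdiff: "hol F x \<Longrightarrow> cdiff F x"
  unfolding hol_def by (rule eventually_nhds_x_imp_x)

lemma hol_isCont: "hol F x \<Longrightarrow> isCont F x"
  using cdiff_isCont hol_imp_cdiff by blast

lemma hol_eventually: "hol F x \<Longrightarrow> \<forall>\<^sub>F y in nhds x. hol F y"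
  unfolding hol_def by (simp add: eventually_eventually)

lemma hol_cong: "\<forall>\<^sub>F y in nhds x. F y = G y \<Longrightarrow> hol F x \<Longrightarrow> hol G x"
proof -
  assume a: "\<forall>\<^sub>F y in nhds x. F y = G y" "hol F x"
  have "\<forall>\<^sub>F y in nhds x. \<forall>\<^sub>F y in nhds y. F y = G y"
    using a(1) by (simp add: eventually_eventually)
  with a(2) show "hol G x" unfolding hol_def
    by eventually_elim (rule cdiff_cong)
qed

lemma isCont_eventually_nhds: "isCont G x \<Longrightarrow> \<forall>\<^sub>F y in nhds (G x). P y \<Longrightarrow> \<forall>\<^sub>F y in nhds x. P (G y)"
  unfolding isCont_def tendsto_at_iff_tendsto_nhds by (auto simp: filterlim_iff)

lemma hol_lift2: "hol F x \<Longrightarrow> hol G x \<Longrightarrow> (\<And>y. cdiff F y \<Longrightarrow> cdiff G y \<Longrightarrow> cdiff K y) \<Longrightarrow> hol K x"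
  unfolding hol_def by (rule eventually_elim2)

lemma hol_compose: "hol F (G x) \<Longrightarrow> hol G x \<Longrightarrow> hol (\<lambda>y. F (G y)) x"
proof -
  assume a: "hol F (G x)" "hol G x"
  have "\<forall>\<^sub>F y in nhds x. cdiff F (G y)"
    using isCont_eventually_nhds[OF hol_isCont[OF a(2)]] a(1) unfolding hol_def by blast
  with a(2) show ?thesis unfolding hol_def by eventually_elim (rule cdiff_compose)
qed

lemma hol_compose2: "hol F (G x, G' x) \<Longrightarrow> hol (\<lambda>y. (G y, G' y)) x \<Longrightarrow> hol (\<lambda>y. F (G y, G' y)) x"
  using hol_compose[of F "\<lambda>y. (G y, G' y)"] by simp

section \<open>Closure rules for holomorphic germs\<close>

named_theorems hol_intros

lemma hol_linear: "bounded_linear L \<Longrightarrow> (\<And>c v. L (cs c v) = cs c (L v)) \<Longrightarrow> hol L x"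
  unfolding hol_def by (intro always_eventually allI cdiff_linear)

lemma hol_const [hol_intros]: "hol (\<lambda>x. c) x"
  unfolding hol_def cdiff_def by (auto intro!: always_eventually exI[of _ "\<lambda>x. 0"])

lemma hol_ident [hol_intros]: "hol (\<lambda>x. x) x"
  by (rule hol_linear) (auto intro: bounded_linear_ident)

lemma hol_fst' : "hol fst x" by (rule hol_linear) (auto intro: bounded_linear_fst)
lemma hol_snd' : "hol snd x" by (rule hol_linear) (auto intro: bounded_linear_snd)
lemma hol_fst [hol_intros]: "hol F x \<Longrightarrow> hol (\<lambda>x. fst (F x)) x" by (rule hol_compose[OF hol_fst'])
lemma hol_snd [hol_intros]: "hol F x \<Longrightarrow> hol (\<lambda>x. snd (F x)) x" by (rule hol_compose[OF hol_snd'])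

lemma hol_Pair [hol_intros]: "hol F x \<Longrightarrow> hol G x \<Longrightarrow> hol (\<lambda>x. (F x, G x)) x"
  by (erule (1) hol_lift2, rule cdiffI[OF has_derivative_Pair[OF cdiff_has_derivative cdiff_has_derivative]])
    (auto simp: ddir_cs)

lemma hol_add [hol_intros]: "hol F x \<Longrightarrow> hol G x \<Longrightarrow> hol (\<lambda>x. F x + G x) x"
  by (erule (1) hol_lift2, rule cdiffI[OF has_derivative_add[OF cdiff_has_derivative cdiff_has_derivative]])
    (auto simp: ddir_cs cs_add_right)

lemma hol_minus [hol_intros]: "hol F x \<Longrightarrow> hol (\<lambda>x. - F x) x"
  by (rule hol_compose[of uminus]) (auto intro!: hol_linear bounded_linear_minus bounded_linear_ident simp: cs_minus_right)

lemma hol_diff [hol_intros]: "hol F x \<Longrightarrow> hol G x \<Longrightarrow> hol (\<lambda>x. F x - G x) x"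
  using hol_add[OF _ hol_minus, of F x G] by simp

lemma hol_mult [hol_intros]: "hol F x \<Longrightarrow> hol G x \<Longrightarrow> hol (\<lambda>x. F x * G x :: complex) x"
  by (erule (1) hol_lift2, rule cdiffI[OF has_derivative_mult[OF cdiff_has_derivative cdiff_has_derivative]])
    (auto simp: ddir_cs algebra_simps)

lemma hol_sum [hol_intros]: "(\<And>i. i \<in> A \<Longrightarrow> hol (F i) x) \<Longrightarrow> hol (\<lambda>x. \<Sum>i\<in>A. F i x) x"
  by (induction A rule: infinite_finite_induct) (auto intro!: hol_intros)

lemma hol_prod [hol_intros]: "(\<And>i. i \<in> A \<Longrightarrow> hol (F i) x) \<Longrightarrow> hol (\<lambda>x. \<Prod>i\<in>A. F i x :: complex) x"
  by (induction A rule: infinite_finite_induct) (auto intro!: hol_intros)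

lemma hol_power [hol_intros]: "hol F x \<Longrightarrow> hol (\<lambda>x. F x ^ n :: complex) x"
  by (induction n) (auto intro!: hol_intros)

lemma hol_complex: "open S \<Longrightarrow> f holomorphic_on S \<Longrightarrow> z \<in> S \<Longrightarrow> hol f z" for f :: "complex \<Rightarrow> complex"
  unfolding hol_def using eventually_nhds_in_open[of S z]
  by (rule eventually_mono) (auto simp: cdiff_complex_iff intro: holomorphic_on_imp_differentiable_at)

lemma hol_analytic: "f analytic_on {z} \<Longrightarrow> hol f z" for f :: "complex \<Rightarrow> complex"
  by (metis analytic_at hol_complex)

lemma hol_divide [hol_intros]: "hol F x \<Longrightarrow> hol G x \<Longrightarrow> G x \<noteq> 0 \<Longrightarrow> hol (\<lambda>x. F x / G x :: complex) x"
proof -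
  assume a: "hol F x" "hol G x" "G x \<noteq> 0"
  have "hol (\<lambda>y. inverse (G y)) x"
    by (rule hol_compose[OF _ a(2), of inverse])
      (rule hol_complex[of "-{0}"], use a(3) in \<open>auto intro!: holomorphic_intros\<close>)
  from hol_mult[OF a(1) this] show ?thesis by (simp add: divide_inverse)
qed

lemma hol_vec_nth' : "hol (\<lambda>x. x $ i) x"
  by (rule hol_linear) (auto intro: bounded_linear_vec_nth)
lemma hol_vec_nth [hol_intros]: "hol F x \<Longrightarrow> hol (\<lambda>x. F x $ i) x"
  by (rule hol_compose[OF hol_vec_nth'])

lemma bounded_linear_axis: "bounded_linear (axis i :: 'a \<Rightarrow> 'a::euclidean_space ^ 'n)"
  unfolding linear_conv_bounded_linear[symmetric]
  by (rule linearI) (auto simp: axis_def vec_eq_iff)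

lemma vec_lambda_eq_sum_axis: "(\<chi> i. f i) = (\<Sum>i\<in>UNIV. axis i (f i :: 'a::euclidean_space))"
  by (simp add: vec_eq_iff axis_def sum.delta' if_distrib cong: if_cong)

lemma has_derivative_vec_lambda:
  assumes "\<And>i. (F i has_derivative D i) (at x)"
  shows "((\<lambda>x. \<chi> i. (F i x :: 'a::euclidean_space)) has_derivative (\<lambda>v. \<chi> i. D i v)) (at x)"
  unfolding vec_lambda_eq_sum_axis
  by (intro has_derivative_sum bounded_linear.has_derivative[OF bounded_linear_axis] assms)

lemma hol_vec [hol_intros]:
  assumes "\<And>i. hol (F i) x"
  shows "hol (\<lambda>x. \<chi> i. F i x) x"
proof -
  have "\<forall>\<^sub>F y in nhds x. \<forall>i. cdiff (F i) y"
    using assms unfolding hol_def by (simp add: eventually_all_finite)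
  thus ?thesis unfolding hol_def
  proof eventually_elim
    case (elim y)
    have "((\<lambda>x. \<chi> i. F i x) has_derivative (\<lambda>v. \<chi> i. ddir (F i) y v)) (at y)"
      by (rule has_derivative_vec_lambda) (use elim cdiff_has_derivative in blast)
    thus ?case by (rule cdiffI) (use elim in \<open>auto simp: vec_eq_iff ddir_cs\<close>)
  qed
qed

section \<open>Circle integrals depending on parameters\<close>

definition ucirc :: "real \<Rightarrow> complex" where "ucirc t = exp (2 * of_real pi * \<i> * of_real t)"

text \<open>The integral of \<open>f\<close> over the circle of radius \<open>R\<close>, divided by \<open>2 \<pi> i\<close>.\<close>

definition cint :: "real \<Rightarrow> (complex \<Rightarrow> complex) \<Rightarrow> complex" where
  "cint R f = integral (cbox 0 1) (\<lambda>t. f (of_real R * ucirc t) * (of_real R * ucirc t))"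

lemma norm_ucirc [simp]: "norm (ucirc t) = 1"
  by (simp add: ucirc_def norm_exp)

lemma ucirc_ne_0 [simp]: "ucirc t \<noteq> 0"
  by (simp add: ucirc_def)

lemma continuous_on_ucirc [continuous_intros]:
  "continuous_on S h \<Longrightarrow> continuous_on S (\<lambda>x. ucirc (h x))"
  unfolding ucirc_def by (intro continuous_intros)

lemma circle_mem_sphere: "R \<ge> 0 \<Longrightarrow> of_real R * ucirc t \<in> sphere 0 R"
  by (simp add: norm_mult)

text \<open>Integration over a fixed real interval makes the dependence on parameters a matter of
  the Leibniz rule; this identity brings in Cauchy's theorems.\<close>

lemma cint_contour: "cint R f = contour_integral (circlepath 0 R) f / (2 * of_real pi * \<i>)"
proof -
  have "contour_integral (circlepath 0 R) f =
      integral {0..1} (\<lambda>t. (2 * of_real pi * \<i>) * (f (of_real R * ucirc t) * (of_real R * ucirc t)))"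
    unfolding contour_integral_integral
    by (intro integral_cong) (simp add: vector_derivative_circlepath, simp add: circlepath_def part_circlepath_def linepath_def ucirc_def algebra_simps)
  also have "\<dots> = (2 * of_real pi * \<i>) * cint R f"
    by (simp add: cint_def)
  finally show ?thesis by simp
qed

lemma cint_cong:
  assumes "R \<ge> 0" "\<And>w. norm w = R \<Longrightarrow> f w = g w"
  shows "cint R f = cint R g"
  unfolding cint_def by (intro integral_cong) (use assms circle_mem_sphere[of R] in \<open>auto simp: norm_mult\<close>)

lemma cint_integrable:
  assumes "R \<ge> 0" "continuous_on (sphere 0 R) f"
  shows "(\<lambda>t. f (of_real R * ucirc t) * (of_real R * ucirc t)) integrable_on cbox 0 (1::real)"
  by (intro integrable_continuous continuous_intros continuous_on_compose2[OF assms(2)])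
    (use circle_mem_sphere[OF assms(1)] in auto)

lemma cint_add:
  assumes "R \<ge> 0" "continuous_on (sphere 0 R) f" "continuous_on (sphere 0 R) g"
  shows "cint R (\<lambda>w. f w + g w) = cint R f + cint R g"
  unfolding cint_def distrib_right
  by (rule integral_add) (use assms cint_integrable in blast)+

lemma cint_mult_left: "cint R (\<lambda>w. c * f w) = c * cint R f"
  unfolding cint_def mult.assoc by (rule integral_mult_right)

lemma cint_minus: "cint R (\<lambda>w. - f w) = - cint R f"
  using cint_mult_left[of R "-1" f] by simp

lemma cint_diff:
  assumes "R \<ge> 0" "continuous_on (sphere 0 R) f" "continuous_on (sphere 0 R) g"
  shows "cint R (\<lambda>w. f w - g w) = cint R f - cint R g"
  using cint_add[OF assms(1,2), of "\<lambda>w. - g w"] assms(3) by (simp add: cint_minus continuous_on_minus)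

lemma cint_sum:
  assumes "R \<ge> 0" "\<And>i. i \<in> A \<Longrightarrow> continuous_on (sphere 0 R) (f i)"
  shows "cint R (\<lambda>w. \<Sum>i\<in>A. f i w) = (\<Sum>i\<in>A. cint R (f i))"
  using assms(2)
proof (induction A rule: infinite_finite_induct)
  case (insert x F)
  show ?case using insert
    by (simp add: cint_add[OF assms(1)] continuous_on_sum)
qed (auto simp: cint_def)

lemma cint_bound:
  assumes "R \<ge> 0" "continuous_on (sphere 0 R) f" "\<And>w. norm w = R \<Longrightarrow> norm (f w) \<le> B"
  shows "norm (cint R f) \<le> B * R"
proof -
  have "norm (cint R f) \<le> (B * R) * measure lborel (cbox 0 (1::real))"
    unfolding cint_def
  proof (rule integrable_bound)
    have "norm (f (of_real R)) \<le> B" using assms(1,3) by simp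
    hence "B \<ge> 0" using norm_ge_zero order_trans by blast
    thus "0 \<le> B * R" using assms(1) by simp
    show "(\<lambda>t. f (of_real R * ucirc t) * (of_real R * ucirc t)) integrable_on cbox 0 (1::real)"
      by (rule cint_integrable[OF assms(1,2)])
    show "norm (f (of_real R * ucirc t) * (of_real R * ucirc t)) \<le> B * R" for t
      using assms(1) assms(3)[of "of_real R * ucirc t"] by (simp add: norm_mult mult_right_mono)
  qed
  thus ?thesis by simp
qed

lemma cint_Cauchy:
  assumes "continuous_on (cball 0 R) f" "f holomorphic_on ball 0 R" "norm w < R"
  shows "cint R (\<lambda>u. f u / (u - w)) = f w"
  using Cauchy_integral_circlepath[OF assms(1,2), of w] assms(3)
  by (simp add: cint_contour contour_integral_unique)

lemma cint_Cauchy_deriv: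
  assumes "continuous_on (cball 0 R) f" "f holomorphic_on ball 0 R" "norm w < R"
  shows "(f has_field_derivative cint R (\<lambda>u. f u / (u - w)\<^sup>2)) (at w)"
  using Cauchy_derivative_integral_circlepath(2)[OF assms(1,2), of w] assms(3)
  by (simp add: cint_contour)

text \<open>The points near which \<open>P\<close> holds form an open set containing
  \<open>C \<times> {x0}\<close>, so it contains a tube. Applied to circles and discs, it turns
  estimates at \<open>x0\<close> into estimates for all nearby parameters.\<close>

lemma eventually_nhds_prod_compact:
  fixes x0 :: "'b::topological_space" and C :: "'a::topological_space set"
  assumes "compact C" "\<And>s. s \<in> C \<Longrightarrow> \<forall>\<^sub>F p in nhds (s, x0). P p"
  shows "\<forall>\<^sub>F x in nhds x0. \<forall>s\<in>C. P (s, x)"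
proof -
  define W where "W = {q. \<forall>\<^sub>F p in nhds q. P p}"
  have "open W" unfolding W_def
  proof (subst open_subopen, safe)
    fix q assume "\<forall>\<^sub>F p in nhds q. P p"
    then obtain S where "open S" "q \<in> S" "\<forall>p\<in>S. P p" by (auto simp: eventually_nhds)
    thus "\<exists>T. open T \<and> q \<in> T \<and> T \<subseteq> {q. \<forall>\<^sub>F p in nhds q. P p}"
      by (intro exI[of _ S]) (auto simp: eventually_nhds)
  qed
  hence "open ((\<lambda>p. (snd p, fst p)) -` W)"
    by (intro open_vimage) (auto intro!: continuous_intros)
  moreover have "{x0} \<times> C \<subseteq> (\<lambda>p. (snd p, fst p)) -` W"
  proof
    fix p assume "p \<in> {x0} \<times> C"
    hence "snd p \<in> C" "fst p = x0" by auto
    with assms(2)[of "snd p"] show "p \<in> (\<lambda>p. (snd p, fst p)) -` W"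
      unfolding W_def vimage_def mem_Collect_eq by (simp only:)
  qed
  ultimately have "\<exists>X0. x0 \<in> X0 \<and> open X0 \<and> X0 \<times> C \<subseteq> (\<lambda>p. (snd p, fst p)) -` W"
    by (rule Elementary_Topology.tube_lemma[OF assms(1)])
  then obtain X0 where X0: "x0 \<in> X0" "open X0" "X0 \<times> C \<subseteq> (\<lambda>p. (snd p, fst p)) -` W"
    by (elim exE conjE)
  show ?thesis
  proof (rule eventually_mono[OF eventually_nhds_in_open[OF X0(2,1)]], safe)
    fix x s assume "x \<in> X0" "s \<in> C"
    hence "(s, x) \<in> W" using X0(3) by auto
    thus "P (s, x)" unfolding W_def mem_Collect_eq by (rule eventually_nhds_x_imp_x)
  qed
qed

lemma open_hol: "open {x. hol F x}"
proof (subst open_subopen, safe)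
  fix x assume "hol F x"
  then obtain S where "open S" "x \<in> S" "\<forall>p\<in>S. hol F p" using hol_eventually by (force simp: eventually_nhds)
  thus "\<exists>T. open T \<and> x \<in> T \<and> T \<subseteq> {x. hol F x}" by (intro exI[of _ S]) auto
qed

lemma cint_continuous_param:
  fixes K :: "complex \<Rightarrow> 'a::topological_space \<Rightarrow> complex"
  assumes "R \<ge> 0" "continuous_on (U \<times> sphere 0 R) (\<lambda>(x, s). K s x)"
  shows "continuous_on U (\<lambda>x. cint R (\<lambda>s. K s x))"
proof -
  have "continuous_on (U \<times> cbox 0 (1::real)) (\<lambda>p. (\<lambda>(x, s). K s x) (fst p, of_real R * ucirc (snd p)))"
    by (intro continuous_on_compose2[OF assms(2)] continuous_intros)
      (use circle_mem_sphere[OF assms(1)] in auto)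
  hence "continuous_on (U \<times> cbox 0 1) (\<lambda>(x, t). K (of_real R * ucirc t) x * (of_real R * ucirc t))"
    unfolding case_prod_unfold by (auto intro!: continuous_intros)
  from integral_continuous_on_param[OF this] show ?thesis unfolding cint_def .
qed

section \<open>Derivatives along complex lines by Cauchy's formula\<close>

lemma cdiff_line:
  fixes F :: "'a::cvec \<Rightarrow> complex"
  assumes "cdiff F (x + cs s v)"
  shows "((\<lambda>s. F (x + cs s v)) has_field_derivative ddir F (x + cs s v) v) (at s)"
proof -
  have "((\<lambda>s. x + cs s v) has_derivative (\<lambda>h. cs h v)) (at s)"
    by (auto intro!: derivative_eq_intros bounded_linear_imp_has_derivative bounded_linear_cs_left)
  from has_derivative_compose[OF this cdiff_has_derivative[OF assms]]
  show ?thesis by (simp add: has_field_derivative_def ddir_cs[OF assms] mult.commute[of _ "ddir F (x + cs s v) v"])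
qed

text \<open>Cauchy's formula on the complex line through \<open>x\<close> in direction
  \<open>v\<close>. Only values of \<open>F\<close> occur on the right, so continuity and holomorphy
  pass from \<open>F\<close> to its derivative.\<close>

lemma ddir_cint:
  fixes F :: "'a::cvec \<Rightarrow> complex"
  assumes "r > 0" "\<And>s. norm s \<le> r \<Longrightarrow> cdiff F (x + cs s v)"
  shows "ddir F x v = cint r (\<lambda>s. F (x + cs s v) / s\<^sup>2)"
proof -
  have d: "((\<lambda>s. F (x + cs s v)) has_field_derivative ddir F (x + cs s v) v) (at s)" if "norm s \<le> r" for s
    using cdiff_line assms(2) that by blast
  have "continuous_on (cball 0 r) (\<lambda>s. F (x + cs s v))"
    by (intro continuous_at_imp_continuous_on ballI DERIV_isCont[OF d]) simp
  moreover have "(\<lambda>s. F (x + cs s v)) holomorphic_on ball 0 r"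
  proof (rule holomorphic_onI)
    fix s :: complex assume "s \<in> ball 0 r"
    hence "norm s \<le> r" by simp
    from d[OF this] show "(\<lambda>s. F (x + cs s v)) field_differentiable at s within ball 0 r"
      unfolding field_differentiable_def by (blast intro: has_field_derivative_at_within)
  qed
  ultimately have "((\<lambda>s. F (x + cs s v)) has_field_derivative cint r (\<lambda>s. F (x + cs s v) / (s - 0)\<^sup>2)) (at 0)"
    by (rule cint_Cauchy_deriv) (use assms in auto)
  moreover have "((\<lambda>s. F (x + cs s v)) has_field_derivative ddir F x v) (at 0)"
    using d[of 0] assms(1) by simp
  ultimately show ?thesis using DERIV_unique by fastforce
qed

text \<open>Stated with the product \<open>r * norm v\<close>, so that the direction
  \<open>v = 0\<close> needs no separate treatment.\<close>

lemma ex_small_radius: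
  assumes "\<rho> > 0"
  obtains r where "r > 0" "r * norm v \<le> \<rho> / (2::real)"
proof (rule that)
  have n: "norm v + 1 > 0" by (simp add: add_nonneg_pos)
  thus "\<rho> / (2 * (norm v + 1)) > 0" using assms by simp
  have "\<rho> / (2 * (norm v + 1)) * norm v = \<rho> / 2 * (norm v / (norm v + 1))" by simp
  also have "\<dots> \<le> \<rho> / 2 * 1" using n assms by (intro mult_left_mono) (auto simp: field_simps)
  finally show "\<rho> / (2 * (norm v + 1)) * norm v \<le> \<rho> / 2" by simp
qed

text \<open>Pointwise complex differentiability already forces a continuous derivative, which the
  inverse function theorem and the Leibniz rule presuppose.\<close>

lemma continuous_on_ddir_local:
  fixes F :: "'a::cvec \<Rightarrow> complex"
  assumes "\<And>y. y \<in> ball x \<rho> \<Longrightarrow> cdiff F y" "\<rho> > 0"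
  shows "isCont (\<lambda>y. ddir F y v) x"
proof -
  obtain r where r: "r > 0" "r * norm v \<le> \<rho> / 2" using ex_small_radius assms(2) by blast
  have mem: "y + cs s v \<in> ball x \<rho>" if "y \<in> ball x (\<rho> / 2)" "norm s \<le> r" for y s
  proof -
    have "norm (cs s v) \<le> \<rho> / 2"
      using that(2) r(2) by (smt (verit) mult_right_mono norm_cs norm_ge_zero)
    thus ?thesis using that(1) by (simp add: dist_norm) (smt (verit) diff_diff_add norm_triangle_ineq4)
  qed
  have cF: "continuous_on (ball x \<rho>) F"
    using assms(1) cdiff_isCont continuous_at_imp_continuous_on by blast
  have "continuous_on (ball x (\<rho>/2) \<times> sphere 0 r) (\<lambda>p. F (fst p + cs (snd p) v) / (snd p)\<^sup>2)"
    by (intro continuous_intros continuous_on_compose2[OF cF]) (use mem r(1) in auto)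
  hence "continuous_on (ball x (\<rho>/2)) (\<lambda>y. cint r (\<lambda>s. F (y + cs s v) / s\<^sup>2))"
    by (intro cint_continuous_param) (use r in \<open>auto simp: case_prod_unfold\<close>)
  hence "continuous_on (ball x (\<rho>/2)) (\<lambda>y. ddir F y v)"
    by (rule continuous_on_eq) (use ddir_cint[OF r(1)] mem assms(1) in metis)
  thus ?thesis using assms(2) by (simp add: continuous_on_eq_continuous_at)
qed

lemma hol_isCont_ddir:
  fixes F :: "'a::cvec \<Rightarrow> complex"
  assumes "hol F x"
  shows "isCont (\<lambda>y. ddir F y v) x"
proof -
  obtain \<rho> where "\<rho> > 0" "\<And>y. y \<in> ball x \<rho> \<Longrightarrow> cdiff F y"
    using assms unfolding hol_def eventually_nhds_metric by (auto simp: dist_commute)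
  thus ?thesis using continuous_on_ddir_local by blast
qed

text \<open>Joint holomorphy in \<open>(s, x)\<close> makes the parameter derivative of the
  integrand continuous on circle times ball, which is what the Leibniz rule requires; complex
  linearity is inherited under the integral.\<close>

lemma hol_cint:
  fixes K :: "complex \<times> 'a::cvec \<Rightarrow> complex"
  assumes R: "R \<ge> 0" and K: "\<And>s. norm s = R \<Longrightarrow> hol K (s, x0)"
  shows "hol (\<lambda>x. cint R (\<lambda>s. K (s, x))) x0"
    and "ddir (\<lambda>x. cint R (\<lambda>s. K (s, x))) x0 v = cint R (\<lambda>s. ddir K (s, x0) (0, v))"
proof -
  have "\<forall>\<^sub>F x in nhds x0. \<forall>s\<in>sphere 0 R. hol K (s, x)"
    by (rule eventually_nhds_prod_compact) (use K hol_eventually in auto)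
  then obtain \<rho> where \<rho>: "\<rho> > 0" "\<And>x s. x \<in> ball x0 \<rho> \<Longrightarrow> norm s = R \<Longrightarrow> hol K (s, x)"
    unfolding eventually_nhds_metric by (auto simp: dist_commute)
  \<comment> \<open>The Leibniz rule takes derivatives as bounded linear maps; the factor
    \<open>of_real R * ucirc t\<close> from the parametrisation of the circle is absorbed
    here.\<close>
  define fx where "fx x t = Blinfun (\<lambda>v. ddir K (of_real R * ucirc t, x) (0, v) * (of_real R * ucirc t))" for x t
  let ?c = "\<lambda>t. of_real R * ucirc t"
  have nc: "norm (?c t) = R" for t using R by (simp add: norm_mult)
  have hd: "((\<lambda>x. K (?c t, x) * ?c t) has_derivative (\<lambda>v. ddir K (?c t, x) (0, v) * ?c t)) (at x)"
    if "x \<in> ball x0 \<rho>" for x t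
  proof -
    have "((\<lambda>x. (?c t, x)) has_derivative (\<lambda>v. (0, v))) (at x)"
      by (auto intro!: derivative_eq_intros)
    from has_derivative_compose[OF this cdiff_has_derivative[OF hol_imp_cdiff[OF \<rho>(2)[OF that nc]]]]
    show ?thesis by (auto intro!: derivative_eq_intros)
  qed
  have fxa: "blinfun_apply (fx x t) = (\<lambda>v. ddir K (?c t, x) (0, v) * ?c t)" if "x \<in> ball x0 \<rho>" for x t
    unfolding fx_def using has_derivative_bounded_linear[OF hd[OF that, of t]] by (rule bounded_linear_Blinfun_apply)
  have cont: "continuous_on (ball x0 \<rho> \<times> cbox 0 1) (\<lambda>(x, t). fx x t)"
  proof (rule continuous_on_blinfun_componentwise)
    fix i :: 'a
    have "continuous_on (ball x0 \<rho> \<times> cbox 0 (1::real)) (\<lambda>p. ddir K (?c (snd p), fst p) (0, i) * ?c (snd p))"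
    proof (intro continuous_intros)
      have "continuous_on (sphere 0 R \<times> ball x0 \<rho>) (\<lambda>p. ddir K p (0, i))"
        by (intro continuous_at_imp_continuous_on ballI hol_isCont_ddir) (use \<rho>(2) in auto)
      thus "continuous_on (ball x0 \<rho> \<times> cbox 0 (1::real)) (\<lambda>p. ddir K (?c (snd p), fst p) (0, i))"
        by (rule continuous_on_compose2) (use nc in \<open>auto intro!: continuous_intros\<close>)
    qed
    thus "continuous_on (ball x0 \<rho> \<times> cbox 0 1) (\<lambda>p. blinfun_apply (case p of (x, t) \<Rightarrow> fx x t) i)"
      by (rule continuous_on_eq) (auto simp: fxa)
  qed
  have cK: "continuous_on (sphere 0 R) (\<lambda>s. K (s, x))" if "x \<in> ball x0 \<rho>" for x
  proof -
    have "continuous_on (sphere 0 R \<times> {x}) K"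
      by (intro continuous_at_imp_continuous_on ballI hol_isCont) (use \<rho>(2) that in auto)
    thus ?thesis by (rule continuous_on_compose2) (auto intro!: continuous_intros)
  qed
  have main: "((\<lambda>x. cint R (\<lambda>s. K (s, x))) has_derivative (\<lambda>v. cint R (\<lambda>s. ddir K (s, x) (0, v)))) (at x)"
    if x: "x \<in> ball x0 \<rho>" for x
  proof -
    have "((\<lambda>x. integral (cbox 0 1) (\<lambda>t. K (?c t, x) * ?c t)) has_derivative
        blinfun_apply (integral (cbox 0 1) (fx x))) (at x within ball x0 \<rho>)"
    proof (rule leibniz_rule[OF _ _ cont x convex_ball])
      show "((\<lambda>x. K (?c t, x) * ?c t) has_derivative blinfun_apply (fx x t)) (at x within ball x0 \<rho>)"
        if "x \<in> ball x0 \<rho>" for x t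
        using hd[OF that] fxa[OF that] has_derivative_at_withinI by metis
      show "(\<lambda>t. K (?c t, x) * ?c t) integrable_on cbox 0 1" if "x \<in> ball x0 \<rho>" for x
        using cint_integrable[OF R cK[OF that]] .
    qed
    moreover have "fx x integrable_on cbox 0 1"
    proof (rule integrable_continuous)
      have "continuous_on (cbox 0 1) (\<lambda>t. (\<lambda>(x, t). fx x t) (x, t))"
        by (rule continuous_on_compose2[OF cont]) (use x in \<open>auto intro!: continuous_intros\<close>)
      thus "continuous_on (cbox 0 1) (fx x)" by simp
    qed
    hence "blinfun_apply (integral (cbox 0 1) (fx x)) = (\<lambda>v. cint R (\<lambda>s. ddir K (s, x) (0, v)))"
      by (auto simp: blinfun_apply_integral fxa[OF x] cint_def)
    ultimately show ?thesis using x by (simp add: cint_def at_within_open[OF x])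
  qed
  have cd: "cdiff (\<lambda>x. cint R (\<lambda>s. K (s, x))) x" if x: "x \<in> ball x0 \<rho>" for x
  proof (rule cdiffI[OF main[OF x]])
    fix c v
    have "cint R (\<lambda>s. ddir K (s, x) (0, cs c v)) = cint R (\<lambda>s. c * ddir K (s, x) (0, v))"
    proof (rule cint_cong[OF R])
      fix w :: complex assume "norm w = R"
      hence "cdiff K (w, x)" using \<rho>(2) x hol_imp_cdiff by blast
      from ddir_cs[OF this, of c "(0, v)"] show "ddir K (w, x) (0, cs c v) = c * ddir K (w, x) (0, v)" by simp
    qed
    thus "cint R (\<lambda>s. ddir K (s, x) (0, cs c v)) = cs c (cint R (\<lambda>s. ddir K (s, x) (0, v)))"
      by (simp add: cint_mult_left)
  qed
  have "\<forall>\<^sub>F x in nhds x0. x \<in> ball x0 \<rho>" using \<rho>(1) by (intro eventually_nhds_in_open) auto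
  thus "hol (\<lambda>x. cint R (\<lambda>s. K (s, x))) x0"
    unfolding hol_def by (rule eventually_mono) (rule cd)
  show "ddir (\<lambda>x. cint R (\<lambda>s. K (s, x))) x0 v = cint R (\<lambda>s. ddir K (s, x0) (0, v))"
    using ddir_eq[OF main[of x0]] \<rho>(1) by simp
qed

lemma hol_cs_line: "hol (\<lambda>p. x (snd p) + cs (fst p) v) (s, y)" if "hol x y" for v :: "'a::cvec" and x :: "'b::cvec \<Rightarrow> 'a"
proof (intro hol_intros)
  show "hol (\<lambda>p. x (snd p)) (s, y)"
    by (rule hol_compose) (auto intro: that hol_snd')
  have "hol (\<lambda>c::complex. cs c v) s"
    by (rule hol_linear) (auto simp: bounded_linear_cs_left cs_cs)
  thus "hol (\<lambda>p. cs (fst p) v) (s, y)"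
    by (intro hol_compose[of "\<lambda>c. cs c v" fst]) (auto intro: hol_fst')
qed

text \<open>The Cauchy integral of \<open>ddir_cint\<close> has a kernel holomorphic in
  \<open>(s, x)\<close>, so \<open>hol_cint\<close> applies to it.\<close>

lemma hol_ddir:
  fixes F :: "'a::cvec \<Rightarrow> complex"
  assumes "hol F x0"
  shows "hol (\<lambda>x. ddir F x v) x0"
proof -
  obtain \<rho> where \<rho>: "\<rho> > 0" "\<And>y. y \<in> ball x0 \<rho> \<Longrightarrow> hol F y"
    using hol_eventually[OF assms] unfolding eventually_nhds_metric by (auto simp: dist_commute)
  obtain r where r: "r > 0" "r * norm v \<le> \<rho> / 2" using ex_small_radius \<rho>(1) by blast
  have mem: "y + cs s v \<in> ball x0 \<rho>" if "y \<in> ball x0 (\<rho> / 2)" "norm s \<le> r" for y s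
  proof -
    have "norm (cs s v) \<le> \<rho> / 2"
      using that(2) r(2) by (smt (verit) mult_right_mono norm_cs norm_ge_zero)
    thus ?thesis using that(1) by (simp add: dist_norm) (smt (verit) diff_diff_add norm_triangle_ineq4)
  qed
  have "hol (\<lambda>p. F (snd p + cs (fst p) v) / (fst p)\<^sup>2) (s, x0)" if s: "norm s = r" for s
  proof (rule hol_divide)
    have "x0 + cs s v \<in> ball x0 \<rho>" using mem[of x0 s] s \<rho>(1) by simp
    hence "hol F (snd (s, x0) + cs (fst (s, x0)) v)" using \<rho>(2) by simp
    thus "hol (\<lambda>p. F (snd p + cs (fst p) v)) (s, x0)"
      by (rule hol_compose) (rule hol_cs_line[of "\<lambda>x. x", OF hol_ident])
    show "hol (\<lambda>p. (fst p)\<^sup>2) (s, x0)" by (rule hol_power) (rule hol_fst')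
    show "(fst (s, x0))\<^sup>2 \<noteq> 0" using s r(1) by auto
  qed
  hence h: "hol (\<lambda>x. cint r (\<lambda>s. F (x + cs s v) / s\<^sup>2)) x0"
    using hol_cint(1)[of r "\<lambda>p. F (snd p + cs (fst p) v) / (fst p)\<^sup>2" x0] r(1) by simp
  have "\<forall>\<^sub>F y in nhds x0. y \<in> ball x0 (\<rho>/2)" using \<rho>(1) by (intro eventually_nhds_in_open) auto
  hence "\<forall>\<^sub>F y in nhds x0. cint r (\<lambda>s. F (y + cs s v) / s\<^sup>2) = ddir F y v"
    by (rule eventually_mono) (rule ddir_cint[OF r(1) hol_imp_cdiff[OF \<rho>(2)[OF mem]], symmetric])
  from hol_cong[OF this h] show ?thesis .
qed

lemma isCont_ddir:
  fixes F :: "'a::cvec \<Rightarrow> 'b::cvec"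
  assumes "hol F x0"
  shows "isCont (\<lambda>x. ddir F x v) x0"
proof -
  \<comment> \<open>The complex linear functional with real part \<open>y \<bullet> b\<close>; it
    reduces the vector-valued case to the scalar one.\<close>
  define l :: "'b \<Rightarrow> 'b \<Rightarrow> complex"
    where "l b y = complex_of_real (y \<bullet> b) - \<i> * of_real (cs \<i> y \<bullet> b)" for b y
  have l_lin: "bounded_linear (l b)" for b
    unfolding l_def by (intro bounded_linear_intros bounded_linear_sub bounded_linear_const_mult
      bounded_linear_of_real[THEN bounded_linear_compose] bounded_linear_inner_left_comp bounded_linear_cs
      bounded_linear_ident)
  have l_cs: "l b (cs c y) = cs c (l b y)" for b c y
  proof -
    have c: "c = of_real (Re c) + of_real (Im c) * \<i>" by (simp add: complex_eq_iff)
    have 1: "cs c y = Re c *\<^sub>R y + Im c *\<^sub>R cs \<i> y"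
      by (subst c) (simp add: cs_add_left cs_of_real flip: cs_cs)
    have "\<i> * c = of_real (Re c) * \<i> + of_real (- Im c)" by (simp add: complex_eq_iff)
    hence 2: "cs (\<i> * c) y = Re c *\<^sub>R cs \<i> y - Im c *\<^sub>R y"
      by (simp only: cs_add_left cs_cs[symmetric] cs_of_real) simp
    show ?thesis
      unfolding l_def cs_cs 2 by (simp add: 1 inner_add_left inner_diff_left complex_eq_iff algebra_simps)
  qed
  have "isCont (\<lambda>x. ddir F x v \<bullet> b) x0" for b
  proof -
    have hl: "hol (\<lambda>x. l b (F x)) x0"
      by (rule hol_compose[OF hol_linear[OF l_lin] assms]) (rule l_cs)
    have ev: "\<forall>\<^sub>F x in nhds x0. Re (ddir (\<lambda>x. l b (F x)) x v) = ddir F x v \<bullet> b"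
      using assms unfolding hol_def
    proof eventually_elim
      case (elim x)
      have "((\<lambda>x. l b (F x)) has_derivative (\<lambda>v. l b (ddir F x v))) (at x)"
        using bounded_linear.has_derivative[OF l_lin cdiff_has_derivative[OF elim]] .
      thus ?case by (simp add: ddir_eq l_def)
    qed
    have "isCont (\<lambda>x. Re (ddir (\<lambda>x. l b (F x)) x v)) x0"
      by (intro continuous_Re hol_isCont_ddir hl)
    thus ?thesis using ev isCont_cong by fast
  qed
  thus ?thesis
    unfolding isCont_def by (subst tendsto_componentwise_iff) auto
qed

lemma isCont_Blinfun_ddir:
  fixes F :: "'a::cvec \<Rightarrow> 'b::cvec"
  assumes "hol F x0"
  shows "isCont (\<lambda>x. Blinfun (ddir F x)) x0"
proof (rule continuous_blinfun_componentwiseI1)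
  fix i :: 'a
  have "\<forall>\<^sub>F x in nhds x0. ddir F x i = blinfun_apply (Blinfun (ddir F x)) i"
    using assms unfolding hol_def by eventually_elim (metis bounded_linear_Blinfun_apply cdiff_has_derivative has_derivative_bounded_linear)
  thus "isCont (\<lambda>x. blinfun_apply (Blinfun (ddir F x)) i) x0"
    using isCont_ddir[OF assms, of i] isCont_cong by fast
qed

section \<open>Inverse and implicit functions\<close>

lemma Blinfun_ddir:
  fixes F :: "'a::cvec \<Rightarrow> 'b::cvec"
  shows "cdiff F x \<Longrightarrow> blinfun_apply (Blinfun (ddir F x)) = ddir F x"
  by (rule bounded_linear_Blinfun_apply) (rule has_derivative_bounded_linear[OF cdiff_has_derivative])

lemma hol_ball:
  assumes "hol F x0"
  obtains \<rho> where "\<rho> > 0" "\<And>y. y \<in> ball x0 \<rho> \<Longrightarrow> hol F y"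
  using hol_eventually[OF assms] unfolding eventually_nhds_metric by (auto simp: dist_commute)

text \<open>The real inverse function theorem, together with the fact that the inverse of a complex
  linear derivative is complex linear. Injectivity of the derivative suffices because source and
  target are the same space of finite dimension.\<close>

lemma hol_inverse_function:
  fixes F :: "'a::cvec \<Rightarrow> 'a"
  assumes F: "hol F x0" and inj: "\<And>v. ddir F x0 v = 0 \<Longrightarrow> v = 0"
  obtains G where "hol G (F x0)" "G (F x0) = x0"
    "\<forall>\<^sub>F y in nhds (F x0). F (G y) = y" "\<forall>\<^sub>F x in nhds x0. G (F x) = x"
proof -
  obtain \<rho> where \<rho>: "\<rho> > 0" "\<And>y. y \<in> ball x0 \<rho> \<Longrightarrow> hol F y" using hol_ball[OF F] by blast
  define f' where "f' x = Blinfun (ddir F x)" for x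
  have f': "blinfun_apply (f' x) = ddir F x" if "x \<in> ball x0 \<rho>" for x
    unfolding f'_def by (rule Blinfun_ddir) (use \<rho>(2) that hol_imp_cdiff in blast)
  have x0: "x0 \<in> ball x0 \<rho>" using \<rho>(1) by simp
  have lin: "linear (ddir F x0)" using F hol_imp_cdiff ddir_linear by blast
  have "inj (ddir F x0)" using linear_injective_0[OF lin] inj by blast
  then obtain g where g: "linear g" "g \<circ> ddir F x0 = id"
    using linear_injective_left_inverse[OF lin] by blast
  have gb: "bounded_linear g" using g(1) linear_conv_bounded_linear by blast
  have inv: "Blinfun g o\<^sub>L f' x0 = id_blinfun"
    by (rule blinfun_eqI) (use g(2) f'[OF x0] in \<open>auto simp: bounded_linear_Blinfun_apply[OF gb] fun_eq_iff\<close>)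
  obtain U' V G g' where UV: "open U'" "U' \<subseteq> ball x0 \<rho>" "x0 \<in> U'" "open V" "F x0 \<in> V"
    "homeomorphism U' V F G" and
    G: "\<And>y. y \<in> V \<Longrightarrow> (G has_derivative (g' y)) (at y)"
    "\<And>y. y \<in> V \<Longrightarrow> g' y = inv (blinfun_apply (f' (G y)))"
    "\<And>y. y \<in> V \<Longrightarrow> bij (blinfun_apply (f' (G y)))"
  proof (rule inverse_function_theorem[of "ball x0 \<rho>" F f' x0 "Blinfun g"])
    show "(F has_derivative blinfun_apply (f' x)) (at x)" if "x \<in> ball x0 \<rho>" for x
      using f'[OF that] cdiff_has_derivative[OF hol_imp_cdiff[OF \<rho>(2)[OF that]]] by simp
    show "continuous_on (ball x0 \<rho>) f'"
      unfolding f'_def by (intro continuous_at_imp_continuous_on ballI isCont_Blinfun_ddir \<rho>(2))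
  qed (use x0 inv in auto)
  have hom: "\<And>x. x \<in> U' \<Longrightarrow> G (F x) = x" "\<And>y. y \<in> V \<Longrightarrow> F (G y) = y" "\<And>y. y \<in> V \<Longrightarrow> G y \<in> U'"
    using UV(6) by (auto simp: homeomorphism_def)
  have cd: "cdiff G y" if y: "y \<in> V" for y
  proof (rule cdiffI[OF G(1)[OF y]])
    fix c v
    have Gy: "G y \<in> ball x0 \<rho>" using hom(3)[OF y] UV(2) by blast
    have cdF: "cdiff F (G y)" using \<rho>(2)[OF Gy] hol_imp_cdiff by blast
    have b: "bij (ddir F (G y))" "g' y = inv (ddir F (G y))" using G(2,3)[OF y] f'[OF Gy] by auto
    have "ddir F (G y) (cs c (g' y v)) = cs c v"
      using b by (simp add: ddir_cs[OF cdF] bij_is_surj surj_f_inv_f)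
    thus "g' y (cs c v) = cs c (g' y v)"
      using b by (metis bij_inv_eq_iff)
  qed
  show ?thesis
  proof (rule that)
    show "hol G (F x0)" unfolding hol_def
      using eventually_nhds_in_open[OF UV(4,5)] by (rule eventually_mono) (rule cd)
    show "G (F x0) = x0" using hom(1) UV(3) by blast
    show "\<forall>\<^sub>F y in nhds (F x0). F (G y) = y"
      using eventually_nhds_in_open[OF UV(4,5)] by (rule eventually_mono) (rule hom(2))
    show "\<forall>\<^sub>F x in nhds x0. G (F x) = x"
      using eventually_nhds_in_open[OF UV(1,3)] by (rule eventually_mono) (rule hom(1))
  qed
qed

lemma ddir_Pair:
  assumes "cdiff F x" "cdiff G x"
  shows "ddir (\<lambda>x. (F x, G x)) x v = (ddir F x v, ddir G x v)"
  using has_derivative_Pair[OF cdiff_has_derivative[OF assms(1)] cdiff_has_derivative[OF assms(2)]]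
  by (simp add: ddir_eq)

lemma ddir_linear_map: "bounded_linear L \<Longrightarrow> ddir L x = L"
  by (rule ddir_eq) (rule bounded_linear_imp_has_derivative)

lemma ddir_snd [simp]: "ddir snd x = snd" by (rule ddir_linear_map) (rule bounded_linear_snd)
lemma ddir_fst [simp]: "ddir fst x = fst" by (rule ddir_linear_map) (rule bounded_linear_fst)

text \<open>The map \<open>q \<mapsto> (F q, snd q)\<close> is inverted. Restricted to a fixed value
  of \<open>F\<close> this is the implicit function theorem; in general \<open>G\<close> inverts a
  change of variable that depends on parameters.\<close>

lemma hol_partial_inverse:
  fixes F :: "'x::cvec \<times> 'p::cvec \<Rightarrow> 'x"
  assumes F: "hol F (x0, p0)" and inj: "\<And>v. ddir F (x0, p0) (v, 0) = 0 \<Longrightarrow> v = 0"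
  obtains G where "hol G (F (x0, p0), p0)" "G (F (x0, p0), p0) = x0"
    "\<forall>\<^sub>F q in nhds (F (x0, p0), p0). F (G q, snd q) = fst q"
    "\<forall>\<^sub>F q in nhds (x0, p0). G (F q, snd q) = fst q"
proof -
  define \<Phi> where "\<Phi> q = (F q, snd q)" for q
  have h: "hol \<Phi> (x0, p0)" unfolding \<Phi>_def by (intro hol_intros F)
  have d: "ddir \<Phi> (x0, p0) v = (ddir F (x0, p0) v, snd v)" for v
    unfolding \<Phi>_def using ddir_Pair[OF hol_imp_cdiff[OF F] hol_imp_cdiff[OF hol_snd']] by simp
  obtain \<Gamma> where \<Gamma>: "hol \<Gamma> (\<Phi> (x0, p0))" "\<Gamma> (\<Phi> (x0, p0)) = (x0, p0)"
    "\<forall>\<^sub>F y in nhds (\<Phi> (x0, p0)). \<Phi> (\<Gamma> y) = y" "\<forall>\<^sub>F x in nhds (x0, p0). \<Gamma> (\<Phi> x) = x"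
  proof (rule hol_inverse_function[OF h])
    fix v assume "ddir \<Phi> (x0, p0) v = 0"
    thus "v = 0" using inj[of "fst v"] unfolding d by (cases v) (auto simp: zero_prod_def)
  qed
  show ?thesis
  proof (rule that[of "\<lambda>q. fst (\<Gamma> q)"])
    show "hol (\<lambda>q. fst (\<Gamma> q)) (F (x0, p0), p0)" using \<Gamma>(1) unfolding \<Phi>_def by (intro hol_intros) simp
    show "fst (\<Gamma> (F (x0, p0), p0)) = x0" using \<Gamma>(2) unfolding \<Phi>_def by simp
    show "\<forall>\<^sub>F q in nhds (F (x0, p0), p0). F (fst (\<Gamma> q), snd q) = fst q"
    proof -
      have "\<forall>\<^sub>F y in nhds (F (x0, p0), p0). \<Phi> (\<Gamma> y) = y" using \<Gamma>(3) unfolding \<Phi>_def by simp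
      thus ?thesis
      proof (rule eventually_mono)
        fix q assume "\<Phi> (\<Gamma> q) = q"
        hence "F (\<Gamma> q) = fst q" "snd (\<Gamma> q) = snd q" unfolding \<Phi>_def by (metis fst_conv, metis snd_conv)
        thus "F (fst (\<Gamma> q), snd q) = fst q" by (metis prod.collapse)
      qed
    qed
    show "\<forall>\<^sub>F q in nhds (x0, p0). fst (\<Gamma> (F q, snd q)) = fst q"
      using \<Gamma>(4) by (rule eventually_mono) (simp add: \<Phi>_def)
  qed
qed

text \<open>Strict differentiability at \<open>x0\<close>: the derivative is continuous, so
  \<open>F\<close> minus its derivative at \<open>x0\<close> has a small Lipschitz constant on a
  small ball.\<close>

lemma hol_lipschitz:
  fixes F :: "'a::cvec \<Rightarrow> 'b::cvec"
  assumes F: "hol F x0" and e: "\<epsilon> > 0"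
  obtains r where "r > 0" "\<And>x y. x \<in> ball x0 r \<Longrightarrow> y \<in> ball x0 r \<Longrightarrow>
    norm (F x - F y - ddir F x0 (x - y)) \<le> \<epsilon> * norm (x - y)"
proof -
  obtain \<rho> where \<rho>: "\<rho> > 0" "\<And>y. y \<in> ball x0 \<rho> \<Longrightarrow> hol F y" using hol_ball[OF F] by blast
  have "((\<lambda>x. Blinfun (ddir F x)) \<longlongrightarrow> Blinfun (ddir F x0)) (nhds x0)"
    using tendsto_at_iff_tendsto_nhds[of "\<lambda>x. Blinfun (ddir F x)" x0] isCont_Blinfun_ddir[OF F]
    unfolding isCont_def by blast
  from tendstoD[OF this e]
  have "\<forall>\<^sub>F x in nhds x0. dist (Blinfun (ddir F x)) (Blinfun (ddir F x0)) < \<epsilon>" .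
  then obtain r1 where r1: "r1 > 0" "\<And>x. x \<in> ball x0 r1 \<Longrightarrow> dist (Blinfun (ddir F x)) (Blinfun (ddir F x0)) < \<epsilon>"
    unfolding eventually_nhds_metric by (auto simp: dist_commute)
  define r where "r = min \<rho> r1"
  have cd: "cdiff F x" if "x \<in> ball x0 r" for x using that \<rho>(2) hol_imp_cdiff by (auto simp: r_def)
  have lin: "bounded_linear (ddir F x0)"
    using has_derivative_bounded_linear[OF cdiff_has_derivative[OF hol_imp_cdiff[OF F]]] .
  show ?thesis
  proof (rule that[of r])
    show "r > 0" using \<rho>(1) r1(1) by (simp add: r_def)
    fix x y assume xy: "x \<in> ball x0 r" "y \<in> ball x0 r"
    have "norm ((F x - ddir F x0 x) - (F y - ddir F x0 y)) \<le> \<epsilon> * norm (x - y)"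
    proof (rule differentiable_bound[of "ball x0 r" "\<lambda>x. F x - ddir F x0 x" "\<lambda>x v. ddir F x v - ddir F x0 v"])
      fix z assume z: "z \<in> ball x0 r"
      show "((\<lambda>x. F x - ddir F x0 x) has_derivative (\<lambda>v. ddir F z v - ddir F x0 v)) (at z within ball x0 r)"
        by (intro has_derivative_diff has_derivative_at_withinI[OF cdiff_has_derivative[OF cd[OF z]]]
          bounded_linear_imp_has_derivative lin)
      have "blinfun_apply (Blinfun (ddir F z) - Blinfun (ddir F x0)) = (\<lambda>v. ddir F z v - ddir F x0 v)"
        using Blinfun_ddir[OF cd[OF z]] Blinfun_ddir[OF hol_imp_cdiff[OF F]] by (auto simp: blinfun.diff_left)
      hence "onorm (\<lambda>v. ddir F z v - ddir F x0 v) = dist (Blinfun (ddir F z)) (Blinfun (ddir F x0))"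
        unfolding dist_norm norm_blinfun.rep_eq by simp
      thus "onorm (\<lambda>v. ddir F z v - ddir F x0 v) \<le> \<epsilon>" using r1(2)[of z] z by (auto simp: r_def)
    qed (use xy in auto)
    thus "norm (F x - F y - ddir F x0 (x - y)) \<le> \<epsilon> * norm (x - y)"
      by (simp add: linear_diff[OF bounded_linear.linear[OF lin]] algebra_simps)
  qed
qed

section \<open>Conjugated germs and slices in one variable\<close>

lemma cdiff_conj:
  assumes "cdiff F (cj x)"
  shows "cdiff (\<lambda>x. cj (F (cj x))) x" "ddir (\<lambda>x. cj (F (cj x))) x v = cj (ddir F (cj x) (cj v))"
proof -
  have "((\<lambda>x. cj (F (cj x))) has_derivative (\<lambda>v. cj (ddir F (cj x) (cj v)))) (at x)"
    by (rule bounded_linear.has_derivative[OF bounded_linear_cj]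
      has_derivative_compose[OF bounded_linear_imp_has_derivative[OF bounded_linear_cj] cdiff_has_derivative[OF assms]])+
  note d = this
  show "ddir (\<lambda>x. cj (F (cj x))) x v = cj (ddir F (cj x) (cj v))" using ddir_eq[OF d] by simp
  show "cdiff (\<lambda>x. cj (F (cj x))) x"
    by (rule cdiffI[OF d]) (simp add: cj_cs ddir_cs[OF assms])
qed

lemma isCont_cj: "isCont (cj :: 'a \<Rightarrow> 'a::cvec) x"
  using tendsto_cj[OF tendsto_ident_at] by (simp add: isCont_def)

lemma eventually_nhds_cj:
  "\<forall>\<^sub>F y in nhds (cj x). P y \<Longrightarrow> \<forall>\<^sub>F y in nhds (x::'a::cvec). P (cj y)"
  by (rule isCont_eventually_nhds[OF isCont_cj])

lemma hol_conj:
  assumes "hol F (cj x)"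
  shows "hol (\<lambda>x. cj (F (cj x))) x"
  using eventually_nhds_cj[OF assms[unfolded hol_def]] unfolding hol_def
  by (rule eventually_mono) (rule cdiff_conj)

lemma hol_snd_arg: "hol F p \<Longrightarrow> hol (\<lambda>q. F (snd q)) (z, p)"
  by (rule hol_compose) (auto intro: hol_snd')

lemma hol_slice1: "hol F (z, p) \<Longrightarrow> hol (\<lambda>z. F (z, p)) z"
  by (rule hol_compose[of F]) (auto intro!: hol_intros)

lemma hol_slice2: "hol F (z, p) \<Longrightarrow> hol (\<lambda>p. F (z, p)) p"
  by (rule hol_compose[of F]) (auto intro!: hol_intros)

lemma cdiff_slice:
  fixes F :: "complex \<times> 'p::cvec \<Rightarrow> complex"
  assumes "cdiff F (z, p)"
  shows "((\<lambda>z. F (z, p)) has_field_derivative ddir F (z, p) (1, 0)) (at z)"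
  using cdiff_line[of F "(0, p)" z "(1, 0)"] assms by simp

lemma hol_slice_holomorphic:
  fixes F :: "complex \<times> 'p::cvec \<Rightarrow> complex"
  assumes "\<And>z. z \<in> S \<Longrightarrow> cdiff F (z, p)"
  shows "(\<lambda>z. F (z, p)) holomorphic_on S"
proof (rule holomorphic_onI)
  fix z assume "z \<in> S"
  from cdiff_slice[OF assms[OF this]] show "(\<lambda>z. F (z, p)) field_differentiable at z within S"
    unfolding field_differentiable_def by (blast intro: has_field_derivative_at_within)
qed

section \<open>Real-analytic and holomorphic maps\<close>

text \<open>The majorant of the multi-index power series below: a product of geometric series,
  summed by splitting off one index at a time.\<close>

lemma summable_on_geometric_PiE:
  fixes t :: "'i \<Rightarrow> real"
  assumes "finite B" "\<And>b. b \<in> B \<Longrightarrow> 0 \<le> t b \<and> t b < 1"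
  shows "(\<lambda>\<alpha>. \<Prod>b\<in>B. t b ^ \<alpha> b) summable_on (B \<rightarrow>\<^sub>E (UNIV :: nat set))"
  using assms
proof (induction B rule: finite_induct)
  case empty
  show ?case by simp
next
  case (insert j B)
  let ?P = "B \<rightarrow>\<^sub>E (UNIV :: nat set)"
  have IH: "(\<lambda>\<alpha>. \<Prod>b\<in>B. t b ^ \<alpha> b) summable_on ?P" using insert by auto
  then obtain S where S: "((\<lambda>\<alpha>. \<Prod>b\<in>B. t b ^ \<alpha> b) has_sum S) ?P" by (auto simp: summable_on_def)
  have tj: "0 \<le> t j" "t j < 1" using insert by auto
  have geo: "(\<lambda>n. t j ^ n) summable_on UNIV"
    using tj by (intro norm_summable_imp_summable_on) (auto simp: power_abs)
  have "(\<lambda>(n, \<alpha>). t j ^ n * (\<Prod>b\<in>B. t b ^ \<alpha> b)) summable_on (UNIV \<times> ?P)"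
  proof (rule summable_on_SigmaI)
    show "((\<lambda>\<alpha>. case (n, \<alpha>) of (n, \<alpha>) \<Rightarrow> t j ^ n * (\<Prod>b\<in>B. t b ^ \<alpha> b)) has_sum t j ^ n * S) ?P" for n
      using has_sum_cmult_right[OF S] by simp
    show "(\<lambda>n. t j ^ n * S) summable_on UNIV"
      using geo by (rule summable_on_cmult_left)
    show "0 \<le> (case (n, \<alpha>) of (n, \<alpha>) \<Rightarrow> t j ^ n * (\<Prod>b\<in>B. t b ^ \<alpha> b))" for n \<alpha>
      using insert.prems by (auto intro!: mult_nonneg_nonneg prod_nonneg)
  qed
  also have "(\<lambda>(n, \<alpha>). t j ^ n * (\<Prod>b\<in>B. t b ^ \<alpha> b)) summable_on (UNIV \<times> ?P) \<longleftrightarrow>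
      ((\<lambda>\<alpha>. \<Prod>b\<in>insert j B. t b ^ \<alpha> b) \<circ> (\<lambda>(n, \<alpha>). \<alpha>(j := n))) summable_on (UNIV \<times> ?P)"
  proof (rule summable_on_cong)
    fix x :: "nat \<times> ('i \<Rightarrow> nat)"
    obtain n \<alpha> where x: "x = (n, \<alpha>)" by (cases x)
    have "(\<Prod>b\<in>B. t b ^ (\<alpha>(j := n)) b) = (\<Prod>b\<in>B. t b ^ \<alpha> b)"
      by (rule prod.cong) (use insert.hyps in auto)
    thus "(case x of (n, \<alpha>) \<Rightarrow> t j ^ n * (\<Prod>b\<in>B. t b ^ \<alpha> b)) =
        ((\<lambda>\<alpha>. \<Prod>b\<in>insert j B. t b ^ \<alpha> b) \<circ> (\<lambda>(n, \<alpha>). \<alpha>(j := n))) x"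
      unfolding x using insert.hyps by simp
  qed
  also have "\<dots> \<longleftrightarrow> (\<lambda>\<alpha>. \<Prod>b\<in>insert j B. t b ^ \<alpha> b) summable_on (insert j B \<rightarrow>\<^sub>E UNIV)"
    unfolding PiE_insert_eq by (rule summable_on_reindex[symmetric]) (rule inj_combinator, rule insert.hyps)
  finally show ?case .
qed

text \<open>The coefficients are written as integrals so that they remain holomorphic functions of
  the other variables in \<open>polydisc_series\<close>; the Cauchy estimates make the sum
  unconditional.\<close>

lemma cint_power_series:
  assumes "r > 0" "continuous_on (cball 0 r) f" "f holomorphic_on ball 0 r" "norm w < r"
  shows "((\<lambda>n. w ^ n * cint r (\<lambda>s. f s / s ^ Suc n)) has_sum f w) (UNIV :: nat set)"
proof (rule norm_summable_imp_has_sum)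
  have eq: "(deriv ^^ n) f 0 / fact n = cint r (\<lambda>s. f s / s ^ Suc n)" for n
  proof -
    have "contour_integral (circlepath 0 r) (\<lambda>s. f s / (s - 0) ^ Suc n) = (2 * pi * \<i>) / (fact n) * (deriv ^^ n) f 0"
      by (rule contour_integral_unique[OF Cauchy_has_contour_integral_higher_derivative_circlepath[OF assms(2,3)]])
        (use assms(1) in simp)
    thus ?thesis by (simp add: cint_contour field_simps)
  qed
  show "(\<lambda>n. w ^ n * cint r (\<lambda>s. f s / s ^ Suc n)) sums f w"
    using holomorphic_power_series[OF assms(3), of w] assms(4) unfolding eq by (simp add: mult.commute)
  have "bounded (f ` sphere 0 r)"
    using compact_imp_bounded[OF compact_continuous_image[OF continuous_on_subset[OF assms(2) sphere_cball] compact_sphere]] .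
  then obtain M where "\<forall>x\<in>f ` sphere 0 r. norm x \<le> M" unfolding bounded_iff by blast
  hence M: "\<And>s. s \<in> sphere 0 r \<Longrightarrow> norm (f s) \<le> M" by blast
  have b: "norm (cint r (\<lambda>s. f s / s ^ Suc n)) \<le> M / r ^ n" for n
  proof -
    have "norm (cint r (\<lambda>s. f s / s ^ Suc n)) \<le> M / r ^ Suc n * r"
    proof (rule cint_bound)
      show "continuous_on (sphere 0 r) (\<lambda>s. f s / s ^ Suc n)"
        by (intro continuous_intros continuous_on_subset[OF assms(2)]) (use assms(1) in auto)
      show "norm (f w / w ^ Suc n) \<le> M / r ^ Suc n" if "norm w = r" for w
        unfolding norm_divide norm_power that using M[of w] that assms(1) by (intro divide_right_mono) auto
    qed (use assms(1) in simp)
    thus ?thesis using assms(1) by simp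
  qed
  show "summable (\<lambda>n. norm (w ^ n * cint r (\<lambda>s. f s / s ^ Suc n)))"
  proof (rule summable_comparison_test')
    show "summable (\<lambda>n. M * (norm w / r) ^ n)"
      by (intro summable_mult summable_geometric) (use assms(1,4) in auto)
    show "norm (norm (w ^ n * cint r (\<lambda>s. f s / s ^ Suc n))) \<le> M * (norm w / r) ^ n" for n
    proof -
      have "norm (w ^ n) * norm (cint r (\<lambda>s. f s / s ^ Suc n)) \<le> norm w ^ n * (M / r ^ n)"
        unfolding norm_power using b by (intro mult_left_mono) auto
      thus ?thesis by (simp add: norm_mult power_divide mult.commute)
    qed
  qed
qed

text \<open>Induction over the directions: expand along \<open>v j\<close>, then expand each
  coefficient function along the remaining directions. The Cauchy estimates are part of the
  induction because they provide the absolute convergence that merges the two sums into one.\<close>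

lemma polydisc_series:
  fixes v :: "'i \<Rightarrow> 'c::cvec" and F :: "'c \<Rightarrow> complex"
  assumes "finite B" "r > 0" "r * (\<Sum>b\<in>B. norm (v b)) < \<rho>"
    "\<And>x. x \<in> ball y \<rho> \<Longrightarrow> hol F x" "\<And>x. x \<in> ball y \<rho> \<Longrightarrow> norm (F x) \<le> M"
  shows "\<exists>c. (\<forall>\<alpha>\<in>B \<rightarrow>\<^sub>E (UNIV :: nat set). norm (c \<alpha>) \<le> M * (\<Prod>b\<in>B. (1 / r) ^ \<alpha> b)) \<and>
    (\<forall>\<zeta>. (\<forall>b\<in>B. norm (\<zeta> b) < r) \<longrightarrow>
      ((\<lambda>\<alpha>. (\<Prod>b\<in>B. \<zeta> b ^ \<alpha> b) * c \<alpha>) has_sum F (y + (\<Sum>b\<in>B. cs (\<zeta> b) (v b)))) (B \<rightarrow>\<^sub>E UNIV))"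
  using assms
proof (induction B arbitrary: F \<rho> M rule: finite_induct)
  case (empty F \<rho> M)
  have "norm (F y) \<le> M" using empty by simp
  moreover have "((\<lambda>\<alpha>. F y) has_sum F y) {\<lambda>x::'i. undefined :: nat}"
    using has_sum_finite[of "{\<lambda>x::'i. undefined :: nat}" "\<lambda>\<alpha>. F y"] by simp
  ultimately show ?case by (intro exI[of _ "\<lambda>_. F y"]) simp
next
  case (insert j B F \<rho> M)
  let ?P = "B \<rightarrow>\<^sub>E (UNIV :: nat set)"
  define Fn where "Fn n x = cint r (\<lambda>s. F (x + cs s (v j)) / s ^ Suc n)" for n x
  \<comment> \<open>The radius left over after a displacement of norm at most
    \<open>r * norm (v j)\<close>.\<close>
  define \<rho>' where "\<rho>' = \<rho> - r * norm (v j)"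
  note r = insert.prems(1)
  have "ball y \<rho> \<noteq> {}"
  proof -
    have "0 \<le> r * (\<Sum>b\<in>insert j B. norm (v b))" using r by (intro mult_nonneg_nonneg sum_nonneg) auto
    hence "\<rho> > 0" using insert.prems(2) by simp
    thus ?thesis by simp
  qed
  have mem: "x + cs s (v j) \<in> ball y \<rho>" if "x \<in> ball y \<rho>'" "norm s \<le> r" for x s
  proof -
    have "norm (cs s (v j)) \<le> r * norm (v j)"
      unfolding norm_cs by (intro mult_right_mono that) auto
    moreover have "dist y (x + cs s (v j)) \<le> dist y x + norm (cs s (v j))"
      by (metis add_diff_cancel_left' dist_commute dist_norm dist_triangle)
    ultimately show ?thesis using that(1) by (simp add: \<rho>'_def)
  qed
  have Fn_hol: "hol (Fn n) x" if x: "x \<in> ball y \<rho>'" for n x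
  proof -
    have "hol (\<lambda>p. F (snd p + cs (fst p) (v j)) / fst p ^ Suc n) (s, x)" if s: "norm s = r" for s
    proof (rule hol_divide)
      have "hol F (snd (s, x) + cs (fst (s, x)) (v j))" using insert.prems(3)[OF mem[OF x]] s by simp
      thus "hol (\<lambda>p. F (snd p + cs (fst p) (v j))) (s, x)"
        by (rule hol_compose) (rule hol_cs_line[of "\<lambda>x. x", OF hol_ident])
      show "hol (\<lambda>p. fst p ^ Suc n) (s, x)" by (rule hol_power) (rule hol_fst')
      show "fst (s, x) ^ Suc n \<noteq> 0" using s r(1) by auto
    qed
    from hol_cint(1)[OF _ this] show ?thesis unfolding Fn_def using r by simp
  qed
  have cont: "continuous_on (cball 0 r) (\<lambda>s. F (x + cs s (v j)))" if x: "x \<in> ball y \<rho>'" for x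
  proof (rule continuous_on_compose2[of "ball y \<rho>" F])
    show "continuous_on (ball y \<rho>) F"
      by (intro continuous_at_imp_continuous_on ballI hol_isCont insert.prems(3))
  qed (use mem[OF x] in \<open>auto intro!: continuous_intros\<close>)
  have holo: "(\<lambda>s. F (x + cs s (v j))) holomorphic_on ball 0 r" if x: "x \<in> ball y \<rho>'" for x
  proof (rule holomorphic_onI)
    fix s :: complex assume "s \<in> ball 0 r"
    hence "cdiff F (x + cs s (v j))" by (intro hol_imp_cdiff insert.prems(3) mem[OF x]) simp
    from cdiff_line[OF this] show "(\<lambda>s. F (x + cs s (v j))) field_differentiable at s within ball 0 r"
      unfolding field_differentiable_def by (blast intro: has_field_derivative_at_within)
  qed
  have Fn_bound: "norm (Fn n x) \<le> M * (1 / r) ^ n" if x: "x \<in> ball y \<rho>'" for n x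
  proof -
    have "norm (Fn n x) \<le> M / r ^ Suc n * r"
      unfolding Fn_def
    proof (rule cint_bound)
      show "continuous_on (sphere 0 r) (\<lambda>s. F (x + cs s (v j)) / s ^ Suc n)"
        by (intro continuous_intros continuous_on_subset[OF cont[OF x]]) (use r in auto)
      show "norm (F (x + cs w (v j)) / w ^ Suc n) \<le> M / r ^ Suc n" if "norm w = r" for w
        unfolding norm_divide norm_power that using insert.prems(4)[OF mem[OF x]] that r
        by (intro divide_right_mono) auto
    qed (use r in simp)
    thus ?thesis using r by (simp add: power_divide)
  qed
  have "r * (\<Sum>b\<in>B. norm (v b)) < \<rho>'"
    using insert.prems(2) insert.hyps by (simp add: \<rho>'_def algebra_simps)
  hence "\<exists>c. (\<forall>\<alpha>\<in>?P. norm (c \<alpha>) \<le> (M * (1 / r) ^ n) * (\<Prod>b\<in>B. (1 / r) ^ \<alpha> b)) \<and>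
    (\<forall>\<zeta>. (\<forall>b\<in>B. norm (\<zeta> b) < r) \<longrightarrow>
      ((\<lambda>\<alpha>. (\<Prod>b\<in>B. \<zeta> b ^ \<alpha> b) * c \<alpha>) has_sum Fn n (y + (\<Sum>b\<in>B. cs (\<zeta> b) (v b)))) ?P)" for n
    by (intro insert.IH[OF r, of \<rho>' "Fn n" "M * (1 / r) ^ n"] Fn_hol Fn_bound)
  hence "\<forall>n. \<exists>c. (\<forall>\<alpha>\<in>?P. norm (c \<alpha>) \<le> (M * (1 / r) ^ n) * (\<Prod>b\<in>B. (1 / r) ^ \<alpha> b)) \<and>
    (\<forall>\<zeta>. (\<forall>b\<in>B. norm (\<zeta> b) < r) \<longrightarrow>
      ((\<lambda>\<alpha>. (\<Prod>b\<in>B. \<zeta> b ^ \<alpha> b) * c \<alpha>) has_sum Fn n (y + (\<Sum>b\<in>B. cs (\<zeta> b) (v b)))) ?P)" by (rule allI)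
  from choice[OF this] obtain c where c: "\<And>n \<alpha>. \<alpha> \<in> ?P \<Longrightarrow> norm (c n \<alpha>) \<le> (M * (1 / r) ^ n) * (\<Prod>b\<in>B. (1 / r) ^ \<alpha> b)"
    "\<And>n \<zeta>. (\<forall>b\<in>B. norm (\<zeta> b) < r) \<Longrightarrow>
      ((\<lambda>\<alpha>. (\<Prod>b\<in>B. \<zeta> b ^ \<alpha> b) * c n \<alpha>) has_sum Fn n (y + (\<Sum>b\<in>B. cs (\<zeta> b) (v b)))) ?P"
    by blast
  define C where "C \<alpha> = c (\<alpha> j) (restrict \<alpha> B)" for \<alpha>
  have upd: "C (\<alpha>(j := n)) = c n \<alpha>" "(\<Prod>b\<in>B. g b ^ (\<alpha>(j := n)) b) = (\<Prod>b\<in>B. g b ^ \<alpha> b)"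
    if "\<alpha> \<in> ?P" for \<alpha> n and g :: "'i \<Rightarrow> 'd::comm_monoid_mult"
  proof -
    have "restrict (\<alpha>(j := n)) B = \<alpha>"
      using that insert.hyps(2) by (auto simp: fun_eq_iff PiE_def extensional_def restrict_def)
    thus "C (\<alpha>(j := n)) = c n \<alpha>" by (simp add: C_def)
    show "(\<Prod>b\<in>B. g b ^ (\<alpha>(j := n)) b) = (\<Prod>b\<in>B. g b ^ \<alpha> b)"
      by (rule prod.cong) (use insert.hyps in auto)
  qed
  have bound: "norm (C \<alpha>) \<le> M * (\<Prod>b\<in>insert j B. (1 / r) ^ \<alpha> b)" if "\<alpha> \<in> insert j B \<rightarrow>\<^sub>E (UNIV :: nat set)" for \<alpha>
  proof -
    have "\<alpha> = (restrict \<alpha> B)(j := \<alpha> j)"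
      using that by (auto simp: fun_eq_iff PiE_def extensional_def restrict_def)
    moreover have "restrict \<alpha> B \<in> ?P" by simp
    ultimately obtain n \<alpha>' where a: "\<alpha> = \<alpha>'(j := n)" "\<alpha>' \<in> ?P" by blast
    show ?thesis unfolding a(1) using c(1)[OF a(2), of n] insert.hyps upd(2)[OF a(2), of "\<lambda>b. 1 / r" n]
      by (simp add: upd(1)[OF a(2)] mult.assoc)
  qed
  have "((\<lambda>\<alpha>. (\<Prod>b\<in>insert j B. \<zeta> b ^ \<alpha> b) * C \<alpha>) has_sum F (y + (\<Sum>b\<in>insert j B. cs (\<zeta> b) (v b)))) (insert j B \<rightarrow>\<^sub>E UNIV)"
    if \<zeta>: "\<forall>b\<in>insert j B. norm (\<zeta> b) < r" for \<zeta>
  proof -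
    define x where "x = y + (\<Sum>b\<in>B. cs (\<zeta> b) (v b))"
    have xin: "x \<in> ball y \<rho>'"
    proof -
      have "norm (\<Sum>b\<in>B. cs (\<zeta> b) (v b)) \<le> (\<Sum>b\<in>B. r * norm (v b))"
        using \<zeta> by (intro sum_norm_le) (auto simp: norm_cs intro!: mult_right_mono)
      also have "\<dots> < \<rho>'" using \<open>r * (\<Sum>b\<in>B. norm (v b)) < \<rho>'\<close> by (simp add: sum_distrib_left)
      finally show ?thesis by (simp add: x_def dist_norm)
    qed
    define f where "f p = (\<Prod>b\<in>insert j B. \<zeta> b ^ ((\<lambda>(n, \<alpha>). \<alpha>(j := n)) p) b) * C ((\<lambda>(n, \<alpha>). \<alpha>(j := n)) p)" for p
    have f: "f (n, \<alpha>) = \<zeta> j ^ n * ((\<Prod>b\<in>B. \<zeta> b ^ \<alpha> b) * c n \<alpha>)" if "\<alpha> \<in> ?P" for n \<alpha>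
      unfolding f_def using insert.hyps upd(2)[OF that, of \<zeta> n] by (simp add: upd(1)[OF that] mult.assoc)
    have f_comp: "(\<lambda>\<alpha>. (\<Prod>b\<in>insert j B. \<zeta> b ^ \<alpha> b) * C \<alpha>) \<circ> (\<lambda>(n, \<alpha>). \<alpha>(j := n)) = f"
      unfolding f_def o_def ..
    have "(f has_sum F (x + cs (\<zeta> j) (v j))) (UNIV \<times> ?P)"
    proof (rule has_sum_SigmaI)
      show "((\<lambda>\<alpha>. f (n, \<alpha>)) has_sum \<zeta> j ^ n * Fn n x) ?P" for n
      proof -
        have "((\<lambda>\<alpha>. \<zeta> j ^ n * ((\<Prod>b\<in>B. \<zeta> b ^ \<alpha> b) * c n \<alpha>)) has_sum \<zeta> j ^ n * Fn n x) ?P"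
          unfolding x_def by (intro has_sum_cmult_right c(2)) (use \<zeta> in auto)
        thus ?thesis by (subst has_sum_cong[OF f]) auto
      qed
      show "((\<lambda>n. \<zeta> j ^ n * Fn n x) has_sum F (x + cs (\<zeta> j) (v j))) UNIV"
        unfolding Fn_def using cint_power_series[OF r cont[OF xin] holo[OF xin], of "\<zeta> j"] \<zeta> by simp
      \<comment> \<open>Iterated sums may be merged only under summability over the product, which
        comes from the geometric majorant.\<close>
      have s: "(\<lambda>\<alpha>. \<Prod>b\<in>insert j B. (norm (\<zeta> b) / r) ^ \<alpha> b) summable_on (insert j B \<rightarrow>\<^sub>E UNIV)"
        by (rule summable_on_geometric_PiE) (use insert.hyps \<zeta> r in auto)
      hence "(\<lambda>\<alpha>. M * (\<Prod>b\<in>insert j B. (norm (\<zeta> b) / r) ^ \<alpha> b)) summable_on (insert j B \<rightarrow>\<^sub>E UNIV)"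
        by (rule summable_on_cmult_right)
      hence "(\<lambda>\<alpha>. norm ((\<Prod>b\<in>insert j B. \<zeta> b ^ \<alpha> b) * C \<alpha>)) summable_on (insert j B \<rightarrow>\<^sub>E UNIV)"
      proof (rule summable_on_comparison_test)
        fix \<alpha> assume a: "\<alpha> \<in> insert j B \<rightarrow>\<^sub>E (UNIV :: nat set)"
        have "norm ((\<Prod>b\<in>insert j B. \<zeta> b ^ \<alpha> b) * C \<alpha>) \<le>
            (\<Prod>b\<in>insert j B. norm (\<zeta> b) ^ \<alpha> b) * (M * (\<Prod>b\<in>insert j B. (1 / r) ^ \<alpha> b))"
          unfolding norm_mult prod_norm[symmetric] norm_power
          using bound[OF a] by (intro mult_left_mono prod_nonneg) auto
        also have "\<dots> = M * (\<Prod>b\<in>insert j B. norm (\<zeta> b) ^ \<alpha> b * (1 / r) ^ \<alpha> b)"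
          by (simp only: prod.distrib mult_ac)
        finally show "norm ((\<Prod>b\<in>insert j B. \<zeta> b ^ \<alpha> b) * C \<alpha>) \<le> M * (\<Prod>b\<in>insert j B. (norm (\<zeta> b) / r) ^ \<alpha> b)"
          by (simp only: power_mult_distrib[symmetric] times_divide_eq_right mult_1_right)
      qed auto
      hence "(\<lambda>\<alpha>. (\<Prod>b\<in>insert j B. \<zeta> b ^ \<alpha> b) * C \<alpha>) summable_on (insert j B \<rightarrow>\<^sub>E UNIV)"
        by (rule abs_summable_summable)
      hence "((\<lambda>\<alpha>. (\<Prod>b\<in>insert j B. \<zeta> b ^ \<alpha> b) * C \<alpha>) \<circ> (\<lambda>(n, \<alpha>). \<alpha>(j := n))) summable_on (UNIV \<times> ?P)"
        unfolding PiE_insert_eq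
        by (subst summable_on_reindex[symmetric]) (rule inj_combinator, rule insert.hyps)
      thus "f summable_on (UNIV \<times> ?P)" unfolding f_comp .
    qed
    hence "((\<lambda>\<alpha>. (\<Prod>b\<in>insert j B. \<zeta> b ^ \<alpha> b) * C \<alpha>) \<circ> (\<lambda>(n, \<alpha>). \<alpha>(j := n)) has_sum F (x + cs (\<zeta> j) (v j))) (UNIV \<times> ?P)"
      unfolding f_comp .
    hence "((\<lambda>\<alpha>. (\<Prod>b\<in>insert j B. \<zeta> b ^ \<alpha> b) * C \<alpha>) has_sum F (x + cs (\<zeta> j) (v j))) (insert j B \<rightarrow>\<^sub>E UNIV)"
      unfolding PiE_insert_eq by (subst has_sum_reindex) (rule inj_combinator, rule insert.hyps)
    moreover have "x + cs (\<zeta> j) (v j) = y + (\<Sum>b\<in>insert j B. cs (\<zeta> b) (v b))"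
      using insert.hyps by (simp add: x_def add_ac)
    ultimately show ?thesis by simp
  qed
  with bound show ?case by blast
qed

text \<open>The expansion of \<open>F\<close> along the images \<open>\<iota> b\<close> of the real
  basis vectors, evaluated at real coordinates, is the required real power series.\<close>

lemma real_analytic_onI:
  fixes f :: "'a::euclidean_space \<Rightarrow> complex" and \<iota> :: "'a \<Rightarrow> 'c::cvec"
  assumes \<iota>: "bounded_linear \<iota>"
    and F: "\<And>a. a \<in> U \<Longrightarrow> \<exists>F. hol F (\<iota> a) \<and> (\<forall>\<^sub>F x in nhds a. f x = F (\<iota> x))"
  shows "real_analytic_on f U"
  unfolding real_analytic_on_def
proof
  fix a assume "a \<in> U"
  then obtain F where F: "hol F (\<iota> a)" "\<forall>\<^sub>F x in nhds a. f x = F (\<iota> x)" using assms(2) by blast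
  interpret \<iota>: bounded_linear \<iota> by fact
  obtain \<rho>1 where \<rho>1: "\<rho>1 > 0" "\<And>y. y \<in> ball (\<iota> a) \<rho>1 \<Longrightarrow> hol F y" using hol_ball[OF F(1)] by blast
  have "(F \<longlongrightarrow> F (\<iota> a)) (nhds (\<iota> a))"
    using hol_isCont[OF F(1)] tendsto_at_iff_tendsto_nhds[of F "\<iota> a"] unfolding isCont_def by blast
  from tendstoD[OF this, of 1]
  obtain \<rho>2 where \<rho>2: "\<rho>2 > 0" "\<And>y. y \<in> ball (\<iota> a) \<rho>2 \<Longrightarrow> dist (F y) (F (\<iota> a)) < 1"
    unfolding eventually_nhds_metric by (auto simp: dist_commute)
  define \<rho> where "\<rho> = min \<rho>1 \<rho>2"
  define M where "M = norm (F (\<iota> a)) + 1"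
  have M: "norm (F y) \<le> M" if "y \<in> ball (\<iota> a) \<rho>" for y
    using \<rho>2(2)[of y] that norm_triangle_sub[of "F y" "F (\<iota> a)"] by (auto simp: \<rho>_def M_def dist_norm)
  \<comment> \<open>A change of all coordinates by less than \<open>r\<close> moves the image point
    by at most half of \<open>\<rho>\<close>; the summand 1 avoids a zero denominator.\<close>
  define r where "r = \<rho> / (2 * ((\<Sum>b\<in>Basis. norm (\<iota> b)) + 1))"
  have \<rho>: "\<rho> > 0" using \<rho>1 \<rho>2 by (simp add: \<rho>_def)
  define s where "s = (\<Sum>b\<in>Basis. norm (\<iota> b))"
  have s: "s \<ge> 0" unfolding s_def by (rule sum_nonneg) simp
  have r: "r > 0" using \<rho> s unfolding r_def s_def[symmetric] by simp
  have "r * s = \<rho> / 2 * (s / (s + 1))" using s by (simp add: r_def s_def[symmetric] field_simps)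
  also have "\<dots> \<le> \<rho> / 2 * 1" using s \<rho> by (intro mult_left_mono) (auto simp: field_simps)
  finally have rs: "r * (\<Sum>b\<in>Basis. norm (\<iota> b)) < \<rho>" using \<rho> by (simp add: s_def)
  obtain c where c: "\<And>\<zeta>. (\<forall>b\<in>Basis. norm (\<zeta> b) < r) \<Longrightarrow>
      ((\<lambda>\<alpha>. (\<Prod>b\<in>Basis. \<zeta> b ^ \<alpha> b) * c \<alpha>) has_sum F (\<iota> a + (\<Sum>b\<in>Basis. cs (\<zeta> b) (\<iota> b)))) (Basis \<rightarrow>\<^sub>E (UNIV :: nat set))"
  proof -
    have "hol F y" if "y \<in> ball (\<iota> a) \<rho>" for y using that \<rho>1(2) by (simp add: \<rho>_def)
    from polydisc_series[OF finite_Basis r rs this M] show thesis using that by blast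
  qed
  obtain d where d: "d > 0" "\<And>x. x \<in> ball a d \<Longrightarrow> f x = F (\<iota> x)"
    using F(2) unfolding eventually_nhds_metric by (auto simp: dist_commute)
  show "\<exists>c. \<exists>r>0. \<forall>x\<in>ball a r. ((\<lambda>\<alpha>. (\<Prod>b\<in>Basis. ((x - a) \<bullet> b) ^ \<alpha> b) *\<^sub>R c \<alpha>) has_sum f x) (Basis \<rightarrow>\<^sub>E (UNIV :: nat set))"
  proof (rule exI[of _ c], rule exI[of _ "min r d"], intro conjI ballI)
    show "min r d > 0" using r d by simp
    fix x assume x: "x \<in> ball a (min r d)"
    define \<zeta> where "\<zeta> b = complex_of_real ((x - a) \<bullet> b)" for b
    have "\<forall>b\<in>Basis. norm (\<zeta> b) < r"
    proof
      fix b :: 'a assume "b \<in> Basis"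
      hence "\<bar>(x - a) \<bullet> b\<bar> \<le> norm (x - a)" by (rule Basis_le_norm)
      also have "\<dots> < r" using x by (simp add: dist_norm norm_minus_commute)
      finally show "norm (\<zeta> b) < r" by (simp add: \<zeta>_def)
    qed
    from c[OF this] have "((\<lambda>\<alpha>. (\<Prod>b\<in>Basis. \<zeta> b ^ \<alpha> b) * c \<alpha>) has_sum F (\<iota> a + (\<Sum>b\<in>Basis. cs (\<zeta> b) (\<iota> b)))) (Basis \<rightarrow>\<^sub>E UNIV)" .
    moreover have "\<iota> a + (\<Sum>b\<in>Basis. cs (\<zeta> b) (\<iota> b)) = \<iota> x"
    proof -
      have "(\<Sum>b\<in>Basis. cs (\<zeta> b) (\<iota> b)) = \<iota> (\<Sum>b\<in>Basis. ((x - a) \<bullet> b) *\<^sub>R b)"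
        by (simp add: \<zeta>_def cs_of_real \<iota>.sum \<iota>.scaleR)
      also have "\<dots> = \<iota> (x - a)" by (simp only: euclidean_representation)
      finally show ?thesis by (simp add: \<iota>.diff)
    qed
    ultimately show "((\<lambda>\<alpha>. (\<Prod>b\<in>Basis. ((x - a) \<bullet> b) ^ \<alpha> b) *\<^sub>R c \<alpha>) has_sum f x) (Basis \<rightarrow>\<^sub>E UNIV)"
      using d(2)[of x] x by (simp add: \<zeta>_def scaleR_conv_of_real)
  qed
qed

section \<open>Linear operations on real-analytic maps\<close>

lemma real_analytic_on_bounded_linear:
  assumes "bounded_linear L" "real_analytic_on f U"
  shows "real_analytic_on (\<lambda>x. L (f x)) U"
  unfolding real_analytic_on_def
proof
  fix a assume "a \<in> U"
  then obtain c r where cr: "r > 0" "\<And>x. x \<in> ball a r \<Longrightarrow> ((\<lambda>\<alpha>. (\<Prod>b\<in>Basis. ((x - a) \<bullet> b) ^ \<alpha> b) *\<^sub>R c \<alpha>) has_sum f x) (Basis \<rightarrow>\<^sub>E (UNIV :: nat set))"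
    using assms(2) unfolding real_analytic_on_def by blast
  have "((\<lambda>\<alpha>. (\<Prod>b\<in>Basis. ((x - a) \<bullet> b) ^ \<alpha> b) *\<^sub>R L (c \<alpha>)) has_sum L (f x)) (Basis \<rightarrow>\<^sub>E (UNIV :: nat set))"
    if "x \<in> ball a r" for x
    using has_sum_bounded_linear[OF assms(1) cr(2)[OF that]]
    unfolding linear_cmul[OF bounded_linear.linear[OF assms(1)]] .
  thus "\<exists>c. \<exists>r>0. \<forall>x\<in>ball a r. ((\<lambda>\<alpha>. (\<Prod>b\<in>Basis. ((x - a) \<bullet> b) ^ \<alpha> b) *\<^sub>R c \<alpha>) has_sum L (f x)) (Basis \<rightarrow>\<^sub>E (UNIV :: nat set))"
    using cr(1) by (intro exI[of _ "\<lambda>\<alpha>. L (c \<alpha>)"] exI[of _ r] conjI ballI)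
qed

lemma real_analytic_on_add:
  assumes "real_analytic_on f U" "real_analytic_on g U"
  shows "real_analytic_on (\<lambda>x. f x + g x) U"
  unfolding real_analytic_on_def
proof
  fix a assume a: "a \<in> U"
  obtain c r where cr: "r > 0" "\<And>x. x \<in> ball a r \<Longrightarrow> ((\<lambda>\<alpha>. (\<Prod>b\<in>Basis. ((x - a) \<bullet> b) ^ \<alpha> b) *\<^sub>R c \<alpha>) has_sum f x) (Basis \<rightarrow>\<^sub>E (UNIV :: nat set))"
    using assms(1) a unfolding real_analytic_on_def by blast
  obtain c' r' where cr': "r' > 0" "\<And>x. x \<in> ball a r' \<Longrightarrow> ((\<lambda>\<alpha>. (\<Prod>b\<in>Basis. ((x - a) \<bullet> b) ^ \<alpha> b) *\<^sub>R c' \<alpha>) has_sum g x) (Basis \<rightarrow>\<^sub>E (UNIV :: nat set))"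
    using assms(2) a unfolding real_analytic_on_def by blast
  have "\<forall>x\<in>ball a (min r r'). ((\<lambda>\<alpha>. (\<Prod>b\<in>Basis. ((x - a) \<bullet> b) ^ \<alpha> b) *\<^sub>R (c \<alpha> + c' \<alpha>)) has_sum (f x + g x)) (Basis \<rightarrow>\<^sub>E (UNIV :: nat set))"
    unfolding scaleR_add_right by (intro ballI has_sum_add cr(2) cr'(2)) simp_all
  moreover have "min r r' > 0" using cr(1) cr'(1) by simp
  ultimately have "min r r' > 0 \<and> (\<forall>x\<in>ball a (min r r'). ((\<lambda>\<alpha>. (\<Prod>b\<in>Basis. ((x - a) \<bullet> b) ^ \<alpha> b) *\<^sub>R (c \<alpha> + c' \<alpha>)) has_sum (f x + g x)) (Basis \<rightarrow>\<^sub>E (UNIV :: nat set)))"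
    by (rule conjI[rotated])
  thus "\<exists>c. \<exists>r>0. \<forall>x\<in>ball a r. ((\<lambda>\<alpha>. (\<Prod>b\<in>Basis. ((x - a) \<bullet> b) ^ \<alpha> b) *\<^sub>R c \<alpha>) has_sum (f x + g x)) (Basis \<rightarrow>\<^sub>E (UNIV :: nat set))"
    by (intro exI[of _ "\<lambda>\<alpha>. c \<alpha> + c' \<alpha>"] exI[of _ "min r r'"])
qed

lemma real_analytic_on_zero: "real_analytic_on (\<lambda>x. 0) U"
  unfolding real_analytic_on_def
  by (intro ballI exI[of _ "\<lambda>_. 0"] exI[of _ 1] conjI) simp_all

lemma real_analytic_on_sum:
  "(\<And>i. i \<in> A \<Longrightarrow> real_analytic_on (f i) U) \<Longrightarrow> real_analytic_on (\<lambda>x. \<Sum>i\<in>A. f i x) U"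
  by (induction A rule: infinite_finite_induct) (auto intro!: real_analytic_on_add real_analytic_on_zero)

section \<open>Complexification of real power series\<close>

lemma cint_radius_zero [simp]: "cint 0 f = 0"
  by (simp add: cint_def)

text \<open>Weierstrass's theorem: by Cauchy's formula, uniform convergence of the maps forces
  convergence of the derivatives with an error proportional to \<open>norm v\<close>, and complex
  linearity passes to the limit.\<close>

lemma hol_uniform_limit:
  fixes f :: "nat \<Rightarrow> 'a::cvec \<Rightarrow> complex"
  assumes \<rho>: "\<rho> > 0" and f: "\<And>n x. x \<in> ball x0 \<rho> \<Longrightarrow> hol (f n) x"
    and lim: "uniform_limit (ball x0 \<rho>) f g sequentially"
  shows "hol g x0"
proof -
  let ?S = "ball x0 (\<rho> / 2)"
  \<comment> \<open>The radius is adapted to \<open>v\<close>, so that points move by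
    \<open>\<rho> / 4\<close> and the error scales with \<open>norm v\<close>. At
    \<open>v = 0\<close> division by zero yields radius 0 and thus the correct value 0.\<close>
  define D where "D x v = cint (\<rho> / (4 * norm v)) (\<lambda>s. g (x + cs s v) / s\<^sup>2)" for x v
  have cf: "continuous_on (ball x0 \<rho>) (f n)" for n
    by (intro continuous_at_imp_continuous_on ballI hol_isCont f)
  have cg: "continuous_on (ball x0 \<rho>) g"
    by (rule uniform_limit_theorem[OF _ lim]) (use cf in auto)
  have mem: "x + cs s v \<in> ball x0 \<rho>" if "x \<in> ?S" "v \<noteq> 0" "norm s \<le> \<rho> / (4 * norm v)" for x v s
  proof -
    have "norm (cs s v) \<le> \<rho> / (4 * norm v) * norm v"
      unfolding norm_cs by (intro mult_right_mono that) auto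
    hence "norm (cs s v) < \<rho> / 2" using that(2) \<rho> by simp
    moreover have "dist x0 (x + cs s v) \<le> dist x0 x + norm (cs s v)"
      by (metis add_diff_cancel_left' dist_commute dist_norm dist_triangle)
    ultimately show ?thesis using that(1) by simp
  qed
  have nle: "\<forall>\<^sub>F n in sequentially. \<forall>x\<in>?S. \<forall>v. norm (ddir (f n) x v - D x v) \<le> e * norm v" if e: "e > 0" for e
  proof -
    have "\<forall>\<^sub>F n in sequentially. \<forall>x\<in>ball x0 \<rho>. dist (f n x) (g x) < e * \<rho> / 4"
      using uniform_limitD[OF lim, of "e * \<rho> / 4"] e \<rho> by simp
    thus ?thesis
    proof (rule eventually_mono, intro ballI allI)
      fix n x v
      assume n: "\<forall>x\<in>ball x0 \<rho>. dist (f n x) (g x) < e * \<rho> / 4" and x: "x \<in> ?S"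
      have xb: "x \<in> ball x0 \<rho>" using x \<rho> by simp
      show "norm (ddir (f n) x v - D x v) \<le> e * norm v"
      proof (cases "v = 0")
        case True
        thus ?thesis using ddir_zero[OF hol_imp_cdiff[OF f[OF xb]]] by (simp add: D_def)
      next
        case False
        define r where "r = \<rho> / (4 * norm v)"
        have r: "r > 0" using False \<rho> by (simp add: r_def)
        have m: "x + cs s v \<in> ball x0 \<rho>" if "norm s \<le> r" for s using mem[OF x False] that unfolding r_def by blast
        have cr: "continuous_on (sphere 0 r) (\<lambda>s. h (x + cs s v) / s\<^sup>2)" if "continuous_on (ball x0 \<rho>) h" for h :: "'a \<Rightarrow> complex"
          by (intro continuous_intros continuous_on_compose2[OF that]) (use m r in auto)
        have "ddir (f n) x v - D x v = cint r (\<lambda>s. f n (x + cs s v) / s\<^sup>2) - cint r (\<lambda>s. g (x + cs s v) / s\<^sup>2)"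
          unfolding D_def r_def[symmetric] by (subst ddir_cint[OF r hol_imp_cdiff[OF f[OF m]]]) auto
        also have "\<dots> = cint r (\<lambda>s. f n (x + cs s v) / s\<^sup>2 - g (x + cs s v) / s\<^sup>2)"
          by (rule cint_diff[symmetric]) (use r cr cf cg in auto)
        also have "norm \<dots> \<le> ((e * \<rho> / 4) / r\<^sup>2) * r"
        proof (rule cint_bound)
          show "continuous_on (sphere 0 r) (\<lambda>s. f n (x + cs s v) / s\<^sup>2 - g (x + cs s v) / s\<^sup>2)"
            by (intro continuous_on_diff cr cf cg)
          fix w :: complex assume w: "norm w = r"
          have "norm (f n (x + cs w v) / w\<^sup>2 - g (x + cs w v) / w\<^sup>2) = dist (f n (x + cs w v)) (g (x + cs w v)) / r\<^sup>2"
            using w by (simp add: diff_divide_distrib[symmetric] norm_divide norm_power dist_norm)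
          also have "\<dots> \<le> (e * \<rho> / 4) / r\<^sup>2"
            using bspec[OF n m[of w]] w by (intro divide_right_mono) auto
          finally show "norm (f n (x + cs w v) / w\<^sup>2 - g (x + cs w v) / w\<^sup>2) \<le> (e * \<rho> / 4) / r\<^sup>2" .
        qed (use r in simp)
        also have "\<dots> = e * norm v" using r False \<rho> by (simp add: power2_eq_square r_def)
        finally show ?thesis .
      qed
    qed
  qed
  have xlim: "(\<lambda>n. f n x) \<longlonglongrightarrow> g x" if "x \<in> ball x0 \<rho>" for x
    using tendsto_uniform_limitI[OF lim that] .
  have x0S: "x0 \<in> ?S" "x0 \<in> ball x0 \<rho>" using \<rho> by auto
  have "\<exists>g. \<forall>x\<in>?S. (\<lambda>n. f n x) \<longlonglongrightarrow> g x \<and> (g has_derivative D x) (at x within ?S)"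
  proof (rule has_derivative_sequence[where S = ?S and f = f and f' = "\<lambda>n x. ddir (f n) x" and g' = D])
    show "x0 \<in> ?S" "(\<lambda>n. f n x0) \<longlonglongrightarrow> g x0" using x0S xlim by blast+
    show "convex ?S" by (rule convex_ball)
    show "\<forall>\<^sub>F n in sequentially. \<forall>x\<in>?S. \<forall>v. norm (ddir (f n) x v - D x v) \<le> e * norm v" if "e > 0" for e
      by (rule nle[OF that])
    fix n x assume "x \<in> ?S"
    hence "x \<in> ball x0 \<rho>" using \<rho> by simp
    from cdiff_has_derivative[OF hol_imp_cdiff[OF f[OF this]]]
    show "(f n has_derivative ddir (f n) x) (at x within ?S)" by (rule has_derivative_at_withinI)
  qed
  then obtain g' where g': "\<And>x. x \<in> ?S \<Longrightarrow> (\<lambda>n. f n x) \<longlonglongrightarrow> g' x" "\<And>x. x \<in> ?S \<Longrightarrow> (g' has_derivative D x) (at x within ?S)"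
    by blast
  have gg: "g' x = g x" if "x \<in> ?S" for x
    using LIMSEQ_unique[OF g'(1)[OF that] xlim] that \<rho> by simp
  have cd: "cdiff g x" if x: "x \<in> ?S" for x
  proof (rule cdiffI)
    have "(g' has_derivative D x) (at x)" using g'(2)[OF x] at_within_open[OF x] by simp
    thus "(g has_derivative D x) (at x)"
      by (rule has_derivative_transform_within_open[of _ _ _ UNIV ?S]) (use x gg in auto)
    have L: "(\<lambda>n. ddir (f n) x v) \<longlonglongrightarrow> D x v" for v
    proof (rule tendstoI)
      fix e :: real assume e: "e > 0"
      define e' where "e' = e / (norm v + 1)"
      have p: "norm v + 1 > 0" by (simp add: add_nonneg_pos)
      have "e * norm v < e * (norm v + 1)" using e by simp
      hence e': "e' > 0" "e' * norm v < e"
        using e p by (auto simp: e'_def pos_divide_less_eq)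
      from nle[OF e'(1)] show "\<forall>\<^sub>F n in sequentially. dist (ddir (f n) x v) (D x v) < e"
      proof (rule eventually_mono)
        fix n assume "\<forall>x\<in>?S. \<forall>v. norm (ddir (f n) x v - D x v) \<le> e' * norm v"
        hence "norm (ddir (f n) x v - D x v) \<le> e' * norm v" using x by blast
        thus "dist (ddir (f n) x v) (D x v) < e" using e'(2) by (simp add: dist_norm)
      qed
    qed
    have cdf: "cdiff (f n) x" for n using x \<rho> by (intro hol_imp_cdiff f) simp
    have "(\<lambda>n. ddir (f n) x (cs c v)) \<longlonglongrightarrow> c * D x v" for c v
      unfolding ddir_cs[OF cdf] cs_complex by (intro tendsto_mult_left L)
    thus "D x (cs c v) = cs c (D x v)" for c v
      using LIMSEQ_unique L by fastforce
  qed
  have "\<forall>\<^sub>F x in nhds x0. x \<in> ?S" by (rule eventually_nhds_in_open) (use x0S in auto)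
  thus ?thesis unfolding hol_def by (rule eventually_mono) (rule cd)
qed

text \<open>Complex numbers \<open>L x b\<close> are substituted for the real coordinates
  \<open>y \<bullet> b\<close>. An unconditionally convergent complex family is absolutely summable,
  so convergence at the single real point with all coordinates equal to \<open>s\<close> dominates
  the terms on the whole polydisc.\<close>

lemma real_analytic_imp_hol:
  fixes f :: "'a::euclidean_space \<Rightarrow> complex" and L :: "'c::cvec \<Rightarrow> 'a \<Rightarrow> complex"
  assumes f: "real_analytic_on f U" "a \<in> U"
    and L: "\<And>b. bounded_linear (\<lambda>x. L x b)" "\<And>b c x. L (cs c x) b = c * L x b"
  obtains G s where "s > 0" "hol G 0"
    "\<And>x y. (\<And>b. b \<in> Basis \<Longrightarrow> L x b = of_real (y \<bullet> b)) \<Longrightarrow> norm y < s \<Longrightarrow> G x = f (a + y)"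
proof -
  let ?P = "Basis \<rightarrow>\<^sub>E (UNIV :: nat set) :: ('a \<Rightarrow> nat) set"
  obtain c r where cr: "r > 0" "\<And>x. x \<in> ball a r \<Longrightarrow>
      ((\<lambda>\<alpha>. (\<Prod>b\<in>Basis. ((x - a) \<bullet> b) ^ \<alpha> b) *\<^sub>R c \<alpha>) has_sum f x) ?P"
    using f unfolding real_analytic_on_def by blast
  define s where "s = r / (2 * (real (card (Basis :: 'a set)) + 1))"
  have n0: "real (card (Basis :: 'a set)) \<ge> 0" by simp
  have s: "s > 0" "s * card (Basis :: 'a set) < r"
    unfolding s_def using cr(1) n0 by (auto simp: field_simps intro!: add_nonneg_pos add_pos_nonneg)
  define y0 :: 'a where "y0 = (\<Sum>b\<in>Basis. s *\<^sub>R b)"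
  have y0: "y0 \<bullet> b = s" if "b \<in> Basis" for b using that by (simp add: y0_def inner_sum_left_Basis)
  have "norm y0 \<le> (\<Sum>b\<in>Basis. \<bar>y0 \<bullet> b\<bar>)" by (rule norm_le_l1)
  also have "\<dots> = s * card (Basis :: 'a set)" using s(1) by (simp add: y0 mult.commute)
  finally have "a + y0 \<in> ball a r" using s(2) by (simp add: dist_norm)
  from cr(2)[OF this] have "((\<lambda>\<alpha>. (\<Prod>b\<in>Basis. s ^ \<alpha> b) *\<^sub>R c \<alpha>) has_sum f (a + y0)) ?P"
    by (simp add: y0 cong: prod.cong)
  hence "(\<lambda>\<alpha>. (\<Prod>b\<in>Basis. s ^ \<alpha> b) *\<^sub>R c \<alpha>) summable_on ?P" by (auto simp: summable_on_def)
  hence abs: "(\<lambda>\<alpha>. norm ((\<Prod>b\<in>Basis. s ^ \<alpha> b) *\<^sub>R c \<alpha>)) summable_on ?P"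
    by (rule summable_on_iff_abs_summable_on_complex[THEN iffD1])
  define u where "u \<alpha> x = (\<Prod>b\<in>Basis. L x b ^ \<alpha> b) * c \<alpha>" for \<alpha> x
  define N where "N = {x. \<forall>b\<in>Basis. norm (L x b) < s}"
  define G where "G x = (\<Sum>\<^sub>\<infinity>\<alpha>\<in>?P. u \<alpha> x)" for x
  have "uniform_limit N (\<lambda>X x. \<Sum>\<alpha>\<in>X. u \<alpha> x) G (finite_subsets_at_top ?P)"
    unfolding G_def
  proof (rule Weierstrass_m_test_general[OF _ abs])
    fix \<alpha> x assume "x \<in> N"
    hence "(\<Prod>b\<in>Basis. norm (L x b) ^ \<alpha> b) \<le> (\<Prod>b\<in>Basis. s ^ \<alpha> b)"
      by (intro prod_mono conjI power_mono) (auto simp: N_def less_imp_le)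
    moreover have "(\<Prod>b\<in>Basis. s ^ \<alpha> b) \<ge> 0" using s(1) by (intro prod_nonneg) auto
    ultimately show "norm (u \<alpha> x) \<le> norm ((\<Prod>b\<in>Basis. s ^ \<alpha> b) *\<^sub>R c \<alpha>)"
      by (simp add: u_def norm_mult prod_norm[symmetric] norm_power mult_right_mono)
  qed
  note ul = this
  have "\<exists>X. finite X \<and> (\<forall>x\<in>N. dist (\<Sum>\<alpha>\<in>X. u \<alpha> x) (G x) < 1 / real (Suc n))" for n
  proof -
    have "\<forall>\<^sub>F X in finite_subsets_at_top ?P. finite X \<and> (\<forall>x\<in>N. dist (\<Sum>\<alpha>\<in>X. u \<alpha> x) (G x) < 1 / real (Suc n))"
      by (intro eventually_conj eventually_finite_subsets_at_top_weakI uniform_limitD[OF ul]) auto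
    from eventually_happens'[OF finite_subsets_at_top_neq_bot this] show ?thesis .
  qed
  note ex_X = this
  \<comment> \<open>The partial sums converge along the net of finite sets of multi-indices; a
    sequence of finite sets is extracted for the theorem on uniform limits.\<close>
  define X where "X n = (SOME X. finite X \<and> (\<forall>x\<in>N. dist (\<Sum>\<alpha>\<in>X. u \<alpha> x) (G x) < 1 / real (Suc n)))" for n
  have X: "dist (\<Sum>\<alpha>\<in>X n. u \<alpha> x) (G x) < 1 / real (Suc n)" if "x \<in> N" for n x
    using conjunct2[OF someI_ex[OF ex_X[of n], folded X_def], rule_format, OF that] .
  have "\<forall>\<^sub>F x in nhds 0. \<forall>b\<in>(Basis :: 'a set). norm (L x b) < s"
  proof (rule eventually_ball_finite[OF finite_Basis], rule ballI)
    fix b :: 'a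
    have "((\<lambda>x. L x b) \<longlongrightarrow> L 0 b) (nhds 0)"
      using linear_continuous_at[OF L(1), of 0 b] tendsto_at_iff_tendsto_nhds[of "\<lambda>x. L x b" 0] unfolding isCont_def by blast
    moreover have "L 0 b = 0" using linear_0[OF bounded_linear.linear[OF L(1)]] .
    ultimately show "\<forall>\<^sub>F x in nhds 0. norm (L x b) < s" using tendstoD[of "\<lambda>x. L x b" 0 "nhds 0" s] s(1) by simp
  qed
  then obtain \<rho> where \<rho>: "\<rho> > 0" "ball 0 \<rho> \<subseteq> N"
    unfolding eventually_nhds_metric N_def by (force simp: dist_commute)
  show ?thesis
  proof (rule that)
    show "s > 0" by fact
    show "hol G 0"
    proof (rule hol_uniform_limit[OF \<rho>(1)])
      show "hol (\<lambda>x. \<Sum>\<alpha>\<in>X n. u \<alpha> x) x" for n x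
        unfolding u_def by (intro hol_sum hol_mult hol_prod hol_power hol_const hol_linear L(1)) (simp add: L(2))
      show "uniform_limit (ball 0 \<rho>) (\<lambda>n x. \<Sum>\<alpha>\<in>X n. u \<alpha> x) G sequentially"
      proof (rule uniform_limitI)
        fix e :: real assume "e > 0"
        hence "\<forall>\<^sub>F n in sequentially. 1 / real (Suc n) < e"
          using order_tendstoD(2)[OF LIMSEQ_inverse_real_of_nat] by (simp add: inverse_eq_divide)
        thus "\<forall>\<^sub>F n in sequentially. \<forall>x\<in>ball 0 \<rho>. dist (\<Sum>\<alpha>\<in>X n. u \<alpha> x) (G x) < e"
        proof (rule eventually_mono, intro ballI)
          fix n and x :: 'c assume "1 / real (Suc n) < e" "x \<in> ball 0 \<rho>"
          from this(1) X[OF subsetD[OF \<rho>(2) this(2)], of n]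
          show "dist (\<Sum>\<alpha>\<in>X n. u \<alpha> x) (G x) < e" by (rule less_trans[rotated])
        qed
      qed
    qed
    fix x y assume xy: "\<And>b. b \<in> Basis \<Longrightarrow> L x b = of_real (y \<bullet> b)" "norm y < s"
    have "s \<le> r" unfolding s_def using cr(1) n0 by (simp add: field_simps)
    hence "a + y \<in> ball a r" using xy(2) by (simp add: dist_norm)
    from cr(2)[OF this] have "((\<lambda>\<alpha>. u \<alpha> x) has_sum f (a + y)) ?P"
      by (simp add: u_def xy(1) scaleR_conv_of_real cong: prod.cong)
    thus "G x = f (a + y)" unfolding G_def by (rule infsumI)
  qed
qed

section \<open>Wirtinger derivatives and antiholomorphic families\<close>

lemma d_z_zero_iff:
  assumes "f differentiable (at z)" "d_z f z = 0"
  shows "((\<lambda>w. f (cnj w)) has_field_derivative d_zbar f z) (at (cnj z))"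
proof -
  define D where "D = frechet_derivative f (at z)"
  have D: "(f has_derivative D) (at z)" using assms(1) unfolding D_def by (simp add: frechet_derivative_works)
  hence lin: "linear D" by (rule has_derivative_linear)
  have e: "D 1 = \<i> * D \<i>" using assms(2) by (simp add: d_z_def D_def)
  have De: "D \<i> = - \<i> * D 1" using e by simp
  \<comment> \<open>So \<open>D\<close> is antilinear; after composition with \<open>cnj\<close> it
    becomes multiplication by \<open>D 1\<close>, which is \<open>d_zbar f z\<close>.\<close>
  have Dv: "D v = D 1 * cnj v" for v
  proof -
    have "v = Re v *\<^sub>R 1 + Im v *\<^sub>R \<i>" by (simp add: complex_eq_iff)
    hence "D v = D (Re v *\<^sub>R 1 + Im v *\<^sub>R \<i>)" by simp
    also have "\<dots> = Re v *\<^sub>R D 1 + Im v *\<^sub>R D \<i>" by (simp only: linear_add[OF lin] linear_cmul[OF lin])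
    also note De
    finally show ?thesis by (simp add: complex_eq_iff algebra_simps)
  qed
  have "(f has_derivative (\<lambda>v. D 1 * cnj v)) (at z)"
    by (rule has_derivative_eq_rhs[OF D]) (rule ext, rule Dv)
  hence "((\<lambda>w. f (cnj w)) has_derivative (\<lambda>v. D 1 * cnj (cnj v))) (at (cnj z))"
    by (intro has_derivative_compose[OF bounded_linear_imp_has_derivative[OF bounded_linear_cnj], of f _ "cnj z"]) simp
  moreover have "d_zbar f z = D 1" unfolding d_zbar_def D_def[symmetric] De by simp
  ultimately show ?thesis by (simp add: has_field_derivative_def)
qed

lemma d_zbar_cnj:
  assumes "(g has_field_derivative d) (at (cnj z))" "\<forall>\<^sub>F w in nhds z. f w = g (cnj w)"
  shows "d_zbar f z = d"
proof -
  have "((\<lambda>w. g (cnj w)) has_derivative (\<lambda>v. d * cnj v)) (at z)"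
    using has_derivative_compose[OF bounded_linear_imp_has_derivative[OF bounded_linear_cnj] assms(1)[unfolded has_field_derivative_def]] .
  hence "(f has_derivative (\<lambda>v. d * cnj v)) (at z)"
    by (rule has_derivative_transform_eventually)
      (use assms(2) in \<open>auto simp: eventually_at_filter eq_commute elim: eventually_mono dest: eventually_nhds_x_imp_x\<close>)
  hence "frechet_derivative f (at z) = (\<lambda>v. d * cnj v)" by (rule frechet_derivative_at[symmetric])
  thus ?thesis by (simp add: d_zbar_def complex_eq_iff)
qed

definition cvec :: "real ^ 'k \<Rightarrow> complex ^ 'k" where "cvec \<eta> = (\<chi> i. of_real (\<eta> $ i))"

lemma cvec_nth [simp]: "cvec \<eta> $ i = of_real (\<eta> $ i)" by (simp add: cvec_def)
lemma cvec_0 [simp]: "cvec 0 = 0" by (simp add: vec_eq_iff)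
lemma cj_cvec [simp]: "cj (cvec \<eta>) = cvec \<eta>" by (simp add: vec_eq_iff)
lemma norm_cvec [simp]: "norm (cvec \<eta>) = norm \<eta>"
  by (simp add: norm_vec_def)
lemma bounded_linear_cvec: "bounded_linear cvec"
  by (rule bounded_linear_intro[of _ 1]) (auto simp: vec_eq_iff complex_eq_iff)

text \<open>Only the real part of \<open>z\<close> is complexified, together with
  \<open>\<eta>\<close>. The resulting germ agrees with \<open>f \<eta>\<close> for real
  \<open>z\<close>, and since \<open>f \<eta>\<close> composed with \<open>cnj\<close> is
  holomorphic, the identity theorem extends the agreement to a disc.\<close>

lemma antiholomorphic_family_hol:
  fixes f :: "real ^ 'k::finite \<Rightarrow> complex \<Rightarrow> complex"
  assumes "antiholomorphic_family f r U" "r > 0" "open U" "0 \<in> U"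
  obtains g s where "s > 0" "s \<le> r" "ball 0 s \<subseteq> U" "hol g 0"
    "\<And>\<eta> z. norm \<eta> < s \<Longrightarrow> norm z < s \<Longrightarrow> f \<eta> z = g (cnj z, cvec \<eta>)"
proof -
  \<comment> \<open>The basis direction of the imaginary part of \<open>z\<close> is sent to 0, so
    the germ matches \<open>f\<close> only at real \<open>z\<close>.\<close>
  define L :: "complex \<times> (complex ^ 'k) \<Rightarrow> complex \<times> (real ^ 'k) \<Rightarrow> complex"
    where "L x b = fst x * of_real (Re (fst b)) + (\<Sum>i\<in>UNIV. snd x $ i * of_real (snd b $ i))" for x b
  have ra: "real_analytic_on (\<lambda>(z, \<eta>). f \<eta> z) (ball 0 r \<times> U)" "(0, 0) \<in> ball 0 r \<times> U"
    using assms unfolding antiholomorphic_family_def by auto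
  have Llin: "bounded_linear (\<lambda>x. L x b)" for b
    unfolding L_def by (intro bounded_linear_add bounded_linear_sum bounded_linear_mult_const
      bounded_linear_fst bounded_linear_compose[OF bounded_linear_vec_nth bounded_linear_snd])
  have Lcs: "L (cs c x) b = c * L x b" for c x b
    by (simp add: L_def algebra_simps sum_distrib_left)
  obtain G s1 where G: "s1 > 0" "hol G 0"
    "\<And>x y. (\<And>b. b \<in> Basis \<Longrightarrow> L x b = of_real (y \<bullet> b)) \<Longrightarrow> norm y < s1 \<Longrightarrow>
      G x = (\<lambda>(z, \<eta>). f \<eta> z) ((0, 0) + y)"
  proof (rule real_analytic_imp_hol[OF ra Llin Lcs])
    fix s G assume a: "0 < s" "hol G 0" "\<And>x y. (\<And>b. b \<in> Basis \<Longrightarrow> L x b = of_real (y \<bullet> b)) \<Longrightarrow> norm y < s \<Longrightarrow>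
      G x = (\<lambda>(z, \<eta>). f \<eta> z) ((0, 0) + y)"
    show thesis by (rule that[OF a(1,2)]) (rule a(3))
  qed
  have Gr: "G (of_real t, cvec \<eta>) = f \<eta> (of_real t)" if "norm t + norm \<eta> < s1" for t \<eta>
  proof -
    have "G (of_real t, cvec \<eta>) = (\<lambda>(z, \<eta>). f \<eta> z) ((0, 0) + (complex_of_real t, \<eta>))"
    proof (rule G(3))
      show "norm (complex_of_real t, \<eta>) < s1" using norm_Pair_le[of "complex_of_real t" \<eta>] that by simp
      show "L (of_real t, cvec \<eta>) b = of_real ((complex_of_real t, \<eta>) \<bullet> b)" for b
        by (cases b) (simp add: L_def inner_vec_def inner_complex_def)
    qed
    thus ?thesis by simp
  qed
  obtain \<rho> where \<rho>: "\<rho> > 0" "\<And>y. y \<in> ball 0 \<rho> \<Longrightarrow> hol G y" using hol_ball[OF G(2)] by blast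
  obtain u where u: "u > 0" "ball 0 u \<subseteq> U" using assms(3,4) open_contains_ball by blast
  define s where "s = min (min (s1 / 2) (\<rho> / 2)) (min u r)"
  have s: "s > 0" "s \<le> r" "s \<le> u" "2 * s \<le> s1" "2 * s \<le> \<rho>" using G(1) \<rho>(1) u(1) assms(2) by (auto simp: s_def)
  show ?thesis
  proof (rule that[of s G])
    show "ball 0 s \<subseteq> U" using s(3) u(2) by (meson order_trans subset_ball)
    fix \<eta> :: "real ^ 'k" and z :: complex
    assume \<eta>: "norm \<eta> < s" and z: "norm z < s"
    have \<eta>U: "\<eta> \<in> U" using \<eta> u s by (auto simp: subset_iff)
    have h1: "(\<lambda>w. f \<eta> (cnj w)) holomorphic_on ball 0 s"
    proof (rule holomorphic_onI)
      fix w :: complex assume "w \<in> ball 0 s"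
      hence "cnj w \<in> ball 0 r" using s(2) by simp
      hence "f \<eta> differentiable (at (cnj w))" "d_z (f \<eta>) (cnj w) = 0"
        using assms(1) \<eta>U unfolding antiholomorphic_family_def antiholomorphic_diffeo_on_def antiholomorphic_on_def by auto
      from d_z_zero_iff[OF this] show "(\<lambda>w. f \<eta> (cnj w)) field_differentiable at w within ball 0 s"
        unfolding field_differentiable_def by (auto intro: has_field_derivative_at_within)
    qed
    have h2: "(\<lambda>w. G (w, cvec \<eta>)) holomorphic_on ball 0 s"
    proof (rule hol_slice_holomorphic)
      fix w :: complex assume "w \<in> ball 0 s"
      hence "(w, cvec \<eta>) \<in> ball 0 \<rho>" using \<eta> s(5) norm_Pair_le[of w "cvec \<eta>"] by simp
      thus "cdiff G (w, cvec \<eta>)" by (intro hol_imp_cdiff \<rho>(2))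
    qed
    have "f \<eta> (cnj (cnj z)) - G (cnj z, cvec \<eta>) = 0"
    \<comment> \<open>The real points of the disc accumulate at 0, where both functions are
      holomorphic.\<close>
    proof (rule analytic_continuation[of "\<lambda>w. f \<eta> (cnj w) - G (w, cvec \<eta>)" "ball 0 s" "of_real ` {0<..<s}" 0])
      show "(0::complex) islimpt of_real ` {0<..<s}"
        unfolding islimpt_approachable
      proof (intro allI impI)
        fix e :: real assume "e > 0"
        thus "\<exists>x'\<in>complex_of_real ` {0<..<s}. x' \<noteq> 0 \<and> dist x' 0 < e"
          using s(1) by (intro bexI[of _ "of_real (min (e/2) (s/2))"]) auto
      qed
      show "f \<eta> (cnj w) - G (w, cvec \<eta>) = 0" if "w \<in> of_real ` {0<..<s}" for w
        using that Gr[of _ \<eta>] \<eta> s by auto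
    qed (use h1 h2 z s(1) in \<open>auto intro!: holomorphic_intros\<close>)
    thus "f \<eta> z = G (cnj z, cvec \<eta>)" by simp
  qed (use s G(2) in auto)
qed

section \<open>Division by polynomials and orders of vanishing\<close>

lemma holomorphic_factor_root:
  assumes "f holomorphic_on S" "open S" "f a = (0::complex)"
  obtains V where "V holomorphic_on S" "\<And>z. f z = (z - a) * V z"
proof (rule that)
  show "(\<lambda>z. if z = a then deriv f a else (f z - f a) / (z - a)) holomorphic_on S"
    by (rule pole_lemma_open) (fact assms)+
  show "f z = (z - a) * (if z = a then deriv f a else (f z - f a) / (z - a))" for z
    using assms(3) by simp
qed

text \<open>Roots are split off one at a time: a bound by \<open>p\<close> near a root forces a zero
  of \<open>f\<close> there and survives the division of both by the linear factor. Multiplicities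
  never have to be counted.\<close>

lemma poly_factor_holomorphic:
  fixes p :: "complex poly"
  assumes "p \<noteq> 0" "open S" "\<And>a. poly p a = 0 \<Longrightarrow> a \<in> S" "f holomorphic_on S"
    "\<And>a. poly p a = 0 \<Longrightarrow> \<exists>C. \<forall>\<^sub>F z in at a. norm (f z) \<le> C * norm (poly p z)"
  shows "\<exists>V. V holomorphic_on S \<and> (\<forall>z\<in>S. f z = poly p z * V z)"
  using assms
proof (induction "degree p" arbitrary: p f)
  case 0
  then obtain c where p: "p = [:c:]" using degree_eq_zeroE by metis
  with "0.prems"(1) have c: "c \<noteq> 0" by simp
  have "(\<lambda>z. f z / c) holomorphic_on S" using c by (intro holomorphic_intros "0.prems"(4)) auto
  thus ?case using c by (intro exI[of _ "\<lambda>z. f z / c"]) (auto simp: p)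
next
  case (Suc n)
  have "degree p > 0" using Suc.hyps(2) by simp
  from alg_closed_imp_poly_has_root[OF this] obtain a where a: "poly p a = 0" ..
  hence "[:-a, 1:] dvd p" by (simp only: poly_eq_0_iff_dvd)
  then obtain q where q: "p = [:-a, 1:] * q" unfolding dvd_def ..
  have q0: "q \<noteq> 0"
  proof
    assume "q = 0"
    with q Suc.prems(1) show False by simp
  qed
  have dq: "degree q = n"
  proof -
    have "degree p = degree [:-a, 1:] + degree q" unfolding q by (rule degree_mult_eq) (use q0 in auto)
    with Suc.hyps(2) show ?thesis by simp
  qed
  have pz: "poly p z = (z - a) * poly q z" for z
    using arg_cong[OF q, of "\<lambda>p. poly p z"] by (simp add: algebra_simps)
  have aS: "a \<in> S" by (rule Suc.prems(3)[OF a])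
  have "f a = 0"
  proof -
    obtain C where C: "\<forall>\<^sub>F z in at a. norm (f z) \<le> C * norm (poly p z)" using Suc.prems(5)[OF a] by blast
    have "((\<lambda>z. C * norm (poly p z)) \<longlongrightarrow> C * norm (poly p a)) (at a)" by (intro tendsto_intros)
    hence "((\<lambda>z. C * norm (poly p z)) \<longlongrightarrow> 0) (at a)" by (simp add: a)
    from Lim_null_comparison[OF C this] have "(f \<longlongrightarrow> 0) (at a)" .
    moreover have "isCont f a"
      using Suc.prems(2,4) aS by (metis continuous_on_eq_continuous_at holomorphic_on_imp_continuous_on)
    hence "(f \<longlongrightarrow> f a) (at a)" by (simp add: isCont_def)
    ultimately show ?thesis using tendsto_unique[OF at_neq_bot] by metis
  qed
  then obtain V where V: "V holomorphic_on S" "\<And>z. f z = (z - a) * V z"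
    using holomorphic_factor_root[OF Suc.prems(4,2)] by blast
  have "\<exists>W. W holomorphic_on S \<and> (\<forall>z\<in>S. V z = poly q z * W z)"
  proof (rule Suc.hyps(1)[OF dq[symmetric] q0 Suc.prems(2) _ V(1)])
    fix a' assume a': "poly q a' = 0"
    hence pa': "poly p a' = 0" by (simp add: pz)
    thus "a' \<in> S" by (rule Suc.prems(3))
    obtain C where C: "\<forall>\<^sub>F z in at a'. norm (f z) \<le> C * norm (poly p z)" using Suc.prems(5)[OF pa'] by blast
    have "\<forall>\<^sub>F z in at a'. z \<noteq> a"
      by (cases "a' = a") (auto simp: eventually_neq_at_within eventually_at_filter intro: t1_space_nhds)
    with C have "\<forall>\<^sub>F z in at a'. norm (V z) \<le> C * norm (poly q z)"
    proof eventually_elim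
      case (elim z)
      have "norm (z - a) * norm (V z) \<le> norm (z - a) * (C * norm (poly q z))"
        using elim(1) by (simp only: V(2) pz norm_mult mult.left_commute)
      thus ?case using elim(2) by simp
    qed
    thus "\<exists>C. \<forall>\<^sub>F z in at a'. norm (V z) \<le> C * norm (poly q z)" by blast
  qed
  then obtain W where "W holomorphic_on S" "\<forall>z\<in>S. V z = poly q z * W z" by blast
  thus ?case using V(2) pz by (intro exI[of _ W]) (auto simp: mult.assoc)
qed

text \<open>The converse of Cauchy's theorem for \<open>f / p\<close>. Unlike conditions at the
  individual roots, the moments depend holomorphically on the coefficients of \<open>p\<close> even
  when roots collide, and there are exactly \<open>degree p\<close> of them.\<close>

lemma moments_factor:
  fixes p :: "complex poly"
  assumes "p \<noteq> 0" "R > 0" "open S" "cball 0 R \<subseteq> S" "\<And>a. poly p a = 0 \<Longrightarrow> norm a < R" "f holomorphic_on S"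
    "\<And>j. j < degree p \<Longrightarrow> cint R (\<lambda>w. w ^ j * (f w / poly p w)) = 0"
  shows "\<exists>V. V holomorphic_on S \<and> (\<forall>z\<in>S. f z = poly p z * V z)"
  using assms
proof (induction "degree p" arbitrary: p f)
  case 0
  then obtain c where p: "p = [:c:]" using degree_eq_zeroE by metis
  with "0.prems"(1) have c: "c \<noteq> 0" by simp
  have "(\<lambda>z. f z / c) holomorphic_on S" using c by (intro holomorphic_intros "0.prems"(6)) auto
  thus ?case using c by (intro exI[of _ "\<lambda>z. f z / c"]) (auto simp: p)
next
  case (Suc n)
  note R = Suc.prems(2)
  have "degree p > 0" using Suc.hyps(2) by simp
  from alg_closed_imp_poly_has_root[OF this] obtain a where a: "poly p a = 0" ..
  hence "[:-a, 1:] dvd p" by (simp only: poly_eq_0_iff_dvd)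
  then obtain q where q: "p = [:-a, 1:] * q" unfolding dvd_def ..
  have q0: "q \<noteq> 0"
  proof
    assume "q = 0"
    with q Suc.prems(1) show False by simp
  qed
  have dq: "degree q = n"
  proof -
    have "degree p = degree [:-a, 1:] + degree q" unfolding q by (rule degree_mult_eq) (use q0 in auto)
    with Suc.hyps(2) show ?thesis by simp
  qed
  have pz: "poly p z = (z - a) * poly q z" for z
    using arg_cong[OF q, of "\<lambda>p. poly p z"] by (simp add: algebra_simps)
  have aR: "norm a < R" by (rule Suc.prems(5)[OF a])
  have cf: "continuous_on S f" using Suc.prems(6) holomorphic_on_imp_continuous_on by blast
  have pnz: "poly p w \<noteq> 0" if "norm w = R" for w using Suc.prems(5)[of w] that by auto
  have cfs: "continuous_on (sphere 0 R) f"
    by (rule continuous_on_subset[OF cf]) (use Suc.prems(4) in auto)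
  \<comment> \<open>With \<open>p = (X - a) q\<close>, the combination of the moments with the
    coefficients of \<open>q\<close> is Cauchy's formula for \<open>f a\<close>.\<close>
  have "cint R (\<lambda>w. poly q w * (f w / poly p w)) = 0"
  proof -
    have "cint R (\<lambda>w. poly q w * (f w / poly p w)) = cint R (\<lambda>w. \<Sum>j\<le>n. coeff q j * (w ^ j * (f w / poly p w)))"
      unfolding poly_altdef[of q] dq sum_distrib_right mult.assoc ..
    also have "\<dots> = (\<Sum>j\<le>n. cint R (\<lambda>w. coeff q j * (w ^ j * (f w / poly p w))))"
      by (rule cint_sum) (use R pnz in \<open>auto intro!: continuous_intros cfs\<close>)
    also have "\<dots> = 0"
    proof (rule sum.neutral, intro ballI)
      fix j assume "j \<in> {..n}"
      hence "cint R (\<lambda>w. w ^ j * (f w / poly p w)) = 0" using Suc.prems(7)[of j] Suc.hyps(2) by simp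
      thus "cint R (\<lambda>w. coeff q j * (w ^ j * (f w / poly p w))) = 0" by (simp only: cint_mult_left mult_zero_right)
    qed
    finally show ?thesis .
  qed
  also have "cint R (\<lambda>w. poly q w * (f w / poly p w)) = cint R (\<lambda>w. f w / (w - a))"
  proof (rule cint_cong)
    fix w :: complex assume "norm w = R"
    from pnz[OF this] show "poly q w * (f w / poly p w) = f w / (w - a)" unfolding pz by simp
  qed (use R in simp)
  also have "\<dots> = f a"
    by (rule cint_Cauchy[OF _ _ aR])
      (use Suc.prems(4,6) in \<open>auto intro!: continuous_on_subset[OF cf] elim!: holomorphic_on_subset\<close>)
  finally have "f a = 0" .
  then obtain V where V: "V holomorphic_on S" "\<And>z. f z = (z - a) * V z"
    using holomorphic_factor_root[OF Suc.prems(6,3)] by blast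
  have "\<exists>W. W holomorphic_on S \<and> (\<forall>z\<in>S. V z = poly q z * W z)"
  proof (rule Suc.hyps(1)[OF dq[symmetric] q0 R Suc.prems(3,4) _ V(1)])
    show "norm a' < R" if "poly q a' = 0" for a' using Suc.prems(5)[of a'] that by (simp add: pz)
    fix j assume "j < degree q"
    hence "cint R (\<lambda>w. w ^ j * (f w / poly p w)) = 0" using Suc.prems(7)[of j] Suc.hyps(2) dq by simp
    also have "cint R (\<lambda>w. w ^ j * (f w / poly p w)) = cint R (\<lambda>w. w ^ j * (V w / poly q w))"
    proof (rule cint_cong)
      fix w :: complex assume "norm w = R"
      from pnz[OF this] show "w ^ j * (f w / poly p w) = w ^ j * (V w / poly q w)" unfolding pz V(2) by simp
    qed (use R in simp)
    finally show "cint R (\<lambda>w. w ^ j * (V w / poly q w)) = 0" .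
  qed
  then obtain W where "W holomorphic_on S" "\<forall>z\<in>S. V z = poly q z * W z" by blast
  thus ?case using V(2) pz by (intro exI[of _ W]) (auto simp: mult.assoc)
qed

text \<open>The filter is \<open>nhds 0\<close> instead of \<open>at 0\<close>: for positive
  \<open>n\<close> membership includes the value 0 at the origin, and composition with germs that
  take the value 0 elsewhere is harmless.\<close>

abbreviation bz :: "nat \<Rightarrow> (complex \<Rightarrow> complex) set" where "bz n \<equiv> O[nhds 0](\<lambda>z. z ^ n)"

lemma power_in_bz: "(\<lambda>z. z ^ n) \<in> bz n" by simp

lemma eventually_norm_less: "e > 0 \<Longrightarrow> \<forall>\<^sub>F z in nhds (0::'a::real_normed_vector). norm z < e"
  unfolding eventually_nhds_metric by (auto simp: dist_norm)

lemma bz_mono: "f \<in> bz n \<Longrightarrow> m \<le> n \<Longrightarrow> f \<in> bz m"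
proof (erule landau_o.big_trans)
  assume "m \<le> n"
  have "\<forall>\<^sub>F z in nhds (0::complex). norm (z ^ n) \<le> 1 * norm (z ^ m)"
    by (rule eventually_mono[OF eventually_norm_less[OF zero_less_one]])
      (use \<open>m \<le> n\<close> in \<open>auto simp: norm_power intro!: power_decreasing\<close>)
  thus "(\<lambda>z. z ^ n) \<in> bz m" by (rule bigoI)
qed

lemma power_in_bz_le: "m \<le> n \<Longrightarrow> (\<lambda>z. z ^ n) \<in> bz m"
  using bz_mono[OF power_in_bz] .

lemma bz_mult: "f \<in> bz m \<Longrightarrow> g \<in> bz n \<Longrightarrow> (\<lambda>z. f z * g z) \<in> bz (m + n)"
  using landau_o.big.mult[of f "nhds 0" "\<lambda>z. z ^ m" g "\<lambda>z. z ^ n"] by (simp add: power_add)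

lemma bz_power: "f \<in> bz m \<Longrightarrow> (\<lambda>z. f z ^ n) \<in> bz (m * n)"
  using landau_o.big_power[of f "nhds 0" "\<lambda>z. z ^ m" n] by (simp add: power_mult)

lemma bz_add: "f \<in> bz n \<Longrightarrow> g \<in> bz n \<Longrightarrow> (\<lambda>z. f z + g z) \<in> bz n"
  by (rule sum_in_bigo)

lemma bz_diff: "f \<in> bz n \<Longrightarrow> g \<in> bz n \<Longrightarrow> (\<lambda>z. f z - g z) \<in> bz n"
  by (rule sum_in_bigo)

lemma bz_cmult: "f \<in> bz n \<Longrightarrow> (\<lambda>z. c * f z) \<in> bz n"
  by (cases "c = 0") auto

lemma bz_ident: "(\<lambda>z. z) \<in> bz 1" by simp

lemma bz_cong: "f \<in> bz n \<Longrightarrow> \<forall>\<^sub>F z in nhds 0. f z = g z \<Longrightarrow> g \<in> bz n"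
  using landau_o.big.in_cong[of f g "nhds 0"] by simp

lemma bz_0_imp_tendsto: "f \<in> bz (Suc n) \<Longrightarrow> (f \<longlongrightarrow> 0) (nhds 0)"
proof -
  assume "f \<in> bz (Suc n)"
  then obtain c where "\<forall>\<^sub>F z in nhds 0. norm (f z) \<le> c * norm (z ^ Suc n)" by (elim landau_o.bigE)
  moreover have "((\<lambda>z. c * norm (z ^ Suc n)) \<longlongrightarrow> c * norm ((0::complex) ^ Suc n)) (nhds (0::complex))"
    by (intro tendsto_mult_left tendsto_norm tendsto_power filterlim_ident)
  hence "((\<lambda>z. c * norm (z ^ Suc n)) \<longlongrightarrow> 0) (nhds (0::complex))" by simp
  ultimately show ?thesis by (rule Lim_null_comparison)
qed

lemma bz_at_0: "f \<in> bz (Suc n) \<Longrightarrow> f 0 = 0"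
proof -
  assume "f \<in> bz (Suc n)"
  then obtain c where "\<forall>\<^sub>F z in nhds 0. norm (f z) \<le> c * norm (z ^ Suc n)" by (elim landau_o.bigE)
  from eventually_nhds_x_imp_x[OF this] show ?thesis by simp
qed

lemma bz_compose: "f \<in> bz n \<Longrightarrow> u \<in> bz 1 \<Longrightarrow> (\<lambda>z. f (u z)) \<in> bz n"
proof -
  assume a: "f \<in> bz n" "u \<in> bz 1"
  have "(\<lambda>z. f (u z)) \<in> O[nhds 0](\<lambda>z. u z ^ n)"
    using landau_o.big.compose[OF a(1) bz_0_imp_tendsto[of u 0]] a(2) by simp
  moreover have "(\<lambda>z. u z ^ n) \<in> bz n" using bz_power[OF a(2), of n] by simp
  ultimately show ?thesis by (rule landau_o.big_trans)
qed

lemma bz_isCont: "isCont f 0 \<Longrightarrow> f \<in> bz 0"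
proof -
  assume "isCont f 0"
  hence "(f \<longlongrightarrow> f 0) (nhds 0)" using tendsto_at_iff_tendsto_nhds[of f 0] unfolding isCont_def by blast
  have "\<forall>\<^sub>F z in nhds 0. norm (f z) \<le> (norm (f 0) + 1) * norm (z ^ 0)"
    by (rule eventually_mono[OF tendstoD[OF \<open>(f \<longlongrightarrow> f 0) (nhds 0)\<close> zero_less_one]]) (auto simp: dist_norm intro: order_trans[OF norm_triangle_sub[of _ "f 0"]])
  thus "f \<in> bz 0" by (rule bigoI)
qed

lemma bz_hol: "hol f 0 \<Longrightarrow> f \<in> bz 0"
  by (rule bz_isCont) (rule hol_isCont)

lemma bz_hol1: "hol f 0 \<Longrightarrow> f 0 = 0 \<Longrightarrow> f \<in> bz 1"
proof -
  assume f: "hol f 0" "f 0 = 0"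
  obtain r where r: "r > 0" "\<And>x y. x \<in> ball 0 r \<Longrightarrow> y \<in> ball 0 r \<Longrightarrow> norm (f x - f y - ddir f 0 (x - y)) \<le> 1 * norm (x - y)"
    using hol_lipschitz[OF f(1), of 1] by auto
  have d: "ddir f 0 v = deriv f 0 * v" for v
    by (rule ddir_complex) (use hol_imp_cdiff[OF f(1)] cdiff_complex_iff in blast)
  have "\<forall>\<^sub>F z in nhds 0. norm (f z) \<le> (1 + norm (deriv f 0)) * norm (z ^ 1)"
    using eventually_norm_less[OF r(1)]
  proof (rule eventually_mono)
    fix z :: complex assume "norm z < r"
    hence "norm (f z - deriv f 0 * z) \<le> norm z" using r(2)[of z 0] r(1) by (simp add: f(2) d)
    moreover have "norm (f z) \<le> norm (deriv f 0 * z) + norm (f z - deriv f 0 * z)" by (rule norm_triangle_sub)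
    ultimately show "norm (f z) \<le> (1 + norm (deriv f 0)) * norm (z ^ 1)" by (simp add: norm_mult algebra_simps)
  qed
  thus "f \<in> bz 1" by (rule bigoI)
qed

lemma bz_lipschitz:
  assumes f: "hol f 0" and u: "u \<in> bz 1" "v \<in> bz 1" "(\<lambda>z. u z - v z) \<in> bz n"
  shows "(\<lambda>z. f (u z) - f (v z)) \<in> bz n"
proof -
  obtain r where r: "r > 0" "\<And>x y. x \<in> ball 0 r \<Longrightarrow> y \<in> ball 0 r \<Longrightarrow> norm (f x - f y - ddir f 0 (x - y)) \<le> 1 * norm (x - y)"
    using hol_lipschitz[OF f(1), of 1] by auto
  have d: "ddir f 0 v = deriv f 0 * v" for v
    by (rule ddir_complex) (use hol_imp_cdiff[OF f(1)] cdiff_complex_iff in blast)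
  have "\<forall>\<^sub>F z in nhds 0. norm (u z) < r" "\<forall>\<^sub>F z in nhds 0. norm (v z) < r"
    using tendstoD[OF bz_0_imp_tendsto[of u 0] r(1)] tendstoD[OF bz_0_imp_tendsto[of v 0] r(1)] u by auto
  hence "\<forall>\<^sub>F z in nhds 0. norm (f (u z) - f (v z)) \<le> (1 + norm (deriv f 0)) * norm (u z - v z)"
  proof eventually_elim
    case (elim z)
    hence "norm (f (u z) - f (v z) - deriv f 0 * (u z - v z)) \<le> norm (u z - v z)" using r(2)[of "u z" "v z"] by (simp add: d)
    moreover have "norm (f (u z) - f (v z)) \<le> norm (deriv f 0 * (u z - v z)) + norm (f (u z) - f (v z) - deriv f 0 * (u z - v z))"
      by (rule norm_triangle_sub)
    ultimately show ?case by (simp add: norm_mult distrib_right)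
  qed
  hence "(\<lambda>z. f (u z) - f (v z)) \<in> O[nhds 0](\<lambda>z. u z - v z)" by (rule bigoI)
  thus ?thesis using u(3) by (rule landau_o.big_trans)
qed

lemma hol_complex_ball:
  fixes f :: "complex \<Rightarrow> complex"
  assumes "hol f 0"
  obtains r where "r > 0" "f holomorphic_on ball 0 r"
proof -
  obtain \<rho> where \<rho>: "\<rho> > 0" "\<And>y. y \<in> ball 0 \<rho> \<Longrightarrow> hol f y" using hol_ball[OF assms] by blast
  have "f holomorphic_on ball 0 \<rho>"
    by (rule holomorphic_onI) (use \<rho>(2) hol_imp_cdiff cdiff_complex_iff field_differentiable_at_within in metis)
  thus ?thesis using that \<rho>(1) by blast
qed

lemma bz_factor:
  assumes "hol f 0" "f \<in> bz n"
  obtains V where "hol V 0" "\<forall>\<^sub>F z in nhds 0. f z = z ^ n * V z"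
proof -
  obtain r where r: "r > 0" "f holomorphic_on ball 0 r" using hol_complex_ball[OF assms(1)] by blast
  obtain c where c: "\<forall>\<^sub>F z in nhds 0. norm (f z) \<le> c * norm (z ^ n)" using assms(2) by (elim landau_o.bigE)
  have pm: "poly (monom 1 n) z = z ^ n" for z :: complex by (simp add: poly_monom)
  have "\<exists>V. V holomorphic_on ball 0 r \<and> (\<forall>z\<in>ball 0 r. f z = poly (monom 1 n) z * V z)"
  proof (rule poly_factor_holomorphic)
    show "\<exists>C. \<forall>\<^sub>F z in at a. norm (f z) \<le> C * norm (poly (monom 1 n) z)" if "poly (monom 1 n) a = 0" for a
    proof -
      have "a = 0" using that by (simp add: pm)
      thus ?thesis using c unfolding pm by (auto simp: eventually_at_filter elim: eventually_mono)
    qed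
  qed (use r in \<open>auto simp: pm\<close>)
  then obtain V where V: "V holomorphic_on ball 0 r" "\<And>z. z \<in> ball 0 r \<Longrightarrow> f z = z ^ n * V z" by (auto simp: pm)
  show ?thesis
  proof (rule that[of V])
    show "hol V 0" by (rule hol_complex[OF open_ball V(1)]) (use r(1) in simp)
    show "\<forall>\<^sub>F z in nhds 0. f z = z ^ n * V z"
      using eventually_norm_less[OF r(1)] by (rule eventually_mono) (simp add: V(2))
  qed
qed

lemma deriv_cong_nhds: "\<forall>\<^sub>F z in nhds x. f z = g z \<Longrightarrow> deriv f x = deriv g x"
  by (rule deriv_cong_ev) auto

lemma hol_field_differentiable: "hol f z \<Longrightarrow> f field_differentiable at z" for f :: "complex \<Rightarrow> complex"
  using hol_imp_cdiff cdiff_complex_iff by blast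

lemma hol_deriv: "hol f z \<Longrightarrow> hol (deriv f) z" for f :: "complex \<Rightarrow> complex"
proof -
  assume f: "hol f z"
  have "\<forall>\<^sub>F y in nhds z. ddir f y 1 = deriv f y"
    using hol_eventually[OF f] by (rule eventually_mono) (simp add: ddir_complex hol_field_differentiable)
  from hol_cong[OF this hol_ddir[OF f]] show ?thesis .
qed

text \<open>An asymptotic bound on a holomorphic germ may be differentiated, because it is a
  factorisation \<open>z ^ Suc n * V z\<close>.\<close>

lemma bz_deriv:
  assumes "hol f 0" "f \<in> bz (Suc n)"
  shows "deriv f \<in> bz n"
proof -
  obtain V where V: "hol V 0" "\<forall>\<^sub>F z in nhds 0. f z = z ^ Suc n * V z" using bz_factor[OF assms] by blast
  have "\<forall>\<^sub>F z in nhds 0. (\<forall>\<^sub>F z in nhds z. f z = z ^ Suc n * V z) \<and> hol V z"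
    using V(2) hol_eventually[OF V(1)] by (simp add: eventually_eventually eventually_conj)
  hence "\<forall>\<^sub>F z in nhds 0. z ^ n * (of_nat (Suc n) * V z + z * deriv V z) = deriv f z"
  proof (rule eventually_mono, elim conjE)
    fix z assume z: "\<forall>\<^sub>F z in nhds z. f z = z ^ Suc n * V z" "hol V z"
    have "(V has_field_derivative deriv V z) (at z)"
      using hol_field_differentiable[OF z(2)] DERIV_deriv_iff_field_differentiable by blast
    hence "((\<lambda>z. z ^ Suc n * V z) has_field_derivative (of_nat (Suc n) * z ^ n * V z + z ^ Suc n * deriv V z)) (at z)"
      by (rule DERIV_cong[OF DERIV_mult[OF DERIV_power_Suc[OF DERIV_ident]]]) (simp add: algebra_simps)
    hence "deriv (\<lambda>z. z ^ Suc n * V z) z = of_nat (Suc n) * z ^ n * V z + z ^ Suc n * deriv V z" by (rule DERIV_imp_deriv)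
    with deriv_cong_nhds[OF z(1)] show "z ^ n * (of_nat (Suc n) * V z + z * deriv V z) = deriv f z"
      by (simp add: algebra_simps)
  qed
  moreover have "(\<lambda>z. z ^ n * (of_nat (Suc n) * V z + z * deriv V z)) \<in> bz (n + 0)"
    by (intro bz_mult power_in_bz bz_hol hol_intros hol_deriv V(1))
  ultimately show ?thesis using bz_cong by fastforce
qed

text \<open>The order of a holomorphic germ is an integer, so little-o of \<open>z ^ n\<close> gains
  a full power: the quotient by \<open>z ^ n\<close> is holomorphic with limit 0.\<close>

lemma bz_small:
  assumes "hol f 0" "f \<in> o[at 0](\<lambda>z. z ^ n)"
  shows "f \<in> bz (Suc n)"
proof -
  obtain r where r: "r > 0" "f holomorphic_on ball 0 r" using hol_complex_ball[OF assms(1)] by blast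
  have pm: "poly (monom 1 n) z = z ^ n" for z :: complex by (simp add: poly_monom)
  have "\<exists>V. V holomorphic_on ball 0 r \<and> (\<forall>z\<in>ball 0 r. f z = poly (monom 1 n) z * V z)"
  proof (rule poly_factor_holomorphic)
    show "\<exists>C. \<forall>\<^sub>F z in at a. norm (f z) \<le> C * norm (poly (monom 1 n) z)" if "poly (monom 1 n) a = 0" for a
    proof -
      have "a = 0" using that by (simp add: pm)
      thus ?thesis using landau_o.smallD[OF assms(2), of 1] unfolding pm by (intro exI[of _ 1]) simp
    qed
  qed (use r in \<open>auto simp: pm\<close>)
  then obtain V where V: "V holomorphic_on ball 0 r" "\<And>z. z \<in> ball 0 r \<Longrightarrow> f z = z ^ n * V z" by (auto simp: pm)
  have hV: "hol V 0" by (rule hol_complex[OF open_ball V(1)]) (use r(1) in simp)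
  have evf: "\<forall>\<^sub>F z in nhds 0. z ^ n * V z = f z"
    using eventually_norm_less[OF r(1)] by (rule eventually_mono) (simp add: V(2))
  have "V 0 = 0"
  proof (rule ccontr)
    assume "V 0 \<noteq> 0"
    hence "norm (V 0) / 2 > 0" by simp
    have "(V \<longlongrightarrow> V 0) (at 0)" using hol_isCont[OF hV] by (simp add: isCont_def)
    from tendstoD[OF this \<open>norm (V 0) / 2 > 0\<close>] landau_o.smallD[OF assms(2) \<open>norm (V 0) / 2 > 0\<close>]
    have "\<forall>\<^sub>F z in at (0::complex). False"
      using evf[unfolded eventually_nhds_conv_at, THEN conjunct1] eventually_neq_at_within[of 0]
    proof eventually_elim
      case (elim z)
      have "norm (z ^ n) * norm (V z) \<le> norm (z ^ n) * (norm (V 0) / 2)"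
        using elim(2) unfolding elim(3)[symmetric] by (simp add: norm_mult mult.commute)
      hence "norm (V z) \<le> norm (V 0) / 2" using elim(4) by simp
      thus False using elim(1) norm_triangle_sub[of "V 0" "V z"] by (simp add: dist_norm norm_minus_commute)
    qed
    thus False by simp
  qed
  hence "(\<lambda>z. z ^ n * V z) \<in> bz (n + 1)" by (intro bz_mult power_in_bz bz_hol1 hV)
  from bz_cong[OF this evf] show ?thesis unfolding Suc_eq_plus1 .
qed

text \<open>If the order of \<open>p\<close> at 0 were below \<open>n\<close>, its cofactor would
  tend to 0 there.\<close>

lemma bz_poly_coeff:
  assumes "poly p \<in> bz n" "j < n"
  shows "coeff p j = 0"
proof (cases "p = 0")
  case False
  define m where "m = order 0 p"
  obtain q where q: "p = [:-0, 1:] ^ m * q" "\<not> [:-0, 1:] dvd q" using order_decomp[OF False] m_def by blast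
  have q0: "poly q 0 \<noteq> 0" using q(2) by (simp add: poly_eq_0_iff_dvd)
  have "n \<le> m"
  proof (rule ccontr)
    assume "\<not> n \<le> m"
    then obtain l where l: "n = m + Suc l" by (metis add_Suc_right less_imp_Suc_add not_le)
    obtain c where c: "\<forall>\<^sub>F z in nhds 0. norm (poly p z) \<le> c * norm (z ^ n)" using assms(1) by (elim landau_o.bigE)
    have "\<forall>\<^sub>F z in at (0::complex). norm (poly q z) \<le> c * norm (z ^ Suc l)"
      using c[unfolded eventually_nhds_conv_at, THEN conjunct1] eventually_neq_at_within[of 0]
    proof eventually_elim
      case (elim z)
      have "poly p z = z ^ m * poly q z" by (subst q(1)) (simp add: poly_power)
      hence "norm (z ^ m) * norm (poly q z) \<le> norm (z ^ m) * (c * norm (z ^ Suc l))"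
        using elim(1) unfolding l power_add by (simp add: norm_mult mult_ac)
      thus ?case using elim(2) by simp
    qed
    moreover have "((\<lambda>z. c * norm (z ^ Suc l)) \<longlongrightarrow> c * norm ((0::complex) ^ Suc l)) (at (0::complex))"
      by (intro tendsto_mult_left tendsto_norm tendsto_power tendsto_ident_at)
    hence "((\<lambda>z. c * norm (z ^ Suc l)) \<longlongrightarrow> 0) (at (0::complex))" by simp
    ultimately have "(poly q \<longlongrightarrow> 0) (at 0)" by (rule Lim_null_comparison)
    moreover have "(poly q \<longlongrightarrow> poly q 0) (at 0)" by (intro tendsto_intros)
    ultimately show False using q0 tendsto_unique[OF at_neq_bot] by blast
  qed
  hence "monom 1 n dvd p"
    by (subst q(1)) (auto intro!: dvd_mult2 simp: monom_altdef le_imp_power_dvd)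
  thus ?thesis using assms(2) by (simp add: monom_1_dvd_iff')
qed simp

section \<open>Conjugated germs and chain rules with parameters\<close>

definition cc :: "('a::cvec \<Rightarrow> 'b::cvec) \<Rightarrow> 'a \<Rightarrow> 'b" where "cc F x = cj (F (cj x))"

lemma cc_cc [simp]: "cc (cc F) = F" by (rule ext) (simp add: cc_def)

lemma hol_cc: "hol F (cj x) \<Longrightarrow> hol (cc F) x"
  unfolding cc_def by (rule hol_conj)

lemma ddir_cc: "cdiff F (cj x) \<Longrightarrow> ddir (cc F) x v = cj (ddir F (cj x) (cj v))"
  unfolding cc_def by (rule cdiff_conj)

lemma ddir_cong: "\<forall>\<^sub>F y in nhds x. F y = G y \<Longrightarrow> cdiff F x \<Longrightarrow> ddir F x = ddir G x"
proof -
  assume a: "\<forall>\<^sub>F y in nhds x. F y = G y" "cdiff F x"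
  have "\<forall>\<^sub>F y in at x. F y = G y" "F x = G x"
    using a(1) eventually_nhds_x_imp_x by (auto simp: eventually_at_filter elim: eventually_mono)
  hence "(G has_derivative ddir F x) (at x)"
    using has_derivative_transform_eventually[OF cdiff_has_derivative[OF a(2)]] by auto
  thus ?thesis by (simp add: ddir_eq)
qed

lemma bz_cnj: "f \<in> bz n \<Longrightarrow> (\<lambda>z. cnj (f (cnj z))) \<in> bz n"
proof -
  assume "f \<in> bz n"
  then obtain c where c: "\<forall>\<^sub>F z in nhds 0. norm (f z) \<le> c * norm (z ^ n)" by (elim landau_o.bigE)
  hence "\<forall>\<^sub>F z in nhds (cj 0). norm (f z) \<le> c * norm (z ^ n)" by simp
  from eventually_nhds_cj[OF this] have "\<forall>\<^sub>F z in nhds 0. norm (cnj (f (cnj z))) \<le> c * norm (z ^ n)"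
    by (simp add: norm_power)
  thus ?thesis by (rule bigoI)
qed

lemma isCont_nhds_0: "isCont F x \<Longrightarrow> F x = y \<Longrightarrow> \<forall>\<^sub>F z in nhds y. P z \<Longrightarrow> \<forall>\<^sub>F z in nhds x. P (F z)"
  using isCont_eventually_nhds by blast

lemma hol_pair_arg: "hol B q \<Longrightarrow> hol (\<lambda>q. (B q, snd q)) q"
  by (intro hol_intros)

lemma hol_comp_pair:
  "hol F (B q, snd q) \<Longrightarrow> hol B q \<Longrightarrow> hol (\<lambda>q. F (B q, snd q)) q"
  by (rule hol_compose[of F "\<lambda>q. (B q, snd q)"]) (auto intro: hol_pair_arg)

lemma ddir_comp_pair:
  assumes "cdiff F (B q, snd q)" "cdiff B q"
  shows "ddir (\<lambda>q. F (B q, snd q)) q v = ddir F (B q, snd q) (ddir B q v, snd v)"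
proof -
  have s: "cdiff snd q" by (rule hol_imp_cdiff[OF hol_snd'])
  have "cdiff (\<lambda>q. (B q, snd q)) q"
    by (rule cdiffI[OF has_derivative_Pair[OF cdiff_has_derivative[OF assms(2)] cdiff_has_derivative[OF s]]])
      (simp add: ddir_cs[OF assms(2)])
  from ddir_compose[of F "\<lambda>q. (B q, snd q)", OF assms(1) this]
  show ?thesis by (simp add: ddir_Pair[OF assms(2) s])
qed

lemma ddir_fst_direction:
  fixes F :: "complex \<times> 'p::cvec \<Rightarrow> complex"
  assumes "cdiff F q"
  shows "ddir F q (c, v) = c * ddir F q (1, 0) + ddir F q (0, v)"
proof -
  have "(c, v) = cs c (1, 0) + (0, v)" by simp
  thus ?thesis by (simp only: ddir_add[OF assms] ddir_cs[OF assms] cs_complex)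
qed

lemma ddir_add_fun: "cdiff F x \<Longrightarrow> cdiff G x \<Longrightarrow> ddir (\<lambda>x. F x + G x) x v = ddir F x v + ddir G x v"
  by (rule fun_cong[OF ddir_eq[OF has_derivative_add[OF cdiff_has_derivative cdiff_has_derivative]], THEN trans]) auto

lemma ddir_diff_fun: "cdiff F x \<Longrightarrow> cdiff G x \<Longrightarrow> ddir (\<lambda>x. F x - G x) x v = ddir F x v - ddir G x v"
  by (rule fun_cong[OF ddir_eq[OF has_derivative_diff[OF cdiff_has_derivative cdiff_has_derivative]], THEN trans]) auto

lemma ddir_mult_fun: "cdiff F x \<Longrightarrow> cdiff G x \<Longrightarrow> ddir (\<lambda>x. F x * G x :: complex) x v = F x * ddir G x v + ddir F x v * G x"
  by (rule fun_cong[OF ddir_eq[OF has_derivative_mult[OF cdiff_has_derivative cdiff_has_derivative]], THEN trans]) auto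

lemma ddir_divide_const: "cdiff F x \<Longrightarrow> ddir (\<lambda>x. F x / c :: complex) x v = ddir F x v / c"
  by (rule fun_cong[OF ddir_eq[OF bounded_linear.has_derivative[OF bounded_linear_divide cdiff_has_derivative]]])

section \<open>The midpoint chart and the logarithms of the multipliers\<close>

text \<open>The derivative in \<open>h\<close> is twice a first difference of
  \<open>deriv f\<close>, hence O(h). This permits replacing the mean of two values by the value at
  the midpoint with a quadratic error, as the midpoint chart requires.\<close>

lemma second_difference:
  fixes f :: "complex \<Rightarrow> complex"
  assumes f: "hol f 0"
  obtains C r where "r > 0" "\<And>w h. norm w < r \<Longrightarrow> norm h < r \<Longrightarrow>
    norm (f w + f (w + 2 * h) - 2 * f (w + h)) \<le> C * norm h ^ 2"
proof -
  obtain r1 where r1: "r1 > 0" "f holomorphic_on ball 0 r1" using hol_complex_ball[OF f] by blast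
  obtain r2 where r2: "r2 > 0" "\<And>x y. x \<in> ball 0 r2 \<Longrightarrow> y \<in> ball 0 r2 \<Longrightarrow>
      norm (deriv f x - deriv f y - ddir (deriv f) 0 (x - y)) \<le> 1 * norm (x - y)"
    using hol_lipschitz[OF hol_deriv[OF f], of 1] by auto
  define K where "K = 1 + norm (deriv (deriv f) 0)"
  have d: "ddir (deriv f) 0 v = deriv (deriv f) 0 * v" for v
    by (rule ddir_complex) (rule hol_field_differentiable[OF hol_deriv[OF f]])
  have lip: "norm (deriv f x - deriv f y) \<le> K * norm (x - y)" if "x \<in> ball 0 r2" "y \<in> ball 0 r2" for x y
  proof -
    have "norm (deriv f x - deriv f y) \<le> norm (deriv (deriv f) 0 * (x - y)) + norm (deriv f x - deriv f y - deriv (deriv f) 0 * (x - y))"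
      by (rule norm_triangle_sub)
    thus ?thesis using r2(2)[OF that] by (simp add: K_def d norm_mult distrib_right)
  qed
  define r where "r = min r1 r2 / 4"
  have r: "r > 0" using r1 r2 by (simp add: r_def)
  show ?thesis
  proof (rule that[OF r])
    fix w h :: complex assume wh: "norm w < r" "norm h < r"
    have mem: "w + t \<in> ball 0 (min r1 r2)" if "norm t \<le> 2 * norm h" for t
      using norm_triangle_ineq[of w t] that wh r1(1) r2(1) by (auto simp: r_def)
    define q where "q t = f (w + 2 * t) - 2 * f (w + t)" for t
    have "norm (q h - q 0) \<le> (2 * K * norm h) * norm (h - 0)"
    proof (rule field_differentiable_bound[of "cball 0 (norm h)" q "\<lambda>t. 2 * (deriv f (w + 2 * t) - deriv f (w + t))"])
      fix t :: complex assume "t \<in> cball 0 (norm h)"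
      hence t: "norm t \<le> norm h" by simp
      hence m: "w + 2 * t \<in> ball 0 (min r1 r2)" "w + t \<in> ball 0 (min r1 r2)"
        using mem[of "2 * t"] mem[of t] norm_ge_zero[of h] by (auto simp: norm_mult simp del: norm_ge_zero)
      have "(f has_field_derivative deriv f (w + 2 * t)) (at (w + 2 * t))" "(f has_field_derivative deriv f (w + t)) (at (w + t))"
        using holomorphic_derivI[OF r1(2) open_ball] m by auto
      note D = this
      have "((\<lambda>t. f (w + 2 * t)) has_field_derivative deriv f (w + 2 * t) * 2) (at t)"
        by (rule DERIV_chain2[where g = "\<lambda>t. w + 2 * t", OF D(1)]) (auto intro!: derivative_eq_intros)
      moreover have "((\<lambda>t. f (w + t)) has_field_derivative deriv f (w + t) * 1) (at t)"
        by (rule DERIV_chain2[where g = "\<lambda>t. w + t", OF D(2)]) (auto intro!: derivative_eq_intros)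
      ultimately have "(q has_field_derivative 2 * (deriv f (w + 2 * t) - deriv f (w + t))) (at t)"
        unfolding q_def by (auto intro!: derivative_eq_intros)
      thus "(q has_field_derivative 2 * (deriv f (w + 2 * t) - deriv f (w + t))) (at t within cball 0 (norm h))"
        by (rule has_field_derivative_at_within)
      have "norm (deriv f (w + 2 * t) - deriv f (w + t)) \<le> K * norm ((w + 2 * t) - (w + t))"
        by (rule lip) (use m in auto)
      also have "\<dots> \<le> K * norm h" by (rule mult_left_mono) (use t in \<open>auto simp: K_def\<close>)
      finally show "norm (2 * (deriv f (w + 2 * t) - deriv f (w + t))) \<le> 2 * K * norm h"
        unfolding norm_mult by simp
    qed auto
    moreover have "q h - q 0 = f w + f (w + 2 * h) - 2 * f (w + h)" by (simp add: q_def)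
    ultimately show "norm (f w + f (w + 2 * h) - 2 * f (w + h)) \<le> (2 * K) * norm h ^ 2"
      by (simp add: power2_eq_square mult.assoc)
  qed
qed

lemma bz_second_difference:
  fixes f :: "complex \<Rightarrow> complex"
  assumes f: "hol f 0" and h: "h \<in> bz n" "n \<ge> 1"
  shows "(\<lambda>w. f w + f (w + 2 * h w) - 2 * f (w + h w)) \<in> bz (2 * n)"
proof -
  obtain C r where r: "r > 0" "\<And>w h. norm w < r \<Longrightarrow> norm h < r \<Longrightarrow>
    norm (f w + f (w + 2 * h) - 2 * f (w + h)) \<le> C * norm h ^ 2"
  proof (rule second_difference[OF f])
    fix C r assume a: "0 < r" "\<And>w h. norm w < r \<Longrightarrow> norm h < r \<Longrightarrow> norm (f w + f (w + 2 * h) - 2 * f (w + h)) \<le> C * norm h ^ 2"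
    show thesis by (rule that[OF a(1)]) (rule a(2))
  qed
  obtain m where m: "n = Suc m" using h(2) by (cases n) auto
  have ev: "\<forall>\<^sub>F w in nhds 0. norm (h w) < r"
    using tendstoD[OF bz_0_imp_tendsto[of h m] r(1)] h(1) m by auto
  have "\<forall>\<^sub>F w in nhds 0. norm (f w + f (w + 2 * h w) - 2 * f (w + h w)) \<le> C * norm (h w ^ 2)"
    using ev eventually_norm_less[OF r(1)] by eventually_elim (simp add: r(2) norm_power)
  hence "(\<lambda>w. f w + f (w + 2 * h w) - 2 * f (w + h w)) \<in> O[nhds 0](\<lambda>w. h w ^ 2)" by (rule bigoI)
  moreover have "(\<lambda>w. h w ^ 2) \<in> bz (2 * n)" using bz_power[OF h(1), of 2] by (simp add: mult.commute)
  ultimately show ?thesis by (rule landau_o.big_trans)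
qed


lemma ddir_slice1:
  fixes F :: "complex \<times> 'p::cvec \<Rightarrow> complex"
  assumes "cdiff F (z, p)"
  shows "ddir F (z, p) (1, 0) = deriv (\<lambda>z. F (z, p)) z"
  using DERIV_imp_deriv[OF cdiff_slice[OF assms]] by simp

lemma bz_deriv_diff_ident:
  assumes "hol f 0" "(\<lambda>z. f z - z) \<in> bz (Suc n)"
  shows "(\<lambda>z. deriv f z - 1) \<in> bz n"
proof -
  have "deriv (\<lambda>z. f z - z) \<in> bz n" by (intro bz_deriv assms hol_intros)
  moreover have "\<forall>\<^sub>F z in nhds 0. deriv (\<lambda>z. f z - z) z = deriv f z - 1"
    using hol_eventually[OF assms(1)]
    by (rule eventually_mono) (simp add: hol_field_differentiable)
  ultimately show ?thesis by (rule bz_cong)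
qed

lemma eventually_nhds_Pair:
  assumes "\<forall>\<^sub>F q in nhds (a, b). P q" "u 0 = a" "isCont u 0" "w 0 = b" "isCont w 0"
  shows "\<forall>\<^sub>F x in nhds (0::'a::{t2_space,zero}). P (u x, w x)"
proof -
  have "isCont (\<lambda>x. (u x, w x)) 0" using assms by (intro continuous_Pair)
  from isCont_eventually_nhds[OF this] show ?thesis using assms by simp
qed

lemma eventually_slice: "\<forall>\<^sub>F q in nhds (0, b). P q \<Longrightarrow> \<forall>\<^sub>F x in nhds (0::complex). P (x, b)"
  by (rule eventually_nhds_Pair[where u = "\<lambda>x. x" and w = "\<lambda>x. b"]) auto

text \<open>
  The chart \<open>B\<close> is the inverse of \<open>w \<mapsto> (w + g w) / 2\<close>. Then \<open>2 (cc e - e)\<close> is a difference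
  \<open>g (w + h) - g w - h\<close> with \<open>h = 2 e\<close>, up to a shift of the argument by \<open>e\<close>, which makes it \<open>o(e)\<close>.
\<close>

lemma midpoint_chart:
  fixes g :: "complex \<times> 'p::cvec \<Rightarrow> complex" and \<gamma> :: real
  assumes g: "hol g (0, 0)" and k: "k \<ge> 1"
    and gE: "(\<lambda>w. g (w, 0) - w - (w ^ (k + 1) / 2 + \<gamma> * w ^ (2 * k + 1))) \<in> bz (2 * k + 2)"
  obtains B e where "hol B (0, 0)" "B (0, 0) = 0" "ddir B (0, 0) (1, 0) = 1" "hol e (0, 0)"
    "\<forall>\<^sub>F q in nhds (0, 0). g (B q, snd q) = cc B (fst q + e q, snd q)"
    "\<forall>\<^sub>F q in nhds (0, 0). norm (cc e q - e q) \<le> norm (e q) / 4"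
    "(\<lambda>x. e (x, 0) - (x ^ (k + 1) / 2 + \<gamma> * x ^ (2 * k + 1))) \<in> bz (2 * k + 2)"
    "\<forall>v. (\<lambda>x. ddir e (x, 0) (0, v) - (ddir g (x, 0) (0, v) + ddir (cc g) (x, 0) (0, v)) / 2) \<in> bz k"
proof -
  define E where "E w = w ^ (k + 1) / 2 + \<gamma> * w ^ (2 * k + 1)" for w :: complex
  define G where "G w = g (w, 0)" for w
  define Gc where "Gc w = cc g (w, 0)" for w
  have hE: "hol E 0" unfolding E_def by (intro hol_intros) auto
  have E_bz: "E \<in> bz (k + 1)"
    unfolding E_def using bz_cmult[OF power_in_bz_le[of "k + 1" "k + 1"], of "1/2"]
    by (intro bz_add bz_cmult power_in_bz_le) auto
  have hG: "hol G 0" unfolding G_def by (rule hol_slice1[OF g])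
  have hcg: "hol (cc g) (0, 0)" by (rule hol_cc) (use g in simp)
  have hGc: "hol Gc 0" unfolding Gc_def by (rule hol_slice1[OF hcg])
  have GE: "(\<lambda>w. G w - w - E w) \<in> bz (2 * k + 2)" using gE by (simp add: G_def E_def)
  \<comment> \<open>The coefficients of \<open>E\<close> are real, so \<open>cc g\<close> has the
    same expansion as \<open>g\<close>.\<close>
  have GcE: "(\<lambda>w. Gc w - w - E w) \<in> bz (2 * k + 2)"
    using bz_cnj[OF GE] by (simp add: Gc_def G_def cc_def E_def)
  have G1: "(\<lambda>w. G w - w) \<in> bz (Suc k)"
    using bz_add[OF bz_mono[OF GE, of "Suc k"] bz_mono[OF E_bz, of "Suc k"]] by simp
  have Gc1: "(\<lambda>w. Gc w - w) \<in> bz (Suc k)"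
    using bz_add[OF bz_mono[OF GcE, of "Suc k"] bz_mono[OF E_bz, of "Suc k"]] by simp
  have Gbz: "G \<in> bz 1" "Gc \<in> bz 1"
    using bz_add[OF bz_mono[OF G1, of 1] bz_ident] bz_add[OF bz_mono[OF Gc1, of 1] bz_ident] by simp_all
  have G0: "G 0 = 0" "Gc 0 = 0" using bz_at_0[of _ 0] Gbz by auto
  have g0: "g (0, 0) = 0" using G0 by (simp add: G_def)
  have dG: "(\<lambda>w. deriv G w - 1) \<in> bz k" "(\<lambda>w. deriv Gc w - 1) \<in> bz k"
    by (intro bz_deriv_diff_ident hG hGc G1 Gc1)+
  have "deriv G 0 = 1" using bz_at_0[of "\<lambda>w. deriv G w - 1" 0] bz_mono[OF dG(1), of 1] k by simp
  hence gz: "ddir g (0, 0) (1, 0) = 1"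
    using ddir_slice1[OF hol_imp_cdiff[OF g]] unfolding G_def by simp
  define A where "A q = (fst q + g q) / 2" for q :: "complex \<times> 'p"
  have hA: "hol A (0, 0)" unfolding A_def by (intro hol_intros g) simp
  have cdfst: "cdiff fst q" for q :: "complex \<times> 'p" by (rule hol_imp_cdiff[OF hol_fst'])
  have dA: "ddir A (0, 0) (v, 0) = v" for v
  proof -
    have "ddir A (0, 0) (v, 0) = (v + ddir g (0, 0) (v, 0)) / 2"
      unfolding A_def using hol_imp_cdiff[OF hol_add[OF hol_fst' g]] hol_imp_cdiff[OF g]
      by (simp add: ddir_divide_const ddir_add_fun cdfst)
    also have "ddir g (0, 0) (v, 0) = v" using ddir_fst_direction[OF hol_imp_cdiff[OF g], of v 0] gz
      by (simp add: ddir_zero[OF hol_imp_cdiff[OF g], unfolded zero_prod_def])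
    finally show ?thesis by simp
  qed
  have A00: "A (0, 0) = 0" by (simp add: A_def g0)
  obtain B where "hol B (A (0, 0), 0)" "B (A (0, 0), 0) = 0"
    "\<forall>\<^sub>F q in nhds (A (0, 0), 0). A (B q, snd q) = fst q"
    "\<forall>\<^sub>F q in nhds (0, 0). B (A q, snd q) = fst q"
  proof (rule hol_partial_inverse[OF hA])
    show "v = 0" if "ddir A (0, 0) (v, 0) = 0" for v using that dA by simp
  qed
  hence B: "hol B (0, 0)" "B (0, 0) = 0" "\<forall>\<^sub>F q in nhds (0, 0). A (B q, snd q) = fst q"
    "\<forall>\<^sub>F q in nhds (0, 0). B (A q, snd q) = fst q" unfolding A00 by auto
  have dB: "ddir B (0, 0) (1, 0) = 1"
  proof -
    have "ddir (\<lambda>q. A (B q, snd q)) (0, 0) (1, 0) = ddir fst ((0, 0) :: complex \<times> 'p) (1, 0)"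
      by (rule fun_cong[OF ddir_cong[OF B(3)]])
        (rule hol_imp_cdiff[OF hol_comp_pair], use hA B in auto)
    moreover have "ddir (\<lambda>q. A (B q, snd q)) (0, 0) (1, 0) = ddir A (0, 0) (ddir B (0, 0) (1, 0), 0)"
      using ddir_comp_pair[of A B "(0, 0)" "(1, 0)"] hol_imp_cdiff[OF hA] hol_imp_cdiff[OF B(1)] B(2) by simp
    ultimately show ?thesis by (simp add: dA)
  qed
  \<comment> \<open>With \<open>w = B q\<close>, the midpoint of \<open>g w\<close> and
    \<open>cc g (g w)\<close> exceeds the midpoint of \<open>w\<close> and \<open>g w\<close>, which
    is \<open>fst q\<close>, exactly by \<open>e q\<close>.\<close>
  define e where "e q = (cc g (g (B q, snd q), snd q) - B q) / 2" for q
  have hgB: "hol (\<lambda>q. g (B q, snd q)) (0, 0)" by (rule hol_comp_pair) (use g B in auto)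
  have hcgB: "hol (\<lambda>q. cc g (g (B q, snd q), snd q)) (0, 0)"
    by (rule hol_comp_pair[of "cc g" "\<lambda>q. g (B q, snd q)"]) (use hcg hgB B g0 in auto)
  have he: "hol e (0, 0)" unfolding e_def by (intro hol_intros hcgB B) simp
  have cg0: "cc g (0, 0) = 0" using G0(2) by (simp add: Gc_def)
  have e00: "e (0, 0) = 0" by (simp add: e_def B g0 cg0)
  have evB: "\<forall>\<^sub>F q in nhds (0, 0). P (g (B q, snd q), snd q)" if "\<forall>\<^sub>F q in nhds (0, 0). P q" for P
  proof -
    have "isCont (\<lambda>q. (g (B q, snd q), snd q)) (0, 0)"
      by (intro hol_isCont hol_intros hgB)
    from isCont_eventually_nhds[OF this] show ?thesis using that B g0 by simp
  qed
  have inv_c: "\<forall>\<^sub>F q in nhds (0, 0). cc B (cc A q, snd q) = fst q"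
  proof -
    have "\<forall>\<^sub>F q in nhds (cj (0, 0)). B (A q, snd q) = fst q" using B(4) by simp
    from eventually_nhds_cj[OF this] show ?thesis
      by (rule eventually_mono) (simp add: cc_def)
  qed
  have cA: "cc A q = (fst q + cc g q) / 2" for q by (simp add: cc_def A_def)
  have main: "\<forall>\<^sub>F q in nhds (0, 0). g (B q, snd q) = cc B (fst q + e q, snd q)"
    using B(3) evB[OF inv_c]
  proof eventually_elim
    case (elim q)
    have "cc A (g (B q, snd q), snd q) = fst q + e q"
    proof -
      have *: "(y + c) / 2 = f + (c - b) / 2" if "(b + y) / 2 = f" for y c f b :: complex
        unfolding that[symmetric] by (simp add: field_simps)
      show ?thesis unfolding cA e_def fst_conv by (rule *) (use elim(1) in \<open>simp add: A_def\<close>)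
    qed
    with elim(2) show ?case by simp
  qed
  have eE: "(\<lambda>x. e (x, 0) - E x) \<in> bz (2 * k + 2)"
  proof -
    define d where "d w = (G w - w) / 2" for w
    have d: "d \<in> bz (k + 1)" using bz_cmult[OF G1, of "1/2"] by (simp add: d_def[abs_def])
    have "(\<lambda>w. E w + E (w + 2 * d w) - 2 * E (w + d w)) \<in> bz (2 * (k + 1))"
      by (rule bz_second_difference[OF hE d]) simp
    hence 1: "(\<lambda>w. E w + E (G w) - 2 * E ((w + G w) / 2)) \<in> bz (2 * k + 2)"
    proof (rule bz_cong[OF bz_mono])
      show "\<forall>\<^sub>F w in nhds 0. E w + E (w + 2 * d w) - 2 * E (w + d w) = E w + E (G w) - 2 * E ((w + G w) / 2)"
      proof (rule always_eventually, rule allI)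
        fix w
        have "w + 2 * d w = G w" "w + d w = (w + G w) / 2" by (simp_all add: d_def field_simps)
        thus "E w + E (w + 2 * d w) - 2 * E (w + d w) = E w + E (G w) - 2 * E ((w + G w) / 2)" by (simp only:)
      qed
    qed simp
    have 2: "(\<lambda>w. Gc (G w) - G w - E (G w)) \<in> bz (2 * k + 2)" by (rule bz_compose[OF GcE Gbz(1)])
    have "(\<lambda>w. 1/2 * ((E w + E (G w) - 2 * E ((w + G w) / 2)) + ((Gc (G w) - G w - E (G w)) + (G w - w - E w)))) \<in> bz (2 * k + 2)"
      by (intro bz_cmult bz_add 1 2 GE)
    hence 3: "(\<lambda>w. (Gc (G w) - w) / 2 - E ((w + G w) / 2)) \<in> bz (2 * k + 2)"
      by (rule bz_cong) (simp add: field_simps)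
    have "(\<lambda>x. B (x, 0)) \<in> bz 1" by (rule bz_hol1[OF hol_slice1[OF B(1)] B(2)])
    from bz_compose[OF 3 this]
    have "(\<lambda>x. (Gc (G (B (x, 0))) - B (x, 0)) / 2 - E ((B (x, 0) + G (B (x, 0))) / 2)) \<in> bz (2 * k + 2)" .
    thus ?thesis
    proof (rule bz_cong)
      show "\<forall>\<^sub>F x in nhds 0. (Gc (G (B (x, 0))) - B (x, 0)) / 2 - E ((B (x, 0) + G (B (x, 0))) / 2) = e (x, 0) - E x"
        using eventually_slice[OF B(3)] by (rule eventually_mono) (simp add: e_def A_def G_def Gc_def)
    qed
  qed
  have e_bz: "(\<lambda>x. e (x, 0)) \<in> bz (k + 1)"
    using bz_add[OF bz_mono[OF eE, of "k + 1"] E_bz] by simp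
  have "deriv (\<lambda>x. e (x, 0)) \<in> bz k" by (rule bz_deriv) (use hol_slice1[OF he] e_bz in auto)
  hence "deriv (\<lambda>x. e (x, 0)) 0 = 0" using bz_at_0[of _ 0] bz_mono[of _ k 1] k by fastforce
  hence ez: "ddir e (0, 0) (1, 0) = 0" using ddir_slice1[OF hol_imp_cdiff[OF he]] by simp
  have hce: "hol (cc e) (0, 0)" by (rule hol_cc) (use he in simp)
  have cez: "ddir (cc e) (0, 0) (1, 0) = 0"
    using ddir_cc[of e "(0, 0)" "(1, 0)"] hol_imp_cdiff[OF he] ez by simp
  \<comment> \<open>The tolerance 1/4 is spent in halves: 1/8 for the deviation of \<open>g\<close>
    from the identity over an increment \<open>2 * e q\<close>, and 1/8 for undoing the shift of the
    argument by \<open>e q\<close>, since \<open>cc e\<close> has derivative 0 at the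
    origin.\<close>
  have comp: "\<forall>\<^sub>F q in nhds (0, 0). norm (cc e q - e q) \<le> norm (e q) / 4"
  proof -
    obtain r1 where r1: "r1 > 0" "\<And>x y. x \<in> ball (0, 0) r1 \<Longrightarrow> y \<in> ball (0, 0) r1 \<Longrightarrow>
        norm (g x - g y - ddir g (0, 0) (x - y)) \<le> 1/8 * norm (x - y)"
      using hol_lipschitz[OF g, of "1/8"] by auto
    obtain r2 where r2: "r2 > 0" "\<And>x y. x \<in> ball (0, 0) r2 \<Longrightarrow> y \<in> ball (0, 0) r2 \<Longrightarrow>
        norm (cc e x - cc e y - ddir (cc e) (0, 0) (x - y)) \<le> 1/8 * norm (x - y)"
      using hol_lipschitz[OF hce, of "1/8"] by auto
    have ctoI: "\<forall>\<^sub>F q in nhds (0, 0). F q \<in> ball (0, 0) r" if "hol F (0, 0)" "F (0, 0) = (0, 0)" "r > 0"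
      for F :: "complex \<times> 'p \<Rightarrow> complex \<times> 'p" and r
    proof -
      have "\<forall>\<^sub>F q in nhds (F (0, 0)). q \<in> ball (0, 0) r"
        by (rule eventually_nhds_in_open) (use that in auto)
      from isCont_eventually_nhds[OF hol_isCont[OF that(1)] this] show ?thesis .
    qed
    have 1: "\<forall>\<^sub>F q in nhds (0, 0). (B q + 2 * e q, snd q) \<in> ball (0, 0) r1"
      by (rule ctoI) (use r1(1) B e00 in \<open>auto intro!: hol_intros he\<close>)
    have 2: "\<forall>\<^sub>F q in nhds (0, 0). (B q, snd q) \<in> ball (0, 0) r1"
      by (rule ctoI) (use r1(1) B in \<open>auto intro!: hol_intros\<close>)
    have 3: "\<forall>\<^sub>F q in nhds (0, 0). (fst q + e q, snd q) \<in> ball (0, 0) r2"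
      by (rule ctoI) (use r2(1) e00 in \<open>auto intro!: hol_intros he\<close>)
    have 4: "\<forall>\<^sub>F q in nhds (0, 0). (fst q, snd q) \<in> ball (0::complex, 0::'p) r2"
      by (rule ctoI) (use r2(1) in \<open>auto intro!: hol_intros hol_ident\<close>)
    have cce: "cc e q = (g (cc g (cc B q, snd q), snd q) - cc B q) / 2" for q by (simp add: cc_def e_def)
    show ?thesis using main 1 2 3 4
    proof eventually_elim
      case (elim q)
      obtain x p where q: "q = (x, p)" by (cases q)
      define w where "w = B q"
      have a: "g (w, p) = cc B (x + e q, p)" using elim(1) by (simp add: q w_def)
      have b: "cc g (g (w, p), p) = w + 2 * e q" by (simp add: e_def w_def q field_simps)
      have c: "cc e (x + e q, p) = (g (w + 2 * e q, p) - g (w, p)) / 2"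
        unfolding cce by (simp add: a[symmetric] b)
      have "ddir g (0, 0) (2 * e q, 0) = 2 * e q"
        using ddir_fst_direction[OF hol_imp_cdiff[OF g], of "2 * e q" 0] gz
        by (simp add: ddir_zero[OF hol_imp_cdiff[OF g], unfolded zero_prod_def])
      hence "norm (g (w + 2 * e q, p) - g (w, p) - 2 * e q) \<le> 1/8 * norm (2 * e q)"
        using r1(2)[OF elim(2) elim(3)] by (simp add: q w_def)
      moreover have "cc e (x + e q, p) - e q = (g (w + 2 * e q, p) - g (w, p) - 2 * e q) / 2"
        unfolding c by (simp add: diff_divide_distrib)
      hence "norm (cc e (x + e q, p) - e q) = norm (g (w + 2 * e q, p) - g (w, p) - 2 * e q) / 2"
        by (simp only: norm_divide norm_numeral)
      ultimately have d: "norm (cc e (x + e q, p) - e q) \<le> 1/8 * norm (e q)" by (simp add: norm_mult)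
      have "ddir (cc e) (0, 0) (e q, 0) = 0"
        using ddir_fst_direction[OF hol_imp_cdiff[OF hce], of "e q" 0] cez
        by (simp add: ddir_zero[OF hol_imp_cdiff[OF hce], unfolded zero_prod_def])
      hence "norm (cc e (x + e q, p) - cc e q) \<le> 1/8 * norm (e q)"
        using r2(2)[OF elim(4) elim(5)] by (simp add: q)
      with d have "norm ((cc e (x + e q, p) - e q) - (cc e (x + e q, p) - cc e q)) \<le> 1/8 * norm (e q) + 1/8 * norm (e q)"
        by (rule order_trans[OF norm_triangle_ineq4 add_mono])
      thus ?case by simp
    qed
  qed
  \<comment> \<open>At parameter 0 the maps \<open>B\<close>, \<open>G\<close> and \<open>Gc\<close>
    differ from the identity by order \<open>k + 1\<close>, and \<open>deriv G\<close>,
    \<open>deriv Gc\<close> differ from 1 by order \<open>k\<close>. Modulo \<open>z ^ k\<close> the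
    chain rule therefore leaves the mean of the two parameter derivatives; the contributions of
    \<open>B\<close> cancel.\<close>
  have der: "(\<lambda>x. ddir e (x, 0) (0, v) - (ddir g (x, 0) (0, v) + ddir (cc g) (x, 0) (0, v)) / 2) \<in> bz k" for v
  proof -
    define b where "b x = B (x, 0)" for x
    define dg where "dg x = ddir g (x, 0) (0, v)" for x
    define dgc where "dgc x = ddir (cc g) (x, 0) (0, v)" for x
    define db where "db x = ddir B (x, 0) (0, v)" for x
    have hd: "hol dg 0" "hol dgc 0" "hol db 0"
      unfolding dg_def dgc_def db_def by (intro hol_slice1 hol_ddir g hcg B)+
    have b_bz: "b \<in> bz 1" unfolding b_def by (rule bz_hol1[OF hol_slice1[OF B(1)] B(2)])
    have b_x: "(\<lambda>x. b x - x) \<in> bz (Suc k)"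
    proof (rule bz_cong[OF bz_cmult[OF bz_compose[OF G1 b_bz], of "-1/2"]])
      show "\<forall>\<^sub>F x in nhds 0. -1/2 * (G (b x) - b x) = b x - x"
        using eventually_slice[OF B(3)] by (rule eventually_mono) (simp add: A_def b_def G_def field_simps)
    qed
    have Gb: "(\<lambda>x. G (b x)) \<in> bz 1" by (rule bz_compose[OF Gbz(1) b_bz])
    have Gb_x: "(\<lambda>x. G (b x) - x) \<in> bz (Suc k)"
      using bz_add[OF bz_compose[OF G1 b_bz] b_x] by simp
    have formula: "\<forall>\<^sub>F x in nhds 0. ddir e (x, 0) (0, v) =
        1/2 * (deriv Gc (G (b x)) * (deriv G (b x) * db x + dg (b x)) + dgc (G (b x)) - db x)"
    proof -
      have evs: "\<forall>\<^sub>F q in nhds (0, 0). hol B q \<and> hol g (B q, snd q) \<and> hol (cc g) (g (B q, snd q), snd q)"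
      proof (intro eventually_conj)
        show "\<forall>\<^sub>F q in nhds (0, 0). hol B q" by (rule hol_eventually[OF B(1)])
        have "isCont (\<lambda>q. (B q, snd q)) (0, 0)" by (intro hol_isCont hol_intros B)
        from isCont_eventually_nhds[OF this, of "hol g"]
        show "\<forall>\<^sub>F q in nhds (0, 0). hol g (B q, snd q)" using hol_eventually[OF g] B(2) by simp
        show "\<forall>\<^sub>F q in nhds (0, 0). hol (cc g) (g (B q, snd q), snd q)" by (rule evB[OF hol_eventually[OF hcg]])
      qed
      show ?thesis using eventually_slice[OF evs]
      proof (rule eventually_mono, elim conjE)
        fix x assume h: "hol B (x, 0)" "hol g (B (x, 0), snd (x, 0::'p))" "hol (cc g) (g (B (x, 0), snd (x, 0::'p)), snd (x, 0::'p))"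
        have h1: "hol (\<lambda>q. g (B q, snd q)) (x, 0)" by (rule hol_comp_pair) (use h in auto)
        have h2: "hol (\<lambda>q. cc g (g (B q, snd q), snd q)) (x, 0)"
          by (rule hol_comp_pair[of "cc g" "\<lambda>q. g (B q, snd q)"]) (use h h1 in auto)
        note hc = h[THEN hol_imp_cdiff] h1[THEN hol_imp_cdiff]
        have cg: "cdiff g (b x, 0)" "cdiff (cc g) (G (b x), 0)"
          using hc by (simp_all add: b_def G_def)
        have d1: "ddir (\<lambda>q. g (B q, snd q)) (x, 0) (0, v) = deriv G (b x) * db x + dg (b x)"
        proof -
          have "ddir (\<lambda>q. g (B q, snd q)) (x, 0) (0, v) = ddir g (b x, 0) (db x, v)"
            using ddir_comp_pair[of g B "(x, 0)" "(0, v)"] hc by (simp add: b_def db_def)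
          also have "\<dots> = db x * deriv G (b x) + dg (b x)"
            unfolding ddir_fst_direction[OF cg(1), of "db x"] ddir_slice1[OF cg(1)] by (simp add: G_def[abs_def] dg_def)
          finally show ?thesis by simp
        qed
        have d2: "ddir (\<lambda>q. cc g (g (B q, snd q), snd q)) (x, 0) (0, v) =
            deriv Gc (G (b x)) * (deriv G (b x) * db x + dg (b x)) + dgc (G (b x))"
        proof -
          have "ddir (\<lambda>q. cc g (g (B q, snd q), snd q)) (x, 0) (0, v) =
              ddir (cc g) (G (b x), 0) (deriv G (b x) * db x + dg (b x), v)"
            using ddir_comp_pair[of "cc g" "\<lambda>q. g (B q, snd q)" "(x, 0)" "(0, v)"] hc d1
            by (simp add: b_def G_def)
          also have "\<dots> = (deriv G (b x) * db x + dg (b x)) * deriv Gc (G (b x)) + dgc (G (b x))"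
            unfolding ddir_fst_direction[OF cg(2), of "deriv G (b x) * db x + dg (b x)"] ddir_slice1[OF cg(2)]
            by (simp add: Gc_def[abs_def] dgc_def)
          finally show ?thesis by simp
        qed
        have "ddir e (x, 0) (0, v) = (ddir (\<lambda>q. cc g (g (B q, snd q), snd q)) (x, 0) (0, v) - db x) / 2"
          unfolding e_def using hol_imp_cdiff[OF hol_diff[OF h2 h(1)]] hol_imp_cdiff[OF h2] hol_imp_cdiff[OF h(1)]
          by (simp add: ddir_divide_const ddir_diff_fun db_def)
        thus "ddir e (x, 0) (0, v) =
          1/2 * (deriv Gc (G (b x)) * (deriv G (b x) * db x + dg (b x)) + dgc (G (b x)) - db x)"
          unfolding d2 by simp
      qed
    qed
    define u where "u x = deriv Gc (G (b x)) - 1" for x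
    define w where "w x = deriv G (b x) - 1" for x
    have uw: "u \<in> bz k" "w \<in> bz k"
      unfolding u_def w_def using bz_compose[OF dG(2) Gb] bz_compose[OF dG(1) b_bz] by simp_all
    have bd: "db \<in> bz 0" "(\<lambda>x. dg (b x)) \<in> bz 0" "w \<in> bz 0"
      using bz_hol[OF hd(3)] bz_compose[OF bz_hol[OF hd(1)] b_bz] bz_mono[OF uw(2), of 0] by simp_all
    have L1: "(\<lambda>x. dg (b x) - dg x) \<in> bz k"
      by (rule bz_lipschitz[OF hd(1) b_bz bz_ident bz_mono[OF b_x]]) simp
    have L2: "(\<lambda>x. dgc (G (b x)) - dgc x) \<in> bz k"
      by (rule bz_lipschitz[OF hd(2) Gb bz_ident bz_mono[OF Gb_x]]) simp
    have M1: "(\<lambda>x. u x * db x) \<in> bz k" "(\<lambda>x. w x * db x) \<in> bz k" "(\<lambda>x. u x * dg (b x)) \<in> bz k"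
      using bz_mult[OF uw(1) bd(1)] bz_mult[OF uw(2) bd(1)] bz_mult[OF uw(1) bd(2)] by simp_all
    have M2: "(\<lambda>x. u x * (w x * db x)) \<in> bz k"
      using bz_mono[OF bz_mult[OF uw(1) M1(2)], of k] by simp
    have "(\<lambda>x. 1/2 * (u x * (w x * db x) + u x * db x + w x * db x + u x * dg (b x) + (dg (b x) - dg x) + (dgc (G (b x)) - dgc x))) \<in> bz k"
      by (intro bz_cmult bz_add M1 M2 L1 L2)
    thus ?thesis
    proof (rule bz_cong)
      show "\<forall>\<^sub>F x in nhds 0. 1/2 * (u x * (w x * db x) + u x * db x + w x * db x + u x * dg (b x) + (dg (b x) - dg x) + (dgc (G (b x)) - dgc x)) =
        ddir e (x, 0) (0, v) - (ddir g (x, 0) (0, v) + ddir (cc g) (x, 0) (0, v)) / 2"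
        using formula
      proof (rule eventually_mono)
        fix x assume f: "ddir e (x, 0) (0, v) = 1/2 * (deriv Gc (G (b x)) * (deriv G (b x) * db x + dg (b x)) + dgc (G (b x)) - db x)"
        show "1/2 * (u x * (w x * db x) + u x * db x + w x * db x + u x * dg (b x) + (dg (b x) - dg x) + (dgc (G (b x)) - dgc x)) =
          ddir e (x, 0) (0, v) - (ddir g (x, 0) (0, v) + ddir (cc g) (x, 0) (0, v)) / 2"
          unfolding f u_def w_def dg_def dgc_def by (simp add: field_simps)
      qed
    qed
  qed
  show ?thesis
    by (rule that[OF B(1,2) dB he main comp]) (use eE der in \<open>simp_all add: E_def[abs_def]\<close>)
qed

text \<open>The germ of \<open>Ln (1 + u) / u\<close> with its removable singularity filled, so that
  \<open>e * L (e')\<close> is holomorphic also where \<open>e'\<close> vanishes. The two-term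
  expansion settles the coefficient of \<open>x ^ (2 * k + 1)\<close> in the field
  \<open>X\<close>.\<close>

lemma Ln_factor:
  obtains L where "hol L 0" "L 0 = 1" "\<forall>\<^sub>F u in nhds 0. Ln (1 + u) = u * L u"
    "(\<lambda>u. L u - 1 + u / 2) \<in> bz 2"
proof -
  have h: "hol (\<lambda>u. Ln (1 + u)) 0"
    by (rule hol_analytic) (auto intro!: analytic_intros simp: complex_nonpos_Reals_iff)
  define F where "F u = Ln (1 + u) - u + u\<^sup>2 / 2" for u
  have hF: "hol F 0" unfolding F_def by (intro hol_intros h) auto
  \<comment> \<open>The remainder has a zero of order 3 because its derivative is
    \<open>u\<^sup>2 / (1 + u)\<close>.\<close>
  have "F \<in> bz 3"
  proof -
    obtain r where r: "r > 0" "F holomorphic_on ball 0 r" by (rule hol_complex_ball[OF hF])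
    have "\<forall>\<^sub>F u in nhds 0. deriv F u = u\<^sup>2 / (1 + u)"
    proof (rule eventually_mono[OF eventually_nhds_in_open[of "ball 0 1"]])
      fix u :: complex assume u: "u \<in> ball 0 1"
      have *: "(1 + u) \<noteq> 0"
      proof
        assume "1 + u = 0"
        hence "u = -1" by (simp add: add_eq_0_iff)
        thus False using u by simp
      qed
      have "1 + u \<notin> \<real>\<^sub>\<le>\<^sub>0"
      proof
        assume "1 + u \<in> \<real>\<^sub>\<le>\<^sub>0"
        hence "Re u \<le> -1" by (auto simp: complex_nonpos_Reals_iff)
        thus False using u abs_Re_le_cmod[of u] by simp
      qed
      hence "(F has_field_derivative (1 / (1 + u) - 1 + u)) (at u)"
        unfolding F_def by (auto intro!: derivative_eq_intros simp: field_simps)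
      hence "deriv F u = 1 / (1 + u) - 1 + u" by (rule DERIV_imp_deriv)
      also have "\<dots> = u\<^sup>2 / (1 + u)" using * by (simp add: field_simps power2_eq_square)
      finally show "deriv F u = u\<^sup>2 / (1 + u)" .
    qed auto
    note dF = this
    have "(\<lambda>u. u\<^sup>2 * (1 / (1 + u))) \<in> bz (2 + 0)"
      by (intro bz_mult bz_hol power_in_bz hol_intros) auto
    hence "deriv F \<in> bz 2" unfolding add_0_right by (rule bz_cong) (rule eventually_mono[OF dF], simp)
    then obtain C where C: "\<forall>\<^sub>F u in nhds 0. norm (deriv F u) \<le> C * norm (u\<^sup>2)" by (elim landau_o.bigE)
    then obtain s where s: "s > 0" "\<And>u. dist u 0 < s \<Longrightarrow> norm (deriv F u) \<le> C * norm (u\<^sup>2)"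
      by (auto simp: eventually_nhds_metric)
    show ?thesis
    proof (rule bigoI)
      show "\<forall>\<^sub>F u in nhds 0. norm (F u) \<le> C * norm (u ^ 3)"
      proof (rule eventually_mono[OF eventually_nhds_in_open[of "ball 0 (min r s)"]])
        fix u :: complex assume u: "u \<in> ball 0 (min r s)"
        have "norm (F u - F 0) \<le> (C * norm (u\<^sup>2)) * norm (u - 0)"
        proof (rule field_differentiable_bound[where S = "cball 0 (norm u)"])
          fix z :: complex assume z: "z \<in> cball 0 (norm u)"
          have zr: "z \<in> ball 0 r" "dist z 0 < s" using u z by auto
          show "(F has_field_derivative deriv F z) (at z within cball 0 (norm u))"
            by (rule has_field_derivative_at_within[OF holomorphic_derivI[OF r(2) open_ball zr(1)]])
          have C0: "0 \<le> C * norm (u\<^sup>2)" using order_trans[OF norm_ge_zero s(2)[of u]] u by simp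
          show "norm (deriv F z) \<le> C * norm (u\<^sup>2)"
          proof (cases "u = 0")
            case False
            hence "C \<ge> 0" using C0 by (simp add: norm_power zero_le_mult_iff)
            moreover have "norm (z\<^sup>2) \<le> norm (u\<^sup>2)" using z by (simp add: norm_power power_mono)
            ultimately show ?thesis using s(2)[OF zr(2)] mult_left_mono[of "norm (z\<^sup>2)" "norm (u\<^sup>2)" C] by linarith
          next
            case True thus ?thesis using s(2)[OF zr(2)] z by simp
          qed
        qed auto
        thus "norm (F u) \<le> C * norm (u ^ 3)"
          by (simp add: F_def norm_mult norm_power power3_eq_cube power2_eq_square mult_ac)
      qed (use r s in auto)
    qed
  qed
  then obtain V where V: "hol V 0" "\<forall>\<^sub>F u in nhds 0. F u = u ^ 3 * V u"
    using bz_factor[OF hF] by blast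
  show ?thesis
  proof (rule that[of "\<lambda>u. 1 - u / 2 + u\<^sup>2 * V u"])
    show "hol (\<lambda>u. 1 - u / 2 + u\<^sup>2 * V u) 0" by (intro hol_intros V) auto
    show "\<forall>\<^sub>F u in nhds 0. Ln (1 + u) = u * (1 - u / 2 + u\<^sup>2 * V u)"
      using V(2) by eventually_elim (simp add: F_def field_simps power2_eq_square power3_eq_cube)
    have "(\<lambda>u. u\<^sup>2 * V u) \<in> bz (2 + 0)" by (intro bz_mult bz_hol power_in_bz V)
    thus "(\<lambda>u. 1 - u / 2 + u\<^sup>2 * V u - 1 + u / 2) \<in> bz 2" by simp
  qed auto
qed

lemma hol_ddir_slice: 
  fixes e :: "complex \<times> 'p::cvec \<Rightarrow> complex"
  assumes "hol e (z, p)"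
  shows "\<forall>\<^sub>F x in nhds z. ddir e (x, p) (1, 0) = deriv (\<lambda>x. e (x, p)) x"
proof -
  have "\<forall>\<^sub>F x in nhds z. cdiff e (x, p)"
    using isCont_eventually_nhds[where G = "\<lambda>x. (x, p)" and x = z and P = "cdiff e"] assms by (auto simp: hol_def)
  thus ?thesis by eventually_elim (rule ddir_slice1)
qed

lemma isCont_tendsto_nhds: "isCont f x \<Longrightarrow> f x = l \<Longrightarrow> (f \<longlongrightarrow> l) (nhds x)"
  using tendsto_at_iff_tendsto_nhds[of f x] by (simp add: isCont_def)

lemma cc_compare:
  fixes Y e :: "'a::cvec \<Rightarrow> complex"
  assumes "\<forall>\<^sub>F q in nhds 0. norm (Y q - e q) \<le> norm (e q) * c"
  shows "\<forall>\<^sub>F q in nhds 0. norm (cc Y q - cc e q) \<le> norm (cc e q) * c"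
proof -
  have "\<forall>\<^sub>F q in nhds (cj 0). norm (Y q - e q) \<le> norm (e q) * c" using assms by simp
  from eventually_nhds_cj[OF this] show ?thesis
    by eventually_elim (simp add: cc_def flip: complex_cnj_diff)
qed

text \<open>At a zero of \<open>e\<close> the product rule for \<open>e * L (e')\<close> loses the
  term with the derivative of \<open>L (e')\<close>, and \<open>e' * L (e')\<close> is the
  logarithm. Adding the conjugate gives the logarithm of the multiplier of the second iterate and
  makes \<open>X\<close> real.\<close>

lemma log_multiplier_field:
  fixes e :: "complex \<times> 'p::cvec \<Rightarrow> complex" and b :: real
  assumes he: "hol e (0, 0)" and k: "k \<ge> 1"
    and comp: "\<forall>\<^sub>F q in nhds (0, 0). norm (cc e q - e q) \<le> norm (e q) / 4"
    and eE: "(\<lambda>x. e (x, 0) - (x ^ (k + 1) / 2 + of_real ((real k + 1) / 8 - b / 2) * x ^ (2 * k + 1))) \<in> bz (2 * k + 2)"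
  obtains X where "hol X (0, 0)" "cc X = X"
    "\<forall>\<^sub>F q in nhds (0, 0). norm (e q) \<le> norm (X q)"
    "\<forall>\<^sub>F q in nhds (0, 0). e q = 0 \<longrightarrow>
        ddir X q (1, 0) = Ln (1 + ddir e q (1, 0)) + cnj (Ln (1 + ddir e (cj q) (1, 0)))"
    "(\<lambda>x. X (x, 0) - (x ^ (k + 1) - of_real b * x ^ (2 * k + 1))) \<in> bz (2 * k + 2)"
    "\<forall>v. (\<lambda>x. ddir X (x, 0) (0, v) - (ddir e (x, 0) (0, v) + ddir (cc e) (x, 0) (0, v))) \<in> bz k"
proof -
  obtain L where L: "hol L 0" "L 0 = 1" "\<forall>\<^sub>F u in nhds 0. Ln (1 + u) = u * L u" "(\<lambda>u. L u - 1 + u / 2) \<in> bz 2"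
    by (rule Ln_factor)
  define de where "de q = ddir e q (1, 0)" for q
  have hde: "hol de (0, 0)" unfolding de_def by (rule hol_ddir[OF he])
  define \<epsilon> where "\<epsilon> x = e (x, 0)" for x
  have h\<epsilon>: "hol \<epsilon> 0" unfolding \<epsilon>_def by (rule hol_slice1[OF he])
  define c where "c = complex_of_real ((real k + 1) / 8 - b / 2)"
  have \<epsilon>1: "(\<lambda>x. \<epsilon> x - x ^ (k + 1) / 2) \<in> bz (2 * k + 1)"
  proof -
    have "(\<lambda>x. \<epsilon> x - (x ^ (k + 1) / 2 + c * x ^ (2 * k + 1)) + c * x ^ (2 * k + 1)) \<in> bz (2 * k + 1)"
      by (intro bz_add bz_cmult power_in_bz bz_mono[OF eE[folded \<epsilon>_def c_def]]) simp
    thus ?thesis by simp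
  qed
  have \<epsilon>bz: "\<epsilon> \<in> bz (k + 1)"
  proof -
    have "(\<lambda>x. \<epsilon> x - x ^ (k + 1) / 2 + (1/2) * x ^ (k + 1)) \<in> bz (k + 1)"
      by (intro bz_add bz_cmult power_in_bz bz_mono[OF \<epsilon>1]) simp
    thus ?thesis by simp
  qed
  have d\<epsilon>: "deriv \<epsilon> \<in> bz k" by (rule bz_deriv[OF h\<epsilon>]) (use \<epsilon>bz in simp)
  have hd\<epsilon>: "hol (deriv \<epsilon>) 0" by (rule hol_deriv[OF h\<epsilon>])
  have d\<epsilon>0: "deriv \<epsilon> 0 = 0" using d\<epsilon> bz_at_0[of "deriv \<epsilon>" "k - 1"] k by simp
  have de_eq: "\<forall>\<^sub>F x in nhds 0. de (x, 0) = deriv \<epsilon> x"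
    unfolding de_def \<epsilon>_def[abs_def] by (rule hol_ddir_slice[OF he])
  hence de0: "de (0, 0) = 0" using d\<epsilon>0 eventually_nhds_x_imp_x by fastforce
  have d\<epsilon>1: "(\<lambda>x. deriv \<epsilon> x - of_nat (k + 1) / 2 * x ^ k) \<in> bz (2 * k)"
  proof -
    have h: "hol (\<lambda>x. \<epsilon> x - x ^ (k + 1) / 2) 0" by (intro hol_intros h\<epsilon>) auto
    have "deriv (\<lambda>x. \<epsilon> x - x ^ (k + 1) / 2) \<in> bz (2 * k)" by (rule bz_deriv[OF h]) (use \<epsilon>1 in simp)
    thus ?thesis
    proof (rule bz_cong)
      have "\<forall>\<^sub>F x in nhds 0. cdiff \<epsilon> x" using h\<epsilon> by (simp add: hol_def)
      thus "\<forall>\<^sub>F x in nhds 0. deriv (\<lambda>x. \<epsilon> x - x ^ (k + 1) / 2) x = deriv \<epsilon> x - of_nat (k + 1) / 2 * x ^ k"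
      proof eventually_elim
        case (elim x)
        hence "(\<epsilon> has_field_derivative deriv \<epsilon> x) (at x)"
          by (simp add: DERIV_deriv_iff_field_differentiable cdiff_complex_iff)
        hence "((\<lambda>x. \<epsilon> x - x ^ (k + 1) / 2) has_field_derivative (deriv \<epsilon> x - of_nat (k + 1) * x ^ k / 2)) (at x)"
          using DERIV_diff[OF _ DERIV_cdivide[OF DERIV_power[OF DERIV_ident, where n = "k + 1"], of 2]] by simp
        thus ?case by (simp add: DERIV_imp_deriv)
      qed
    qed
  qed
  define Y where "Y q = e q * L (de q)" for q
  have hLde: "hol (\<lambda>q. L (de q)) (0, 0)" by (rule hol_compose) (use L hde de0 in auto)
  have hY: "hol Y (0, 0)" unfolding Y_def by (intro hol_intros he hLde)
  have hcY: "hol (cc Y) (0, 0)" by (rule hol_cc) (use hY in simp)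
  define X where "X q = Y q + cc Y q" for q
  show ?thesis
  proof (rule that[of X])
    show "hol X (0, 0)" unfolding X_def by (intro hol_intros hY hcY)
    show "cc X = X" by (rule ext) (simp add: cc_def X_def add.commute)
    have Ye: "\<forall>\<^sub>F q in nhds (0, 0). norm (Y q - e q) \<le> norm (e q) * (1 / 8)"
    proof -
      have "((\<lambda>q. L (de q) - 1) \<longlongrightarrow> 0) (nhds (0, 0))"
        by (rule isCont_tendsto_nhds[OF hol_isCont[OF hol_diff[OF hLde hol_const]]]) (simp add: de0 L(2))
      from tendstoD[OF this, of "1 / 8"]
      have "\<forall>\<^sub>F q in nhds (0, 0). norm (L (de q) - 1) < 1 / 8" by simp
      thus ?thesis
      proof eventually_elim
        case (elim q)
        have "Y q - e q = e q * (L (de q) - 1)" by (simp add: Y_def algebra_simps)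
        thus ?case using mult_left_mono[of "norm (L (de q) - 1)" "1 / 8" "norm (e q)"] elim by (simp only: norm_mult) simp
      qed
    qed
    have cYe: "\<forall>\<^sub>F q in nhds (0, 0). norm (cc Y q - cc e q) \<le> norm (cc e q) * (1 / 8)"
      using cc_compare[of Y e "1/8"] Ye by (simp add: zero_prod_def)
    \<comment> \<open>Each of the two summands of \<open>X\<close> is close to \<open>e\<close>: the
      losses 1/8, 5/32 and 1/4 leave more than \<open>norm (e q)\<close> out of
      \<open>2 * norm (e q)\<close>.\<close>
    show "\<forall>\<^sub>F q in nhds (0, 0). norm (e q) \<le> norm (X q)"
      using Ye cYe comp
    proof eventually_elim
      case (elim q)
      have 1: "norm (cc e q) \<le> norm (e q) + norm (e q) / 4"
        using norm_triangle_ineq[of "cc e q - e q" "e q"] elim(3) by simp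
      have "norm (2 * e q) \<le> norm (X q) + norm (Y q - e q) + norm (cc Y q - cc e q) + norm (cc e q - e q)"
      proof -
        have "2 * e q = X q - (Y q - e q) - (cc Y q - cc e q) - (cc e q - e q)" by (simp add: X_def)
        thus ?thesis by (smt (verit) norm_triangle_ineq4)
      qed
      hence "2 * norm (e q) \<le> norm (X q) + norm (Y q - e q) + norm (cc Y q - cc e q) + norm (cc e q - e q)"
        by (simp add: norm_mult)
      thus ?case using 1 elim norm_ge_zero[of "e q"] by linarith
    qed
    show "\<forall>\<^sub>F q in nhds (0, 0). e q = 0 \<longrightarrow>
        ddir X q (1, 0) = Ln (1 + ddir e q (1, 0)) + cnj (Ln (1 + ddir e (cj q) (1, 0)))"
    proof -
      have A: "\<forall>\<^sub>F q in nhds (0, 0). e q = 0 \<longrightarrow> cdiff Y q \<and> ddir Y q (1, 0) = Ln (1 + de q)"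
      proof -
        have 1: "\<forall>\<^sub>F q in nhds (0, 0). cdiff e q" "\<forall>\<^sub>F q in nhds (0, 0). cdiff Y q"
          "\<forall>\<^sub>F q in nhds (0, 0). cdiff (\<lambda>q. L (de q)) q"
          using he hY hLde by (auto simp: hol_def)
        have "\<forall>\<^sub>F q in nhds (0, 0). Ln (1 + de q) = de q * L (de q)"
          by (rule isCont_nhds_0[OF hol_isCont[OF hde] de0 L(3)])
        with 1 show ?thesis
        proof eventually_elim
          case (elim q)
          show ?case using elim ddir_mult_fun[OF elim(1) elim(3), of "(1, 0)"]
            by (auto simp: Y_def[abs_def] de_def)
        qed
      qed
      have "\<forall>\<^sub>F q in nhds (cj (0, 0)). e q = 0 \<longrightarrow> cdiff Y q \<and> ddir Y q (1, 0) = Ln (1 + de q)"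
        using A by simp
      from eventually_nhds_cj[OF this]
      have B: "\<forall>\<^sub>F q in nhds (0, 0). e (cj q) = 0 \<longrightarrow> cdiff Y (cj q) \<and> ddir Y (cj q) (1, 0) = Ln (1 + de (cj q))" .
      have C: "\<forall>\<^sub>F q in nhds (0, 0). cdiff (cc Y) q" using hcY by (simp add: hol_def)
      show ?thesis using A B C comp
      proof eventually_elim
        case (elim q)
        show ?case
        proof
          assume e0: "e q = 0"
          hence ce0: "e (cj q) = 0" using elim(4) by (simp add: cc_def)
          have "ddir X q (1, 0) = ddir Y q (1, 0) + ddir (cc Y) q (1, 0)"
            unfolding X_def[abs_def] using elim e0 by (intro ddir_add_fun) auto
          also have "ddir (cc Y) q (1, 0) = cnj (Ln (1 + de (cj q)))"
            using ddir_cc[of Y q "(1, 0)"] elim ce0 by simp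
          finally show "ddir X q (1, 0) = Ln (1 + ddir e q (1, 0)) + cnj (Ln (1 + ddir e (cj q) (1, 0)))"
            using elim e0 by (simp add: de_def)
        qed
      qed
    qed
    \<comment> \<open>Here \<open>(k + 1) / 8\<close> cancels: the term \<open>- e * e' / 2\<close>
      of \<open>e * L (e')\<close> contributes \<open>- (k + 1) / 8\<close> to the coefficient of
      \<open>x ^ (2 * k + 1)\<close>, which leaves \<open>- b / 2\<close> for each of the two
      summands.\<close>
    show "(\<lambda>x. X (x, 0) - (x ^ (k + 1) - of_real b * x ^ (2 * k + 1))) \<in> bz (2 * k + 2)"
    proof -
      define y where "y x = x ^ (k + 1) / 2 - of_real b / 2 * x ^ (2 * k + 1)" for x :: complex
      have 1: "(\<lambda>x. \<epsilon> x * (L (deriv \<epsilon> x) - 1 + deriv \<epsilon> x / 2)) \<in> bz (2 * k + 2)"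
      proof -
        have Lb: "(\<lambda>x. L (deriv \<epsilon> x) - 1 + deriv \<epsilon> x / 2) \<in> bz (2 * k)"
        proof -
          obtain C where "\<forall>\<^sub>F u in nhds 0. norm (L u - 1 + u / 2) \<le> C * norm (u\<^sup>2)" using L(4) by (elim landau_o.bigE)
          from isCont_nhds_0[OF hol_isCont[OF hd\<epsilon>] d\<epsilon>0 this]
          have "(\<lambda>x. L (deriv \<epsilon> x) - 1 + deriv \<epsilon> x / 2) \<in> O[nhds 0](\<lambda>x. (deriv \<epsilon> x)\<^sup>2)" by (rule bigoI)
          moreover have "(\<lambda>x. (deriv \<epsilon> x)\<^sup>2) \<in> bz (k * 2)" by (rule bz_power[OF d\<epsilon>])
          ultimately show ?thesis using landau_o.big.trans by (fastforce simp: mult.commute)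
        qed
        show ?thesis by (rule bz_mono[OF bz_mult[OF \<epsilon>bz Lb]]) (use k in simp)
      qed
      have 2: "(\<lambda>x. \<epsilon> x * (deriv \<epsilon> x - of_nat (k + 1) / 2 * x ^ k)) \<in> bz (2 * k + 2)"
        using bz_mono[OF bz_mult[OF \<epsilon>bz d\<epsilon>1], of "2*k+2"] k by simp
      have 3: "(\<lambda>x. x ^ k * (\<epsilon> x - x ^ (k + 1) / 2)) \<in> bz (2 * k + 2)"
        using bz_mono[OF bz_mult[OF power_in_bz[of k] \<epsilon>1], of "2*k+2"] k by simp
      have "(\<lambda>x. \<epsilon> x * (L (deriv \<epsilon> x) - 1 + deriv \<epsilon> x / 2)
          + (-1/2) * (\<epsilon> x * (deriv \<epsilon> x - of_nat (k + 1) / 2 * x ^ k))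
          + (- of_nat (k + 1) / 4) * (x ^ k * (\<epsilon> x - x ^ (k + 1) / 2))
          + (\<epsilon> x - (x ^ (k + 1) / 2 + c * x ^ (2 * k + 1)))) \<in> bz (2 * k + 2)"
        by (intro bz_add bz_cmult 1 2 3 eE[folded \<epsilon>_def c_def])
      hence 4: "(\<lambda>x. Y (x, 0) - y x) \<in> bz (2 * k + 2)"
      proof (rule bz_cong)
        show "\<forall>\<^sub>F x in nhds 0. \<epsilon> x * (L (deriv \<epsilon> x) - 1 + deriv \<epsilon> x / 2)
          + (-1/2) * (\<epsilon> x * (deriv \<epsilon> x - of_nat (k + 1) / 2 * x ^ k))
          + (- of_nat (k + 1) / 4) * (x ^ k * (\<epsilon> x - x ^ (k + 1) / 2))
          + (\<epsilon> x - (x ^ (k + 1) / 2 + c * x ^ (2 * k + 1))) = Y (x, 0) - y x"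
          using de_eq
        proof eventually_elim
          case (elim x)
          have p: "x ^ (2 * k + 1) = x ^ k * x ^ (k + 1)" by (simp flip: power_add add: mult_2)
          have c: "c = (of_nat k + 1) / 8 - of_real b / 2" by (simp add: c_def)
          show ?case unfolding Y_def y_def \<epsilon>_def[symmetric] elim p c
            by (simp add: field_simps)
        qed
      qed
      have 5: "(\<lambda>x. cc Y (x, 0) - y x) \<in> bz (2 * k + 2)"
        using bz_cnj[OF 4] by (simp add: cc_def y_def)
      show ?thesis using bz_add[OF 4 5] by (simp add: X_def y_def algebra_simps)
    qed
    show "\<forall>v. (\<lambda>x. ddir X (x, 0) (0, v) - (ddir e (x, 0) (0, v) + ddir (cc e) (x, 0) (0, v))) \<in> bz k"
    proof
      fix v :: 'p
      \<comment> \<open>To first order in the parameters \<open>Y\<close> differs from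
        \<open>e\<close> only through terms containing \<open>\<epsilon>\<close> or
        \<open>L (deriv \<epsilon>) - 1\<close>, and both have order at least
        \<open>k\<close>.\<close>
      have Yb: "(\<lambda>x. ddir Y (x, 0) (0, v) - ddir e (x, 0) (0, v)) \<in> bz k" for v
      proof -
        have 1: "(\<lambda>x. \<epsilon> x * ddir (\<lambda>q. L (de q)) (x, 0) (0, v)) \<in> bz (k + 1 + 0)"
          by (intro bz_mult \<epsilon>bz bz_hol hol_slice1 hol_ddir hLde)
        have "(\<lambda>x. L (deriv \<epsilon> x) - 1) \<in> bz k"
        proof -
          have "(\<lambda>u. L u - 1) \<in> bz 1" by (rule bz_hol1) (auto intro!: hol_intros L simp: L)
          then obtain C where "\<forall>\<^sub>F u in nhds 0. norm (L u - 1) \<le> C * norm (u ^ 1)" by (elim landau_o.bigE)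
          from isCont_nhds_0[OF hol_isCont[OF hd\<epsilon>] d\<epsilon>0 this]
          have "(\<lambda>x. L (deriv \<epsilon> x) - 1) \<in> O[nhds 0](\<lambda>x. (deriv \<epsilon> x) ^ 1)" by (rule bigoI)
          with d\<epsilon> show ?thesis using landau_o.big.trans by fastforce
        qed
        hence 2: "(\<lambda>x. ddir e (x, 0) (0, v) * (L (deriv \<epsilon> x) - 1)) \<in> bz (0 + k)"
          by (intro bz_mult bz_hol hol_slice1 hol_ddir he)
        have "(\<lambda>x. \<epsilon> x * ddir (\<lambda>q. L (de q)) (x, 0) (0, v) + ddir e (x, 0) (0, v) * (L (deriv \<epsilon> x) - 1)) \<in> bz k"
          by (intro bz_add bz_mono[OF 1] bz_mono[OF 2]) auto
        thus ?thesis
        proof (rule bz_cong)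
          have evs: "\<forall>\<^sub>F q in nhds (0, 0). cdiff e q \<and> cdiff (\<lambda>q. L (de q)) q"
            using he hLde by (simp add: hol_def eventually_conj_iff)
          show "\<forall>\<^sub>F x in nhds 0. \<epsilon> x * ddir (\<lambda>q. L (de q)) (x, 0) (0, v) + ddir e (x, 0) (0, v) * (L (deriv \<epsilon> x) - 1)
            = ddir Y (x, 0) (0, v) - ddir e (x, 0) (0, v)"
            using de_eq eventually_slice[OF evs]
          proof eventually_elim
            case (elim x)
            have "ddir Y (x, 0) (0, v) = e (x, 0) * ddir (\<lambda>q. L (de q)) (x, 0) (0, v) + ddir e (x, 0) (0, v) * L (de (x, 0))"
              unfolding Y_def[abs_def] using elim(2) by (intro ddir_mult_fun) auto
            thus ?case by (simp add: elim(1) \<epsilon>_def algebra_simps)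
          qed
        qed
      qed
      have ev: "\<forall>\<^sub>F q in nhds (0, 0). cdiff Y q \<and> cdiff (cc Y) q \<and> cdiff Y (cj q) \<and> cdiff e (cj q)"
      proof -
        have "\<forall>\<^sub>F q in nhds (cj (0, 0)). cdiff Y q \<and> cdiff e q"
          using hY he by (simp add: hol_def eventually_conj_iff)
        from eventually_nhds_cj[OF this] show ?thesis
          using hY hcY by (simp add: hol_def eventually_conj_iff)
      qed
      show "(\<lambda>x. ddir X (x, 0) (0, v) - (ddir e (x, 0) (0, v) + ddir (cc e) (x, 0) (0, v))) \<in> bz k"
      proof (rule bz_cong[OF bz_add[OF Yb[of v] bz_cnj[OF Yb[of "cj v"]]]])
        show "\<forall>\<^sub>F x in nhds 0. ddir Y (x, 0) (0, v) - ddir e (x, 0) (0, v) +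
           cnj (ddir Y (cnj x, 0) (0, cj v) - ddir e (cnj x, 0) (0, cj v)) =
           ddir X (x, 0) (0, v) - (ddir e (x, 0) (0, v) + ddir (cc e) (x, 0) (0, v))"
          using eventually_slice[OF ev]
        proof eventually_elim
          case (elim x)
          have "ddir X (x, 0) (0, v) = ddir Y (x, 0) (0, v) + ddir (cc Y) (x, 0) (0, v)"
            unfolding X_def[abs_def] using elim by (intro ddir_add_fun) auto
          thus ?case using elim ddir_cc[of Y "(x, 0)" "(0, v)"] ddir_cc[of e "(x, 0)" "(0, v)"] by simp
        qed
      qed
    qed
  qed
qed

section \<open>The polynomial normal form\<close>

definition low_poly :: "('k::finite \<Rightarrow> nat) \<Rightarrow> complex^'k \<Rightarrow> complex poly" where
  "low_poly \<iota> \<epsilon> = (\<Sum>i\<in>UNIV. monom (\<epsilon> $ i) (\<iota> i))"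

definition cpoly :: "('k::finite \<Rightarrow> nat) \<Rightarrow> complex^'k \<Rightarrow> complex poly" where
  "cpoly \<iota> \<epsilon> = monom 1 (CARD('k) + 1) + low_poly \<iota> \<epsilon>"

text \<open>All polynomials of degree at most \<open>k\<close>: the vector part is moved up by one
  degree to make room for the constant term, so that \<open>k + 1\<close> coefficients are indexed
  with the type \<open>'k\<close> alone.\<close>

definition shift_poly :: "('k::finite \<Rightarrow> nat) \<Rightarrow> complex \<times> (complex^'k) \<Rightarrow> complex poly" where
  "shift_poly \<iota> t = pCons (fst t) (low_poly \<iota> (snd t))"

lemma P_poly_eq: "P_poly \<iota> \<epsilon> = cpoly \<iota> (cvec \<epsilon>)"
  by (simp add: P_poly_def cpoly_def low_poly_def)

lemma bij_betw_card: "bij_betw \<iota> (UNIV :: 'k::finite set) {..<k} \<Longrightarrow> CARD('k) = k"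
  using bij_betw_same_card by fastforce

lemma coeff_low_poly:
  assumes "bij_betw \<iota> (UNIV :: 'k::finite set) {..<k}"
  shows "coeff (low_poly \<iota> \<epsilon>) (\<iota> i) = (\<epsilon> :: complex^'k) $ i"
proof -
  have "coeff (low_poly \<iota> \<epsilon>) (\<iota> i) = (\<Sum>j\<in>UNIV. if j = i then \<epsilon> $ j else 0)"
    unfolding low_poly_def coeff_sum
    by (intro sum.cong) (use assms in \<open>auto simp: bij_betw_def inj_eq\<close>)
  thus ?thesis by simp
qed

lemma coeff_low_poly_ge:
  assumes "bij_betw \<iota> (UNIV :: 'k::finite set) {..<k}" "n \<ge> k"
  shows "coeff (low_poly \<iota> (\<epsilon> :: complex^'k)) n = 0"
proof -
  have "\<iota> i < k" for i using assms(1) by (auto simp: bij_betw_def)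
  hence "\<iota> i \<noteq> n" for i using assms(2) by (metis not_le)
  thus ?thesis by (simp add: low_poly_def coeff_sum)
qed

lemma low_poly_eq_0:
  assumes "bij_betw \<iota> (UNIV :: 'k::finite set) {..<k}" "\<And>j. j < k \<Longrightarrow> coeff (low_poly \<iota> (\<epsilon> :: complex^'k)) j = 0"
  shows "\<epsilon> = 0"
proof -
  have "\<iota> i < k" for i using assms(1) by (auto simp: bij_betw_def)
  thus ?thesis using assms coeff_low_poly[OF assms(1), of \<epsilon>] by (simp add: vec_eq_iff)
qed

lemma smult_sum_right: "smult c (\<Sum>i\<in>A. p i) = (\<Sum>i\<in>A. smult c (p i))"
  by (induction A rule: infinite_finite_induct) (auto simp: smult_add_right)

lemma pderiv_sum_poly: "pderiv (\<Sum>i\<in>A. p i) = (\<Sum>i\<in>A. pderiv (p i))"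
  by (induction A rule: infinite_finite_induct) (auto simp: pderiv_add)

lemma low_poly_0 [simp]: "low_poly \<iota> 0 = 0" by (simp add: low_poly_def)
lemma low_poly_add: "low_poly \<iota> (x + y) = low_poly \<iota> x + low_poly \<iota> y"
  by (simp add: low_poly_def sum.distrib flip: add_monom)
lemma low_poly_cs: "low_poly \<iota> (cs c x) = smult c (low_poly \<iota> x)"
  by (simp add: low_poly_def smult_sum_right smult_monom)
lemma shift_poly_0 [simp]: "shift_poly \<iota> 0 = 0" by (simp add: shift_poly_def)
lemma shift_poly_cs: "shift_poly \<iota> (cs c x) = smult c (shift_poly \<iota> x)"
  by (simp add: shift_poly_def low_poly_cs)

lemma cnj_poly_low_poly: "cnj (poly (low_poly \<iota> \<epsilon>) z) = poly (low_poly \<iota> (cj \<epsilon>)) (cnj z)"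
  by (simp add: low_poly_def poly_sum poly_monom)

lemma cnj_poly_cpoly: "cnj (poly (cpoly \<iota> \<epsilon>) z) = poly (cpoly \<iota> (cj \<epsilon>)) (cnj z)"
  by (simp add: cpoly_def poly_monom cnj_poly_low_poly)

lemma cnj_poly_shift_poly: "cnj (poly (shift_poly \<iota> t) z) = poly (shift_poly \<iota> (cj t)) (cnj z)"
  by (simp add: shift_poly_def cnj_poly_low_poly)

lemma cnj_poly_pderiv_shift_poly:
  "cnj (poly (pderiv (shift_poly \<iota> t)) z) = poly (pderiv (shift_poly \<iota> (cj t))) (cnj z)"
  by (simp add: shift_poly_def low_poly_def pderiv_pCons pderiv_sum_poly pderiv_monom poly_sum poly_monom)

lemma hol_low_poly [hol_intros]:
  "hol E x \<Longrightarrow> hol Z x \<Longrightarrow> hol (\<lambda>x. poly (low_poly \<iota> (E x)) (Z x)) x"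
  unfolding low_poly_def poly_sum poly_monom by (intro hol_intros)

lemma hol_cpoly [hol_intros]:
  "hol E x \<Longrightarrow> hol Z x \<Longrightarrow> hol (\<lambda>x. poly (cpoly \<iota> (E x)) (Z x)) x"
  unfolding cpoly_def poly_add poly_monom by (intro hol_intros)

lemma hol_shift_poly [hol_intros]:
  "hol E x \<Longrightarrow> hol Z x \<Longrightarrow> hol (\<lambda>x. poly (shift_poly \<iota> (E x)) (Z x)) x"
  unfolding shift_poly_def poly_pCons by (intro hol_intros)

lemma hol_pderiv_shift_poly [hol_intros]:
  assumes "hol E x" "hol Z x"
  shows "hol (\<lambda>x. poly (pderiv (shift_poly \<iota> (E x))) (Z x)) x"
proof -
  have "hol (\<lambda>x. poly (low_poly \<iota> (snd (E x))) (Z x) + Z x * (\<Sum>i\<in>UNIV. of_nat (\<iota> i) * snd (E x) $ i * Z x ^ (\<iota> i - 1))) x"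
    by (intro hol_intros assms)
  thus ?thesis by (simp add: shift_poly_def low_poly_def pderiv_pCons pderiv_sum_poly pderiv_monom poly_sum poly_monom mult_ac)
qed

lemma degree_low_poly:
  assumes "bij_betw \<iota> (UNIV :: 'k::finite set) {..<k}"
  shows "degree (low_poly \<iota> (\<epsilon> :: complex^'k)) \<le> k"
  by (rule degree_le) (use coeff_low_poly_ge[OF assms] in auto)

lemma degree_cpoly:
  assumes "bij_betw \<iota> (UNIV :: 'k::finite set) {..<k}"
  shows "degree (cpoly \<iota> (\<epsilon> :: complex^'k)) = k + 1" "lead_coeff (cpoly \<iota> \<epsilon>) = 1"
proof -
  have "degree (low_poly \<iota> \<epsilon>) < degree (monom (1::complex) (CARD('k) + 1))"
    using degree_low_poly[OF assms, of \<epsilon>] by (simp add: degree_monom_eq bij_betw_card[OF assms])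
  from degree_add_eq_left[OF this]
  show d: "degree (cpoly \<iota> \<epsilon>) = k + 1" by (simp add: cpoly_def degree_monom_eq bij_betw_card[OF assms])
  show "lead_coeff (cpoly \<iota> \<epsilon>) = 1"
    unfolding d unfolding cpoly_def by (simp add: bij_betw_card[OF assms] coeff_low_poly_ge[OF assms])
qed

lemma cpoly_neq_0: "bij_betw \<iota> (UNIV :: 'k::finite set) {..<k} \<Longrightarrow> cpoly \<iota> (\<epsilon> :: complex^'k) \<noteq> 0"
  using degree_cpoly(2)[of \<iota> k \<epsilon>] by auto

text \<open>For \<open>norm a \<ge> R\<close> the leading term dominates as soon as
  \<open>h \<epsilon>\<close>, the sum of the relative sizes of the lower terms on the circle of
  radius \<open>R\<close>, is below 1.\<close>

lemma cpoly_roots_small: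
  assumes "bij_betw \<iota> (UNIV :: 'k::finite set) {..<k}" "R > 0"
  shows "\<forall>\<^sub>F \<epsilon> in nhds (0 :: complex^'k). \<forall>a. poly (cpoly \<iota> \<epsilon>) a = 0 \<longrightarrow> norm a < R"
proof -
  define h where "h \<epsilon> = (\<Sum>i\<in>UNIV. norm (\<epsilon> $ i) * (1 / R) ^ (k + 1 - \<iota> i))" for \<epsilon> :: "complex^'k"
  have "isCont h 0" unfolding h_def by (intro continuous_intros)
  hence "(h \<longlongrightarrow> h 0) (nhds 0)" using tendsto_at_iff_tendsto_nhds[of h 0] by (simp add: isCont_def)
  from order_tendstoD(2)[OF this, of 1] have "\<forall>\<^sub>F \<epsilon> in nhds 0. h \<epsilon> < 1" by (simp add: h_def)
  thus ?thesis
  proof eventually_elim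
    case (elim \<epsilon>)
    show ?case
    proof (intro allI impI, rule ccontr)
      fix a assume a: "poly (cpoly \<iota> \<epsilon>) a = 0" "\<not> norm a < R"
      have a0: "norm a > 0" using a(2) assms(2) by linarith
      have \<iota>: "\<iota> i < k" for i using assms(1) by (auto simp: bij_betw_def)
      have "a ^ (k + 1) = - (\<Sum>i\<in>UNIV. \<epsilon> $ i * a ^ \<iota> i)"
        using a(1) by (simp add: cpoly_def low_poly_def poly_sum poly_monom bij_betw_card[OF assms(1)] add_eq_0_iff2)
      hence "norm a ^ (k + 1) = norm (\<Sum>i\<in>UNIV. \<epsilon> $ i * a ^ \<iota> i)" by (metis norm_minus_cancel norm_power)
      also have "\<dots> \<le> (\<Sum>i\<in>UNIV. norm (\<epsilon> $ i * a ^ \<iota> i))" by (rule norm_sum)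
      also have "\<dots> \<le> (\<Sum>i\<in>UNIV. norm a ^ (k + 1) * (norm (\<epsilon> $ i) * (1 / R) ^ (k + 1 - \<iota> i)))"
      proof (rule sum_mono)
        fix i
        have "norm a ^ \<iota> i = norm a ^ (k + 1) * (1 / norm a) ^ (k + 1 - \<iota> i)"
          using \<iota>[of i] a0 by (simp add: power_diff power_one_over field_simps)
        moreover have "(1 / norm a) ^ (k + 1 - \<iota> i) \<le> (1 / R) ^ (k + 1 - \<iota> i)"
          using a(2) assms(2) by (intro power_mono divide_left_mono mult_pos_pos a0) auto
        ultimately have "norm a ^ \<iota> i \<le> norm a ^ (k + 1) * (1 / R) ^ (k + 1 - \<iota> i)"
          by (simp add: mult_left_mono)
        from mult_left_mono[OF this norm_ge_zero[of "\<epsilon> $ i"]]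
        show "norm (\<epsilon> $ i * a ^ \<iota> i) \<le> norm a ^ (k + 1) * (norm (\<epsilon> $ i) * (1 / R) ^ (k + 1 - \<iota> i))"
          by (simp add: norm_mult norm_power mult_ac)
      qed
      also have "\<dots> = norm a ^ (k + 1) * h \<epsilon>" by (simp add: h_def sum_distrib_left)
      finally have "norm a ^ (k + 1) * 1 \<le> norm a ^ (k + 1) * h \<epsilon>" by simp
      hence "1 \<le> h \<epsilon>" using a0 by (subst (asm) mult_le_cancel_left_pos) auto
      thus False using elim by simp
    qed
  qed
qed

text \<open>The linearised system is triangular in the order of vanishing. Below order
  \<open>k\<close> only \<open>\<pi>\<close> is visible; then the coefficient of
  \<open>z ^ (k + j)\<close> determines the \<open>j\<close>-th coefficient of the shift;
  \<open>\<beta>\<close> remains at order \<open>2 * k + 1\<close>. The second claim serves the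
  invertibility of the parameter change: without a variation of \<open>\<epsilon>\<close>, every
  term besides \<open>dX\<close> has order at least \<open>k\<close>.\<close>

lemma linearized_core:
  fixes b :: complex and X0 V0 dX num :: "complex \<Rightarrow> complex" and t :: "complex \<times> (complex^'k::finite)" and \<pi> :: "complex^'k"
  assumes \<iota>: "bij_betw \<iota> (UNIV :: 'k set) {..<k}" and k: "k \<ge> 1"
    and hX: "hol X0 0" and X0: "(\<lambda>x. X0 x - (x ^ (k + 1) - b * x ^ (2 * k + 1))) \<in> bz (2 * k + 2)"
    and hV: "hol V0 0"
    and num: "(\<lambda>z. \<beta> * z ^ k * X0 z + (1 + b * z ^ k) * (deriv X0 z * poly (shift_poly \<iota> t) z + dX z)
        - poly (pderiv (shift_poly \<iota> t)) z * z ^ (k + 1) - poly (low_poly \<iota> \<pi>) z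
        - 2 * V0 z * z ^ (k + 1) * poly (low_poly \<iota> \<pi>) z) \<in> bz (2 * k + 2)" (is "?num \<in> _")
  shows "(\<And>z. dX z = 0) \<Longrightarrow> \<pi> = 0 \<and> t = 0 \<and> \<beta> = 0"
    and "\<pi> = 0 \<Longrightarrow> hol dX 0 \<Longrightarrow> dX \<in> bz k"
proof -
  define \<tau> where "\<tau> = shift_poly \<iota> t"
  define p where "p = low_poly \<iota> \<pi>"
  have hp: "hol (poly q) 0" for q :: "complex poly"
    by (rule hol_complex[of UNIV]) (auto intro: holomorphic_intros)
  have X0b: "X0 \<in> bz (k + 1)"
  proof -
    have "(\<lambda>x. X0 x - (x ^ (k + 1) - b * x ^ (2 * k + 1)) + (x ^ (k + 1) - b * x ^ (2 * k + 1))) \<in> bz (k + 1)"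
      by (intro bz_add bz_diff bz_cmult power_in_bz_le bz_mono[OF X0]) auto
    thus ?thesis by simp
  qed
  have X0': "deriv X0 \<in> bz k" by (rule bz_deriv[OF hX]) (use X0b in simp)
  have X0'1: "(\<lambda>x. deriv X0 x - of_nat (k + 1) * x ^ k) \<in> bz (2 * k)"
  proof -
    have h: "hol (\<lambda>x. X0 x - x ^ (k + 1)) 0" by (intro hol_intros hX)
    have "(\<lambda>x. X0 x - (x ^ (k + 1) - b * x ^ (2 * k + 1)) + (- b) * x ^ (2 * k + 1)) \<in> bz (2 * k + 1)"
      by (intro bz_add bz_cmult power_in_bz_le bz_mono[OF X0]) auto
    hence "(\<lambda>x. X0 x - x ^ (k + 1)) \<in> bz (Suc (2 * k))" by simp
    from bz_deriv[OF h this] show ?thesis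
    proof (rule bz_cong)
      have "\<forall>\<^sub>F x in nhds 0. cdiff X0 x" using hX by (simp add: hol_def)
      thus "\<forall>\<^sub>F x in nhds 0. deriv (\<lambda>x. X0 x - x ^ (k + 1)) x = deriv X0 x - of_nat (k + 1) * x ^ k"
      proof eventually_elim
        case (elim x)
        hence "(X0 has_field_derivative deriv X0 x) (at x)"
          by (simp add: DERIV_deriv_iff_field_differentiable cdiff_complex_iff)
        from DERIV_diff[OF this DERIV_power[OF DERIV_ident, where n = "k + 1"]]
        show ?case by (intro DERIV_imp_deriv) simp
      qed
    qed
  qed
  have b1: "(\<lambda>z. 1 + b * z ^ k) \<in> bz 0" by (intro bz_hol hol_intros)
  have pb: "poly q \<in> bz 0" for q :: "complex poly" by (rule bz_hol[OF hp])
  have mk: "(\<lambda>z. z ^ (k + 1)) \<in> bz k" by (rule power_in_bz_le) simp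
  have kX: "(\<lambda>z. z ^ k * X0 z) \<in> bz (2 * k + 1)" using bz_mult[OF power_in_bz X0b, of k] by (simp add: mult_2)
  note num' = num[folded \<tau>_def p_def]
  {
    assume dX: "\<And>z. dX z = 0"
    note num'' = num'[unfolded dX add_0_right]
    note n1 = bz_mono[OF bz_cmult[OF kX, of \<beta>], of k]
      and n2 = bz_mono[OF bz_mult[OF b1 bz_mult[OF X0' pb, of \<tau>]], of k]
      and n3 = bz_mono[OF bz_mult[OF pb mk, of "pderiv \<tau>"], of k]
      and n4 = bz_mono[OF bz_cmult[OF bz_mult[OF bz_hol[OF hV] bz_mult[OF mk pb, of p]], of 2], of k]
    have "poly p = (\<lambda>z. (\<beta> * (z ^ k * X0 z) + (1 + b * z ^ k) * (deriv X0 z * poly \<tau> z)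
        - poly (pderiv \<tau>) z * z ^ (k + 1) - 2 * (V0 z * (z ^ (k + 1) * poly p z))) -
        (\<beta> * z ^ k * X0 z + (1 + b * z ^ k) * (deriv X0 z * poly \<tau> z)
        - poly (pderiv \<tau>) z * z ^ (k + 1) - poly p z - 2 * V0 z * z ^ (k + 1) * poly p z))"
      by (simp add: algebra_simps)
    also have "\<dots> \<in> bz k"
      by (rule bz_diff[OF bz_diff[OF bz_diff[OF bz_add[OF n1 n2] n3] n4] bz_mono[OF num'']]) auto
    finally have "poly p \<in> bz k" .
    hence \<pi>0: "\<pi> = 0" unfolding p_def by (intro low_poly_eq_0[OF \<iota>] bz_poly_coeff)
    hence p0: "p = 0" by (simp add: p_def)
    \<comment> \<open>The leading part of \<open>X0' * \<tau> - \<tau>' * z ^ (k + 1)\<close>,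
      divided by \<open>z ^ k\<close>. Its coefficients are \<open>k + 1 - j\<close> times those of
      \<open>\<tau>\<close>, and \<open>j \<le> k\<close> excludes the resonance
      \<open>j = k + 1\<close>.\<close>
    define \<sigma> where "\<sigma> = smult (of_nat (k + 1)) \<tau> - pCons 0 (pderiv \<tau>)"
    have c\<sigma>: "coeff \<sigma> j = (of_nat (k + 1) - of_nat j) * coeff \<tau> j" for j
      by (cases j) (simp_all add: \<sigma>_def coeff_pderiv algebra_simps)
    \<comment> \<open>A bootstrap: some error terms have order \<open>2 * k\<close> plus the order
      of \<open>\<tau>\<close>. Without information on \<open>\<tau>\<close> the coefficients below
      \<open>k\<close> vanish; then \<open>\<tau>\<close> is a multiple of \<open>z ^ k\<close>, and
      one more order is gained.\<close>
    have step: "poly (monom 1 k * \<sigma>) \<in> bz (min (2 * k + 1) (2 * k + m))" if "poly \<tau> \<in> bz m" for m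
    proof -
      have 1: "(\<lambda>z. (1 + b * z ^ k) * ((deriv X0 z - of_nat (k + 1) * z ^ k) * poly \<tau> z)) \<in> bz (min (2 * k + 1) (2 * k + m))"
        by (rule bz_mono[OF bz_mult[OF b1 bz_mult[OF X0'1 that]]]) simp
      have 2: "(\<lambda>z. z ^ (2 * k) * poly \<tau> z) \<in> bz (min (2 * k + 1) (2 * k + m))"
        by (rule bz_mono[OF bz_mult[OF power_in_bz that]]) simp
      have "(\<lambda>z. ?num z + (- \<beta>) * (z ^ k * X0 z) - (1 + b * z ^ k) * ((deriv X0 z - of_nat (k + 1) * z ^ k) * poly \<tau> z)
          + (- b * of_nat (k + 1)) * (z ^ (2 * k) * poly \<tau> z)) \<in> bz (min (2 * k + 1) (2 * k + m))"
        by (intro bz_add bz_diff bz_cmult 1 2 bz_mono[OF kX] bz_mono[OF num]) auto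
      moreover have "?num z + (- \<beta>) * (z ^ k * X0 z) - (1 + b * z ^ k) * ((deriv X0 z - of_nat (k + 1) * z ^ k) * poly \<tau> z)
          + (- b * of_nat (k + 1)) * (z ^ (2 * k) * poly \<tau> z) = poly (monom 1 k * \<sigma>) z" for z
        unfolding \<tau>_def[symmetric] p_def[symmetric] dX p0 \<sigma>_def poly_mult poly_monom mult_2 power_add by (simp add: algebra_simps)
      ultimately show ?thesis by (simp only:)
    qed
    have \<tau>ge: "coeff \<tau> j = 0" if "j > k" for j
      using that coeff_low_poly_ge[OF \<iota>] by (cases j) (auto simp: \<tau>_def shift_poly_def)
    have "coeff (monom 1 k * \<sigma>) (k + j) = 0" if "j < k" for j
      by (rule bz_poly_coeff[OF step[OF pb]]) (use that in simp)
    hence "(of_nat (k + 1) - of_nat j) * coeff \<tau> j = 0" if "j < k" for j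
      using that by (simp add: coeff_monom_mult c\<sigma>)
    moreover have "of_nat (k + 1) - of_nat j \<noteq> (0::complex)" if "j < k" for j
      using that by (simp only: right_minus_eq of_nat_eq_iff)
    ultimately have \<tau>lt: "coeff \<tau> j = 0" if "j < k" for j using that by fastforce
    have "\<tau> = monom (coeff \<tau> k) k"
    proof (rule poly_eqI)
      show "coeff \<tau> n = coeff (monom (coeff \<tau> k) k) n" for n
        using \<tau>lt[of n] \<tau>ge[of n] by (cases n k rule: linorder_cases) auto
    qed
    hence "poly \<tau> = (\<lambda>z. coeff \<tau> k * z ^ k)" by (metis poly_monom)
    hence "poly \<tau> \<in> bz k" using bz_cmult[OF power_in_bz] by simp
    from step[OF this] k have "poly (monom 1 k * \<sigma>) \<in> bz (2 * k + 1)" by simp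
    hence "coeff (monom 1 k * \<sigma>) (k + k) = 0" by (rule bz_poly_coeff) simp
    hence "coeff \<tau> k = 0" by (simp add: coeff_monom_mult c\<sigma>)
    hence \<tau>0: "\<tau> = 0" using \<tau>lt \<tau>ge by (intro poly_eqI) (metis coeff_0 linorder_neqE_nat)
    hence t0: "t = 0"
      using low_poly_eq_0[OF \<iota>, of "snd t"] by (simp add: \<tau>_def shift_poly_def prod_eq_iff)
    have "(\<lambda>z. ?num z - \<beta> * (z ^ k * (X0 z - (z ^ (k + 1) - b * z ^ (2 * k + 1)))) + (\<beta> * b) * z ^ (3 * k + 1)) \<in> bz (2 * k + 2)"
      by (intro bz_add bz_diff bz_cmult num bz_mono[OF bz_mult[OF power_in_bz X0]] power_in_bz_le) (use k in auto)
    moreover have "?num z - \<beta> * (z ^ k * (X0 z - (z ^ (k + 1) - b * z ^ (2 * k + 1)))) + (\<beta> * b) * z ^ (3 * k + 1)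
        = poly (monom \<beta> (2 * k + 1)) z" for z
    proof -
      have 1: "3 * k + 1 = k + k + k + 1" "2 * k + 1 = k + k + 1" by simp_all
      show ?thesis unfolding t0 \<pi>0 dX poly_monom 1 power_add by (simp add: algebra_simps)
    qed
    ultimately have "poly (monom \<beta> (2 * k + 1)) \<in> bz (2 * k + 2)" by simp
    from bz_poly_coeff[OF this, of "2 * k + 1"] have "\<beta> = 0" by simp
    with \<pi>0 t0 show "\<pi> = 0 \<and> t = 0 \<and> \<beta> = 0" by simp
  }
  {
    assume \<pi>: "\<pi> = 0" and h: "hol dX 0"
    have p0: "p = 0" by (simp add: p_def \<pi>)
    note n1 = bz_mono[OF bz_cmult[OF kX, of "- \<beta>"], of k]
      and n2 = bz_mono[OF bz_mult[OF b1 bz_mult[OF X0' pb, of \<tau>]], of k]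
      and n3 = bz_mono[OF bz_mult[OF pb mk, of "pderiv \<tau>"], of k]
    have "(\<lambda>z. ?num z + (- \<beta>) * (z ^ k * X0 z) - (1 + b * z ^ k) * (deriv X0 z * poly \<tau> z) + poly (pderiv \<tau>) z * z ^ (k + 1)) \<in> bz k"
      by (rule bz_add[OF bz_diff[OF bz_add[OF bz_mono[OF num] n1] n2] n3]) auto
    moreover have "?num z + (- \<beta>) * (z ^ k * X0 z) - (1 + b * z ^ k) * (deriv X0 z * poly \<tau> z) + poly (pderiv \<tau>) z * z ^ (k + 1)
        = (1 + b * z ^ k) * dX z" for z
      unfolding \<tau>_def[symmetric] p_def[symmetric] p0 by (simp add: algebra_simps)
    ultimately have 1: "(\<lambda>z. (1 + b * z ^ k) * dX z) \<in> bz k" by simp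
    have "hol (\<lambda>z. 1 / (1 + b * z ^ k)) 0" by (intro hol_intros) (use k in \<open>simp add: power_0_left\<close>)
    from bz_mult[OF bz_hol[OF this] 1] have "(\<lambda>z. 1 / (1 + b * z ^ k) * ((1 + b * z ^ k) * dX z)) \<in> bz k" by simp
    thus "dX \<in> bz k"
    proof (rule bz_cong)
      have "isCont (\<lambda>z. 1 + b * z ^ k) 0" by (intro continuous_intros)
      from isCont_nhds_0[OF this refl, of "\<lambda>w. w \<noteq> 0"] have "\<forall>\<^sub>F z in nhds 0. 1 + b * z ^ k \<noteq> 0"
        using t1_space_nhds[of "1 + b * 0 ^ k" 0] k by (simp add: power_0_left)
      thus "\<forall>\<^sub>F z in nhds 0. 1 / (1 + b * z ^ k) * ((1 + b * z ^ k) * dX z) = dX z" by eventually_elim simp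
    qed
  }
qed

text \<open>Conjugation reverses the circle, which amounts to substituting \<open>1 - t\<close> for
  \<open>t\<close>. Thus the moments of a conjugation-invariant density commute with conjugation of
  the parameters.\<close>

lemma cint_cnj:
  assumes "R \<ge> 0" "continuous_on (sphere 0 R) f"
  shows "cint R (\<lambda>w. cnj (f (cnj w))) = cnj (cint R f)"
proof -
  define h where "h t = f (of_real R * ucirc t) * (of_real R * ucirc t)" for t
  have "(h has_integral cint R f) {0..1}"
    using integrable_integral[OF cint_integrable[OF assms]] by (simp add: cint_def h_def[abs_def])
  hence "((\<lambda>t. h (- t)) has_integral cint R f) {-1..0}"
    using has_integral_reflect_lemma_real[of h "cint R f" 0 1] by simp
  hence "(((\<lambda>t. h (- t)) \<circ> (+) (-1)) has_integral cint R f) {0..1}"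
    by (subst has_integral_shift_Icc_real) simp
  moreover have u: "ucirc (1 - t) = cnj (ucirc t)" for t
  proof -
    have "ucirc (1 - t) = exp (2 * of_real pi * \<i>) / exp (2 * of_real pi * \<i> * of_real t)"
      by (simp only: ucirc_def of_real_diff right_diff_distrib exp_diff of_real_1 mult_1_right)
    thus ?thesis by (simp add: ucirc_def exp_cnj exp_minus exp_two_pi_i divide_inverse)
  qed
  have "h (1 - t) = f (cnj (of_real R * ucirc t)) * cnj (of_real R * ucirc t)" for t
    by (simp add: h_def u)
  hence "(\<lambda>t. h (- t)) \<circ> (+) (-1) = (\<lambda>t. f (cnj (of_real R * ucirc t)) * cnj (of_real R * ucirc t))"
    by (simp add: fun_eq_iff)
  ultimately have "((\<lambda>t. f (cnj (of_real R * ucirc t)) * cnj (of_real R * ucirc t)) has_integral cint R f) {0..1}"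
    by simp
  from has_integral_cnj[THEN iffD2, OF this]
  have "((\<lambda>t. cnj (f (cnj (of_real R * ucirc t)) * cnj (of_real R * ucirc t))) has_integral cnj (cint R f)) {0..1}"
    unfolding comp_def .
  thus ?thesis unfolding cint_def by (intro integral_unique) simp
qed

lemma cint_holomorphic:
  assumes "R > 0" "f holomorphic_on S" "open S" "cball 0 R \<subseteq> S"
  shows "cint R f = 0"
proof -
  have f: "f holomorphic_on cball 0 R" "f holomorphic_on ball 0 R"
    using holomorphic_on_subset[OF assms(2)] assms(4) ball_subset_cball by blast+
  have "cint R (\<lambda>u. f u * u / (u - 0)) = f 0 * 0"
    by (rule cint_Cauchy[of R "\<lambda>u. f u * u"])
      (use assms in \<open>auto intro!: holomorphic_intros holomorphic_on_imp_continuous_on f\<close>)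
  moreover have "cint R (\<lambda>u. f u * u / (u - 0)) = cint R f"
    by (rule cint_cong) (use assms in auto)
  ultimately show ?thesis by simp
qed

lemma holomorphic_onI_hol: "(\<And>z. z \<in> S \<Longrightarrow> hol f z) \<Longrightarrow> f holomorphic_on S" for f :: "complex \<Rightarrow> complex"
  unfolding holomorphic_on_def by (intro ballI field_differentiable_at_within[OF hol_field_differentiable]) blast

lemma eventually_snd: "\<forall>\<^sub>F y in nhds b. P y \<Longrightarrow> \<forall>\<^sub>F q in nhds (a, b). P (snd q)"
  for a :: "'a::t2_space" and b :: "'b::t2_space"
  by (rule isCont_nhds_0[of "(a, b)" snd b]) (auto intro!: continuous_intros)

lemma eventually_fst: "\<forall>\<^sub>F y in nhds a. P y \<Longrightarrow> \<forall>\<^sub>F q in nhds (a, b). P (fst q)"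
  for a :: "'a::t2_space" and b :: "'b::t2_space"
  by (rule isCont_nhds_0[of "(a, b)" fst a]) (auto intro!: continuous_intros)

lemma isCont_eventually_norm_less:
  "isCont f x \<Longrightarrow> norm (f x) < c \<Longrightarrow> \<forall>\<^sub>F y in nhds x. norm (f y) < c"
proof -
  assume "isCont f x" "norm (f x) < c"
  hence "((\<lambda>y. norm (f y)) \<longlongrightarrow> norm (f x)) (nhds x)" by (intro tendsto_norm isCont_tendsto_nhds) auto
  from order_tendstoD(2)[OF this] show ?thesis using \<open>norm (f x) < c\<close> by simp
qed

text \<open>Where \<open>A\<close> equals \<open>p ^ 2\<close> times \<open>V\<close>,
  differentiating \<open>A / p ^ 2\<close> needs no third power of \<open>p\<close> in the
  denominator.\<close>

lemma quotient_derivative: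
  fixes A p :: "complex \<Rightarrow> complex"
  assumes "(A has_field_derivative A') (at 0)" "(p has_field_derivative p') (at 0)" "p 0 \<noteq> 0"
    "A 0 = p 0 ^ 2 * V"
  shows "((\<lambda>x. c * (A x / p x ^ 2)) has_field_derivative c * ((A' - 2 * V * p 0 * p') / p 0 ^ 2)) (at 0)"
proof -
  have "p 0 ^ 2 \<noteq> 0" using assms(3) by simp
  from DERIV_cmult[OF DERIV_divide[OF assms(1) DERIV_power[OF assms(2), of 2] this], of c]
  show ?thesis
    by (rule DERIV_cong) (use assms(3,4) in \<open>simp add: field_simps power2_eq_square\<close>)
qed

section \<open>Divisibility by the square of the polynomial as a system of moments\<close>

lemma continuous_on_holI: "(\<And>x. x \<in> S \<Longrightarrow> hol f x) \<Longrightarrow> continuous_on S f"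
  using hol_isCont by (auto intro: continuous_at_imp_continuous_on)

text \<open>The unknowns \<open>(\<epsilon>, t, \<beta>)\<close>; the change of coordinate is \<open>T Z = Z + t\<^sub>0 + \<dots> + t\<^sub>k Z^k\<close>.\<close>

type_synonym 'k coeffs = "(complex^'k) \<times> (complex \<times> (complex^'k)) \<times> complex"

text \<open>In terms of vector fields, \<open>T\<close> carries
  \<open>P / (1 + \<beta> z ^ k)\<close> to \<open>X\<close> exactly when this expression is zero;
  divisibility by \<open>P\<^sup>2\<close> already fixes the positions and the eigenvalues of the
  zeros.\<close>

definition reduction_error ::
    "('k::finite \<Rightarrow> nat) \<Rightarrow> (complex \<times> (complex^'k) \<Rightarrow> complex) \<Rightarrow> complex \<times> ('k coeffs \<times> (complex^'k)) \<Rightarrow> complex"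
  where "reduction_error \<iota> X q = (case q of (z, ((\<epsilon>, t, \<beta>), \<eta>)) \<Rightarrow>
      (1 + \<beta> * z ^ CARD('k)) * X (z + poly (shift_poly \<iota> t) z, \<eta>)
      - (1 + poly (pderiv (shift_poly \<iota> t)) z) * poly (cpoly \<iota> \<epsilon>) z)"

definition moment_density ::
    "('k::finite \<Rightarrow> nat) \<Rightarrow> (complex \<times> (complex^'k) \<Rightarrow> complex) \<Rightarrow> nat \<Rightarrow> complex \<times> ('k coeffs \<times> (complex^'k)) \<Rightarrow> complex"
  where "moment_density \<iota> X j q = fst q ^ j * (reduction_error \<iota> X q / poly (cpoly \<iota> (fst (fst (snd q)))) (fst q) ^ 2)"

text \<open>The moments 0 to \<open>2 * k + 1\<close> are packed in the shape of the unknowns, so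
  that for fixed parameters source and target coincide and the implicit function theorem can be
  applied.\<close>

definition moment_map ::
    "('k::finite \<Rightarrow> nat) \<Rightarrow> (complex \<times> (complex^'k) \<Rightarrow> complex) \<Rightarrow> real \<Rightarrow> 'k coeffs \<times> (complex^'k) \<Rightarrow> 'k coeffs"
  where "moment_map \<iota> X R p = (let m = (\<lambda>j. cint R (\<lambda>s. moment_density \<iota> X j (s, p))); k = CARD('k) in
      ((\<chi> i. m (\<iota> i)), (m k, (\<chi> i. m (k + 1 + \<iota> i))), m (2 * k + 1)))"

lemma hol_reduction_error:
  fixes X :: "complex \<times> (complex^'k::finite) \<Rightarrow> complex"
  assumes "hol X (z + poly (shift_poly \<iota> t) z, \<eta>)"
  shows "hol (reduction_error \<iota> X) (z, ((\<epsilon>, t, \<beta>), \<eta>))"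
proof -
  let ?q = "(z, ((\<epsilon>, t, \<beta>), \<eta>)) :: complex \<times> ('k coeffs \<times> (complex^'k))"
  have 1: "hol (\<lambda>q. X (fst q + poly (shift_poly \<iota> (fst (snd (fst (snd q))))) (fst q), snd (snd q))) ?q"
    by (rule hol_compose2[of X]) (use assms in \<open>auto intro!: hol_intros\<close>)
  have "hol (\<lambda>q. (1 + snd (snd (fst (snd q))) * fst q ^ CARD('k)) *
      X (fst q + poly (shift_poly \<iota> (fst (snd (fst (snd q))))) (fst q), snd (snd q))
      - (1 + poly (pderiv (shift_poly \<iota> (fst (snd (fst (snd q)))))) (fst q)) * poly (cpoly \<iota> (fst (fst (snd q)))) (fst q)) ?q"
    by (intro hol_intros 1)
  moreover have "reduction_error \<iota> X = (\<lambda>q. (1 + snd (snd (fst (snd q))) * fst q ^ CARD('k)) *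
      X (fst q + poly (shift_poly \<iota> (fst (snd (fst (snd q))))) (fst q), snd (snd q))
      - (1 + poly (pderiv (shift_poly \<iota> (fst (snd (fst (snd q)))))) (fst q)) * poly (cpoly \<iota> (fst (fst (snd q)))) (fst q))"
    by (auto simp: reduction_error_def fun_eq_iff)
  ultimately show ?thesis by simp
qed

lemma hol_moment_density:
  assumes "hol (reduction_error \<iota> X) q" "poly (cpoly \<iota> (fst (fst (snd q)))) (fst q) \<noteq> 0"
  shows "hol (moment_density \<iota> X j) q"
  unfolding moment_density_def by (intro hol_intros assms) (use assms in auto)

lemma reduction_error_cj:
  assumes "cc X = X"
  shows "reduction_error \<iota> X (cnj z, cj p) = cnj (reduction_error \<iota> X (z, p))"
proof -
  obtain \<epsilon> t \<beta> \<eta> where p: "p = ((\<epsilon>, t, \<beta>), \<eta>)" by (metis prod.exhaust)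
  have X: "X (cnj x, cj y) = cnj (X (x, y))" for x y
    using fun_cong[OF assms, of "(cnj x, cj y)"] by (simp add: cc_def)
  show ?thesis
    by (simp add: p reduction_error_def cnj_poly_shift_poly cnj_poly_pderiv_shift_poly cnj_poly_cpoly flip: X)
qed

lemma moment_density_cj:
  assumes "cc X = X"
  shows "moment_density \<iota> X j (cnj z, cj p) = cnj (moment_density \<iota> X j (z, p))"
  by (simp add: moment_density_def reduction_error_cj[OF assms] cnj_poly_cpoly)

lemma moment_map_cj:
  assumes "cc X = X" "R \<ge> 0" "\<And>j s. norm s = R \<Longrightarrow> hol (moment_density \<iota> X j) (s, cj p)"
  shows "moment_map \<iota> X R (cj p) = cj (moment_map \<iota> X R p)"
proof -
  have "cint R (\<lambda>s. moment_density \<iota> X j (s, p)) = cnj (cint R (\<lambda>s. moment_density \<iota> X j (s, cj p)))" for j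
  proof -
    have "moment_density \<iota> X j (s, p) = cnj (moment_density \<iota> X j (cnj s, cj p))" for s
      using moment_density_cj[OF assms(1), of \<iota> j s p] by simp
    moreover have "continuous_on (sphere 0 R) (\<lambda>s. moment_density \<iota> X j (s, cj p))"
      by (rule continuous_on_holI, rule hol_slice1, rule assms(3)) simp
    ultimately show ?thesis using cint_cnj[OF assms(2)] by simp
  qed
  thus ?thesis by (simp add: moment_map_def Let_def vec_eq_iff)
qed

lemma bij_betw_moment_index:
  assumes "bij_betw \<iota> (UNIV :: 'k::finite set) {..<CARD('k)}" "j < 2 * CARD('k) + 2"
  shows "(\<exists>i. j = \<iota> i) \<or> j = CARD('k) \<or> (\<exists>i. j = CARD('k) + 1 + \<iota> i) \<or> j = 2 * CARD('k) + 1"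
proof -
  have *: "\<exists>i. m = \<iota> i" if "m < CARD('k)" for m
    using assms(1) that by (metis bij_betw_imp_surj_on imageE lessThan_iff)
  consider "j < CARD('k)" | "j = CARD('k)" | "j - (CARD('k) + 1) < CARD('k)" "j > CARD('k)" | "j = 2 * CARD('k) + 1"
    using assms(2) by linarith
  thus ?thesis
  proof cases
    case 3
    with *[OF 3(1)] show ?thesis by (metis Suc_eq_plus1 Suc_leI le_add_diff_inverse)
  qed (use * in auto)
qed

lemma moment_map_eq_0:
  fixes X :: "complex \<times> (complex^'k::finite) \<Rightarrow> complex"
  assumes "bij_betw \<iota> (UNIV :: 'k set) {..<CARD('k)}" "moment_map \<iota> X R p = 0" "j < 2 * CARD('k) + 2"
  shows "cint R (\<lambda>s. moment_density \<iota> X j (s, p)) = 0"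
  using bij_betw_moment_index[OF assms(1,3)] assms(2)
  by (auto simp: moment_map_def Let_def zero_prod_def vec_eq_iff)

lemma square_power_Suc: "(z ^ (k + 1))\<^sup>2 = z ^ (2 * k + 2)" for z :: complex
  unfolding power_mult[symmetric] by (rule arg_cong[where f = "(^) z"]) simp

lemma ddir_ident: "ddir (\<lambda>x. x) x v = v"
  by (simp add: ddir_linear_map bounded_linear_ident)

lemma hol_moment_density_power: "hol (moment_density \<iota> X 0) q \<Longrightarrow> hol (moment_density \<iota> X j) q"
proof -
  assume h: "hol (moment_density \<iota> X 0) q"
  have "hol (\<lambda>q. fst q ^ j * moment_density \<iota> X 0 q) q" by (intro hol_intros h)
  thus ?thesis by (simp add: moment_density_def[abs_def])
qed

text \<open>The data at parameter 0, where the identity, \<open>z ^ (k + 1)\<close> and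
  \<open>\<beta> = b\<close> solve the system and \<open>V0\<close> is the quotient of the error.
  The contour has radius \<open>R\<close>; the larger \<open>R'\<close> keeps everything holomorphic
  on a neighbourhood of the closed disc.\<close>

locale moment_reduction =
  fixes \<iota> :: "'k::finite \<Rightarrow> nat" and X :: "complex \<times> (complex^'k) \<Rightarrow> complex" and b :: real
    and k :: nat and R R' :: real and V0 :: "complex \<Rightarrow> complex"
  assumes index: "bij_betw \<iota> (UNIV :: 'k set) {..<k}" and k: "k \<ge> 1"
    and R: "0 < R" "R < R'"
    and hol_X: "\<And>z. norm z < R' \<Longrightarrow> hol X (z, 0)"
    and cc_X: "cc X = X"
    and X0: "(\<lambda>x. X (x, 0) - (x ^ (k + 1) - of_real b * x ^ (2 * k + 1))) \<in> bz (2 * k + 2)"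
    and V0: "V0 holomorphic_on ball 0 R'"
    and error: "\<And>z. norm z < R' \<Longrightarrow> (1 + of_real b * z ^ k) * X (z, 0) - z ^ (k + 1) = (z ^ (k + 1))\<^sup>2 * V0 z"
begin

lemma card: "CARD('k) = k"
  by (rule bij_betw_card[OF index])

abbreviation base :: "'k coeffs \<times> (complex^'k)" where
  "base \<equiv> ((0, 0, of_real b), 0)"

lemma error_base: "norm z < R' \<Longrightarrow> reduction_error \<iota> X (z, base) = (z ^ (k + 1))\<^sup>2 * V0 z"
  using error[of z] by (simp add: reduction_error_def cpoly_def card poly_monom)

lemma cpoly_base: "poly (cpoly \<iota> 0) z = z ^ (k + 1)"
  by (simp add: cpoly_def card poly_monom)

lemma hol_density: "norm z < R' \<Longrightarrow> z \<noteq> 0 \<Longrightarrow> hol (moment_density \<iota> X j) (z, base)"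
  by (intro hol_moment_density hol_reduction_error) (auto simp: cpoly_base hol_X)

text \<open>The numerator of the derivative of the error over \<open>P\<^sup>2\<close> at
  \<open>base\<close>. The last summand comes from the denominator, the error at \<open>base\<close>
  being \<open>V0\<close> times \<open>P\<^sup>2\<close>.\<close>

definition linearized :: "'k coeffs \<Rightarrow> complex^'k \<Rightarrow> complex \<Rightarrow> complex" where
  "linearized \<theta> v z = (case \<theta> of (\<pi>, t, \<beta>) \<Rightarrow>
     \<beta> * z ^ k * X (z, 0) + (1 + of_real b * z ^ k) * (deriv (\<lambda>x. X (x, 0)) z * poly (shift_poly \<iota> t) z + ddir X (z, 0) (0, v))
        - poly (pderiv (shift_poly \<iota> t)) z * z ^ (k + 1) - poly (low_poly \<iota> \<pi>) z
        - 2 * V0 z * z ^ (k + 1) * poly (low_poly \<iota> \<pi>) z)"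

text \<open>Computed in one complex variable, on the line through \<open>base\<close> in direction
  \<open>(\<theta>, v)\<close>, where numerator and denominator are explicit.\<close>

lemma ddir_density:
  assumes "norm s < R'" "s \<noteq> 0"
  shows "ddir (moment_density \<iota> X j) (s, base) (0, (\<theta>, v)) = s ^ j * (linearized \<theta> v s / (s ^ (k + 1))\<^sup>2)"
proof -
  obtain \<pi> t \<beta> where \<theta>: "\<theta> = (\<pi>, t, \<beta>)" by (metis prod.exhaust)
  define p where "p \<tau> = s ^ (k + 1) + \<tau> * poly (low_poly \<iota> \<pi>) s" for \<tau>
  define u where "u = (poly (shift_poly \<iota> t) s, v)"
  define A where "A \<tau> = (1 + (of_real b + \<tau> * \<beta>) * s ^ k) * X ((s, 0) + cs \<tau> u)
      - (1 + \<tau> * poly (pderiv (shift_poly \<iota> t)) s) * p \<tau>" for \<tau>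
  let ?F = "moment_density \<iota> X j" and ?x = "(s, base)" and ?v = "(0, (\<theta>, v)) :: complex \<times> ('k coeffs \<times> (complex^'k))"
  have eq: "?F (?x + cs \<tau> ?v) = s ^ j * (A \<tau> / p \<tau> ^ 2)" for \<tau>
    by (simp add: \<theta> moment_density_def reduction_error_def A_def p_def u_def cpoly_def card poly_monom
        low_poly_cs shift_poly_cs pderiv_smult algebra_simps)
  have "cdiff ?F (?x + cs 0 ?v)" using hol_imp_cdiff[OF hol_density[OF assms]] by simp
  from cdiff_line[OF this]
  have 1: "((\<lambda>\<tau>. s ^ j * (A \<tau> / p \<tau> ^ 2)) has_field_derivative ddir ?F ?x ?v) (at 0)"
    unfolding eq by simp
  have cX: "cdiff X (s, 0)" using hol_imp_cdiff[OF hol_X[OF assms(1)]] .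
  hence "cdiff X ((s, 0) + cs 0 u)" by simp
  from cdiff_line[OF this]
  have dX: "((\<lambda>\<tau>. X ((s, 0) + cs \<tau> u)) has_field_derivative ddir X (s, 0) u) (at 0)" by simp
  have u: "ddir X (s, 0) u = deriv (\<lambda>x. X (x, 0)) s * poly (shift_poly \<iota> t) s + ddir X (s, 0) (0, v)"
    unfolding u_def ddir_fst_direction[OF cX, of "poly (shift_poly \<iota> t) s" v] by (simp add: ddir_slice1[OF cX])
  have dp: "(p has_field_derivative poly (low_poly \<iota> \<pi>) s) (at 0)"
    unfolding p_def by (auto intro!: derivative_eq_intros)
  define A' where "A' = \<beta> * s ^ k * X (s, 0) + (1 + of_real b * s ^ k) * ddir X (s, 0) u
      - (poly (pderiv (shift_poly \<iota> t)) s * s ^ (k + 1) + poly (low_poly \<iota> \<pi>) s)"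
  have dA: "(A has_field_derivative A') (at 0)"
    unfolding A_def A'_def by (rule derivative_eq_intros dX dp refl)+ (simp add: p_def)
  have A0: "A 0 = p 0 ^ 2 * V0 s"
    using error[OF assms(1)] by (simp add: A_def p_def)
  have "((\<lambda>\<tau>. s ^ j * (A \<tau> / p \<tau> ^ 2)) has_field_derivative
      s ^ j * ((A' - 2 * V0 s * p 0 * poly (low_poly \<iota> \<pi>) s) / p 0 ^ 2)) (at 0)"
    by (rule quotient_derivative[OF dA dp _ A0]) (use assms in \<open>simp add: p_def\<close>)
  from DERIV_unique[OF 1 this] show ?thesis
    by (simp add: \<theta> linearized_def A'_def p_def u algebra_simps)
qed

lemma moment_map_has_derivative:
  "hol (moment_map \<iota> X R) base"
  "ddir (moment_map \<iota> X R) base v = (let m = (\<lambda>j. cint R (\<lambda>s. ddir (moment_density \<iota> X j) (s, base) (0, v))) in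
      ((\<chi> i. m (\<iota> i)), (m k, (\<chi> i. m (k + 1 + \<iota> i))), m (2 * k + 1)))"
proof -
  define m where "m j p = cint R (\<lambda>s. moment_density \<iota> X j (s, p))" for j p
  have hd: "hol (moment_density \<iota> X j) (s, base)" if "norm s = R" for s j
    by (rule hol_density) (use that R in auto)
  have hm: "hol (m j) base" for j
    unfolding m_def using hol_cint(1)[OF less_imp_le[OF R(1)] hd] by simp
  have dm: "ddir (m j) base v = cint R (\<lambda>s. ddir (moment_density \<iota> X j) (s, base) (0, v))" for j v
    unfolding m_def using hol_cint(2)[OF less_imp_le[OF R(1)] hd] by simp
  have eq: "moment_map \<iota> X R = (\<lambda>p. ((\<chi> i. m (\<iota> i) p), (m k p, (\<chi> i. m (k + 1 + \<iota> i) p)), m (2 * k + 1) p))"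
    by (simp add: fun_eq_iff moment_map_def m_def Let_def card)
  show "hol (moment_map \<iota> X R) base" unfolding eq by (intro hol_intros hm)
  note D = cdiff_has_derivative[OF hol_imp_cdiff[OF hm]]
  have "((\<lambda>p. ((\<chi> i. m (\<iota> i) p), (m k p, (\<chi> i. m (k + 1 + \<iota> i) p)), m (2 * k + 1) p)) has_derivative
      (\<lambda>v. ((\<chi> i. ddir (m (\<iota> i)) base v), (ddir (m k) base v, (\<chi> i. ddir (m (k + 1 + \<iota> i)) base v)), ddir (m (2 * k + 1)) base v)))
      (at base)"
    by (intro has_derivative_Pair has_derivative_vec_lambda D)
  from ddir_eq[OF this]
  show "ddir (moment_map \<iota> X R) base v = (let m = (\<lambda>j. cint R (\<lambda>s. ddir (moment_density \<iota> X j) (s, base) (0, v))) in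
      ((\<chi> i. m (\<iota> i)), (m k, (\<chi> i. m (k + 1 + \<iota> i))), m (2 * k + 1)))"
    unfolding eq by (simp add: dm Let_def)
qed

text \<open>Vanishing moments of the linearised numerator over \<open>z ^ (2 * k + 2)\<close> give
  divisibility by \<open>moments_factor\<close>, now with a monomial as divisor.\<close>

lemma kernel_linearized:
  assumes "ddir (moment_map \<iota> X R) base (\<theta>, v) = 0"
  shows "linearized \<theta> v \<in> bz (2 * k + 2)"
proof -
  obtain \<pi> t \<beta> where \<theta>: "\<theta> = (\<pi>, t, \<beta>)" by (metis prod.exhaust)
  define D where "D j = cint R (\<lambda>s. ddir (moment_density \<iota> X j) (s, base) (0, (\<theta>, v)))" for j
  have "((\<chi> i. D (\<iota> i)), (D k, (\<chi> i. D (k + 1 + \<iota> i))), D (2 * k + 1)) = (0 :: 'k coeffs)"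
    using assms unfolding moment_map_has_derivative(2) Let_def D_def .
  hence 0: "D j = 0" if "j < 2 * k + 2" for j
    using bij_betw_moment_index[of \<iota> j] index that by (auto simp: card zero_prod_def vec_eq_iff)
  have h: "linearized \<theta> v holomorphic_on ball 0 R'"
  proof (rule holomorphic_onI_hol)
    fix z :: complex assume z: "z \<in> ball 0 R'"
    have hp: "hol (poly q) z" for q :: "complex poly"
      by (rule hol_complex[of UNIV]) (auto intro: holomorphic_intros)
    have hX0: "hol (\<lambda>x. X (x, 0)) z" by (rule hol_slice1) (use z hol_X in auto)
    have "hol (\<lambda>x. ddir X x (0, v)) (z, 0)" by (rule hol_ddir) (use z hol_X in auto)
    from hol_slice1[OF this] have hdX: "hol (\<lambda>z. ddir X (z, 0) (0, v)) z" .
    have hV: "hol V0 z" by (rule hol_complex[OF open_ball V0 z])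
    show "hol (linearized \<theta> v) z"
      unfolding linearized_def[abs_def] \<theta> prod.case
      by (intro hol_intros hp hX0 hol_deriv[OF hX0] hdX hV)
  qed
  have "\<exists>V. V holomorphic_on ball 0 R' \<and> (\<forall>z\<in>ball 0 R'. linearized \<theta> v z = poly (monom 1 (2 * k + 2)) z * V z)"
  proof (rule moments_factor[OF _ R(1) open_ball _ _ h])
    fix j assume "j < degree (monom (1::complex) (2 * k + 2))"
    hence j: "j < 2 * k + 2" by (simp add: degree_monom_eq)
    have "cint R (\<lambda>w. w ^ j * (linearized \<theta> v w / poly (monom 1 (2 * k + 2)) w))
        = cint R (\<lambda>s. ddir (moment_density \<iota> X j) (s, base) (0, (\<theta>, v)))"
    proof (rule cint_cong)
      fix w :: complex assume w: "norm w = R"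
      have e: "w ^ (2 * k + 2) = (w ^ (k + 1))\<^sup>2" by (simp only: square_power_Suc)
      show "w ^ j * (linearized \<theta> v w / poly (monom 1 (2 * k + 2)) w) = ddir (moment_density \<iota> X j) (w, base) (0, (\<theta>, v))"
        by (subst ddir_density) (use w R in \<open>auto simp only: poly_monom e mult_1_left norm_zero\<close>)
    qed (use R in simp)
    thus "cint R (\<lambda>w. w ^ j * (linearized \<theta> v w / poly (monom 1 (2 * k + 2)) w)) = 0" using 0[OF j] by (simp add: D_def)
  qed (use R in \<open>auto simp: poly_monom\<close>)
  then obtain V where V: "V holomorphic_on ball 0 R'" "\<And>z. z \<in> ball 0 R' \<Longrightarrow> linearized \<theta> v z = z ^ (2 * k + 2) * V z"
    by (auto simp: poly_monom)
  have "V \<in> bz 0" by (rule bz_hol[OF hol_complex[OF open_ball V(1)]]) (use R in auto)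
  from bz_mult[OF power_in_bz this] have "(\<lambda>z. z ^ (2 * k + 2) * V z) \<in> bz (2 * k + 2)" unfolding add_0_right .
  thus ?thesis
    by (rule bz_cong) (rule eventually_mono[OF eventually_nhds_in_open[of "ball 0 R'"]], use R V(2) in auto)
qed

lemma linearized_kernel:
  assumes "linearized (\<pi>, t, \<beta>) v \<in> bz (2 * k + 2)"
  shows "v = 0 \<Longrightarrow> \<pi> = 0 \<and> t = 0 \<and> \<beta> = 0"
    and "\<pi> = 0 \<Longrightarrow> (\<lambda>z. ddir X (z, 0) (0, v)) \<in> bz k"
proof -
  have R': "R' > 0" using R by simp
  have hX: "hol X (0, 0)" using hol_X[of 0] R' by simp
  have hX0: "hol (\<lambda>x. X (x, 0)) 0" by (rule hol_slice1[OF hX])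
  have hV: "hol V0 0" by (rule hol_complex[OF open_ball V0]) (use R' in simp)
  {
    assume v: "v = 0"
    have "(\<lambda>z. \<beta> * z ^ k * X (z, 0) + (1 + of_real b * z ^ k) * (deriv (\<lambda>x. X (x, 0)) z * poly (shift_poly \<iota> t) z + (\<lambda>z. 0) z)
        - poly (pderiv (shift_poly \<iota> t)) z * z ^ (k + 1) - poly (low_poly \<iota> \<pi>) z
        - 2 * V0 z * z ^ (k + 1) * poly (low_poly \<iota> \<pi>) z) \<in> bz (2 * k + 2)"
    proof (rule bz_cong[OF assms])
      have "\<forall>\<^sub>F z in nhds 0. z \<in> ball (0::complex) R'" by (rule eventually_nhds_in_open) (use R' in auto)
      thus "\<forall>\<^sub>F z in nhds 0. linearized (\<pi>, t, \<beta>) v z = \<beta> * z ^ k * X (z, 0) + (1 + of_real b * z ^ k) * (deriv (\<lambda>x. X (x, 0)) z * poly (shift_poly \<iota> t) z + (\<lambda>z. 0) z)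
        - poly (pderiv (shift_poly \<iota> t)) z * z ^ (k + 1) - poly (low_poly \<iota> \<pi>) z
        - 2 * V0 z * z ^ (k + 1) * poly (low_poly \<iota> \<pi>) z"
      proof eventually_elim
        case (elim z)
        hence "ddir X (z, 0) (0, 0) = 0" using ddir_zero[OF hol_imp_cdiff[OF hol_X[of z]]] by (simp add: zero_prod_def)
        thus ?case by (simp add: linearized_def v)
      qed
    qed
    from linearized_core(1)[OF index k hX0 X0 hV this] show "\<pi> = 0 \<and> t = 0 \<and> \<beta> = 0" by simp
  }
  {
    assume \<pi>: "\<pi> = 0"
    have h: "hol (\<lambda>z. ddir X (z, 0) (0, v)) 0" by (intro hol_slice1 hol_ddir hX)
    from linearized_core(2)[OF index k hX0 X0 hV assms[unfolded linearized_def prod.case] \<pi> h]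
    show "(\<lambda>z. ddir X (z, 0) (0, v)) \<in> bz k" .
  }
qed

lemma moment_map_base: "moment_map \<iota> X R base = 0"
proof -
  have "cint R (\<lambda>s. moment_density \<iota> X j (s, base)) = 0" for j
  proof -
    have "cint R (\<lambda>s. moment_density \<iota> X j (s, base)) = cint R (\<lambda>s. s ^ j * V0 s)"
      by (rule cint_cong) (use R in \<open>auto simp: moment_density_def cpoly_base error_base\<close>)
    also have "\<dots> = 0"
      by (rule cint_holomorphic[of R _ "ball 0 R'"]) (use R in \<open>auto intro!: holomorphic_intros V0\<close>)
    finally show ?thesis .
  qed
  thus ?thesis by (simp add: moment_map_def Let_def zero_prod_def vec_eq_iff)
qed

text \<open>The derivative in the unknowns has trivial kernel by the order-of-vanishing argument, so
  the implicit function theorem yields the unknowns as holomorphic functions of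
  \<open>\<eta>\<close>.\<close>

lemma ex_solution:
  obtains \<theta> where "hol \<theta> 0" "\<theta> 0 = (0, 0, of_real b)"
    "\<forall>\<^sub>F \<eta> in nhds 0. moment_map \<iota> X R (\<theta> \<eta>, \<eta>) = 0"
    "\<forall>\<^sub>F \<eta> in nhds 0. \<theta> (cj \<eta>) = cj (\<theta> \<eta>)"
    "\<forall>v. fst (ddir \<theta> 0 v) = 0 \<longrightarrow> (\<lambda>z. ddir X (z, 0) (0, v)) \<in> bz k"
proof -
  let ?N = "moment_map \<iota> X R" and ?\<theta>0 = "(0, 0, of_real b) :: 'k coeffs"
  have inj: "w = 0" if w: "ddir ?N base (w, 0) = 0" for w
  proof -
    obtain \<pi> t \<beta> where w': "w = (\<pi>, t, \<beta>)" by (metis prod.exhaust)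
    from linearized_kernel(1)[OF kernel_linearized[OF w, unfolded w']] show ?thesis by (simp add: w' zero_prod_def)
  qed
  obtain G where G: "hol G (?N base, 0)" "G (?N base, 0) = ?\<theta>0"
    "\<forall>\<^sub>F q in nhds (?N base, 0). ?N (G q, snd q) = fst q"
    "\<forall>\<^sub>F q in nhds base. G (?N q, snd q) = fst q"
    using hol_partial_inverse[OF moment_map_has_derivative(1) inj] by blast
  note G = G[unfolded moment_map_base]
  define \<theta> where "\<theta> \<eta> = G (0, \<eta>)" for \<eta>
  have h\<theta>: "hol \<theta> 0" unfolding \<theta>_def by (rule hol_slice2[OF G(1)])
  have \<theta>0: "\<theta> 0 = ?\<theta>0" using G(2) by (simp add: \<theta>_def)
  have zero: "\<forall>\<^sub>F \<eta> in nhds 0. ?N (\<theta> \<eta>, \<eta>) = 0"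
  proof -
    have "isCont (\<lambda>\<eta>. (0::'k coeffs, \<eta>)) (0::complex^'k)" by (intro continuous_intros)
    from isCont_nhds_0[OF this refl G(3)] show ?thesis by (simp add: \<theta>_def)
  qed
  show ?thesis
  proof (rule that[OF h\<theta> \<theta>0 zero])
    have "\<forall>\<^sub>F \<eta> in nhds (cj 0). ?N (\<theta> \<eta>, \<eta>) = 0" using zero by simp
    from eventually_nhds_cj[OF this] have z': "\<forall>\<^sub>F \<eta> in nhds 0. ?N (\<theta> (cj \<eta>), cj \<eta>) = 0" .
    have hd: "\<forall>\<^sub>F p in nhds base. \<forall>s\<in>sphere 0 R. hol (moment_density \<iota> X 0) (s, p)"
      by (rule eventually_nhds_prod_compact) (use R in \<open>auto intro!: hol_eventually hol_density\<close>)
    have "isCont (\<lambda>\<eta>. (cj (\<theta> (cj \<eta>)), \<eta>)) 0"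
      using hol_isCont[OF hol_cc[of \<theta> 0]] h\<theta> unfolding cc_def by (auto intro!: continuous_intros)
    note cont = this
    have e0: "(cj (\<theta> (cj 0)), 0) = base" using \<theta>0 by simp
    \<comment> \<open>Reality from uniqueness: the conjugated solution
      \<open>cj (\<theta> (cj \<eta>))\<close> solves the same system and lies close to the base
      point.\<close>
    show "\<forall>\<^sub>F \<eta> in nhds 0. \<theta> (cj \<eta>) = cj (\<theta> \<eta>)"
      using isCont_nhds_0[OF cont e0 G(4)] isCont_nhds_0[OF cont e0 hd] z'
    proof eventually_elim
      case (elim \<eta>)
      have "?N (cj (\<theta> (cj \<eta>), cj \<eta>)) = cj (?N (\<theta> (cj \<eta>), cj \<eta>))"
      proof (rule moment_map_cj[OF cc_X less_imp_le[OF R(1)]])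
        fix j s assume "norm (s::complex) = R"
        hence "hol (moment_density \<iota> X 0) (s, cj (\<theta> (cj \<eta>), cj \<eta>))" using elim(2) by simp
        thus "hol (moment_density \<iota> X j) (s, cj (\<theta> (cj \<eta>), cj \<eta>))" by (rule hol_moment_density_power)
      qed
      hence "?N (cj (\<theta> (cj \<eta>)), \<eta>) = 0" using elim(3) by simp
      with elim(1) have "\<theta> \<eta> = cj (\<theta> (cj \<eta>))" by (simp add: \<theta>_def)
      thus ?case by simp
    qed
  next
    show "\<forall>v. fst (ddir \<theta> 0 v) = 0 \<longrightarrow> (\<lambda>z. ddir X (z, 0) (0, v)) \<in> bz k"
    proof (intro allI impI)
    fix v assume v: "fst (ddir \<theta> 0 v) = 0"
    have hp: "hol (\<lambda>\<eta>. (\<theta> \<eta>, \<eta>)) 0" by (intro hol_intros h\<theta>)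
    have cN: "cdiff ?N (\<theta> 0, 0)" using hol_imp_cdiff[OF moment_map_has_derivative(1)] \<theta>0 by simp
    \<comment> \<open>Differentiating the identity \<open>?N (\<theta> \<eta>, \<eta>) = 0\<close>
      puts the pair \<open>(ddir \<theta> 0 v, v)\<close> into the kernel.\<close>
    have "ddir (\<lambda>\<eta>. ?N (\<theta> \<eta>, \<eta>)) 0 v = ddir ?N (\<theta> 0, 0) (ddir (\<lambda>\<eta>. (\<theta> \<eta>, \<eta>)) 0 v)"
      by (rule ddir_compose[of ?N "\<lambda>\<eta>. (\<theta> \<eta>, \<eta>)", OF cN hol_imp_cdiff[OF hp]])
    also have "ddir (\<lambda>\<eta>. (\<theta> \<eta>, \<eta>)) 0 v = (ddir \<theta> 0 v, v)"
      using ddir_Pair[OF hol_imp_cdiff[OF h\<theta>] hol_imp_cdiff[OF hol_ident], of v]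
      by (simp add: ddir_ident)
    also have "ddir (\<lambda>\<eta>. ?N (\<theta> \<eta>, \<eta>)) 0 v = 0"
    proof -
      have "\<forall>\<^sub>F \<eta> in nhds 0. 0 = ?N (\<theta> \<eta>, \<eta>)" using zero by eventually_elim simp
      from ddir_cong[OF this hol_imp_cdiff[OF hol_const]] have "ddir (\<lambda>\<eta>. ?N (\<theta> \<eta>, \<eta>)) 0 v = ddir (\<lambda>\<eta>. 0) 0 v" by simp
      also have "\<dots> = 0" using ddir_eq[OF has_derivative_const] by metis
      finally show ?thesis .
    qed
    finally have "ddir ?N base (ddir \<theta> 0 v, v) = 0" using \<theta>0 by simp
    note ker = kernel_linearized[OF this]
    obtain t \<beta> where d: "ddir \<theta> 0 v = (0, t, \<beta>)" using v by (metis prod.collapse)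
    show "(\<lambda>z. ddir X (z, 0) (0, v)) \<in> bz k"
      by (rule linearized_kernel(2)[OF ker[unfolded d] refl])
    qed
  qed
qed

text \<open>The quotient exists for each parameter separately. A bound independent of
  \<open>\<eta>\<close> comes from the maximum principle, since on the circle the quotient is
  explicit and close to \<open>V0\<close>.\<close>

lemma factor_solution:
  assumes h\<theta>: "hol \<theta> 0" and \<theta>0: "\<theta> 0 = (0, 0, of_real b)"
    and zero: "\<forall>\<^sub>F \<eta> in nhds 0. moment_map \<iota> X R (\<theta> \<eta>, \<eta>) = 0"
  obtains C where "\<forall>\<^sub>F \<eta> in nhds 0. \<exists>V. V holomorphic_on ball 0 R \<and> (\<forall>z\<in>ball 0 R. norm (V z) \<le> C \<and>
      reduction_error \<iota> X (z, (\<theta> \<eta>, \<eta>)) = poly (cpoly \<iota> (fst (\<theta> \<eta>))) z ^ 2 * V z)"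
proof -
  define w where "w q = reduction_error \<iota> X (fst q, (\<theta> (snd q), snd q))" for q
  define D where "D q = poly (cpoly \<iota> (fst (\<theta> (snd q)))) (fst q)" for q
  have hw: "hol w (s, 0)" if "norm s < R'" for s
  proof -
    have "hol (reduction_error \<iota> X) (s, base)" by (rule hol_reduction_error) (use that hol_X in simp)
    thus ?thesis unfolding w_def
      by - (rule hol_compose2[of "reduction_error \<iota> X"], simp add: \<theta>0,
        intro hol_Pair hol_fst' hol_snd' hol_snd_arg h\<theta>)
  qed
  have hD: "hol D (s, 0)" for s
    unfolding D_def by (intro hol_cpoly hol_fst[of "\<lambda>q. \<theta> (snd q)"] hol_fst' hol_snd_arg h\<theta>)
  have D0: "D (s, 0) = s ^ (k + 1)" for s by (simp add: D_def \<theta>0 cpoly_base)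
  have "compact (V0 ` sphere 0 R)"
    by (intro compact_continuous_image continuous_on_holI hol_complex[OF open_ball V0]) (use R in auto)
  from compact_imp_bounded[OF this]
  obtain M where M: "\<And>s. s \<in> sphere 0 R \<Longrightarrow> norm (V0 s) \<le> M"
    unfolding bounded_iff ball_simps by blast
  \<comment> \<open>At parameter 0 the circle avoids the root, so the quotient is continuous near
    it; compactness of the circle gives one neighbourhood of parameters for all its points.\<close>
  have bound: "\<forall>\<^sub>F \<eta> in nhds 0. \<forall>s\<in>sphere 0 R. norm (w (s, \<eta>) / D (s, \<eta>) ^ 2) < M + 1"
  proof (rule eventually_nhds_prod_compact)
    fix s :: complex assume s: "s \<in> sphere 0 R"
    have s0: "s \<noteq> 0" "norm s < R'" using s R by auto
    have h: "hol (\<lambda>q. w q / D q ^ 2) (s, 0)"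
      by (intro hol_intros hw hD s0) (use s0 D0 in simp)
    have "w (s, 0) / D (s, 0) ^ 2 = V0 s"
      using s0 error_base[of s] by (simp add: w_def D0 \<theta>0)
    hence "norm (w (s, 0) / D (s, 0) ^ 2) < M + 1" using M[OF s] by simp
    from isCont_eventually_norm_less[OF hol_isCont[OF h] this]
    show "\<forall>\<^sub>F q in nhds (s, 0). norm (w q / D q ^ 2) < M + 1" .
  qed simp
  have holw: "\<forall>\<^sub>F \<eta> in nhds 0. \<forall>s\<in>cball 0 R. hol w (s, \<eta>)"
    by (rule eventually_nhds_prod_compact) (use R in \<open>auto intro!: hol_eventually hw\<close>)
  have roots: "\<forall>\<^sub>F \<eta> in nhds 0. \<forall>a. poly (cpoly \<iota> (fst (\<theta> \<eta>))) a = 0 \<longrightarrow> norm a < R"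
    by (rule isCont_nhds_0[OF hol_isCont[OF hol_fst[OF h\<theta>]] _ cpoly_roots_small[OF index R(1)]]) (simp add: \<theta>0)
  show ?thesis
  proof (rule that[of "M + 1"])
    show "\<forall>\<^sub>F \<eta> in nhds 0. \<exists>V. V holomorphic_on ball 0 R \<and> (\<forall>z\<in>ball 0 R. norm (V z) \<le> M + 1 \<and>
      reduction_error \<iota> X (z, (\<theta> \<eta>, \<eta>)) = poly (cpoly \<iota> (fst (\<theta> \<eta>))) z ^ 2 * V z)"
      using bound holw roots zero
    proof eventually_elim
      case (elim \<eta>)
      \<comment> \<open>The moment criterion asks for an open set around the closed disc, so the
        whole set where the slice is holomorphic is taken.\<close>
      define S where "S = {z. hol w (z, \<eta>)}"
      have "open ((\<lambda>z. (z, \<eta>)) -` {q. hol w q})"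
        by (intro open_vimage open_hol continuous_intros)
      hence S: "open S" "cball 0 R \<subseteq> S" using elim(2) by (auto simp: S_def vimage_def)
      define p where "p = cpoly \<iota> (fst (\<theta> \<eta>))"
      have p0: "p \<noteq> 0" unfolding p_def by (rule cpoly_neq_0[OF index])
      have "\<exists>V. V holomorphic_on S \<and> (\<forall>z\<in>S. w (z, \<eta>) = poly (p ^ 2) z * V z)"
      proof (rule moments_factor[OF _ R(1) S])
        show "(\<lambda>z. w (z, \<eta>)) holomorphic_on S"
          by (rule holomorphic_onI_hol, rule hol_slice1) (simp add: S_def)
        show "norm a < R" if "poly (p\<^sup>2) a = 0" for a using elim(3) that by (simp add: p_def)
        fix j assume "j < degree (p\<^sup>2)"
        hence j: "j < 2 * CARD('k) + 2" using degree_cpoly(1)[OF index] p0 by (simp add: p_def degree_power_eq card)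
        have "cint R (\<lambda>s. moment_density \<iota> X j (s, \<theta> \<eta>, \<eta>)) = 0"
          by (rule moment_map_eq_0[OF _ elim(4) j]) (simp add: card index)
        thus "cint R (\<lambda>z. z ^ j * (w (z, \<eta>) / poly (p\<^sup>2) z)) = 0"
          by (simp add: moment_density_def w_def p_def)
      qed (use p0 in auto)
      then obtain V where V: "V holomorphic_on S" "\<And>z. z \<in> S \<Longrightarrow> w (z, \<eta>) = poly p z ^ 2 * V z" by auto
      have VR: "V holomorphic_on cball 0 R" by (rule holomorphic_on_subset[OF V(1) S(2)])
      have Vs: "norm (V s) \<le> M + 1" if "s \<in> sphere 0 R" for s
      proof -
        have "poly p s \<noteq> 0" using elim(3) that by (auto simp: p_def)
        hence "V s = w (s, \<eta>) / D (s, \<eta>) ^ 2" using V(2)[of s] S(2) that by (auto simp: D_def p_def)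
        thus ?thesis using elim(1) that by (auto intro: less_imp_le)
      qed
      have "norm (V z) \<le> M + 1" if "z \<in> ball 0 R" for z
      proof (rule maximum_modulus_frontier[of V "ball 0 R"])
        show "V holomorphic_on interior (ball 0 R)" using VR by (auto intro: holomorphic_on_subset)
        show "continuous_on (closure (ball 0 R)) V" using R VR by (simp add: holomorphic_on_imp_continuous_on)
      qed (use that R Vs in auto)
      moreover have "V holomorphic_on ball 0 R" by (rule holomorphic_on_subset[OF VR]) auto
      moreover have "z \<in> S" if "z \<in> ball 0 R" for z using that S(2) by auto
      ultimately show ?case using V(2) unfolding p_def w_def by (intro exI[of _ V]) simp
    qed
  qed
qed

end

text \<open>The solved equation reads N X(T) = D (U + D V). Differentiated at a root of D, it
  becomes N times the derivative of X(T) on the left and D' U on the right, and U, the derivative of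
  T, cancels. The bound on V turns the equation into the estimate of X(T) by D.\<close>

lemma log_multiplier_field_normal_form:
  fixes X :: "complex \<times> (complex^'k::finite) \<Rightarrow> complex" and b :: real
  assumes index: "bij_betw \<iota> (UNIV :: 'k set) {..<k}" and k: "k \<ge> 1"
    and hX: "hol X (0, 0)" and cc_X: "cc X = X"
    and X0: "(\<lambda>x. X (x, 0) - (x ^ (k + 1) - of_real b * x ^ (2 * k + 1))) \<in> bz (2 * k + 2)"
  obtains \<Phi> :: "complex^'k \<Rightarrow> complex^'k" and \<beta> :: "complex^'k \<Rightarrow> complex" and T :: "complex \<times> (complex^'k) \<Rightarrow> complex" and C
  where "hol \<Phi> 0" "\<Phi> 0 = 0" "hol \<beta> 0" "\<beta> 0 = of_real b" "hol T (0, 0)" "\<forall>x. T (x, 0) = x"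
    "\<forall>\<^sub>F \<eta> in nhds 0. \<Phi> (cj \<eta>) = cj (\<Phi> \<eta>) \<and> \<beta> (cj \<eta>) = cj (\<beta> \<eta>)"
    "\<forall>\<^sub>F q in nhds (0, 0). cc T q = T q"
    "\<forall>\<^sub>F q in nhds (0, 0). norm (X (T q, snd q)) \<le> C * norm (poly (cpoly \<iota> (\<Phi> (snd q))) (fst q))"
    "\<forall>\<^sub>F q in nhds (0, 0). poly (cpoly \<iota> (\<Phi> (snd q))) (fst q) = 0 \<longrightarrow>
       ddir X (T q, snd q) (1, 0) * (1 + \<beta> (snd q) * fst q ^ k) = poly (pderiv (cpoly \<iota> (\<Phi> (snd q)))) (fst q)"
    "\<forall>v. ddir \<Phi> 0 v = 0 \<longrightarrow> (\<lambda>z. ddir X (z, 0) (0, v)) \<in> bz k"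
proof -
  obtain r1 where r1: "r1 > 0" "\<And>q. q \<in> ball (0, 0) r1 \<Longrightarrow> hol X q"
    using hol_ball[OF hX] by (metis (no_types, lifting))
  define W where "W z = (1 + of_real b * z ^ k) * X (z, 0) - z ^ (k + 1)" for z
  have hW: "hol W 0" unfolding W_def by (intro hol_intros hol_slice1 hX)
  \<comment> \<open>Multiplying the leading terms of \<open>X\<close> by \<open>1 + b z ^ k\<close>
    leaves \<open>- b\<^sup>2 z ^ (3 * k + 1)\<close>, which has order at least
    \<open>2 * k + 2\<close> because \<open>k \<ge> 1\<close>.\<close>
  have Wb: "W \<in> bz (2 * k + 2)"
  proof -
    have "(\<lambda>z. (1 + of_real b * z ^ k) * (X (z, 0) - (z ^ (k + 1) - of_real b * z ^ (2 * k + 1)))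
        + (- of_real b * of_real b) * z ^ (3 * k + 1)) \<in> bz (2 * k + 2)"
    proof (intro bz_add bz_cmult power_in_bz_le)
      have "(\<lambda>z. 1 + of_real b * z ^ k) \<in> bz 0" by (intro bz_hol hol_intros)
      from bz_mult[OF this X0]
      show "(\<lambda>z. (1 + of_real b * z ^ k) * (X (z, 0) - (z ^ (k + 1) - of_real b * z ^ (2 * k + 1)))) \<in> bz (2 * k + 2)" unfolding add_0_left .
    qed (use k in simp)
    moreover have "(1 + of_real b * z ^ k) * (X (z, 0) - (z ^ (k + 1) - of_real b * z ^ (2 * k + 1)))
        + (- of_real b * of_real b) * z ^ (3 * k + 1) = W z" for z
    proof -
      have 1: "3 * k + 1 = k + k + k + 1" "2 * k + 1 = k + k + 1" by simp_all
      show ?thesis unfolding W_def 1 power_add by (simp add: algebra_simps)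
    qed
    ultimately show ?thesis by (simp only:)
  qed
  obtain V0 where V0: "hol V0 0" "\<forall>\<^sub>F z in nhds 0. W z = z ^ (2 * k + 2) * V0 z"
    using bz_factor[OF hW Wb] by blast
  obtain r2 where r2: "r2 > 0" "V0 holomorphic_on ball 0 r2" by (rule hol_complex_ball[OF V0(1)])
  obtain r3 where r3: "r3 > 0" "\<And>z. norm z < r3 \<Longrightarrow> W z = z ^ (2 * k + 2) * V0 z"
    using V0(2) by (auto simp: eventually_nhds_metric)
  define R' where "R' = min r1 (min r2 r3)"
  define R where "R = R' / 2"
  interpret moment_reduction \<iota> X b k R R' V0
  proof
    show "hol X (z, 0)" if "norm z < R'" for z
      by (rule r1(2)) (use that in \<open>simp add: R'_def dist_Pair_Pair\<close>)
    show "V0 holomorphic_on ball 0 R'" by (rule holomorphic_on_subset[OF r2(2)]) (auto simp: R'_def)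
    show "(1 + of_real b * z ^ k) * X (z, 0) - z ^ (k + 1) = (z ^ (k + 1))\<^sup>2 * V0 z" if "norm z < R'" for z
      using r3(2)[of z] that unfolding R'_def W_def square_power_Suc by simp
  qed (use index k cc_X X0 r1 r2 r3 in \<open>auto simp: R_def R'_def\<close>)
  obtain \<theta> where \<theta>: "hol \<theta> 0" "\<theta> 0 = (0, 0, of_real b)"
    "\<forall>\<^sub>F \<eta> in nhds 0. moment_map \<iota> X R (\<theta> \<eta>, \<eta>) = 0"
    "\<forall>\<^sub>F \<eta> in nhds 0. \<theta> (cj \<eta>) = cj (\<theta> \<eta>)"
    "\<forall>v. fst (ddir \<theta> 0 v) = 0 \<longrightarrow> (\<lambda>z. ddir X (z, 0) (0, v)) \<in> bz k"
    by (rule ex_solution)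
  obtain C where C: "\<forall>\<^sub>F \<eta> in nhds 0. \<exists>V. V holomorphic_on ball 0 R \<and> (\<forall>z\<in>ball 0 R. norm (V z) \<le> C \<and>
      reduction_error \<iota> X (z, (\<theta> \<eta>, \<eta>)) = poly (cpoly \<iota> (fst (\<theta> \<eta>))) z ^ 2 * V z)"
    by (rule factor_solution[OF \<theta>(1-3)])
  define \<Phi> where "\<Phi> \<eta> = fst (\<theta> \<eta>)" for \<eta>
  define t where "t \<eta> = fst (snd (\<theta> \<eta>))" for \<eta>
  define \<beta> where "\<beta> \<eta> = snd (snd (\<theta> \<eta>))" for \<eta>
  have \<theta>_eq: "\<theta> \<eta> = (\<Phi> \<eta>, t \<eta>, \<beta> \<eta>)" for \<eta> by (simp add: \<Phi>_def t_def \<beta>_def)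
  have h: "hol \<Phi> 0" "hol t 0" "hol \<beta> 0" unfolding \<Phi>_def t_def \<beta>_def by (intro hol_intros \<theta>(1))+
  have at0: "\<Phi> 0 = 0" "t 0 = 0" "\<beta> 0 = of_real b" by (simp_all add: \<Phi>_def t_def \<beta>_def \<theta>(2))
  define T where "T q = fst q + poly (shift_poly \<iota> (t (snd q))) (fst q)" for q
  define D where "D q = poly (cpoly \<iota> (\<Phi> (snd q))) (fst q)" for q
  define U where "U q = 1 + poly (pderiv (shift_poly \<iota> (t (snd q)))) (fst q)" for q
  define N where "N q = 1 + \<beta> (snd q) * fst q ^ k" for q
  have hT: "hol T (0, 0)" and hD: "hol D (0, 0)" and hU: "hol U (0, 0)" and hN: "hol N (0, 0)"
    unfolding T_def D_def U_def N_def
    by (intro hol_add hol_mult hol_power hol_const hol_fst' hol_cpoly hol_shift_poly hol_pderiv_shift_poly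
        h[THEN hol_snd_arg])+
  have T0: "T (x, 0) = x" for x by (simp add: T_def at0)
  hence T0': "\<forall>x. T (x, 0) = x" by blast
  have fact: "\<forall>\<^sub>F q in nhds (0 :: complex, 0). \<exists>V. V holomorphic_on ball 0 R \<and> (\<forall>z\<in>ball 0 R. norm (V z) \<le> C \<and>
      N (z, snd q) * X (T (z, snd q), snd q) = D (z, snd q) * (U (z, snd q) + D (z, snd q) * V z))"
    using eventually_snd[OF C, of "0::complex"]
  proof eventually_elim
    case (elim q)
    then obtain V where V: "V holomorphic_on ball 0 R" "\<And>z. z \<in> ball 0 R \<Longrightarrow> norm (V z) \<le> C"
      "\<And>z. z \<in> ball 0 R \<Longrightarrow> reduction_error \<iota> X (z, (\<theta> (snd q), snd q)) = poly (cpoly \<iota> (fst (\<theta> (snd q)))) z ^ 2 * V z"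
      by blast
    have "N (z, snd q) * X (T (z, snd q), snd q) = D (z, snd q) * (U (z, snd q) + D (z, snd q) * V z)" if "z \<in> ball 0 R" for z
    proof -
      have "N (z, snd q) * X (T (z, snd q), snd q) - U (z, snd q) * D (z, snd q) = D (z, snd q) ^ 2 * V z"
        using V(3)[OF that] by (simp add: \<theta>_eq reduction_error_def card N_def T_def U_def D_def)
      thus ?thesis by (simp add: algebra_simps power2_eq_square)
    qed
    thus ?case using V(1,2) by blast
  qed
  have small: "\<forall>\<^sub>F q in nhds (0, 0). norm (N q - 1) < 1 / 2 \<and> norm (U q - 1) < 1 \<and> norm (D q) < 1 \<and> fst q \<in> ball 0 R \<and> cdiff X (T q, snd q)"
  proof (intro eventually_conj)
    show "\<forall>\<^sub>F q in nhds (0, 0). norm (N q - 1) < 1 / 2"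
      by (rule isCont_eventually_norm_less, rule hol_isCont, rule hol_diff[OF hN hol_const])
        (use k in \<open>simp add: N_def power_0_left\<close>)
    show "\<forall>\<^sub>F q in nhds (0, 0). norm (U q - 1) < 1"
      by (rule isCont_eventually_norm_less, rule hol_isCont, rule hol_diff[OF hU hol_const]) (simp add: U_def at0)
    show "\<forall>\<^sub>F q in nhds (0, 0). norm (D q) < 1"
      by (rule isCont_eventually_norm_less, rule hol_isCont, rule hD) (simp add: D_def at0 cpoly_base)
    have "\<forall>\<^sub>F z in nhds 0. z \<in> ball (0::complex) R" by (rule eventually_nhds_in_open) (use R in auto)
    from eventually_fst[OF this]
    show "\<forall>\<^sub>F q in nhds (0, 0 :: complex^'k). fst q \<in> ball (0::complex) R" .
    have "isCont (\<lambda>q. (T q, snd q)) (0, 0)" by (intro hol_isCont hol_intros hT)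
    from isCont_nhds_0[OF this refl, of "cdiff X"] hX T0
    show "\<forall>\<^sub>F q in nhds (0, 0). cdiff X (T q, snd q)" by (simp add: hol_def)
  qed
  show ?thesis
  proof (rule that[OF h(1) at0(1) h(3) at0(3) hT T0'])
    show "\<forall>\<^sub>F \<eta> in nhds 0. \<Phi> (cj \<eta>) = cj (\<Phi> \<eta>) \<and> \<beta> (cj \<eta>) = cj (\<beta> \<eta>)"
      using \<theta>(4) by eventually_elim (simp add: \<theta>_eq)
    show "\<forall>\<^sub>F q in nhds (0, 0). cc T q = T q"
      using eventually_snd[OF \<theta>(4), of "0::complex"]
      by eventually_elim (simp add: \<theta>_eq cc_def T_def cnj_poly_shift_poly)
    \<comment> \<open>The constant comes from \<open>norm N \<ge> 1 / 2\<close>,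
      \<open>norm U \<le> 2\<close> and \<open>norm (D V) \<le> C\<close>.\<close>
    show "\<forall>\<^sub>F q in nhds (0, 0). norm (X (T q, snd q)) \<le> (2 * (2 + C)) * norm (poly (cpoly \<iota> (\<Phi> (snd q))) (fst q))"
      using fact small
    proof eventually_elim
      case (elim q)
      then obtain V where V: "norm (V (fst q)) \<le> C" "N q * X (T q, snd q) = D q * (U q + D q * V (fst q))"
        by (metis prod.collapse)
      have n: "norm (N q) \<ge> 1 / 2" using elim(2) norm_triangle_ineq2[of 1 "1 - N q"] by (simp add: norm_minus_commute)
      have u: "norm (U q) \<le> 2" using elim(2) norm_triangle_ineq[of "U q - 1" 1] by simp
      have C: "C \<ge> 0" using V(1) norm_ge_zero order_trans by blast
      have "norm (D q * V (fst q)) \<le> 1 * C" unfolding norm_mult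
        by (rule mult_mono) (use elim(2) V(1) in auto)
      hence "norm (U q + D q * V (fst q)) \<le> 2 + C" using u norm_triangle_ineq[of "U q" "D q * V (fst q)"] by linarith
      hence "norm (N q * X (T q, snd q)) \<le> norm (D q) * (2 + C)"
        unfolding V(2) norm_mult by (rule mult_left_mono) simp
      moreover have "1 / 2 * norm (X (T q, snd q)) \<le> norm (N q * X (T q, snd q))"
        unfolding norm_mult by (rule mult_right_mono[OF n]) simp
      ultimately show ?case by (simp add: D_def algebra_simps)
    qed
    show "\<forall>\<^sub>F q in nhds (0, 0). poly (cpoly \<iota> (\<Phi> (snd q))) (fst q) = 0 \<longrightarrow>
       ddir X (T q, snd q) (1, 0) * (1 + \<beta> (snd q) * fst q ^ k) = poly (pderiv (cpoly \<iota> (\<Phi> (snd q)))) (fst q)"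
      using fact small
    proof eventually_elim
      case (elim q)
      obtain z \<eta> where q: "q = (z, \<eta>)" by (cases q)
      obtain V where V: "V holomorphic_on ball 0 R"
        "\<And>z. z \<in> ball 0 R \<Longrightarrow> N (z, \<eta>) * X (T (z, \<eta>), \<eta>) = D (z, \<eta>) * (U (z, \<eta>) + D (z, \<eta>) * V z)"
        using elim(1) q by auto
      have z: "z \<in> ball 0 R" using elim(2) q by simp
      show ?case
      proof
        assume "poly (cpoly \<iota> (\<Phi> (snd q))) (fst q) = 0"
        hence D0: "D (z, \<eta>) = 0" by (simp add: D_def q)
        have N0: "N (z, \<eta>) \<noteq> 0" and U0: "U (z, \<eta>) \<noteq> 0" using elim(2) q by auto
        have X0: "X (T (z, \<eta>), \<eta>) = 0" using V(2)[OF z] D0 N0 by simp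
        have dT: "((\<lambda>z. T (z, \<eta>)) has_field_derivative U (z, \<eta>)) (at z)"
          unfolding T_def U_def by (auto intro!: derivative_eq_intros poly_DERIV)
        have "((\<lambda>x. X (x, \<eta>)) has_field_derivative ddir X (T (z, \<eta>), \<eta>) (1, 0)) (at (T (z, \<eta>)))"
          by (rule cdiff_slice) (use elim(2) q in simp)
        from DERIV_chain2[OF this dT]
        have dX: "((\<lambda>z. X (T (z, \<eta>), \<eta>)) has_field_derivative ddir X (T (z, \<eta>), \<eta>) (1, 0) * U (z, \<eta>)) (at z)" .
        \<comment> \<open>Only the existence of \<open>N'\<close> matters, as its cofactor
          \<open>X\<close> vanishes at the root.\<close>
        obtain N' where dN: "((\<lambda>z. N (z, \<eta>)) has_field_derivative N') (at z)"
        proof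
          show "((\<lambda>z. N (z, \<eta>)) has_field_derivative \<beta> \<eta> * (of_nat k * (1 * z ^ (k - Suc 0)))) (at z)"
            unfolding N_def by (auto intro!: derivative_eq_intros)
        qed
        have L: "((\<lambda>z. N (z, \<eta>) * X (T (z, \<eta>), \<eta>)) has_field_derivative N (z, \<eta>) * (ddir X (T (z, \<eta>), \<eta>) (1, 0) * U (z, \<eta>))) (at z)"
          by (rule DERIV_cong[OF DERIV_mult[OF dN dX]]) (simp add: X0)
        have dD: "((\<lambda>z. D (z, \<eta>)) has_field_derivative poly (pderiv (cpoly \<iota> (\<Phi> \<eta>))) z) (at z)"
          unfolding D_def by (simp add: poly_DERIV)
        have "(\<lambda>z. U (z, \<eta>) + D (z, \<eta>) * V z) holomorphic_on ball 0 R"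
          unfolding U_def D_def by (auto intro!: holomorphic_intros V(1))
        from holomorphic_derivI[OF this open_ball z]
        obtain u' where u': "((\<lambda>z. U (z, \<eta>) + D (z, \<eta>) * V z) has_field_derivative u') (at z)" by blast
        have "((\<lambda>z. D (z, \<eta>) * (U (z, \<eta>) + D (z, \<eta>) * V z)) has_field_derivative poly (pderiv (cpoly \<iota> (\<Phi> \<eta>))) z * U (z, \<eta>)) (at z)"
          by (rule DERIV_cong[OF DERIV_mult[OF dD u']]) (simp add: D0)
        hence "((\<lambda>z. N (z, \<eta>) * X (T (z, \<eta>), \<eta>)) has_field_derivative poly (pderiv (cpoly \<iota> (\<Phi> \<eta>))) z * U (z, \<eta>)) (at z)"
          by (rule has_field_derivative_transform_within_open[OF _ open_ball z]) (use V(2) in auto)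
        from DERIV_unique[OF L this] U0
        show "ddir X (T q, snd q) (1, 0) * (1 + \<beta> (snd q) * fst q ^ k) = poly (pderiv (cpoly \<iota> (\<Phi> (snd q)))) (fst q)"
          by (simp add: q N_def mult_ac)
      qed
    qed
    show "\<forall>v. ddir \<Phi> 0 v = 0 \<longrightarrow> (\<lambda>z. ddir X (z, 0) (0, v)) \<in> bz k"
    proof (intro allI impI \<theta>(5)[rule_format])
      fix v assume that: "ddir \<Phi> 0 v = 0"
      have "ddir \<Phi> 0 v = fst (ddir \<theta> 0 v)"
        unfolding \<Phi>_def using ddir_eq[OF has_derivative_fst[OF cdiff_has_derivative[OF hol_imp_cdiff[OF \<theta>(1)]]]] by simp
      thus "fst (ddir \<theta> 0 v) = 0" using that by simp
    qed
  qed
qed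

section \<open>Distributing the multiplier\<close>

lemma eventually_pullback:
  fixes m :: "complex \<times> 'p::cvec \<Rightarrow> complex"
  assumes "hol m (0, 0)" "m (0, 0) = 0" "\<forall>\<^sub>F q in nhds (0, 0). P q"
  shows "\<forall>\<^sub>F q in nhds (0, 0). P (m q, snd q)"
  by (rule isCont_nhds_0[OF hol_isCont[OF hol_pair_arg[OF assms(1)]] _ assms(3)]) (simp add: assms(2))

text \<open>The germs of \<open>Ln (1 + u) / u\<close> and \<open>(exp z - 1) / z\<close> are
  combined, so that \<open>s\<close> is holomorphic at \<open>u = 0\<close>. The displacement
  \<open>e * s (e')\<close> then vanishes with \<open>e\<close>, and at such a point it changes the
  derivative of the chart from 1 to \<open>(1 + e')\<close> to the power -1/2.\<close>

lemma inverse_sqrt_factor: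
  obtains s where "hol s 0" "\<forall>\<^sub>F u in nhds 0. 1 + u * s u = exp (- Ln (1 + u) / 2)" "(\<lambda>u. s u + 1 / 2) \<in> bz 1"
proof -
  obtain L where L: "hol L 0" "L 0 = 1" "\<forall>\<^sub>F u in nhds 0. Ln (1 + u) = u * L u" by (rule Ln_factor)
  have he: "hol (\<lambda>z. exp z) (z::complex)" for z by (rule hol_complex[of UNIV]) (auto intro: holomorphic_intros)
  have "deriv (\<lambda>z::complex. exp z - 1) 0 = 1"
    by (rule DERIV_imp_deriv) (auto intro!: derivative_eq_intros)
  have "hol (\<lambda>z. exp z - 1) (0::complex)" by (intro hol_intros he)
  moreover from this have "(\<lambda>z. exp z - 1) \<in> bz 1" by (rule bz_hol1) simp
  ultimately obtain E where E: "hol E 0" "\<forall>\<^sub>F z in nhds (0::complex). exp z - 1 = z ^ 1 * E z" by (rule bz_factor)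
  have E0: "E 0 = 1"
  proof -
    have d: "(E has_field_derivative deriv E 0) (at 0)"
      using hol_field_differentiable[OF E(1)] by (simp add: DERIV_deriv_iff_field_differentiable)
    have "((\<lambda>z. z ^ 1 * E z) has_field_derivative E 0) (at 0)"
      by (rule derivative_eq_intros d refl)+ simp
    hence "deriv (\<lambda>z. z ^ 1 * E z) 0 = E 0" by (rule DERIV_imp_deriv)
    with deriv_cong_nhds[OF E(2)] show ?thesis
      using \<open>deriv (\<lambda>z::complex. exp z - 1) 0 = 1\<close> by simp
  qed
  define m where "m u = - (u * L u) / 2" for u
  have hm: "hol m 0" unfolding m_def by (intro hol_intros L) simp
  have m0: "m 0 = 0" by (simp add: m_def)
  define s where "s u = - L u * E (m u) / 2" for u
  have hEm: "hol (\<lambda>u. E (m u)) 0" by (rule hol_compose) (use E(1) hm m0 in auto)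
  have hs: "hol s 0" unfolding s_def by (intro hol_intros L hEm) simp
  show ?thesis
  proof (rule that[OF hs])
    show "\<forall>\<^sub>F u in nhds 0. 1 + u * s u = exp (- Ln (1 + u) / 2)"
      using L(3) isCont_nhds_0[OF hol_isCont[OF hm] m0 E(2)]
    proof eventually_elim
      case (elim u)
      have "exp (- Ln (1 + u) / 2) - 1 = m u * E (m u)" using elim by (simp add: m_def)
      thus ?case by (simp add: s_def m_def algebra_simps)
    qed
    show "(\<lambda>u. s u + 1 / 2) \<in> bz 1"
      by (rule bz_hol1[OF hol_add[OF hs hol_const]]) (simp add: s_def m0 E0 L)
  qed
qed

lemma bz_power_diff:
  assumes "a \<in> bz 1" "b \<in> bz 1" "(\<lambda>x. a x - b x) \<in> bz 2"
  shows "(\<lambda>x. a x ^ n - b x ^ n) \<in> bz (n + 1)"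
proof (induction n)
  case (Suc n)
  have 1: "(\<lambda>x. a x * (a x ^ n - b x ^ n)) \<in> bz (1 + (n + 1))" by (rule bz_mult[OF assms(1) Suc])
  have 2: "(\<lambda>x. (a x - b x) * b x ^ n) \<in> bz (2 + 1 * n)" by (rule bz_mult[OF assms(3) bz_power[OF assms(2)]])
  have "(\<lambda>x. a x * (a x ^ n - b x ^ n) + (a x - b x) * b x ^ n) \<in> bz (Suc n + 1)"
    by (intro bz_add bz_mono[OF 1] bz_mono[OF 2]) auto
  thus ?case by (simp add: algebra_simps)
qed simp

text \<open>A change of argument of order 2 multiplies the leading term by \<open>1 + O(x)\<close>,
  so it is felt only at order \<open>n + 1\<close>.\<close>

lemma bz_leading_diff:
  assumes "(\<lambda>x. f x - c * x ^ n) \<in> bz (n + 1)" "a \<in> bz 1" "b \<in> bz 1" "(\<lambda>x. a x - b x) \<in> bz 2"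
  shows "(\<lambda>x. f (a x) - f (b x)) \<in> bz (n + 1)"
proof -
  have "(\<lambda>x. (f (a x) - c * a x ^ n) - (f (b x) - c * b x ^ n) + c * (a x ^ n - b x ^ n)) \<in> bz (n + 1)"
    by (intro bz_add bz_diff bz_cmult bz_compose[OF assms(1)] assms bz_power_diff)
  thus ?thesis by (simp add: algebra_simps)
qed

text \<open>At a root let \<open>L1\<close> be the logarithm of \<open>1 + e'\<close> at the point
  and \<open>L2\<close> the conjugate of that at the mirror point. The source chart contributes
  \<open>exp (- L1 / 2)\<close>, the map \<open>exp L1\<close>, and the target chart the inverse of
  \<open>exp (- L2 / 2)\<close>. The result \<open>exp ((L1 + L2) / 2)\<close> takes conjugate
  values at the two points.\<close>

lemma symmetric_multiplier_chart:
  fixes g B e X T D :: "complex \<times> 'p::cvec \<Rightarrow> complex"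
  assumes k: "k \<ge> 1" and B: "hol B (0, 0)" "B (0, 0) = 0" "ddir B (0, 0) (1, 0) = 1"
    and he: "hol e (0, 0)"
    and gB: "\<forall>\<^sub>F q in nhds (0, 0). g (B q, snd q) = cc B (fst q + e q, snd q)"
    and comp: "\<forall>\<^sub>F q in nhds (0, 0). norm (cc e q - e q) \<le> norm (e q) / 4"
    and eE: "(\<lambda>x. e (x, 0) - x ^ (k + 1) / 2) \<in> bz (k + 2)"
    and eX: "\<forall>\<^sub>F q in nhds (0, 0). norm (e q) \<le> norm (X q)"
    and dX: "\<forall>\<^sub>F q in nhds (0, 0). e q = 0 \<longrightarrow>
        ddir X q (1, 0) = Ln (1 + ddir e q (1, 0)) + cnj (Ln (1 + ddir e (cj q) (1, 0)))"
    and hT: "hol T (0, 0)" and T0: "\<And>x. T (x, 0) = x" and cT: "\<forall>\<^sub>F q in nhds (0, 0). cc T q = T q"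
    and XD: "\<forall>\<^sub>F q in nhds (0, 0). norm (X (T q, snd q)) \<le> C * norm (D q)"
    and D0: "\<And>x. D (x, 0) = x ^ (k + 1)"
  obtains gF Kc H C' where "hol gF (0, 0)" "gF (0, 0) = 0" "hol Kc (0, 0)" "Kc (0, 0) = 0" "hol H (0, 0)" "H (0, 0) = 0"
    "\<forall>\<^sub>F q in nhds (0, 0). cc Kc (H q, snd q) = fst q"
    "\<forall>\<^sub>F q in nhds (0, 0). H (cc Kc q, snd q) = fst q"
    "\<forall>\<^sub>F q in nhds (0, 0). H (g (Kc q, snd q), snd q) = gF q"
    "\<forall>\<^sub>F q in nhds (0, 0). norm (gF q - fst q) \<le> C' * norm (D q)"
    "\<forall>\<^sub>F q in nhds (0, 0). D q = 0 \<longrightarrow> ddir gF q (1, 0) = exp (ddir X (T q, snd q) (1, 0) / 2)"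
    "(\<lambda>x. gF (x, 0) - x - x ^ (k + 1) / 2) \<in> bz (k + 2)"
proof -
  obtain s where s: "hol s 0" "\<forall>\<^sub>F u in nhds 0. 1 + u * s u = exp (- Ln (1 + u) / 2)" "(\<lambda>u. s u + 1 / 2) \<in> bz 1"
    by (rule inverse_sqrt_factor)
  define \<epsilon> where "\<epsilon> x = e (x, 0)" for x
  have h\<epsilon>: "hol \<epsilon> 0" unfolding \<epsilon>_def by (rule hol_slice1[OF he])
  have \<epsilon>b: "\<epsilon> \<in> bz (k + 1)"
  proof -
    have "(\<lambda>x. (\<epsilon> x - x ^ (k + 1) / 2) + (1 / 2) * x ^ (k + 1)) \<in> bz (k + 1)"
      unfolding \<epsilon>_def by (intro bz_add bz_cmult power_in_bz bz_mono[OF eE]) simp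
    thus ?thesis by simp
  qed
  have e0: "e (0, 0) = 0" using \<epsilon>b bz_at_0[of \<epsilon> k] by (simp add: \<epsilon>_def)
  define de where "de q = ddir e q (1, 0)" for q
  have hde: "hol de (0, 0)" unfolding de_def by (rule hol_ddir[OF he])
  have d\<epsilon>: "deriv \<epsilon> \<in> bz k" by (rule bz_deriv[OF h\<epsilon>]) (use \<epsilon>b in simp)
  have de\<epsilon>: "\<forall>\<^sub>F x in nhds 0. de (x, 0) = deriv \<epsilon> x"
    unfolding de_def \<epsilon>_def[abs_def] by (rule hol_ddir_slice[OF he])
  have "(\<lambda>x. de (x, 0)) \<in> bz k"
    by (rule bz_cong[OF d\<epsilon>]) (use de\<epsilon> in eventually_elim, simp)
  hence deb: "(\<lambda>x. de (x, 0)) \<in> bz 1" using bz_mono k by blast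
  have de0: "de (0, 0) = 0" using deb bz_at_0[of "\<lambda>x. de (x, 0)" 0] by simp
  have hsde: "hol (\<lambda>q. s (de q)) (0, 0)" by (rule hol_compose[of s de]) (use s hde de0 in auto)
  define v where "v q = e q * s (de q)" for q
  have hv: "hol v (0, 0)" unfolding v_def by (intro hol_intros he hsde)
  have v0: "v (0, 0) = 0" by (simp add: v_def e0)
  have hcv: "hol (cc v) (0, 0)" by (rule hol_cc) (use hv in simp)
  have cv0: "cc v (0, 0) = 0" by (simp add: cc_def v0)
  define S where "S q = fst q + v q" for q
  have hS: "hol S (0, 0)" unfolding S_def by (intro hol_add hol_fst' hv)
  have S0: "S (0, 0) = 0" by (simp add: S_def v0)
  have hcS: "hol (cc S) (0, 0)" by (rule hol_cc) (use hS in simp)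
  have cS: "cc S q = fst q + cc v q" for q by (simp add: cc_def S_def)
  have cS0: "cc S (0, 0) = 0" by (simp add: cS cv0)
  \<comment> \<open>\<open>SC\<close> is the chart in the coordinate itself; \<open>ST\<close> is
    the same chart read in the conjugate variable, the argument of a holomorphic representative of
    an antiholomorphic map.\<close>
  define ST where "ST q = S (T q, snd q)" for q
  define SC where "SC q = cc S (T q, snd q)" for q
  have hST: "hol ST (0, 0)" unfolding ST_def by (rule hol_comp_pair) (use hS hT T0 in auto)
  have hSC: "hol SC (0, 0)" unfolding SC_def by (rule hol_comp_pair) (use hcS hT T0 in auto)
  have ST0: "ST (0, 0) = 0" and SC0: "SC (0, 0) = 0" by (simp_all add: ST_def SC_def T0 S0 cS0)
  have ddT: "ddir T (0, 0) (1, 0) = 1"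
    using ddir_slice1[OF hol_imp_cdiff[OF hT]] by (simp add: T0)
  have vroot: "\<forall>\<^sub>F q in nhds (0, 0). e q = 0 \<longrightarrow> cdiff v q \<and> ddir v q (1, 0) = exp (- Ln (1 + de q) / 2) - 1"
  proof -
    have 1: "\<forall>\<^sub>F q in nhds (0, 0). cdiff e q" "\<forall>\<^sub>F q in nhds (0, 0). cdiff v q"
      "\<forall>\<^sub>F q in nhds (0, 0). cdiff (\<lambda>q. s (de q)) q"
      using he hv hsde by (auto simp: hol_def)
    have "\<forall>\<^sub>F q in nhds (0, 0). 1 + de q * s (de q) = exp (- Ln (1 + de q) / 2)"
      by (rule isCont_nhds_0[OF hol_isCont[OF hde] de0 s(2)])
    with 1 show ?thesis
    proof eventually_elim
      case (elim q)
      show ?case using elim ddir_mult_fun[OF elim(1) elim(3), of "(1, 0)"]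
        by (auto simp: v_def[abs_def] de_def algebra_simps)
    qed
  qed
  have "\<forall>\<^sub>F q in nhds (cj (0, 0)). e q = 0 \<longrightarrow> cdiff v q \<and> ddir v q (1, 0) = exp (- Ln (1 + de q) / 2) - 1"
    using vroot by simp
  from eventually_nhds_cj[OF this] comp
  have cvroot: "\<forall>\<^sub>F q in nhds (0, 0). e q = 0 \<longrightarrow> cdiff (cc v) q \<and> cc e q = 0 \<and> ddir (cc v) q (1, 0) = cnj (exp (- Ln (1 + de (cj q)) / 2)) - 1"
    (is "\<forall>\<^sub>F q in _. ?c q")
  proof eventually_elim
    case (elim q)
    show "?c q"
    proof
      assume "e q = 0"
      hence ce: "cc e q = 0" using elim(2) by simp
      hence "e (cj q) = 0" by (simp add: cc_def)
      hence v: "cdiff v (cj q)" "ddir v (cj q) (1, 0) = exp (- Ln (1 + de (cj q)) / 2) - 1" using elim(1) by auto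
      show "cdiff (cc v) q \<and> cc e q = 0 \<and> ddir (cc v) q (1, 0) = cnj (exp (- Ln (1 + de (cj q)) / 2)) - 1"
        using cdiff_conj(1)[OF v(1)] ddir_cc[OF v(1), of "(1, 0)"] v(2) ce by (simp add: cc_def[abs_def])
    qed
  qed
  have dcv0: "ddir (cc v) (0, 0) (1, 0) = 0"
  proof -
    from eventually_nhds_x_imp_x[OF cvroot] e0
    have "ddir (cc v) (0, 0) (1, 0) = cnj (exp (- Ln (1 + de (cj (0, 0))) / 2)) - 1" by blast
    thus ?thesis by (simp add: de0)
  qed
  have ddSC: "ddir SC (0, 0) (1, 0) = 1"
  proof -
    have "ddir (cc S) (0, 0) (1, 0) = ddir fst (0, 0 :: 'p) (1, 0) + ddir (cc v) (0, 0) (1, 0)"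
      unfolding cS[abs_def] by (rule ddir_add_fun) (auto intro: hol_imp_cdiff hol_fst' hcv)
    hence "ddir (cc S) (0, 0) (1, 0) = 1" by (simp add: dcv0)
    moreover have "ddir SC (0, 0) (1, 0) = ddir (cc S) (T (0, 0), 0) (ddir T (0, 0) (1, 0), 0)"
      unfolding SC_def using ddir_comp_pair[of "cc S" T "(0, 0)" "(1, 0)"] hcS hT T0 hol_imp_cdiff by auto
    ultimately show ?thesis by (simp add: T0 ddT)
  qed
  obtain J where J: "hol J (0, 0)" "J (0, 0) = 0"
    "\<forall>\<^sub>F q in nhds (0, 0). SC (J q, snd q) = fst q" "\<forall>\<^sub>F q in nhds (0, 0). J (SC q, snd q) = fst q"
  proof (rule hol_partial_inverse[OF hSC])
    fix c :: complex assume "ddir SC (0, 0) (c, 0) = 0"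
    thus "c = 0" using ddir_fst_direction[OF hol_imp_cdiff[OF hSC], of c 0] ddSC
      by (simp add: ddir_zero[OF hol_imp_cdiff[OF hSC], unfolded zero_prod_def])
  qed (auto simp: SC0)
  define w where "w q = ST q + e (ST q, snd q)" for q
  have heST: "hol (\<lambda>q. e (ST q, snd q)) (0, 0)" by (rule hol_comp_pair) (use he hST ST0 in auto)
  have hw: "hol w (0, 0)" unfolding w_def by (intro hol_add hST heST)
  have w0: "w (0, 0) = 0" by (simp add: w_def ST0 e0)
  define gF where "gF q = J (w q, snd q)" for q
  have hgF: "hol gF (0, 0)" unfolding gF_def by (rule hol_comp_pair) (use J hw w0 in auto)
  have gF0: "gF (0, 0) = 0" by (simp add: gF_def w0 J)
  have gFeq: "\<forall>\<^sub>F q in nhds (0, 0). SC (gF q, snd q) = w q"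
    using eventually_pullback[OF hw w0 J(3)] by (simp add: gF_def)
  define Kc where "Kc q = B (ST q, snd q)" for q
  have hKc: "hol Kc (0, 0)" unfolding Kc_def by (rule hol_comp_pair) (use B hST ST0 in auto)
  have Kc0: "Kc (0, 0) = 0" by (simp add: Kc_def ST0 B)
  have hcK: "hol (cc Kc) (0, 0)" by (rule hol_cc) (use hKc in simp)
  have cK0: "cc Kc (0, 0) = 0" by (simp add: cc_def Kc0)
  have hcB: "hol (cc B) (0, 0)" by (rule hol_cc) (use B in simp)
  \<comment> \<open>\<open>T\<close> commutes with conjugation, so conjugating \<open>Kc\<close>
    replaces \<open>ST\<close> by \<open>SC\<close>.\<close>
  have cKeq: "\<forall>\<^sub>F q in nhds (0, 0). cc Kc q = cc B (SC q, snd q)"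
    using cT
  proof eventually_elim
    case (elim q)
    have "cnj (cnj (T (cj q))) = cnj (T q)" using elim by (simp add: cc_def)
    thus ?case by (simp add: cc_def Kc_def ST_def SC_def)
  qed
  have dcK: "ddir (cc Kc) (0, 0) (1, 0) = 1"
  proof -
    have "ddir (cc Kc) (0, 0) (1, 0) = ddir (\<lambda>q. cc B (SC q, snd q)) (0, 0) (1, 0)"
      by (rule fun_cong[OF ddir_cong[OF cKeq hol_imp_cdiff[OF hcK]]])
    also have "\<dots> = ddir (cc B) (SC (0, 0), 0) (ddir SC (0, 0) (1, 0), 0)"
      using ddir_comp_pair[of "cc B" SC "(0, 0)" "(1, 0)"] hcB hSC SC0 hol_imp_cdiff by auto
    also have "\<dots> = cj (ddir B (0, 0) (1, 0))"
      using ddir_cc[of B "(0, 0)" "(1, 0)"] hol_imp_cdiff[OF B(1)] by (simp add: SC0 ddSC)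
    finally show ?thesis by (simp add: B)
  qed
  obtain H where H: "hol H (0, 0)" "H (0, 0) = 0"
    "\<forall>\<^sub>F q in nhds (0, 0). cc Kc (H q, snd q) = fst q" "\<forall>\<^sub>F q in nhds (0, 0). H (cc Kc q, snd q) = fst q"
  proof (rule hol_partial_inverse[OF hcK])
    fix c :: complex assume "ddir (cc Kc) (0, 0) (c, 0) = 0"
    thus "c = 0" using ddir_fst_direction[OF hol_imp_cdiff[OF hcK], of c 0] dcK
      by (simp add: ddir_zero[OF hol_imp_cdiff[OF hcK], unfolded zero_prod_def])
  qed (auto simp: cK0)
  have root: "\<forall>\<^sub>F q in nhds (0, 0). D q = 0 \<longrightarrow> e (T q, snd q) = 0"
    using XD eventually_pullback[OF hT T0 eX] by eventually_elim auto
  obtain C' where C': "\<forall>\<^sub>F q in nhds (0, 0). norm (gF q - fst q) \<le> C' * norm (D q)"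
  proof -
    obtain r1 where r1: "r1 > 0" "\<And>x y. x \<in> ball (0, 0) r1 \<Longrightarrow> y \<in> ball (0, 0) r1 \<Longrightarrow>
        norm (J x - J y - ddir J (0, 0) (x - y)) \<le> 1 * norm (x - y)"
      using hol_lipschitz[OF J(1), of 1] by auto
    obtain r2 where r2: "r2 > 0" "\<And>x y. x \<in> ball (0, 0) r2 \<Longrightarrow> y \<in> ball (0, 0) r2 \<Longrightarrow>
        norm (e x - e y - ddir e (0, 0) (x - y)) \<le> 1 * norm (x - y)"
      using hol_lipschitz[OF he, of 1] by auto
    define j where "j = norm (ddir J (0, 0) (1, 0)) + 1"
    have nb: "\<forall>\<^sub>F q in nhds (0, 0 :: 'p). q \<in> ball (0 :: complex, 0 :: 'p) r" if "r > 0" for r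
      by (rule eventually_nhds_in_open) (use that in auto)
    have bs: "\<forall>\<^sub>F q in nhds (0, 0). norm (s (de q)) < norm (s 0) + 1"
      by (rule isCont_eventually_norm_less[OF hol_isCont[OF hsde]]) (simp add: de0)
    have "\<forall>\<^sub>F q in nhds (cj (0, 0)). norm (s (de q)) < norm (s 0) + 1" using bs by simp
    from eventually_nhds_cj[OF this] have bcs: "\<forall>\<^sub>F q in nhds (0, 0). norm (s (de (cj q))) < norm (s 0) + 1" .
    define m where "m = norm (s 0) + 1"
    have m: "m > 0" by (simp add: m_def add_nonneg_pos)
    have j0: "j \<ge> 0" by (simp add: j_def)
    \<comment> \<open>\<open>gF q - fst q\<close> is \<open>J\<close> at \<open>w q\<close> minus
      \<open>J\<close> at \<open>SC q\<close>. The factors \<open>m\<close>, \<open>2 * m\<close>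
      and \<open>1 + m\<close> bound \<open>v\<close>, \<open>cc v\<close> and \<open>e\<close> at
      the displaced point in terms of \<open>e\<close>, and \<open>j\<close> is the Lipschitz
      constant of \<open>J\<close>; finally \<open>e\<close> is bounded by \<open>X\<close>, and
      \<open>X\<close> by \<open>D\<close>.\<close>
    have "\<forall>\<^sub>F q in nhds (0, 0). norm (gF q - fst q) \<le> (j * (m + 2 * m + (1 + m))) * (C * norm (D q))"
      using eventually_pullback[OF hw w0 nb[OF r1(1)]] eventually_pullback[OF hSC SC0 nb[OF r1(1)]]
        eventually_pullback[OF hST ST0 nb[OF r2(1)]] eventually_pullback[OF hT T0 nb[OF r2(1)]]
        J(4) eventually_pullback[OF hT T0 bs] eventually_pullback[OF hT T0 bcs]
        eventually_pullback[OF hT T0 comp] eventually_pullback[OF hT T0 eX] XD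
    proof eventually_elim
      case (elim q)
      let ?y = "(T q, snd q)"
      have v1: "norm (v ?y) \<le> norm (e ?y) * m"
        unfolding v_def norm_mult m_def using elim(6) by (intro mult_left_mono) auto
      have ce: "norm (cc e ?y) \<le> 2 * norm (e ?y)"
        using norm_triangle_ineq[of "cc e ?y - e ?y" "e ?y", unfolded diff_add_cancel] elim(8) norm_ge_zero[of "e ?y"]
        by linarith
      have "cc v ?y = cc e ?y * cnj (s (de (cj ?y)))" by (simp add: cc_def v_def)
      hence "norm (cc v ?y) = norm (cc e ?y) * norm (s (de (cj ?y)))" by (simp add: norm_mult)
      also have "\<dots> \<le> (2 * norm (e ?y)) * m"
        unfolding m_def using elim(7) ce by (intro mult_mono) auto
      finally have v2: "norm (cc v ?y) \<le> 2 * m * norm (e ?y)" by (simp add: mult_ac)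
      have "ddir e (0, 0) (c, 0) = 0" for c
        using ddir_fst_direction[OF hol_imp_cdiff[OF he], of c 0] de0
        by (simp add: de_def ddir_zero[OF hol_imp_cdiff[OF he], unfolded zero_prod_def])
      hence "norm (e (ST q, snd q) - e ?y) \<le> norm (ST q - T q)"
        using r2(2)[OF elim(3,4)] by (simp add: norm_Pair)
      also have "ST q - T q = v ?y" by (simp add: ST_def S_def)
      finally have e1: "norm (e (ST q, snd q)) \<le> norm (e ?y) + norm (v ?y)"
        using norm_triangle_ineq2[of "e (ST q, snd q)" "e ?y"] by linarith
      have "w q - SC q = v ?y - cc v ?y + e (ST q, snd q)"
        by (simp add: w_def ST_def S_def SC_def cS)
      hence "norm (w q - SC q) \<le> norm (v ?y) + norm (cc v ?y) + norm (e (ST q, snd q))"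
        by (metis norm_triangle_ineq4 norm_triangle_ineq add_right_mono order_trans)
      also have "\<dots> \<le> norm (e ?y) * m + 2 * m * norm (e ?y) + (norm (e ?y) + norm (e ?y) * m)"
        using v1 v2 e1 by linarith
      finally have ws: "norm (w q - SC q) \<le> (m + 2 * m + (1 + m)) * norm (e ?y)" by (simp add: algebra_simps)
      have "norm (gF q - fst q - ddir J (0, 0) (w q - SC q, 0)) \<le> norm (w q - SC q)"
        using r1(2)[OF elim(1,2)] elim(5) by (simp add: gF_def norm_Pair)
      moreover have "ddir J (0, 0) (w q - SC q, 0) = (w q - SC q) * ddir J (0, 0) (1, 0)"
        using ddir_fst_direction[OF hol_imp_cdiff[OF J(1)], of "w q - SC q" 0]
        by (simp add: ddir_zero[OF hol_imp_cdiff[OF J(1)], unfolded zero_prod_def])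
      hence "norm (ddir J (0, 0) (w q - SC q, 0)) = norm (w q - SC q) * norm (ddir J (0, 0) (1, 0))" by (simp add: norm_mult)
      ultimately have "norm (gF q - fst q) \<le> norm (w q - SC q) + norm (w q - SC q) * norm (ddir J (0, 0) (1, 0))"
        using norm_triangle_ineq[of "gF q - fst q - ddir J (0, 0) (w q - SC q, 0)" "ddir J (0, 0) (w q - SC q, 0)"] by simp
      also have "\<dots> = j * norm (w q - SC q)" by (simp add: j_def algebra_simps)
      also have "\<dots> \<le> j * ((m + 2 * m + (1 + m)) * norm (e ?y))"
        by (rule mult_left_mono[OF ws j0])
      also have "\<dots> = (j * (m + 2 * m + (1 + m))) * norm (e ?y)" by simp
      also have "\<dots> \<le> (j * (m + 2 * m + (1 + m))) * (C * norm (D q))"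
        using elim(9,10) j0 m by (intro mult_left_mono) auto
      finally show ?case .
    qed
    thus ?thesis by (intro that[of "(j * (m + 2 * m + (1 + m))) * C"]) (simp add: mult.assoc)
  qed
  show ?thesis
  proof (rule that[OF hgF gF0 hKc Kc0 H _ C'])
    show "\<forall>\<^sub>F q in nhds (0, 0). H (g (Kc q, snd q), snd q) = gF q"
      using eventually_pullback[OF hST ST0 gB] gFeq eventually_pullback[OF hgF gF0 cKeq]
        eventually_pullback[OF hgF gF0 H(4)]
      by eventually_elim (simp add: Kc_def w_def)
    show "\<forall>\<^sub>F q in nhds (0, 0). D q = 0 \<longrightarrow> ddir gF q (1, 0) = exp (ddir X (T q, snd q) (1, 0) / 2)"
    proof -
      \<comment> \<open>The derivative of \<open>T\<close> enters both charts and is cancelled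
        below, so it has to be nonzero.\<close>
      have "\<forall>\<^sub>F q in nhds (0, 0). norm (ddir T q (1, 0) - 1) < 1"
        by (rule isCont_eventually_norm_less, rule hol_isCont, rule hol_diff[OF hol_ddir[OF hT] hol_const]) (simp add: ddT)
      hence dT: "\<forall>\<^sub>F q in nhds (0, 0). ddir T q (1, 0) \<noteq> 0" by eventually_elim auto
      have cd: "\<forall>\<^sub>F q in nhds (0, 0). cdiff T q" "\<forall>\<^sub>F q in nhds (0, 0). cdiff e q" "\<forall>\<^sub>F q in nhds (0, 0). cdiff gF q"
        "\<forall>\<^sub>F q in nhds (0, 0). cdiff ST q" "\<forall>\<^sub>F q in nhds (0, 0). cdiff SC q"
        using hT he hgF hST hSC by (auto simp: hol_def)
      have gFeq': "\<forall>\<^sub>F q in nhds (0, 0). \<forall>\<^sub>F p in nhds q. SC (gF p, snd p) = w p"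
        using gFeq by (simp add: eventually_eventually)
      have de1: "\<forall>\<^sub>F q in nhds (0, 0). 1 + de q \<noteq> 0"
      proof -
        have "\<forall>\<^sub>F q in nhds (0, 0). norm (de q) < 1"
          by (rule isCont_eventually_norm_less[OF hol_isCont[OF hde]]) (simp add: de0)
        thus ?thesis by eventually_elim (auto simp: add_eq_0_iff)
      qed
      show ?thesis
        using root C' dT cd(1) eventually_pullback[OF hT T0 cd(2)] cd(3-5) gFeq'
          eventually_pullback[OF hT T0 vroot] eventually_pullback[OF hT T0 cvroot]
          eventually_pullback[OF hT T0 dX] eventually_pullback[OF hT T0 de1]
      proof eventually_elim
        case (elim q)
        show ?case
        proof
          assume D: "D q = 0"
          let ?y = "(T q, snd q)"
          define L1 where "L1 = Ln (1 + de ?y)"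
          define L2 where "L2 = cnj (Ln (1 + de (cj ?y)))"
          have e: "e ?y = 0" using elim(1) D by simp
          have gq: "gF q = fst q" using elim(2) D by simp
          have dv: "cdiff v ?y" "ddir v ?y (1, 0) = exp (- L1 / 2) - 1"
            and dcv: "cdiff (cc v) ?y" "ddir (cc v) ?y (1, 0) = exp (- L2 / 2) - 1"
            using elim(10,11) e by (auto simp: L1_def L2_def exp_cnj)
          have STy: "ST q = T q" using e by (simp add: ST_def S_def v_def)
          have fstd: "cdiff fst q" for q :: "complex \<times> 'p" by (rule hol_imp_cdiff[OF hol_fst'])
          have zS: "ddir F q (c, 0) = c * ddir F q (1, 0)" if "cdiff F q" for F :: "complex \<times> 'p \<Rightarrow> complex" and q c
            using ddir_fst_direction[OF that, of c 0] ddir_zero[OF that] by (simp add: zero_prod_def)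
          have cS': "cdiff S ?y" unfolding S_def[abs_def]
            by (rule cdiffI[OF has_derivative_add[OF cdiff_has_derivative[OF fstd] cdiff_has_derivative[OF dv(1)]]])
              (simp add: ddir_cs[OF dv(1)] distrib_left)
          have ccS': "cdiff (cc S) ?y" unfolding cS[abs_def]
            by (rule cdiffI[OF has_derivative_add[OF cdiff_has_derivative[OF fstd] cdiff_has_derivative[OF dcv(1)]]])
              (simp add: ddir_cs[OF dcv(1)] distrib_left)
          have dS: "ddir S ?y (1, 0) = exp (- L1 / 2)"
            unfolding S_def[abs_def] using ddir_add_fun[OF fstd dv(1), of "(1, 0)"] dv(2) by simp
          have dcS: "ddir (cc S) ?y (1, 0) = exp (- L2 / 2)"
            unfolding cS[abs_def] using ddir_add_fun[OF fstd dcv(1), of "(1, 0)"] dcv(2) by simp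
          have dST: "ddir ST q (1, 0) = ddir T q (1, 0) * exp (- L1 / 2)"
            unfolding ST_def using ddir_comp_pair[OF cS' elim(4), of "(1, 0)"] zS[OF cS', of "ddir T q (1, 0)"] dS by simp
          have dSC: "ddir SC q (1, 0) = ddir T q (1, 0) * exp (- L2 / 2)"
            unfolding SC_def using ddir_comp_pair[OF ccS' elim(4), of "(1, 0)"] zS[OF ccS', of "ddir T q (1, 0)"] dcS by simp
          have ce: "cdiff e (ST q, snd q)" using elim(5) STy by simp
          have deST: "ddir (\<lambda>q. e (ST q, snd q)) q (1, 0) = ddir ST q (1, 0) * de ?y"
            using ddir_comp_pair[OF ce elim(7), of "(1, 0)"] zS[OF ce, of "ddir ST q (1, 0)"] STy by (simp add: de_def)
          have ceST: "cdiff (\<lambda>q. e (ST q, snd q)) q"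
          proof -
            have p: "cdiff (\<lambda>q. (ST q, snd q)) q"
              by (rule cdiffI[OF has_derivative_Pair[OF cdiff_has_derivative[OF elim(7)] cdiff_has_derivative[OF hol_imp_cdiff[OF hol_snd']]]])
                (simp add: ddir_cs[OF elim(7)])
            show ?thesis by (rule cdiff_compose[of e "\<lambda>q. (ST q, snd q)", OF ce p])
          qed
          have dw: "ddir w q (1, 0) = ddir ST q (1, 0) * (1 + de ?y)"
            unfolding w_def using ddir_add_fun[OF elim(7) ceST, of "(1, 0)"] deST by (simp add: algebra_simps)
          have cSCg: "cdiff SC (gF q, snd q)" using elim(8) gq by simp
          have 1: "ddir (\<lambda>q. SC (gF q, snd q)) q (1, 0) = ddir gF q (1, 0) * ddir SC q (1, 0)"
            using ddir_comp_pair[OF cSCg elim(6), of "(1, 0)"] zS[OF cSCg, of "ddir gF q (1, 0)"] gq by simp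
          have "cdiff (\<lambda>q. SC (gF q, snd q)) q"
          proof -
            have p: "cdiff (\<lambda>q. (gF q, snd q)) q"
              by (rule cdiffI[OF has_derivative_Pair[OF cdiff_has_derivative[OF elim(6)] cdiff_has_derivative[OF hol_imp_cdiff[OF hol_snd']]]])
                (simp add: ddir_cs[OF elim(6)])
            show ?thesis by (rule cdiff_compose[of SC "\<lambda>q. (gF q, snd q)", OF cSCg p])
          qed
          from fun_cong[OF ddir_cong[OF elim(9) this], of "(1, 0)"]
          have 2: "ddir gF q (1, 0) * (ddir T q (1, 0) * exp (- L2 / 2)) = ddir T q (1, 0) * exp (- L1 / 2) * (1 + de ?y)"
            unfolding 1 dw dSC dST .
          have "1 + de ?y = exp L1" using elim(13) by (simp add: L1_def)
          with 2 have "ddir T q (1, 0) * (ddir gF q (1, 0) * exp (- L2 / 2)) = ddir T q (1, 0) * exp (- L1 / 2 + L1)"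
            unfolding exp_add by (simp only: mult_ac)
          hence "ddir gF q (1, 0) * exp (- L2 / 2) = exp (L1 / 2)" using elim(3) by simp
          hence "ddir gF q (1, 0) * exp (- L2 / 2) * exp (L2 / 2) = exp (L1 / 2) * exp (L2 / 2)" by simp
          hence "ddir gF q (1, 0) = exp ((L1 + L2) / 2)"
            unfolding mult.assoc exp_add[symmetric] by (simp add: add_divide_distrib)
          moreover have "ddir X ?y (1, 0) = L1 + L2" using elim(12) e by (simp add: L1_def L2_def de_def)
          ultimately show "ddir gF q (1, 0) = exp (ddir X ?y (1, 0) / 2)" by simp
        qed
      qed
    qed
    \<comment> \<open>The displacements \<open>v\<close> and \<open>cc v\<close> both start with
      \<open>- x ^ (k + 1) / 4\<close> and cancel to this order, so the leading term of
      \<open>e\<close> survives.\<close>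
    show "(\<lambda>x. gF (x, 0) - x - x ^ (k + 1) / 2) \<in> bz (k + 2)"
    proof -
      define u where "u x = gF (x, 0)" for x
      define vx where "vx x = v (x, 0)" for x
      have ub: "u \<in> bz 1" unfolding u_def by (rule bz_hol1[OF hol_slice1[OF hgF] gF0])
      have ux: "(\<lambda>x. u x - x) \<in> bz (k + 1)"
      proof (rule bigoI)
        show "\<forall>\<^sub>F x in nhds 0. norm (u x - x) \<le> C' * norm (x ^ (k + 1))"
          using eventually_slice[OF C'] by eventually_elim (simp add: u_def D0)
      qed
      have vb: "(\<lambda>x. vx x - (- 1 / 4) * x ^ (k + 1)) \<in> bz (k + 2)"
      proof -
        have "(\<lambda>x. s (de (x, 0)) + 1 / 2) \<in> bz 1" by (rule bz_compose[OF s(3) deb])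
        from bz_mult[OF \<epsilon>b this]
        have "(\<lambda>x. \<epsilon> x * (s (de (x, 0)) + 1 / 2)) \<in> bz (k + 2)" by (simp add: numeral_2_eq_2)
        from bz_add[OF this bz_cmult[OF eE, of "- 1 / 2"]]
        show ?thesis by (simp add: vx_def v_def \<epsilon>_def algebra_simps)
      qed
      have cvx: "cnj (vx (cnj x)) = cc v (x, 0)" for x by (simp add: cc_def vx_def)
      have cvb: "(\<lambda>x. cc v (x, 0) - (- 1 / 4) * x ^ (k + 1)) \<in> bz (k + 2)"
        using bz_cnj[OF vb] by (simp add: cvx)
      have vb1: "vx \<in> bz (k + 1)"
      proof -
        have "(\<lambda>x. vx x - (- 1 / 4) * x ^ (k + 1) + (- 1 / 4) * x ^ (k + 1)) \<in> bz (k + 1)"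
          by (intro bz_add bz_cmult power_in_bz bz_mono[OF vb]) simp
        thus ?thesis by simp
      qed
      have xv: "(\<lambda>x. x + vx x) \<in> bz 1" by (intro bz_add bz_ident bz_mono[OF vb1]) simp
      have A1: "(\<lambda>x. cc v (u x, 0) - cc v (x, 0)) \<in> bz (k + 2)"
        using bz_leading_diff[of "\<lambda>x. cc v (x, 0)" "- 1 / 4" "k + 1" u "\<lambda>x. x"] cvb ub bz_ident bz_mono[OF ux, of 2] k by simp
      have A2: "(\<lambda>x. \<epsilon> (x + vx x) - \<epsilon> x) \<in> bz (k + 2)"
        using bz_leading_diff[of \<epsilon> "1 / 2" "k + 1" "\<lambda>x. x + vx x" "\<lambda>x. x"] eE xv bz_ident bz_mono[OF vb1, of 2] k by (simp add: \<epsilon>_def)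
      have "(\<lambda>x. (vx x - (- 1 / 4) * x ^ (k + 1)) - (cc v (u x, 0) - cc v (x, 0)) - (cc v (x, 0) - (- 1 / 4) * x ^ (k + 1))
          + (\<epsilon> (x + vx x) - \<epsilon> x) + (\<epsilon> x - x ^ (k + 1) / 2)) \<in> bz (k + 2)"
        unfolding \<epsilon>_def[of x for x] by (intro bz_add bz_diff vb A1 cvb A2[unfolded \<epsilon>_def] eE)
      thus ?thesis
      proof (rule bz_cong)
        show "\<forall>\<^sub>F x in nhds 0. (vx x - (- 1 / 4) * x ^ (k + 1)) - (cc v (u x, 0) - cc v (x, 0)) - (cc v (x, 0) - (- 1 / 4) * x ^ (k + 1))
          + (\<epsilon> (x + vx x) - \<epsilon> x) + (\<epsilon> x - x ^ (k + 1) / 2) = gF (x, 0) - x - x ^ (k + 1) / 2"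
          using eventually_slice[OF gFeq]
        proof eventually_elim
          case (elim x)
          have "u x + cc v (u x, 0) = x + vx x + \<epsilon> (x + vx x)"
            using elim by (simp add: SC_def cS T0 u_def w_def ST_def S_def vx_def \<epsilon>_def)
          thus ?case by (simp add: u_def[symmetric] algebra_simps)
        qed
      qed
    qed
  qed
qed

section \<open>Division and fixed points\<close>

lemma hol_coeff_cpoly:
  fixes E :: "'a::cvec \<Rightarrow> complex^'k::finite"
  assumes "hol E x"
  shows "hol (\<lambda>x. coeff (cpoly \<iota> (E x)) m) x"
proof -
  have "hol (\<lambda>x. (if m = CARD('k) + 1 then 1 else 0) + (\<Sum>i\<in>UNIV. (if \<iota> i = m then 1 else 0) * E x $ i)) x"
    by (intro hol_intros assms)
  moreover have "coeff (cpoly \<iota> (E x)) m = (if m = CARD('k) + 1 then 1 else 0) + (\<Sum>i\<in>UNIV. (if \<iota> i = m then 1 else 0) * E x $ i)" for x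
    unfolding cpoly_def low_poly_def coeff_add coeff_sum coeff_monom
    by (intro arg_cong2[where f = "(+)"] sum.cong) auto
  ultimately show ?thesis by simp
qed

text \<open>The divided difference of \<open>p\<close>, arranged as a polynomial of degree at most
  \<open>k\<close> in \<open>z\<close> whose coefficients are polynomials in \<open>s\<close>.
  Integrated over \<open>s\<close> it supplies the polynomial part in
  \<open>hol_division\<close>.\<close>

lemma poly_difference_quotient:
  fixes p :: "complex poly"
  assumes "degree p \<le> Suc k"
  shows "(\<Sum>i\<le>k. (\<Sum>m\<le>Suc k. if i < m then coeff p m * s ^ (m - Suc i) else 0) * z ^ i) * (s - z) = poly p s - poly p z"
proof -
  have *: "poly p x = (\<Sum>m\<le>Suc k. coeff p m * x ^ m)" for x
  proof -
    have "(\<Sum>m\<le>degree p. coeff p m * x ^ m) = (\<Sum>m\<le>Suc k. coeff p m * x ^ m)"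
      by (rule sum.mono_neutral_left) (use assms in \<open>auto simp: coeff_eq_0\<close>)
    thus ?thesis by (simp add: poly_altdef)
  qed
  have "(\<Sum>i\<le>k. (\<Sum>m\<le>Suc k. if i < m then coeff p m * s ^ (m - Suc i) else 0) * z ^ i)
      = (\<Sum>i\<le>k. \<Sum>m\<le>Suc k. if i < m then coeff p m * (s ^ (m - Suc i) * z ^ i) else 0)"
    by (simp only: sum_distrib_right) (intro sum.cong, auto)
  also have "\<dots> = (\<Sum>m\<le>Suc k. \<Sum>i\<le>k. if i < m then coeff p m * (s ^ (m - Suc i) * z ^ i) else 0)"
    by (rule sum.swap)
  also have "\<dots> = (\<Sum>m\<le>Suc k. coeff p m * (\<Sum>i<m. s ^ (m - Suc i) * z ^ i))"
  proof (rule sum.cong)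
    fix m assume m: "m \<in> {..Suc k}"
    have "(\<Sum>i\<le>k. if i < m then coeff p m * (s ^ (m - Suc i) * z ^ i) else 0) = (\<Sum>i\<in>{..k} \<inter> {i. i < m}. coeff p m * (s ^ (m - Suc i) * z ^ i))"
      by (subst sum.inter_restrict) auto
    also have "{..k} \<inter> {i. i < m} = {..<m}" using m by auto
    finally show "(\<Sum>i\<le>k. if i < m then coeff p m * (s ^ (m - Suc i) * z ^ i) else 0) = coeff p m * (\<Sum>i<m. s ^ (m - Suc i) * z ^ i)"
      by (simp add: sum_distrib_left)
  qed simp
  finally have "(\<Sum>i\<le>k. (\<Sum>m\<le>Suc k. if i < m then coeff p m * s ^ (m - Suc i) else 0) * z ^ i) * (s - z)
      = (\<Sum>m\<le>Suc k. coeff p m * ((s - z) * (\<Sum>i<m. s ^ (m - Suc i) * z ^ i)))"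
    by (simp only: sum_distrib_right) (intro sum.cong, simp_all add: mult_ac)
  also have "\<dots> = (\<Sum>m\<le>Suc k. coeff p m * (s ^ m - z ^ m))"
  proof (intro sum.cong arg_cong2[where f = "(*)"] refl)
    fix m show "(s - z) * (\<Sum>i<m. s ^ (m - Suc i) * z ^ i) = s ^ m - z ^ m"
      using power_diff_sumr2[of z m s] by (simp add: algebra_simps)
  qed
  also have "\<dots> = poly p s - poly p z" by (simp add: * algebra_simps sum_subtractf)
  finally show ?thesis .
qed

text \<open>Against the kernel \<open>F / P\<^sup>2\<close>, split \<open>P s / (s - z)\<close> into
  the divided difference of \<open>P\<close>, which gives \<open>Q\<close>, and
  \<open>P z / (s - z)\<close>, which gives \<open>P * R\<close>; Cauchy's formula for
  \<open>F / P\<close> recombines them. The contour avoids all roots, so the dependence on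
  \<open>\<epsilon>\<close> stays holomorphic when roots collide.\<close>

lemma hol_division:
  fixes F :: "complex \<times> (complex^'k::finite) \<Rightarrow> complex"
  assumes index: "bij_betw \<iota> (UNIV :: 'k set) {..<k}" and hF: "hol F (0, 0)"
    and bound: "\<forall>\<^sub>F q in nhds (0, 0). norm (F q) \<le> C * norm (poly (cpoly \<iota> (snd q)) (fst q))"
  obtains Q :: "complex^'k \<Rightarrow> complex poly" and R
  where "hol R (0, 0)" "\<forall>j. hol (\<lambda>\<epsilon>. coeff (Q \<epsilon>) j) 0" "\<forall>\<epsilon>. degree (Q \<epsilon>) \<le> k"
    "\<forall>\<^sub>F q in nhds (0, 0). F q = poly (cpoly \<iota> (snd q)) (fst q) *
        (poly (Q (snd q)) (fst q) + poly (cpoly \<iota> (snd q)) (fst q) * R q)"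
proof -
  have "\<forall>\<^sub>F q in nhds (0, 0). hol F q \<and> norm (F q) \<le> C * norm (poly (cpoly \<iota> (snd q)) (fst q))"
    using hol_eventually[OF hF] bound by (rule eventually_conj)
  then obtain d where d: "d > 0" "\<And>q. dist q (0, 0) < d \<Longrightarrow> hol F q \<and> norm (F q) \<le> C * norm (poly (cpoly \<iota> (snd q)) (fst q))"
    unfolding eventually_nhds_metric by blast
  define r where "r = d / 4"
  have r: "r > 0" using d by (simp add: r_def)
  define P where "P q = poly (cpoly \<iota> (snd q)) (fst q)" for q :: "complex \<times> (complex^'k)"
  define m where "m q = F q / P q ^ 2" for q
  define c where "c i q = (\<Sum>m\<le>Suc k. if i < m then coeff (cpoly \<iota> (snd q)) m * fst q ^ (m - Suc i) else 0)"
    for i and q :: "complex \<times> (complex^'k)"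
  define Q where "Q \<epsilon> = (\<Sum>i\<le>k. monom (cint r (\<lambda>s. m (s, \<epsilon>) * c i (s, \<epsilon>))) i)" for \<epsilon>
  define R where "R q = cint r (\<lambda>s. m (s, snd q) / (s - fst q))" for q
  have cQ: "coeff (Q \<epsilon>) j = (if j \<le> k then cint r (\<lambda>s. m (s, \<epsilon>) * c j (s, \<epsilon>)) else 0)" for \<epsilon> j
    by (simp add: Q_def coeff_sum)
  have inball: "dist (z, \<epsilon>) (0, 0) < d" if "norm z < d / 2" "norm \<epsilon> < d / 2" for z :: complex and \<epsilon> :: "complex^'k"
    using norm_Pair_le[of z \<epsilon>] that by (simp add: dist_norm)
  have P0: "P (s, 0) \<noteq> 0" if "norm s = r" for s
  proof -
    have "P (s, 0) = s ^ (k + 1)" by (simp add: P_def cpoly_def poly_monom bij_betw_card[OF index])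
    thus ?thesis using that r by auto
  qed
  have hP: "hol P q" for q unfolding P_def by (intro hol_intros hol_fst' hol_snd')
  have hm: "hol m (s, 0)" if "norm s = r" for s
  proof -
    have "hol F (s, 0)" using d(2)[OF inball[of s 0]] that d(1) by (simp add: r_def)
    thus ?thesis unfolding m_def by (intro hol_intros hP) (use P0[OF that] in auto)
  qed
  have hc: "hol (c i) q" for i q
  proof -
    have "hol (\<lambda>q. if i < m then coeff (cpoly \<iota> (snd q)) m * fst q ^ (m - Suc i) else 0) q" for m
      by (cases "i < m") (auto intro!: hol_intros hol_coeff_cpoly hol_snd' hol_fst')
    thus ?thesis unfolding c_def by (intro hol_sum)
  qed
  show ?thesis
  proof (rule that[of R Q])
    show "hol R (0, 0)"
    proof -
      have h: "hol (\<lambda>p. m (fst p, snd (snd p)) / (fst p - fst (snd p))) (s, ((0::complex), (0::complex^'k)))" if "norm s = r" for s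
      proof -
        have 1: "hol (\<lambda>p. m (fst p, snd (snd p))) (s, ((0::complex), (0::complex^'k)))"
          by (rule hol_compose2[of m fst _ "\<lambda>p. snd (snd p)"]) (auto intro!: hol_intros hol_fst' hol_snd' hm that)
        show ?thesis by (intro hol_divide 1 hol_diff hol_fst' hol_fst hol_snd') (use that r in auto)
      qed
      from hol_cint(1)[OF less_imp_le[OF r] h] show ?thesis unfolding R_def[abs_def] by simp
    qed
    show "\<forall>j. hol (\<lambda>\<epsilon>. coeff (Q \<epsilon>) j) 0"
    proof
      fix j show "hol (\<lambda>\<epsilon>. coeff (Q \<epsilon>) j) 0"
      proof (cases "j \<le> k")
      case True
      have "hol (\<lambda>p. m p * c j p) (s, 0)" if "norm s = r" for s by (intro hol_mult hm hc that)
      from hol_cint(1)[OF less_imp_le[OF r] this] True show ?thesis by (simp add: cQ)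
      qed (simp add: cQ hol_const)
    qed
    show "\<forall>\<epsilon>. degree (Q \<epsilon>) \<le> k"
      by (intro allI degree_le) (simp add: cQ)
    have roots: "\<forall>\<^sub>F q in nhds (0::complex, 0). \<forall>a. poly (cpoly \<iota> (snd q)) a = 0 \<longrightarrow> norm a < r"
      by (rule eventually_snd[OF cpoly_roots_small[OF index r]])
    have small: "\<forall>\<^sub>F q in nhds (0, 0). norm (fst q) < r \<and> norm (snd q :: complex^'k) < d / 2"
      by (intro eventually_conj eventually_fst eventually_snd eventually_norm_less) (use r d in auto)
    show "\<forall>\<^sub>F q in nhds (0, 0). F q = poly (cpoly \<iota> (snd q)) (fst q) *
        (poly (Q (snd q)) (fst q) + poly (cpoly \<iota> (snd q)) (fst q) * R q)"
      using roots small
    proof eventually_elim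
      case (elim q)
      obtain z \<epsilon> where q: "q = (z, \<epsilon>)" by (cases q)
      define p where "p = cpoly \<iota> \<epsilon>"
      have p0: "p \<noteq> 0" unfolding p_def by (rule cpoly_neq_0[OF index])
      have rts: "norm a < r" if "poly p a = 0" for a using elim that by (simp add: p_def q)
      have z: "norm z < r" and \<epsilon>: "norm \<epsilon> < d / 2" using elim(2) by (simp_all add: q)
      have FS: "(\<lambda>z. F (z, \<epsilon>)) holomorphic_on ball 0 (d / 2)"
        by (rule holomorphic_onI_hol, rule hol_slice1) (use d(2) inball \<epsilon> in auto)
      \<comment> \<open>For this parameter the bound near the roots makes \<open>F\<close> divisible
        by \<open>P\<close> on a disc larger than the contour.\<close>
      have "\<exists>N. N holomorphic_on ball 0 (d / 2) \<and> (\<forall>z\<in>ball 0 (d / 2). F (z, \<epsilon>) = poly p z * N z)"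
      proof (rule poly_factor_holomorphic[OF p0 open_ball _ FS])
        fix a assume a: "poly p a = 0"
        show ab: "a \<in> ball 0 (d / 2)" using rts[OF a] d by (simp add: r_def)
        have "norm (F (z, \<epsilon>)) \<le> C * norm (poly p z)" if "z \<in> ball 0 (d / 2)" for z
          using d(2)[OF inball[of z \<epsilon>]] that \<epsilon> by (simp add: p_def)
        hence "\<forall>\<^sub>F z in at a. norm (F (z, \<epsilon>)) \<le> C * norm (poly p z)"
          using eventually_at_in_open'[OF open_ball ab] by (auto elim: eventually_mono)
        thus "\<exists>C. \<forall>\<^sub>F z in at a. norm (F (z, \<epsilon>)) \<le> C * norm (poly p z)" ..
      qed
      then obtain N where N: "N holomorphic_on ball 0 (d / 2)" "\<And>z. z \<in> ball 0 (d / 2) \<Longrightarrow> F (z, \<epsilon>) = poly p z * N z" by blast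
      have sub: "cball 0 r \<subseteq> ball 0 (d / 2)" using d by (auto simp: r_def)
      have ps: "poly p s \<noteq> 0" if "norm s = r" for s using rts that by auto
      have ms: "m (s, \<epsilon>) = N s / poly p s" if "norm s = r" for s
      proof -
        have "s \<in> cball 0 r" using that by simp
        hence "s \<in> ball 0 (d / 2)" using sub by blast
        thus ?thesis using N(2)[of s] ps[OF that] by (simp add: m_def P_def p_def power2_eq_square)
      qed
      have Ncont: "continuous_on (sphere 0 r) N"
        using holomorphic_on_imp_continuous_on[OF N(1)] by (rule continuous_on_subset) (use sub in auto)
      have mc: "continuous_on (sphere 0 r) (\<lambda>s. m (s, \<epsilon>))"
      proof -
        have "continuous_on (sphere 0 r) (\<lambda>s. N s / poly p s)"
          by (intro continuous_intros Ncont) (use ps in auto)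
        thus ?thesis by (rule continuous_on_eq) (use ms in auto)
      qed
      have cc: "continuous_on (sphere 0 r) (\<lambda>s. c i (s, \<epsilon>))" for i
        by (rule continuous_on_holI, rule hol_slice1, rule hc)
      have sz: "s \<noteq> z" if "norm s = r" for s using z that by auto
      have "poly (Q \<epsilon>) z + poly p z * R (z, \<epsilon>)
          = (\<Sum>i\<le>k. z ^ i * cint r (\<lambda>s. m (s, \<epsilon>) * c i (s, \<epsilon>))) + poly p z * cint r (\<lambda>s. m (s, \<epsilon>) / (s - z))"
        by (simp add: Q_def poly_sum poly_monom R_def mult.commute)
      also have "\<dots> = (\<Sum>i\<le>k. cint r (\<lambda>s. z ^ i * (m (s, \<epsilon>) * c i (s, \<epsilon>)))) + cint r (\<lambda>s. poly p z * (m (s, \<epsilon>) / (s - z)))"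
        by (simp only: cint_mult_left)
      also have "(\<Sum>i\<le>k. cint r (\<lambda>s. z ^ i * (m (s, \<epsilon>) * c i (s, \<epsilon>)))) = cint r (\<lambda>s. \<Sum>i\<le>k. z ^ i * (m (s, \<epsilon>) * c i (s, \<epsilon>)))"
        by (rule cint_sum[symmetric]) (use r in \<open>auto intro!: continuous_intros mc cc\<close>)
      also have "\<dots> + cint r (\<lambda>s. poly p z * (m (s, \<epsilon>) / (s - z))) = cint r (\<lambda>s. (\<Sum>i\<le>k. z ^ i * (m (s, \<epsilon>) * c i (s, \<epsilon>))) + poly p z * (m (s, \<epsilon>) / (s - z)))"
        by (rule cint_add[symmetric]) (use r z in \<open>auto intro!: continuous_intros mc cc\<close>)
      also have "\<dots> = cint r (\<lambda>s. N s / (s - z))"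
      proof (rule cint_cong)
        fix s :: complex assume s: "norm s = r"
        have 1: "(\<Sum>i\<le>k. z ^ i * (m (s, \<epsilon>) * c i (s, \<epsilon>))) = m (s, \<epsilon>) * (\<Sum>i\<le>k. c i (s, \<epsilon>) * z ^ i)"
          by (simp add: sum_distrib_left mult_ac)
        have "(\<Sum>i\<le>k. c i (s, \<epsilon>) * z ^ i) * (s - z) = poly p s - poly p z"
          unfolding c_def p_def fst_conv snd_conv
          by (rule poly_difference_quotient) (simp add: degree_cpoly(1)[OF index])
        hence 2: "(\<Sum>i\<le>k. c i (s, \<epsilon>) * z ^ i) = (poly p s - poly p z) / (s - z)"
          using sz[OF s] by (subst nonzero_eq_divide_eq) auto
        have "(\<Sum>i\<le>k. z ^ i * (m (s, \<epsilon>) * c i (s, \<epsilon>))) + poly p z * (m (s, \<epsilon>) / (s - z)) = m (s, \<epsilon>) * poly p s / (s - z)"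
          unfolding 1 2 by (simp add: diff_divide_distrib algebra_simps)
        thus "(\<Sum>i\<le>k. z ^ i * (m (s, \<epsilon>) * c i (s, \<epsilon>))) + poly p z * (m (s, \<epsilon>) / (s - z)) = N s / (s - z)"
          using ms[OF s] ps[OF s] by simp
      qed (use r in simp)
      also have "\<dots> = N z"
      proof (rule cint_Cauchy[OF _ _ z])
        show "continuous_on (cball 0 r) N"
          using holomorphic_on_imp_continuous_on[OF N(1)] by (rule continuous_on_subset) (use sub in auto)
        show "N holomorphic_on ball 0 r" by (rule holomorphic_on_subset[OF N(1)]) (use sub ball_subset_cball in blast)
      qed
      finally have "poly (Q \<epsilon>) z + poly p z * R (z, \<epsilon>) = N z" .
      moreover have "z \<in> ball 0 (d / 2)" using z d by (simp add: r_def)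
      ultimately show ?case using N(2)[of z] by (simp add: q p_def)
    qed
  qed
qed

text \<open>Divide by \<open>(w - z) ^ m\<close>: the cofactor of \<open>h\<close> stays within half
  the size of the cofactor of \<open>p\<close>, so it does not vanish at \<open>z\<close>
  either.\<close>

lemma zorder_perturbed_poly:
  fixes p :: "complex poly"
  assumes p: "p \<noteq> 0" "poly p z = 0" and S: "open S" "z \<in> S" and h: "h holomorphic_on S"
    and b: "\<And>w. w \<in> S \<Longrightarrow> norm (h w - poly p w) \<le> norm (poly p w) / 2"
  shows "zorder h z = int (order z p)"
proof -
  define m where "m = order z p"
  obtain q where q: "p = [:-z, 1:] ^ m * q" "\<not> [:-z, 1:] dvd q" using order_decomp[OF p(1)] m_def by blast
  have qz: "poly q z \<noteq> 0" using q(2) by (simp add: poly_eq_0_iff_dvd)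
  have pw: "poly p w = (w - z) ^ m * poly q w" for w by (subst q(1)) (simp add: poly_power)
  have qc: "(poly q \<longlongrightarrow> poly q z) (at z)" by (intro tendsto_intros)
  have "\<exists>V. V holomorphic_on S \<and> (\<forall>w\<in>S. h w = poly ([:-z, 1:] ^ m) w * V w)"
  proof (rule poly_factor_holomorphic[OF _ S(1) _ h])
    show "a \<in> S" if "poly ([:-z, 1:] ^ m) a = 0" for a using that S(2) by (auto simp: poly_power)
    fix a assume "poly ([:-z, 1:] ^ m) a = 0"
    hence a: "a = z" by (auto simp: poly_power)
    have "\<forall>\<^sub>F w in at z. norm (poly q w) < norm (poly q z) + 1"
      by (rule order_tendstoD(2)[OF tendsto_norm[OF qc]]) simp
    moreover have "\<forall>\<^sub>F w in at z. w \<in> S" by (rule eventually_at_in_open'[OF S])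
    ultimately have "\<forall>\<^sub>F w in at z. norm (h w) \<le> (3 / 2 * (norm (poly q z) + 1)) * norm (poly ([:-z, 1:] ^ m) w)"
    proof eventually_elim
      case (elim w)
      have "norm (h w) \<le> norm (h w - poly p w) + norm (poly p w)" by (metis norm_triangle_ineq diff_add_cancel)
      also have "\<dots> \<le> 3 / 2 * norm (poly p w)" using b[OF elim(2)] by simp
      also have "\<dots> \<le> 3 / 2 * (norm ((w - z) ^ m) * (norm (poly q z) + 1))"
        unfolding pw norm_mult using elim(1) by (intro mult_left_mono) auto
      finally show ?case by (simp add: poly_power algebra_simps)
    qed
    thus "\<exists>C. \<forall>\<^sub>F w in at a. norm (h w) \<le> C * norm (poly ([:-z, 1:] ^ m) w)" unfolding a ..
  qed simp
  then obtain V where V: "V holomorphic_on S" "\<And>w. w \<in> S \<Longrightarrow> h w = (w - z) ^ m * V w" by (auto simp: poly_power)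
  have Vz: "V z \<noteq> 0"
  proof
    assume V0: "V z = 0"
    have Vc: "(V \<longlongrightarrow> V z) (at z)"
      using holomorphic_on_imp_continuous_on[OF V(1)] S by (simp add: continuous_on_eq_continuous_at isCont_def)
    have "\<forall>\<^sub>F w in at z. norm (V w - poly q w) \<le> norm (poly q w) / 2"
      using eventually_at_in_open'[OF S] eventually_neq_at_within[of z]
    proof eventually_elim
      case (elim w)
      have "norm ((w - z) ^ m) * norm (V w - poly q w) = norm (h w - poly p w)"
        using V(2)[OF elim(1)] by (simp add: pw right_diff_distrib flip: norm_mult)
      also have "\<dots> \<le> norm ((w - z) ^ m) * (norm (poly q w) / 2)"
        using b[OF elim(1)] by (simp add: pw norm_mult)
      finally show ?case using elim(2) by simp
    qed
    from tendsto_le[OF _ tendsto_divide[OF tendsto_norm[OF qc] tendsto_const[of 2]] tendsto_norm[OF tendsto_diff[OF Vc qc]] this]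
    have "norm (V z - poly q z) \<le> norm (poly q z) / 2" by simp
    thus False using V0 qz by simp
  qed
  have "zorder h z = int m"
    by (rule zorder_eqI[OF S V(1) Vz]) (use V(2) in \<open>simp add: mult.commute\<close>)
  thus ?thesis by (simp add: m_def)
qed

text \<open>Compare the coefficients of \<open>X^k\<close> in the Lagrange interpolation of \<open>1 + \<beta> X^k\<close> at the roots.\<close>

lemma sum_interpolation_weights:
  fixes p :: "complex poly"
  assumes p: "rsquarefree p" "lead_coeff p = 1" "degree p = k + 1" and k: "k \<ge> 1"
  shows "(\<Sum>z | poly p z = 0. (1 + \<beta> * z ^ k) / poly (pderiv p) z) = \<beta>"
proof -
  define A where "A = {z. poly p z = 0}"
  have p0: "p \<noteq> 0" using p(2) by auto
  have fin: "finite A" unfolding A_def by (rule poly_roots_finite[OF p0])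
  have dec: "p = (\<Prod>z\<in>A. [:-z, 1:])" using complex_poly_decompose_rsquarefree[OF p(1)] p(2) by (simp add: A_def)
  define L where "L z = (\<Prod>w\<in>A - {z}. [:-w, 1:])" for z
  have pL: "p = [:-z, 1:] * L z" if "z \<in> A" for z
    using prod.remove[OF fin that, of "\<lambda>z. [:-z, 1:]"] by (simp add: L_def dec[symmetric])
  have degL: "degree (L z) = k" and lcL: "coeff (L z) k = 1" if "z \<in> A" for z
  proof -
    have L0: "L z \<noteq> 0" using pL[OF that] p0 by auto
    have "degree p = 1 + degree (L z)" using degree_mult_eq[of "[:-z, 1:]" "L z"] L0 pL[OF that] by simp
    thus d: "degree (L z) = k" using p(3) by simp
    have "lead_coeff p = lead_coeff [:-z, 1:] * lead_coeff (L z)" by (metis pL[OF that] lead_coeff_mult)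
    thus "coeff (L z) k = 1" using p(2) d by simp
  qed
  have card: "card A = k + 1"
  proof -
    have "degree (\<Prod>z\<in>A. [:-z, 1:]) = (\<Sum>z\<in>A. degree [:-z, 1:])" by (rule degree_prod_sum_eq) auto
    thus ?thesis using p(3) dec by simp
  qed
  have dp: "poly (pderiv p) z = poly (L z) z" if "z \<in> A" for z
  proof -
    have "pderiv p = pderiv ([:-z, 1:] * L z)" using pL[OF that] by simp
    also have "\<dots> = [:-z, 1:] * pderiv (L z) + L z * pderiv [:-z, 1:]" by (rule pderiv_mult)
    finally show ?thesis by (simp add: pderiv_pCons)
  qed
  have Lw: "poly (L z) w = 0" if "w \<in> A" "w \<noteq> z" for z w
    using that fin by (auto simp: L_def poly_prod intro!: prod_zero)
  have dp0: "poly (pderiv p) z \<noteq> 0" if "z \<in> A" for z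
    using p(1) that by (auto simp: rsquarefree_roots A_def)
  define q where "q = 1 + monom \<beta> k"
  define D where "D = q - (\<Sum>z\<in>A. smult (poly q z / poly (pderiv p) z) (L z))"
  have "degree D \<le> k"
    unfolding D_def q_def
    by (intro degree_diff_le degree_add_le degree_sum_le fin order_trans[OF degree_smult_le] degree_monom_le) (auto simp: degL)
  moreover have "poly D w = 0" if w: "w \<in> A" for w
  proof -
    have "(\<Sum>z\<in>A. poly q z / poly (pderiv p) z * poly (L z) w) = (\<Sum>z\<in>A. if z = w then poly q w else 0)"
      by (rule sum.cong) (use Lw w dp dp0 in auto)
    thus ?thesis using fin w by (simp add: D_def poly_sum)
  qed
  ultimately have "D = 0"
  proof -
    assume d: "degree D \<le> k" and r: "\<And>w. w \<in> A \<Longrightarrow> poly D w = 0"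
    show "D = 0"
    proof (rule ccontr)
      assume D: "D \<noteq> 0"
      have "card A \<le> card {x. poly D x = 0}" by (rule card_mono[OF poly_roots_finite[OF D]]) (use r in auto)
      also have "\<dots> \<le> degree D" by (rule card_poly_roots_bound[OF D])
      finally show False using d card by simp
    qed
  qed
  hence "coeff q k = coeff (\<Sum>z\<in>A. smult (poly q z / poly (pderiv p) z) (L z)) k" by (simp add: D_def)
  also have "\<dots> = (\<Sum>z\<in>A. poly q z / poly (pderiv p) z)"
    unfolding coeff_sum by (rule sum.cong) (auto simp: lcL)
  finally have "(\<Sum>z\<in>A. poly q z / poly (pderiv p) z) = coeff q k" ..
  \<comment> \<open>\<open>k \<ge> 1\<close> keeps the constant 1 of \<open>q\<close> out of its
    coefficient of degree \<open>k\<close>.\<close>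
  thus ?thesis using k by (simp add: q_def A_def poly_monom)
qed

section \<open>Taylor coefficients as circle integrals\<close>

lemma cint_coeff_zero:
  assumes R: "0 < R" "R < R'" and f: "f holomorphic_on ball 0 R'" "f \<in> bz n" and j: "j < n"
  shows "cint R (\<lambda>s. f s / s ^ Suc j) = 0"
proof -
  have "\<exists>V. V holomorphic_on ball 0 R' \<and> (\<forall>z\<in>ball 0 R'. f z = poly (monom 1 n) z * V z)"
  proof (rule poly_factor_holomorphic[OF _ open_ball _ f(1)])
    fix a assume "poly (monom 1 n) a = (0::complex)"
    hence a: "a = 0" by (simp add: poly_monom)
    show "a \<in> ball 0 R'" using a R by simp
    obtain C where "\<forall>\<^sub>F z in nhds 0. norm (f z) \<le> C * norm (z ^ n)" using f(2) by (elim landau_o.bigE)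
    hence "\<forall>\<^sub>F z in at a. norm (f z) \<le> C * norm (poly (monom 1 n) z)"
      unfolding a by (simp add: eventually_nhds_conv_at poly_monom)
    thus "\<exists>C. \<forall>\<^sub>F z in at a. norm (f z) \<le> C * norm (poly (monom 1 n) z)" ..
  qed simp
  then obtain V where V: "V holomorphic_on ball 0 R'" "\<And>z. z \<in> ball 0 R' \<Longrightarrow> f z = z ^ n * V z" by (auto simp: poly_monom)
  have "cint R (\<lambda>s. f s / s ^ Suc j) = cint R (\<lambda>s. s ^ (n - Suc j) * V s)"
  proof (rule cint_cong)
    fix s :: complex assume s: "norm s = R"
    have "s ^ n = s ^ Suc j * s ^ (n - Suc j)" unfolding power_add[symmetric] using j by simp
    thus "f s / s ^ Suc j = s ^ (n - Suc j) * V s" using V(2)[of s] s R by auto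
  qed (use R in simp)
  also have "\<dots> = 0"
    by (rule cint_holomorphic[of R _ "ball 0 R'"]) (use R in \<open>auto intro!: holomorphic_intros V\<close>)
  finally show ?thesis .
qed

lemma cint_inverse_power:
  assumes "R > 0"
  shows "cint R (\<lambda>s. 1 / s ^ Suc j) = (if j = 0 then 1 else 0)"
proof -
  have "((\<lambda>u. 1 / (u - 0) ^ Suc j) has_contour_integral (2 * pi * \<i>) / fact j * (deriv ^^ j) (\<lambda>_. 1) 0) (circlepath 0 R)"
    by (rule Cauchy_has_contour_integral_higher_derivative_circlepath) (use assms in auto)
  from contour_integral_unique[OF this]
  show ?thesis by (simp add: cint_contour higher_deriv_const)
qed

lemma cint_poly_coeff:
  assumes "R > 0"
  shows "cint R (\<lambda>s. poly p s / s ^ Suc j) = coeff p j"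
proof (induction p arbitrary: j)
  case 0
  show ?case using cint_mult_left[of R 0 "\<lambda>s. 0"] by simp
next
  case (pCons a p)
  have cont: "continuous_on (sphere 0 R) (\<lambda>s. poly q s / s ^ n)" for q :: "complex poly" and n
    by (intro continuous_intros) (use assms in auto)
  have "cint R (\<lambda>s. poly (pCons a p) s / s ^ Suc j) = cint R (\<lambda>s. a * (1 / s ^ Suc j) + poly p s / s ^ j)"
    by (rule cint_cong) (use assms in \<open>auto simp: field_simps\<close>)
  also have "\<dots> = a * cint R (\<lambda>s. 1 / s ^ Suc j) + cint R (\<lambda>s. poly p s / s ^ j)"
    using cint_add[of R "\<lambda>s. a * (1 / s ^ Suc j)" "\<lambda>s. poly p s / s ^ j"] cont[of "[:a:]" "Suc j"] cont[of p j] assms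
    by (simp add: cint_mult_left[symmetric])
  also have "cint R (\<lambda>s. poly p s / s ^ j) = (case j of 0 \<Rightarrow> 0 | Suc i \<Rightarrow> coeff p i)"
  proof (cases j)
    case 0
    have "cint R (poly p) = 0"
      by (rule cint_holomorphic[of R _ UNIV]) (use assms in \<open>auto intro: holomorphic_intros\<close>)
    thus ?thesis by (simp add: 0)
  qed (simp add: pCons.IH del: power_Suc)
  finally show ?case using cint_inverse_power[OF assms, of j] by (cases j) simp_all
qed

section \<open>The prepared family\<close>

text \<open>The holomorphic representative with complex parameters: \<open>prepared_family\<close>
  is its value at \<open>cnj Z\<close> and real parameters.\<close>

definition prepared_map ::
    "('k::finite \<Rightarrow> nat) \<Rightarrow> (complex^'k \<Rightarrow> complex poly) \<Rightarrow> (complex \<times> (complex^'k) \<Rightarrow> complex) \<Rightarrow> complex \<times> (complex^'k) \<Rightarrow> complex" where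
  "prepared_map \<iota> Q R q = fst q + poly (cpoly \<iota> (snd q)) (fst q) *
      (1 / 2 + poly (Q (snd q)) (fst q) + poly (cpoly \<iota> (snd q)) (fst q) * R q)"

lemma hol_poly_coeffs:
  fixes Q :: "'a::cvec \<Rightarrow> complex poly"
  assumes "\<And>j. hol (\<lambda>\<epsilon>. coeff (Q \<epsilon>) j) \<epsilon>" "\<And>\<epsilon>. degree (Q \<epsilon>) \<le> k"
  shows "hol (\<lambda>q. poly (Q (snd q)) (fst q)) (z, \<epsilon>)"
proof -
  have "poly (Q e) x = (\<Sum>i\<le>k. coeff (Q e) i * x ^ i)" for e x
  proof -
    have "(\<Sum>i\<le>degree (Q e). coeff (Q e) i * x ^ i) = (\<Sum>i\<le>k. coeff (Q e) i * x ^ i)"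
      by (rule sum.mono_neutral_left) (use assms(2)[of e] in \<open>auto simp: coeff_eq_0\<close>)
    thus ?thesis by (simp add: poly_altdef)
  qed
  moreover have "hol (\<lambda>q. \<Sum>i\<le>k. coeff (Q (snd q)) i * fst q ^ i) (z, \<epsilon>)"
    by (intro hol_sum hol_mult hol_power hol_fst' hol_snd_arg assms(1))
  ultimately show ?thesis by simp
qed

text \<open>The derivative of a real map commutes with conjugation, so its complex kernel is spanned
  by real vectors; genericity speaks only about those.\<close>

lemma ddir_zero_real_complex:
  fixes \<Phi> :: "complex^'k::finite \<Rightarrow> complex^'k"
  assumes h: "hol \<Phi> 0" and real: "\<forall>\<^sub>F \<eta> in nhds 0. \<Phi> (cj \<eta>) = cj (\<Phi> \<eta>)"
    and inj: "\<And>w. ddir \<Phi> 0 (cvec w) = 0 \<Longrightarrow> w = 0" and v: "ddir \<Phi> 0 v = 0"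
  shows "v = 0"
proof -
  have c: "cdiff \<Phi> 0" by (rule hol_imp_cdiff[OF h])
  have "\<forall>\<^sub>F \<eta> in nhds 0. cc \<Phi> \<eta> = \<Phi> \<eta>" using real by eventually_elim (simp add: cc_def)
  moreover have "cdiff (cc \<Phi>) 0" by (rule hol_imp_cdiff, rule hol_cc) (use h in simp)
  ultimately have "ddir (cc \<Phi>) 0 = ddir \<Phi> 0" by (rule ddir_cong)
  hence "ddir \<Phi> 0 (cj v) = cj (ddir \<Phi> 0 v)" using ddir_cc[of \<Phi> 0 "cj v"] c by simp
  hence cv: "ddir \<Phi> 0 (cj v) = 0" using v by simp
  define x where "x = (\<chi> i. 2 * Re (v $ i))"
  define y where "y = (\<chi> i. - 2 * Im (v $ i))"
  have ex: "cvec x = v + cj v" by (simp add: vec_eq_iff x_def complex_eq_iff)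
  have "ddir \<Phi> 0 (cvec x) = 0" unfolding ex ddir_add[OF c] v cv by simp
  hence "x = 0" by (rule inj)
  \<comment> \<open>The factor \<open>\<i>\<close> makes \<open>v - cj v\<close> real, with entries
    \<open>- 2 * Im (v $ i)\<close>.\<close>
  moreover have ey: "cvec y = cs \<i> (v + cs (-1) (cj v))"
    unfolding vec_eq_iff by (intro allI complex_eqI) (simp_all add: y_def)
  have "ddir \<Phi> 0 (cvec y) = 0" unfolding ey ddir_add[OF c] ddir_cs[OF c] v cv by simp
  hence "y = 0" by (rule inj)
  ultimately show "v = 0" by (simp add: vec_eq_iff x_def y_def complex_eq_iff)
qed

text \<open>The chart, the field and the division are put together, and everything is rewritten in
  the parameter \<open>\<epsilon>\<close> by means of the inverse \<open>\<psi>\<close> of the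
  parameter change.\<close>

lemma complex_normal_form:
  fixes g :: "complex \<times> (complex^'k::finite) \<Rightarrow> complex" and b :: real
  assumes index: "bij_betw \<iota> (UNIV :: 'k set) {..<k}" and k: "k \<ge> 1"
    and hg: "hol g (0, 0)"
    and gE: "(\<lambda>w. g (w, 0) - w - (w ^ (k + 1) / 2 + of_real ((real k + 1) / 8 - b / 2) * w ^ (2 * k + 1))) \<in> bz (2 * k + 2)"
    and gen: "\<And>w. (\<lambda>x. ddir g (x, 0) (0, cvec w) + ddir (cc g) (x, 0) (0, cvec w)) \<in> bz k \<Longrightarrow> w = 0"
  obtains \<Phi> \<psi> :: "complex^'k \<Rightarrow> complex^'k" and \<beta> :: "complex^'k \<Rightarrow> complex"
    and Kc H R :: "complex \<times> (complex^'k) \<Rightarrow> complex" and Q :: "complex^'k \<Rightarrow> complex poly"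
  where "hol \<Phi> 0" "\<Phi> 0 = 0" "hol \<psi> 0" "\<psi> 0 = 0"
    "\<forall>\<^sub>F \<eta> in nhds 0. \<psi> (\<Phi> \<eta>) = \<eta>" "\<forall>\<^sub>F \<epsilon> in nhds 0. \<Phi> (\<psi> \<epsilon>) = \<epsilon>"
    "\<forall>\<^sub>F \<eta> in nhds 0. \<Phi> (cj \<eta>) = cj (\<Phi> \<eta>)"
    "hol \<beta> 0" "\<forall>\<^sub>F \<epsilon> in nhds 0. \<beta> (cj \<epsilon>) = cj (\<beta> \<epsilon>)"
    "hol Kc (0, 0)" "Kc (0, 0) = 0" "hol H (0, 0)" "H (0, 0) = 0"
    "\<forall>\<^sub>F q in nhds (0, 0). cc Kc (H q, snd q) = fst q"
    "\<forall>\<^sub>F q in nhds (0, 0). H (cc Kc q, snd q) = fst q"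
    "hol R (0, 0)" "\<forall>j. hol (\<lambda>\<epsilon>. coeff (Q \<epsilon>) j) 0" "\<forall>\<epsilon>. degree (Q \<epsilon>) \<le> k" "poly (Q 0) 0 = 0"
    "\<forall>\<^sub>F q in nhds (0, 0). H (g (Kc q, snd q), snd q) = prepared_map \<iota> Q R (fst q, \<Phi> (snd q))"
    "\<forall>\<^sub>F q in nhds (0, 0). poly (cpoly \<iota> (snd q)) (fst q) = 0 \<longrightarrow> ddir (prepared_map \<iota> Q R) q (1, 0) =
        exp (poly (pderiv (cpoly \<iota> (snd q))) (fst q) / (1 + \<beta> (snd q) * fst q ^ k) / 2)"
proof -
  obtain B e where B: "hol B (0, 0)" "B (0, 0) = 0" "ddir B (0, 0) (1, 0) = 1" and he: "hol e (0, 0)"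
    and gB: "\<forall>\<^sub>F q in nhds (0, 0). g (B q, snd q) = cc B (fst q + e q, snd q)"
    and comp: "\<forall>\<^sub>F q in nhds (0, 0). norm (cc e q - e q) \<le> norm (e q) / 4"
    and eE: "(\<lambda>x. e (x, 0) - (x ^ (k + 1) / 2 + of_real ((real k + 1) / 8 - b / 2) * x ^ (2 * k + 1))) \<in> bz (2 * k + 2)"
    and de: "\<forall>v. (\<lambda>x. ddir e (x, 0) (0, v) - (ddir g (x, 0) (0, v) + ddir (cc g) (x, 0) (0, v)) / 2) \<in> bz k"
    by (rule midpoint_chart[OF hg k gE])
  obtain X where X: "hol X (0, 0)" "cc X = X" and eX: "\<forall>\<^sub>F q in nhds (0, 0). norm (e q) \<le> norm (X q)"
    and dX: "\<forall>\<^sub>F q in nhds (0, 0). e q = 0 \<longrightarrow>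
        ddir X q (1, 0) = Ln (1 + ddir e q (1, 0)) + cnj (Ln (1 + ddir e (cj q) (1, 0)))"
    and XE: "(\<lambda>x. X (x, 0) - (x ^ (k + 1) - of_real b * x ^ (2 * k + 1))) \<in> bz (2 * k + 2)"
    and dXe: "\<forall>v. (\<lambda>x. ddir X (x, 0) (0, v) - (ddir e (x, 0) (0, v) + ddir (cc e) (x, 0) (0, v))) \<in> bz k"
    by (rule log_multiplier_field[OF he k comp eE])
  obtain \<Phi> \<beta> T C where \<Phi>: "hol \<Phi> 0" "\<Phi> 0 = 0" and \<beta>: "hol \<beta> 0" "\<beta> 0 = of_real b"
    and T: "hol T (0, 0)" "\<forall>x. T (x, 0) = x"
    and real: "\<forall>\<^sub>F \<eta> in nhds 0. \<Phi> (cj \<eta>) = cj (\<Phi> \<eta>) \<and> \<beta> (cj \<eta>) = cj (\<beta> \<eta>)"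
    and cT: "\<forall>\<^sub>F q in nhds (0, 0). cc T q = T q"
    and XD: "\<forall>\<^sub>F q in nhds (0, 0). norm (X (T q, snd q)) \<le> C * norm (poly (cpoly \<iota> (\<Phi> (snd q))) (fst q))"
    and Xroot: "\<forall>\<^sub>F q in nhds (0, 0). poly (cpoly \<iota> (\<Phi> (snd q))) (fst q) = 0 \<longrightarrow>
       ddir X (T q, snd q) (1, 0) * (1 + \<beta> (snd q) * fst q ^ k) = poly (pderiv (cpoly \<iota> (\<Phi> (snd q)))) (fst q)"
    and d\<Phi>: "\<forall>v. ddir \<Phi> 0 v = 0 \<longrightarrow> (\<lambda>z. ddir X (z, 0) (0, v)) \<in> bz k"
    by (rule log_multiplier_field_normal_form[OF index k X XE])
  define D where "D q = poly (cpoly \<iota> (\<Phi> (snd q))) (fst q)" for q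
  have eE': "(\<lambda>x. e (x, 0) - x ^ (k + 1) / 2) \<in> bz (k + 2)"
  proof -
    have "(\<lambda>x. e (x, 0) - (x ^ (k + 1) / 2 + of_real ((real k + 1) / 8 - b / 2) * x ^ (2 * k + 1))
        + of_real ((real k + 1) / 8 - b / 2) * x ^ (2 * k + 1)) \<in> bz (k + 2)"
      by (intro bz_add bz_cmult power_in_bz_le bz_mono[OF eE]) (use k in auto)
    thus ?thesis by simp
  qed
  have D0: "D (x, 0) = x ^ (k + 1)" for x
    by (simp add: D_def \<Phi> cpoly_def poly_monom bij_betw_card[OF index])
  obtain gF Kc H C' where gF: "hol gF (0, 0)" "gF (0, 0) = 0" and Kc: "hol Kc (0, 0)" "Kc (0, 0) = 0"
    and H: "hol H (0, 0)" "H (0, 0) = 0" "\<forall>\<^sub>F q in nhds (0, 0). cc Kc (H q, snd q) = fst q"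
      "\<forall>\<^sub>F q in nhds (0, 0). H (cc Kc q, snd q) = fst q"
    and HgF: "\<forall>\<^sub>F q in nhds (0, 0). H (g (Kc q, snd q), snd q) = gF q"
    and gFD: "\<forall>\<^sub>F q in nhds (0, 0). norm (gF q - fst q) \<le> C' * norm (D q)"
    and dgF: "\<forall>\<^sub>F q in nhds (0, 0). D q = 0 \<longrightarrow> ddir gF q (1, 0) = exp (ddir X (T q, snd q) (1, 0) / 2)"
    and gFE: "(\<lambda>x. gF (x, 0) - x - x ^ (k + 1) / 2) \<in> bz (k + 2)"
    by (rule symmetric_multiplier_chart[OF k B he gB comp eE' eX dX T(1) T(2)[rule_format] cT XD[folded D_def] D0])
  have \<Phi>real: "\<forall>\<^sub>F \<eta> in nhds 0. \<Phi> (cj \<eta>) = cj (\<Phi> \<eta>)" using real by eventually_elim simp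
  have inj: "v = 0" if v: "ddir \<Phi> 0 v = 0" for v
  proof (rule ddir_zero_real_complex[OF \<Phi>(1) \<Phi>real _ v])
    fix w :: "real^'k" assume w: "ddir \<Phi> 0 (cvec w) = 0"
    let ?h = "\<lambda>x. ddir g (x, 0) (0, cvec w) + ddir (cc g) (x, 0) (0, cvec w)"
    have ccg: "cnj (?h (cnj x)) = ?h x" if "cdiff g (x, 0)" "cdiff g (cnj x, 0)" for x
    proof -
      have "ddir (cc g) (x, 0) (0, cvec w) = cnj (ddir g (cnj x, 0) (0, cvec w))"
        using ddir_cc[of g "(x, 0)" "(0, cvec w)"] that by simp
      moreover have "ddir (cc g) (cnj x, 0) (0, cvec w) = cnj (ddir g (x, 0) (0, cvec w))"
        using ddir_cc[of g "(cnj x, 0)" "(0, cvec w)"] that by simp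
      ultimately show ?thesis by simp
    qed
    have 1: "(\<lambda>x. ddir X (x, 0) (0, cvec w)) \<in> bz k" using d\<Phi> w by blast
    \<comment> \<open>Modulo \<open>z ^ k\<close> the variation of \<open>X\<close> is that of
      \<open>e\<close> plus its conjugate; the former is half of \<open>?h\<close>, which is its own
      conjugate, so that \<open>?h\<close> itself is left.\<close>
    have "(\<lambda>x. ddir X (x, 0) (0, cvec w) - (ddir X (x, 0) (0, cvec w) - (ddir e (x, 0) (0, cvec w) + ddir (cc e) (x, 0) (0, cvec w)))
        - (ddir e (x, 0) (0, cvec w) - ?h x / 2) - cnj (ddir e (cnj x, 0) (0, cvec w) - ?h (cnj x) / 2)) \<in> bz k"
      by (rule bz_diff[OF bz_diff[OF bz_diff[OF 1 dXe[rule_format]] de[rule_format]] bz_cnj[OF de[rule_format]]])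
    hence "?h \<in> bz k"
    proof (rule bz_cong)
      have "\<forall>\<^sub>F q in nhds (cj (0, 0)). cdiff g q \<and> cdiff e q" using hg he by (simp add: hol_def eventually_conj_iff)
      from eventually_nhds_cj[OF this]
      have "\<forall>\<^sub>F q in nhds (0, 0). (cdiff g (cj q) \<and> cdiff e (cj q)) \<and> cdiff g q"
        using hg by (simp add: hol_def eventually_conj_iff)
      from eventually_slice[OF this]
      show "\<forall>\<^sub>F x in nhds 0. ddir X (x, 0) (0, cvec w) - (ddir X (x, 0) (0, cvec w) - (ddir e (x, 0) (0, cvec w) + ddir (cc e) (x, 0) (0, cvec w)))
        - (ddir e (x, 0) (0, cvec w) - ?h x / 2) - cnj (ddir e (cnj x, 0) (0, cvec w) - ?h (cnj x) / 2) = ?h x"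
      proof eventually_elim
        case (elim x)
        have "ddir (cc e) (x, 0) (0, cvec w) = cnj (ddir e (cnj x, 0) (0, cvec w))"
          using ddir_cc[of e "(x, 0)" "(0, cvec w)"] elim by simp
        moreover have "cnj (?h (cnj x)) = ?h x" by (rule ccg) (use elim in auto)
        hence "cnj (?h (cnj x) / 2) = ?h x / 2" by (simp only: complex_cnj_divide complex_cnj_numeral)
        ultimately show ?case by (simp only: complex_cnj_diff) (simp add: field_simps)
      qed
    qed
    thus "w = 0" by (rule gen)
  qed
  obtain \<psi> where \<psi>: "hol \<psi> (\<Phi> 0)" "\<psi> (\<Phi> 0) = 0" "\<forall>\<^sub>F \<epsilon> in nhds (\<Phi> 0). \<Phi> (\<psi> \<epsilon>) = \<epsilon>"
      "\<forall>\<^sub>F \<eta> in nhds 0. \<psi> (\<Phi> \<eta>) = \<eta>"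
    by (rule hol_inverse_function[OF \<Phi>(1) inj])
  note \<psi> = \<psi>[unfolded \<Phi>(2)]
  \<comment> \<open>Both \<open>\<psi> \<epsilon>\<close> and
    \<open>cj (\<psi> (cj \<epsilon>))\<close> are preimages of \<open>\<epsilon>\<close> near
    0.\<close>
  have \<psi>real: "\<forall>\<^sub>F \<epsilon> in nhds 0. \<psi> (cj \<epsilon>) = cj (\<psi> \<epsilon>)"
  proof -
    have h: "isCont (\<lambda>\<epsilon>. cj (\<psi> (cj \<epsilon>))) 0" using hol_isCont[OF hol_cc[of \<psi> 0]] \<psi>(1) by (simp add: cc_def[abs_def])
    have z: "cj (\<psi> (cj 0)) = 0" by (simp add: \<psi>)
    have "\<forall>\<^sub>F \<epsilon> in nhds (cj 0). \<Phi> (\<psi> \<epsilon>) = \<epsilon>" using \<psi>(3) by simp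
    from eventually_nhds_cj[OF this] isCont_nhds_0[OF h z \<Phi>real] isCont_nhds_0[OF h z \<psi>(4)]
    show ?thesis
    proof eventually_elim
      case (elim \<epsilon>)
      have "cj (\<Phi> (cj (\<psi> (cj \<epsilon>)))) = cj \<epsilon>" using elim(1,2) by simp
      hence "\<Phi> (cj (\<psi> (cj \<epsilon>))) = \<epsilon>" by (metis cj_cj)
      hence "cj (\<psi> (cj \<epsilon>)) = \<psi> \<epsilon>" using elim(3) by simp
      thus ?case by (metis cj_cj)
    qed
  qed
  define GF where "GF q = gF (fst q, \<psi> (snd q))" for q
  have hpb: "hol (\<lambda>q. (fst q, \<psi> (snd q))) (0 :: complex, 0)"
    by (intro hol_Pair hol_fst' hol_snd_arg \<psi>(1))
  have pb: "\<forall>\<^sub>F q in nhds (0, 0). A (fst q, \<psi> (snd q))" if "\<forall>\<^sub>F q in nhds (0, 0). A q" for A :: "complex \<times> (complex^'k) \<Rightarrow> bool"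
    by (rule isCont_nhds_0[OF hol_isCont[OF hpb] _ that]) (simp add: \<psi>)
  have hGF: "hol GF (0, 0)" unfolding GF_def
    by (rule hol_compose[of gF "\<lambda>q. (fst q, \<psi> (snd q))", OF _ hpb]) (simp add: \<psi> gF)
  have \<Phi>\<psi>: "\<forall>\<^sub>F q in nhds (0 :: complex, 0). \<Phi> (\<psi> (snd q)) = snd q" by (rule eventually_snd[OF \<psi>(3)])
  have bound: "\<forall>\<^sub>F q in nhds (0, 0). norm (GF q - fst q) \<le> C' * norm (poly (cpoly \<iota> (snd q)) (fst q))"
    using pb[OF gFD] \<Phi>\<psi> by eventually_elim (simp add: GF_def D_def)
  obtain Q1 :: "complex^'k \<Rightarrow> complex poly" and R where hR: "hol R (0, 0)" and Q1: "\<forall>j. hol (\<lambda>\<epsilon>. coeff (Q1 \<epsilon>) j) 0" "\<forall>\<epsilon>. degree (Q1 \<epsilon>) \<le> k"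
    and GFQ: "\<forall>\<^sub>F q in nhds (0, 0). GF q - fst q = poly (cpoly \<iota> (snd q)) (fst q) *
        (poly (Q1 (snd q)) (fst q) + poly (cpoly \<iota> (snd q)) (fst q) * R q)"
    by (rule hol_division[OF index hol_diff[OF hGF hol_fst'] bound])
  \<comment> \<open>The prepared form displays the summand 1/2 of the quotient separately.\<close>
  define Q where "Q \<epsilon> = Q1 \<epsilon> - [:1 / 2:]" for \<epsilon>
  have Qc: "\<forall>j. hol (\<lambda>\<epsilon>. coeff (Q \<epsilon>) j) 0"
    unfolding Q_def coeff_diff by (intro allI hol_diff Q1[rule_format] hol_const)
  have Qd: "\<forall>\<epsilon>. degree (Q \<epsilon>) \<le> k"
    unfolding Q_def by (intro allI degree_diff_le) (use Q1(2) in auto)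
  have GFp: "\<forall>\<^sub>F q in nhds (0, 0). GF q = prepared_map \<iota> Q R q"
    using GFQ by eventually_elim (simp add: prepared_map_def Q_def algebra_simps)
  \<comment> \<open>At parameter 0 the map is \<open>x + x ^ (k + 1) / 2\<close> up to order
    \<open>k + 2\<close>, so no constant term is left for \<open>Q\<close>.\<close>
  have Q0: "poly (Q 0) 0 = 0"
  proof -
    define n where "n x = poly (Q 0) x + x ^ (k + 1) * R (x, 0)" for x
    have hn: "hol n 0" unfolding n_def
      by (intro hol_add hol_mult hol_power hol_ident hol_slice1[OF hR] hol_complex[of UNIV]) (auto intro: holomorphic_intros)
    have "(\<lambda>x. x ^ (k + 1) * n x) \<in> bz (k + 2)"
    proof (rule bz_cong[OF gFE])
      show "\<forall>\<^sub>F x in nhds 0. gF (x, 0) - x - x ^ (k + 1) / 2 = x ^ (k + 1) * n x"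
        using eventually_slice[OF GFp]
      proof eventually_elim
        case (elim x)
        have "gF (x, 0) = x + x ^ (k + 1) * (1 / 2 + n x)"
          using elim by (simp add: GF_def \<psi> prepared_map_def n_def cpoly_def poly_monom bij_betw_card[OF index] add.assoc)
        thus ?case by (simp add: field_simps)
      qed
    qed
    then obtain c where c: "\<forall>\<^sub>F x in nhds 0. norm (x ^ (k + 1) * n x) \<le> c * norm (x ^ (k + 2))" by (elim landau_o.bigE)
    have "\<forall>\<^sub>F x in at (0::complex). norm (n x) \<le> c * norm x"
      using c[unfolded eventually_nhds_conv_at, THEN conjunct1] eventually_neq_at_within[of 0]
    proof eventually_elim
      case (elim x)
      have "norm (x ^ (k + 1)) * norm (n x) \<le> norm (x ^ (k + 1)) * (c * norm x)"
        using elim(1) by (simp add: norm_mult mult_ac)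
      thus ?case using elim(2) by simp
    qed
    moreover have "((\<lambda>x. c * norm x) \<longlongrightarrow> c * norm (0::complex)) (at (0::complex))"
      by (intro tendsto_intros)
    hence "((\<lambda>x. c * norm x) \<longlongrightarrow> 0) (at (0::complex))" by simp
    ultimately have "(n \<longlongrightarrow> 0) (at 0)" by (rule Lim_null_comparison)
    moreover have "(n \<longlongrightarrow> n 0) (at 0)" using hol_isCont[OF hn] by (simp add: isCont_def)
    ultimately have "n 0 = 0" using tendsto_unique[OF at_neq_bot] by blast
    thus ?thesis by (simp add: n_def)
  qed
  define \<beta>' where "\<beta>' \<epsilon> = \<beta> (\<psi> \<epsilon>)" for \<epsilon>
  have h\<beta>': "hol \<beta>' 0" unfolding \<beta>'_def by (rule hol_compose[OF _ \<psi>(1)]) (simp add: \<psi> \<beta>)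
  have \<beta>'real: "\<forall>\<^sub>F \<epsilon> in nhds 0. \<beta>' (cj \<epsilon>) = cj (\<beta>' \<epsilon>)"
    using \<psi>real isCont_nhds_0[OF hol_isCont[OF \<psi>(1)] \<psi>(2) real]
    by eventually_elim (simp add: \<beta>'_def)
  show ?thesis
  proof (rule that[OF \<Phi> \<psi>(1,2,4,3) \<Phi>real h\<beta>' \<beta>'real Kc H hR Qc Qd Q0])
    show "\<forall>\<^sub>F q in nhds (0, 0). H (g (Kc q, snd q), snd q) = prepared_map \<iota> Q R (fst q, \<Phi> (snd q))"
    proof -
      have h: "isCont (\<lambda>q. (fst q, \<Phi> (snd q))) (0 :: complex, 0)"
        by (intro hol_isCont hol_Pair hol_fst' hol_snd_arg \<Phi>(1))
      have z: "(fst (0 :: complex, 0 :: complex^'k), \<Phi> (snd (0 :: complex, 0 :: complex^'k))) = (0, 0)" by (simp add: \<Phi>)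
      show ?thesis
        using HgF isCont_nhds_0[OF h z GFp] eventually_snd[OF \<psi>(4), of "0::complex"]
        by eventually_elim (simp add: GF_def)
    qed
    show "\<forall>\<^sub>F q in nhds (0, 0). poly (cpoly \<iota> (snd q)) (fst q) = 0 \<longrightarrow> ddir (prepared_map \<iota> Q R) q (1, 0) =
        exp (poly (pderiv (cpoly \<iota> (snd q))) (fst q) / (1 + \<beta>' (snd q) * fst q ^ k) / 2)"
    proof -
      have e1: "\<forall>\<^sub>F q in nhds (0, 0). \<forall>\<^sub>F p in nhds q. GF p = prepared_map \<iota> Q R p"
        using GFp by (simp add: eventually_eventually)
      have e2: "\<forall>\<^sub>F q in nhds (0, 0). cdiff GF q" and e3: "\<forall>\<^sub>F q in nhds (0, 0). cdiff gF q"
        using hGF gF(1) by (simp_all add: hol_def)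
      have "hol (\<lambda>q. 1 + \<beta>' (snd q) * fst q ^ k) (0, 0)"
        by (intro hol_add hol_mult hol_const hol_power hol_fst' hol_snd_arg h\<beta>')
      from isCont_nhds_0[OF hol_isCont[OF this] refl, of "\<lambda>w. w \<noteq> 0"]
      have e4: "\<forall>\<^sub>F q in nhds (0, 0). 1 + \<beta>' (snd q) * fst q ^ k \<noteq> 0"
        using t1_space_nhds[of "1::complex" 0] k by (simp add: power_0_left)
      show ?thesis
        using e1 e2 pb[OF e3] e4 pb[OF dgF] pb[OF Xroot] \<Phi>\<psi>
      proof eventually_elim
        case (elim q)
        obtain z \<epsilon> where q: "q = (z, \<epsilon>)" by (cases q)
        show ?case
        proof
          assume P0: "poly (cpoly \<iota> (snd q)) (fst q) = 0"
          have "ddir (prepared_map \<iota> Q R) q (1, 0) = ddir GF q (1, 0)"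
            using fun_cong[OF ddir_cong[OF elim(1,2)], of "(1, 0)"] by simp
          also have "\<dots> = deriv (\<lambda>z. GF (z, \<epsilon>)) z" using ddir_slice1[of GF z \<epsilon>] elim(2) by (simp add: q)
          also have "\<dots> = ddir gF (z, \<psi> \<epsilon>) (1, 0)"
            using ddir_slice1[of gF z "\<psi> \<epsilon>"] elim(3) by (simp add: q GF_def)
          also have "\<dots> = exp (ddir X (T (z, \<psi> \<epsilon>), \<psi> \<epsilon>) (1, 0) / 2)"
            using elim(5,7) P0 by (simp add: q D_def)
          also have "ddir X (T (z, \<psi> \<epsilon>), \<psi> \<epsilon>) (1, 0) = poly (pderiv (cpoly \<iota> \<epsilon>)) z / (1 + \<beta>' \<epsilon> * z ^ k)"
            using elim(4,6,7) P0 by (simp add: q \<beta>'_def nonzero_eq_divide_eq)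
          finally show "ddir (prepared_map \<iota> Q R) q (1, 0) =
            exp (poly (pderiv (cpoly \<iota> (snd q))) (fst q) / (1 + \<beta>' (snd q) * fst q ^ k) / 2)" by (simp add: q)
        qed
      qed
    qed
  qed
qed

text \<open>Adding a constant \<open>t\<close> preserves the critical points, so a multiple root
  occurs only if \<open>- t\<close> is one of the finitely many critical values. Hence simple
  parameters are dense, and the limit in \<open>b_fun\<close> is taken along a nontrivial
  filter.\<close>

lemma islimpt_rsquarefree_cpoly:
  fixes \<epsilon> :: "real^'k::finite"
  assumes index: "bij_betw \<iota> (UNIV :: 'k set) {..<k}" and k: "k \<ge> 1"
  shows "\<epsilon> islimpt {\<epsilon>'. rsquarefree (cpoly \<iota> (cvec \<epsilon>'))}"
  unfolding islimpt_approachable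
proof (intro allI impI)
  fix d :: real assume d: "d > 0"
  obtain i where i: "\<iota> i = 0" using index k by (metis bij_betw_imp_surj_on imageE lessThan_iff less_le_trans zero_less_one)
  let ?p = "cpoly \<iota> (cvec \<epsilon>)"
  have "degree ?p = k + 1" by (rule degree_cpoly(1)[OF index])
  hence "pderiv ?p \<noteq> 0" using pderiv_eq_0_iff[of ?p] by auto
  hence fin: "finite {c. poly (pderiv ?p) c = 0}" by (rule poly_roots_finite)
  define B where "B = (\<lambda>c. norm (poly ?p c)) ` {c. poly (pderiv ?p) c = 0}"
  have "finite B" unfolding B_def by (rule finite_imageI[OF fin])
  moreover have "infinite {0<..<d}" by (rule infinite_Ioo[OF d])
  ultimately have "\<not> {0<..<d} \<subseteq> B" using finite_subset by blast
  then obtain t where "t \<in> {0<..<d}" and tB: "t \<notin> B" by blast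
  hence t: "0 < t" "t < d" "t \<notin> B" by auto
  define \<epsilon>' where "\<epsilon>' = \<epsilon> + axis i t"
  have "low_poly \<iota> (cvec (axis i t)) = [:of_real t:]"
  proof -
    have "low_poly \<iota> (cvec (axis i t)) = (\<Sum>j\<in>UNIV. if j = i then monom (of_real t) 0 else 0)"
      unfolding low_poly_def by (intro sum.cong refl) (auto simp: axis_def i)
    thus ?thesis by (simp add: monom_0)
  qed
  moreover have "cvec \<epsilon>' = cvec \<epsilon> + cvec (axis i t)" by (simp add: vec_eq_iff \<epsilon>'_def)
  ultimately have p': "cpoly \<iota> (cvec \<epsilon>') = ?p + [:of_real t:]"
    by (simp add: cpoly_def low_poly_add add.assoc)
  have "rsquarefree (cpoly \<iota> (cvec \<epsilon>'))"
    unfolding rsquarefree_roots p'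
  proof (intro allI notI, elim conjE)
    fix a assume a: "poly (?p + [:of_real t:]) a = 0" "poly (pderiv (?p + [:of_real t:])) a = 0"
    have "poly (pderiv ?p) a = 0" using a(2) by (simp add: pderiv_add pderiv_pCons)
    moreover have "poly ?p a = - of_real t" using a(1) by (simp add: add_eq_0_iff2)
    hence "norm (poly ?p a) = t" using t by simp
    ultimately show False using t(3) by (auto simp: B_def)
  qed
  moreover have "\<epsilon>' \<noteq> \<epsilon>" using t by (auto simp: \<epsilon>'_def axis_eq_0_iff)
  moreover have "dist \<epsilon>' \<epsilon> < d" using t by (simp add: \<epsilon>'_def dist_norm norm_eq_sqrt_inner inner_axis_axis)
  ultimately show "\<exists>x'\<in>{\<epsilon>'. rsquarefree (cpoly \<iota> (cvec \<epsilon>'))}. x' \<noteq> \<epsilon> \<and> dist x' \<epsilon> < d" by blast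
qed

section \<open>From germs to real parameters and explicit domains\<close>

lemma mix_analytic_onI:
  fixes F :: "complex \<times> (complex^'k::finite) \<Rightarrow> complex"
  assumes "\<And>z \<eta>. norm z < r \<Longrightarrow> \<eta> \<in> U \<Longrightarrow> hol F (z, cvec \<eta>)"
  shows "mix_analytic_on (\<lambda>\<eta> z. F (z, cvec \<eta>)) r U"
  unfolding mix_analytic_on_def
proof
  have bl: "bounded_linear (\<lambda>q :: complex \<times> (real^'k). (fst q, cvec (snd q)))"
    by (intro bounded_linear_Pair bounded_linear_fst bounded_linear_compose[OF bounded_linear_cvec] bounded_linear_snd)
  show "real_analytic_on (\<lambda>(z, \<eta>). F (z, cvec \<eta>)) (ball 0 r \<times> U)"
  proof (rule real_analytic_onI[OF bl])
    fix q :: "complex \<times> (real^'k)" assume q: "q \<in> ball 0 r \<times> U"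
    hence "hol F (fst q, cvec (snd q))" using assms by auto
    thus "\<exists>F'. hol F' (fst q, cvec (snd q)) \<and> (\<forall>\<^sub>F x in nhds q. (case x of (z, \<eta>) \<Rightarrow> F (z, cvec \<eta>)) = F' (fst x, cvec (snd x)))"
      by (intro exI[of _ F]) (auto simp: case_prod_beta)
  qed
  show "\<forall>\<eta>\<in>U. (\<lambda>z. F (z, cvec \<eta>)) holomorphic_on ball 0 r"
    by (intro ballI holomorphic_onI_hol, rule hol_slice1, rule assms) auto
qed

lemma real_analytic_on_cvec:
  fixes F :: "complex^'k::finite \<Rightarrow> complex"
  assumes "\<And>\<eta>. \<eta> \<in> U \<Longrightarrow> hol F (cvec \<eta>)" "open U" "\<And>\<eta>. \<eta> \<in> U \<Longrightarrow> f \<eta> = F (cvec \<eta>)"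
  shows "real_analytic_on f U"
proof (rule real_analytic_onI[OF bounded_linear_cvec])
  fix \<eta> assume \<eta>: "\<eta> \<in> U"
  have "\<forall>\<^sub>F x in nhds \<eta>. f x = F (cvec x)"
    using eventually_nhds_in_open[OF assms(2) \<eta>] by eventually_elim (rule assms(3))
  thus "\<exists>F. hol F (cvec \<eta>) \<and> (\<forall>\<^sub>F x in nhds \<eta>. f x = F (cvec x))" using assms(1)[OF \<eta>] by blast
qed

lemma eventually_nhds_Pair_norm:
  fixes A :: "'a::real_normed_vector \<times> 'b::real_normed_vector \<Rightarrow> bool"
  assumes "\<forall>\<^sub>F q in nhds (0, 0). A q"
  obtains d where "d > 0" "\<And>z \<epsilon>. norm z < d \<Longrightarrow> norm \<epsilon> < d \<Longrightarrow> A (z, \<epsilon>)"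
proof -
  obtain d where d: "d > 0" "\<And>q. dist q (0, 0) < d \<Longrightarrow> A q" using assms unfolding eventually_nhds_metric by blast
  show ?thesis
  proof (rule that[of "d / 2"])
    fix z :: 'a and \<epsilon> :: 'b assume "norm z < d / 2" "norm \<epsilon> < d / 2"
    thus "A (z, \<epsilon>)" using norm_Pair_le[of z \<epsilon>] by (intro d(2)) (simp add: dist_norm)
  qed (use d in simp)
qed

text \<open>The second iterate is \<open>z + P (1 + c)\<close> with \<open>c\<close> of size at most
  1/2, so its fixed points are the roots of \<open>P\<close> with multiplicity, all inside the disc
  once \<open>\<epsilon>\<close> is small. There the logarithm of the multiplier is the eigenvalue
  of the vector field, and interpolation identifies the sum of the inverses with
  \<open>\<beta>\<close>.\<close>

lemma prepared_fixed_points: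
  fixes Q :: "complex^'k::finite \<Rightarrow> complex poly" and R :: "complex \<times> (complex^'k) \<Rightarrow> complex"
  assumes index: "bij_betw \<iota> (UNIV :: 'k set) {..<k}" and k: "k \<ge> 1"
    and hR: "hol R (0, 0)" and hQ: "\<forall>j. hol (\<lambda>\<epsilon>. coeff (Q \<epsilon>) j) 0" and dQ: "\<forall>\<epsilon>. degree (Q \<epsilon>) \<le> k" and Q0: "poly (Q 0) 0 = 0"
    and h\<beta>: "hol \<beta> 0" and \<beta>real: "\<forall>\<^sub>F \<epsilon> in nhds 0. \<beta> (cj \<epsilon>) = cj (\<beta> \<epsilon>)"
    and dF: "\<forall>\<^sub>F q in nhds (0, 0). poly (cpoly \<iota> (snd q)) (fst q) = 0 \<longrightarrow> ddir (prepared_map \<iota> Q R) q (1, 0) =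
        exp (poly (pderiv (cpoly \<iota> (snd q))) (fst q) / (1 + \<beta> (snd q) * fst q ^ k) / 2)"
  obtains \<rho> \<rho>' \<delta> where "0 < \<rho>'" "\<rho>' \<le> \<rho>" "0 < \<delta>"
    "let Q' = (\<lambda>\<epsilon>. Q (cvec \<epsilon>)); R' = (\<lambda>\<epsilon> z. R (z, cvec \<epsilon>)); F = prepared_family \<iota> Q' R'; V = ball 0 \<delta>;
         G = (\<lambda>\<epsilon>. F \<epsilon> \<circ> F \<epsilon>); b = b_fun G (ball 0 \<rho>') V; v = (\<lambda>\<epsilon> Z. poly (P_poly \<iota> \<epsilon>) Z / (1 + b \<epsilon> * Z ^ k)) in
       (\<forall>j. real_analytic_on (\<lambda>\<epsilon>. coeff (Q' \<epsilon>) j) V) \<and> mix_analytic_on R' \<rho> V \<and>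
       (\<forall>\<epsilon>\<in>V. F \<epsilon> ` ball 0 \<rho>' \<subseteq> ball 0 \<rho>) \<and> (\<forall>\<epsilon>\<in>V. b \<epsilon> \<in> \<real>) \<and> real_analytic_on b V \<and>
       (\<forall>\<epsilon>\<in>V. \<exists>M. is_fixed_point_mset (G \<epsilon>) (ball 0 \<rho>') M \<and> size M = k + 1 \<and>
            (\<forall>Z\<in>#M. Ln (d_zbar (F \<epsilon>) Z) = 1/2 * cnj (deriv (v \<epsilon>) Z)))"
proof -
  define P where "P q = poly (cpoly \<iota> (snd q)) (fst q)" for q :: "complex \<times> (complex^'k)"
  define dP where "dP q = poly (pderiv (cpoly \<iota> (snd q))) (fst q)" for q :: "complex \<times> (complex^'k)"
  define F where "F = prepared_map \<iota> Q R"
  define n where "n q = 1 / 2 + poly (Q (snd q)) (fst q) + P q * R q" for q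
  \<comment> \<open>At the roots of \<open>P\<close> this is the derivative of
    \<open>P / (1 + \<beta> z ^ k)\<close>.\<close>
  define \<kappa> where "\<kappa> q = dP q / (1 + \<beta> (snd q) * fst q ^ k)" for q
  have F_eq: "F q = fst q + P q * n q" for q by (simp add: F_def prepared_map_def n_def P_def)
  have hP: "hol P q" for q unfolding P_def by (intro hol_cpoly hol_fst' hol_snd')
  have hdP: "hol dP q" for q
  proof -
    have eq: "dP = (\<lambda>q. ddir P q (1, 0))"
    proof
      fix q :: "complex \<times> (complex^'k)"
      have "ddir P q (1, 0) = deriv (\<lambda>z. P (z, snd q)) (fst q)"
        using ddir_slice1[of P "fst q" "snd q"] hol_imp_cdiff[OF hP] by simp
      also have "(\<lambda>z. P (z, snd q)) = poly (cpoly \<iota> (snd q))" by (simp add: P_def fun_eq_iff)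
      also have "deriv \<dots> (fst q) = dP q" unfolding dP_def by (rule DERIV_imp_deriv[OF poly_DERIV])
      finally show "dP q = ddir P q (1, 0)" ..
    qed
    show ?thesis unfolding eq by (rule hol_ddir[OF hP])
  qed
  have hn: "hol n (0, 0)" unfolding n_def
    by (intro hol_add hol_mult hol_const hP hR hol_poly_coeffs) (use hQ dQ in auto)
  have hF: "hol F (0, 0)" unfolding F_eq[abs_def] by (intro hol_add hol_mult hol_fst' hP hn)
  have P0: "P (0, 0) = 0" by (simp add: P_def cpoly_def poly_monom)
  have dP0: "dP (0, 0) = 0"
    using k by (simp add: dP_def cpoly_def bij_betw_card[OF index] pderiv_monom poly_monom power_0_left)
  have n0: "n (0, 0) = 1 / 2" by (simp add: n_def Q0 P0)
  have F0: "F (0, 0) = 0" by (simp add: F_eq P0)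
  have ccP: "cc P = P" by (rule ext) (simp add: cc_def P_def cnj_poly_cpoly)
  have cF_eq: "cc F q = fst q + P q * cc n q" for q
    using fun_cong[OF ccP, of q] by (simp add: cc_def F_eq)
  have hcF: "hol (cc F) (0, 0)" and hcn: "hol (cc n) (0, 0)" by (rule hol_cc, use hF hn in simp)+
  have cF0: "cc F (0, 0) = 0" by (simp add: cc_def F0)
  have cn0: "cc n (0, 0) = 1 / 2" by (simp add: cc_def n0)
  \<comment> \<open>The family applies \<open>F\<close> to the conjugate of the point, so its second
    iterate is holomorphic, namely \<open>F\<close> after \<open>cc F\<close>.\<close>
  define G where "G q = F (cc F q, snd q)" for q
  have hG: "hol G (0, 0)" unfolding G_def by (rule hol_comp_pair) (use hF hcF cF0 in auto)
  have pbF: "\<forall>\<^sub>F q in nhds (0, 0). A (cc F q, snd q)" if "\<forall>\<^sub>F q in nhds (0, 0). A q" for A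
    by (rule eventually_pullback[OF hcF cF0 that])
  have h\<kappa>: "hol \<kappa> (0, 0)" unfolding \<kappa>_def
    by (intro hol_divide hdP hol_add hol_mult hol_const hol_power hol_fst' hol_snd_arg h\<beta>) (use k in \<open>simp add: power_0_left\<close>)
  have \<kappa>0: "\<kappa> (0, 0) = 0" by (simp add: \<kappa>_def dP0)
  have ev_n: "\<forall>\<^sub>F q in nhds (0, 0). norm (n q - 1 / 2) < 1 / 8"
    by (rule isCont_eventually_norm_less, rule hol_isCont, rule hol_diff[OF hn hol_const]) (simp add: n0)
  have ev_cn: "\<forall>\<^sub>F q in nhds (0, 0). norm (cc n q - 1 / 2) < 1 / 8"
    by (rule isCont_eventually_norm_less, rule hol_isCont, rule hol_diff[OF hcn hol_const]) (simp add: cn0)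
  have ev_\<kappa>: "\<forall>\<^sub>F q in nhds (0, 0). norm (\<kappa> q) < 1"
    by (rule isCont_eventually_norm_less[OF hol_isCont[OF h\<kappa>]]) (simp add: \<kappa>0)
  have ev_den: "\<forall>\<^sub>F q in nhds (0, 0). 1 + \<beta> (snd q) * fst q ^ k \<noteq> 0"
  proof -
    have "hol (\<lambda>q. 1 + \<beta> (snd q) * fst q ^ k) (0, 0)"
      by (intro hol_add hol_mult hol_const hol_power hol_fst' hol_snd_arg h\<beta>)
    from isCont_nhds_0[OF hol_isCont[OF this] refl, of "\<lambda>w. w \<noteq> 0"]
    show ?thesis using t1_space_nhds[of "1::complex" 0] k by (simp add: power_0_left)
  qed
  obtain r where r: "r > 0" "\<And>x y. x \<in> ball (0, 0) r \<Longrightarrow> y \<in> ball (0, 0) r \<Longrightarrow>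
      norm (P x - P y - ddir P (0, 0) (x - y)) \<le> 1 / 4 * norm (x - y)"
    using hol_lipschitz[OF hP, of "1/4" "(0, 0)"] by auto
  have nb: "\<forall>\<^sub>F q in nhds (0, 0). q \<in> ball (0 :: complex, 0 :: complex^'k) r"
    by (rule eventually_nhds_in_open) (use r in auto)
  have ev_G: "\<forall>\<^sub>F q in nhds (0, 0). norm (G q - fst q - P q) \<le> norm (P q) / 2"
    using ev_cn pbF[OF ev_n] nb pbF[OF nb]
  proof eventually_elim
    case (elim q)
    let ?w = "(cc F q, snd q)"
    have "ddir P (0, 0) (c, 0) = 0" for c
    proof -
      have "ddir P (0, 0) (1, 0) = dP (0, 0)"
        using ddir_slice1[of P 0 0] hol_imp_cdiff[OF hP] unfolding dP_def
        by (simp add: P_def[abs_def] DERIV_imp_deriv[OF poly_DERIV])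
      thus ?thesis using ddir_fst_direction[OF hol_imp_cdiff[OF hP], of "(0, 0)" c 0] dP0
        by (simp add: ddir_zero[OF hol_imp_cdiff[OF hP], unfolded zero_prod_def])
    qed
    moreover have "?w - q = (P q * cc n q, 0)" by (cases q) (simp add: cF_eq)
    ultimately have 1: "norm (P ?w - P q) \<le> 1 / 4 * norm (P q * cc n q)"
      using r(2)[OF elim(4,3)] by (simp add: norm_Pair)
    have cn: "norm (cc n q) \<le> 1" using elim(1) norm_triangle_ineq[of "cc n q - 1/2" "1/2"] by simp
    have n1: "norm (n ?w) \<le> 1" using elim(2) norm_triangle_ineq[of "n ?w - 1/2" "1/2"] by simp
    have 2: "norm (P ?w - P q) \<le> norm (P q) / 4"
      using 1 mult_left_mono[OF cn norm_ge_zero[of "P q"]] by (simp add: norm_mult)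
    \<comment> \<open>\<open>cc n\<close> and \<open>n\<close> contribute 1/2 each to the
      coefficient of \<open>P\<close>, with errors 1/8; evaluating \<open>P\<close> at the
      intermediate point costs 1/4, since its derivative in the variable is 0 at the origin.\<close>
    have "G q - fst q - P q = P q * (cc n q - 1 / 2) + P q * (n ?w - 1 / 2) + (P ?w - P q) * n ?w"
      by (simp add: G_def F_eq cF_eq algebra_simps)
    hence "norm (G q - fst q - P q) \<le> norm (P q * (cc n q - 1 / 2)) + norm (P q * (n ?w - 1 / 2)) + norm ((P ?w - P q) * n ?w)"
      by (metis norm_triangle_ineq norm_triangle_mono order_refl)
    also have "\<dots> \<le> norm (P q) * (1 / 8) + norm (P q) * (1 / 8) + norm (P q) / 4 * 1"
      unfolding norm_mult by (intro add_mono mult_mono) (use elim 2 n1 in auto)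
    finally show ?case by simp
  qed
  have ev_dF: "\<forall>\<^sub>F q in nhds (0, 0). P q = 0 \<longrightarrow> ddir F q (1, 0) = exp (\<kappa> q / 2)"
    using dF by (simp add: P_def F_def \<kappa>_def dP_def)
  have ev_c: "\<forall>\<^sub>F q in nhds (0, 0). cdiff F q \<and> cdiff (cc F) q" using hF hcF by (simp add: hol_def eventually_conj_iff)
  have dPcj: "dP (cj q) = cnj (dP q)" for q
  proof -
    have "ddir (cc P) q (1, 0) = cnj (ddir P (cj q) (1, 0))" using ddir_cc[of P q "(1, 0)"] hol_imp_cdiff[OF hP] by simp
    moreover have "ddir P q (1, 0) = dP q" for q
    proof -
      have "ddir P q (1, 0) = deriv (\<lambda>z. P (z, snd q)) (fst q)"
        using ddir_slice1[of P "fst q" "snd q"] hol_imp_cdiff[OF hP] by simp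
      also have "(\<lambda>z. P (z, snd q)) = poly (cpoly \<iota> (snd q))" by (simp add: P_def fun_eq_iff)
      also have "deriv \<dots> (fst q) = dP q" unfolding dP_def by (rule DERIV_imp_deriv[OF poly_DERIV])
      finally show ?thesis .
    qed
    ultimately show ?thesis unfolding ccP by simp
  qed
  have ev_\<kappa>cj: "\<forall>\<^sub>F q in nhds (0, 0). \<kappa> (cj q) = cnj (\<kappa> q)"
    using eventually_snd[OF \<beta>real, of "0 :: complex"] by eventually_elim (simp add: \<kappa>_def dPcj)
  have "\<forall>\<^sub>F q in nhds (cj (0, 0)). P q = 0 \<longrightarrow> ddir F q (1, 0) = exp (\<kappa> q / 2)" using ev_dF by simp
  note ev_dF' = eventually_nhds_cj[OF this]
  have "\<forall>\<^sub>F q in nhds (cj (0, 0)). cdiff F q \<and> cdiff (cc F) q" using ev_c by simp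
  note ev_c' = eventually_nhds_cj[OF this]
  \<comment> \<open>A root and its conjugate carry conjugate values of \<open>\<kappa>\<close>, so
    both applications of the map contribute the same factor
    \<open>exp (\<kappa> q / 2)\<close>.\<close>
  have ev_dG: "\<forall>\<^sub>F q in nhds (0, 0). P q = 0 \<longrightarrow> ddir G q (1, 0) = exp (\<kappa> q)"
    using ev_dF ev_dF' ev_c ev_c' ev_\<kappa>cj
  proof eventually_elim
    case (elim q)
    show ?case
    proof
      assume P: "P q = 0"
      hence "P (cj q) = 0" using fun_cong[OF ccP, of q] by (simp add: cc_def)
      hence 1: "ddir (cc F) q (1, 0) = exp (\<kappa> q / 2)"
        using ddir_cc[of F q "(1, 0)"] elim by (simp add: exp_cnj)
      have cq: "(cc F q, snd q) = q" using P by (simp add: cF_eq)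
      have "ddir G q (1, 0) = ddir F q (ddir (cc F) q (1, 0), 0)"
        unfolding G_def using ddir_comp_pair[of F "cc F" q "(1, 0)"] elim(3) cq by simp
      also have "\<dots> = exp (\<kappa> q / 2) * exp (\<kappa> q / 2)"
        using ddir_fst_direction[of F q "exp (\<kappa> q / 2)" 0] ddir_zero[of F q] elim(1,3) P 1 by (simp add: zero_prod_def)
      also have "\<dots> = exp (\<kappa> q)" by (simp flip: exp_add)
      finally show "ddir G q (1, 0) = exp (\<kappa> q)" .
    qed
  qed
  have "\<forall>\<^sub>F q in nhds (0, 0). (norm (G q - fst q - P q) \<le> norm (P q) / 2) \<and> (P q = 0 \<longrightarrow> ddir G q (1, 0) = exp (\<kappa> q)) \<and>
      (P q = 0 \<longrightarrow> ddir F q (1, 0) = exp (\<kappa> q / 2)) \<and> norm (\<kappa> q) < 1 \<and> 1 + \<beta> (snd q) * fst q ^ k \<noteq> 0 \<and>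
      hol F q \<and> hol G q \<and> hol R q \<and> \<kappa> (cj q) = cnj (\<kappa> q)"
    by (intro eventually_conj ev_G ev_dG ev_dF ev_\<kappa> ev_den ev_\<kappa>cj hol_eventually hF hG hR)
  then obtain \<rho> where \<rho>: "\<rho> > 0" "\<And>z \<epsilon>. norm z < \<rho> \<Longrightarrow> norm \<epsilon> < \<rho> \<Longrightarrow> (norm (G (z, \<epsilon>) - z - P (z, \<epsilon>)) \<le> norm (P (z, \<epsilon>)) / 2) \<and>
      (P (z, \<epsilon>) = 0 \<longrightarrow> ddir G (z, \<epsilon>) (1, 0) = exp (\<kappa> (z, \<epsilon>))) \<and>
      (P (z, \<epsilon>) = 0 \<longrightarrow> ddir F (z, \<epsilon>) (1, 0) = exp (\<kappa> (z, \<epsilon>) / 2)) \<and> norm (\<kappa> (z, \<epsilon>)) < 1 \<and> 1 + \<beta> \<epsilon> * z ^ k \<noteq> 0 \<and>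
      hol F (z, \<epsilon>) \<and> hol G (z, \<epsilon>) \<and> hol R (z, \<epsilon>) \<and> \<kappa> (cnj z, cj \<epsilon>) = cnj (\<kappa> (z, \<epsilon>))"
    by (rule eventually_nhds_Pair_norm) auto
  have "\<forall>\<^sub>F q in nhds (0, 0). norm (F q) < \<rho>"
    by (rule isCont_eventually_norm_less[OF hol_isCont[OF hF]]) (use F0 \<rho> in simp)
  then obtain \<rho>1 where \<rho>1: "\<rho>1 > 0" "\<And>z \<epsilon>. norm z < \<rho>1 \<Longrightarrow> norm \<epsilon> < \<rho>1 \<Longrightarrow> norm (F (z, \<epsilon>)) < \<rho>"
    by (rule eventually_nhds_Pair_norm) auto
  \<comment> \<open>The first image of this smaller disc stays inside the disc on which the germs
    are controlled.\<close>
  define \<rho>' where "\<rho>' = min \<rho> \<rho>1"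
  have \<rho>': "0 < \<rho>'" "\<rho>' \<le> \<rho>" "\<rho>' \<le> \<rho>1" using \<rho> \<rho>1 by (auto simp: \<rho>'_def)
  \<comment> \<open>One common ball for all coefficients exists because only those up to degree
    \<open>k\<close> are in question; the others vanish identically.\<close>
  have "\<forall>\<^sub>F \<epsilon> in nhds 0. \<forall>j\<in>{..k}. hol (\<lambda>\<epsilon>. coeff (Q \<epsilon>) j) \<epsilon>"
    by (rule eventually_ball_finite) (use hQ hol_eventually in auto)
  hence "\<forall>\<^sub>F \<epsilon> in nhds 0. (\<forall>j\<in>{..k}. hol (\<lambda>\<epsilon>. coeff (Q \<epsilon>) j) \<epsilon>) \<and> hol \<beta> \<epsilon> \<and> \<beta> (cj \<epsilon>) = cj (\<beta> \<epsilon>) \<and>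
      (\<forall>a. poly (cpoly \<iota> \<epsilon>) a = 0 \<longrightarrow> norm a < \<rho>')"
    by (intro eventually_conj hol_eventually[OF h\<beta>] \<beta>real cpoly_roots_small[OF index \<rho>'(1)])
  then obtain \<delta>1 where \<delta>1: "\<delta>1 > 0" "\<And>\<epsilon>. norm \<epsilon> < \<delta>1 \<Longrightarrow> (\<forall>j\<in>{..k}. hol (\<lambda>\<epsilon>. coeff (Q \<epsilon>) j) \<epsilon>) \<and> hol \<beta> \<epsilon> \<and> \<beta> (cj \<epsilon>) = cj (\<beta> \<epsilon>) \<and>
      (\<forall>a. poly (cpoly \<iota> \<epsilon>) a = 0 \<longrightarrow> norm a < \<rho>')"
    unfolding eventually_nhds_metric by (auto simp: dist_norm)
  \<comment> \<open>Parameters are also kept below \<open>\<rho>'\<close>, hence below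
    \<open>\<rho>\<close> and \<open>\<rho>1\<close>, the bounds under which the estimates were
    extracted.\<close>
  define \<delta> where "\<delta> = min \<delta>1 \<rho>'"
  have \<delta>: "\<delta> > 0" "\<delta> \<le> \<delta>1" "\<delta> \<le> \<rho>'" using \<delta>1 \<rho>' by (auto simp: \<delta>_def)
  define Q' where "Q' \<epsilon> = Q (cvec \<epsilon>)" for \<epsilon> :: "real^'k"
  define R' where "R' \<epsilon> z = R (z, cvec \<epsilon>)" for \<epsilon> :: "real^'k" and z
  define F' where "F' = prepared_family \<iota> Q' R'"
  define V where "V = ball (0 :: real^'k) \<delta>"
  define G' where "G' \<epsilon> = F' \<epsilon> \<circ> F' \<epsilon>" for \<epsilon>
  define b where "b = b_fun G' (ball 0 \<rho>') V"
  define v where "v \<epsilon> Z = poly (P_poly \<iota> \<epsilon>) Z / (1 + b \<epsilon> * Z ^ k)" for \<epsilon> Z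
  have F'_eq: "F' \<epsilon> z = F (cnj z, cvec \<epsilon>)" for \<epsilon> z
    by (simp add: F'_def prepared_family_def F_def prepared_map_def P_poly_eq Q'_def R'_def)
  have G'_eq: "G' \<epsilon> z = G (z, cvec \<epsilon>)" for \<epsilon> z
    by (simp add: G'_def F'_eq G_def cc_def)
  have nV: "norm (cvec \<epsilon>) < \<delta>" if "\<epsilon> \<in> V" for \<epsilon> using that by (simp add: V_def)
  have V\<rho>: "norm (cvec \<epsilon>) < \<rho>" if "\<epsilon> \<in> V" for \<epsilon> using nV[OF that] \<delta> \<rho>' by simp
  have roots: "norm z < \<rho>'" if "\<epsilon> \<in> V" "poly (cpoly \<iota> (cvec \<epsilon>)) z = 0" for \<epsilon> z
    using \<delta>1(2)[of "cvec \<epsilon>"] nV[OF that(1)] \<delta> that(2) by auto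
  note props = \<rho>(2)[OF _ V\<rho>]
  have fixed: "G' \<epsilon> z = z \<longleftrightarrow> poly (cpoly \<iota> (cvec \<epsilon>)) z = 0" if "\<epsilon> \<in> V" "norm z < \<rho>'" for \<epsilon> z
  proof -
    have 1: "norm (G' \<epsilon> z - z - P (z, cvec \<epsilon>)) \<le> norm (P (z, cvec \<epsilon>)) / 2"
      using props[of z \<epsilon>] that \<rho>' by (simp add: G'_eq)
    show ?thesis
    proof
      assume "G' \<epsilon> z = z"
      hence "norm (P (z, cvec \<epsilon>)) \<le> norm (P (z, cvec \<epsilon>)) / 2" using 1 by simp
      hence "norm (P (z, cvec \<epsilon>)) \<le> 0" by linarith
      thus "poly (cpoly \<iota> (cvec \<epsilon>)) z = 0" by (simp add: P_def)
    next
      assume "poly (cpoly \<iota> (cvec \<epsilon>)) z = 0"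
      thus "G' \<epsilon> z = z" using 1 by (simp add: P_def)
    qed
  qed
  have zord: "zorder (\<lambda>w. G' \<epsilon> w - w) z = int (order z (cpoly \<iota> (cvec \<epsilon>)))"
    if "\<epsilon> \<in> V" "poly (cpoly \<iota> (cvec \<epsilon>)) z = 0" for \<epsilon> z
  proof (rule zorder_perturbed_poly[OF cpoly_neq_0[OF index] that(2) open_ball])
    show "z \<in> ball 0 \<rho>'" using roots[OF that] by simp
    show "(\<lambda>w. G' \<epsilon> w - w) holomorphic_on ball 0 \<rho>'"
      unfolding G'_eq by (intro holomorphic_onI_hol hol_diff hol_ident hol_slice1)
        (use props \<rho>' that(1) in auto)
    show "norm (G' \<epsilon> w - w - poly (cpoly \<iota> (cvec \<epsilon>)) w) \<le> norm (poly (cpoly \<iota> (cvec \<epsilon>)) w) / 2" if "w \<in> ball 0 \<rho>'" for w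
      using props[of w \<epsilon>] that \<open>\<epsilon> \<in> V\<close> \<rho>' by (simp add: G'_eq P_def)
  qed
  have LnG: "Ln (deriv (G' \<epsilon>) z) = \<kappa> (z, cvec \<epsilon>)" if "\<epsilon> \<in> V" "poly (cpoly \<iota> (cvec \<epsilon>)) z = 0" for \<epsilon> z
  proof -
    have z: "norm z < \<rho>" using roots[OF that] \<rho>' by simp
    note pr = props[OF z that(1)]
    have "cdiff G (z, cvec \<epsilon>)" by (rule hol_imp_cdiff) (use pr in blast)
    hence "deriv (G' \<epsilon>) z = ddir G (z, cvec \<epsilon>) (1, 0)"
      unfolding G'_eq[abs_def] by (rule ddir_slice1[symmetric])
    also have "\<dots> = exp (\<kappa> (z, cvec \<epsilon>))" using pr that(2) by (simp add: P_def)
    finally have d: "deriv (G' \<epsilon>) z = exp (\<kappa> (z, cvec \<epsilon>))" .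
    \<comment> \<open>The bound on \<open>\<kappa>\<close> keeps it inside the principal strip,
      where \<open>Ln\<close> inverts the exponential.\<close>
    have "\<bar>Im (\<kappa> (z, cvec \<epsilon>))\<bar> < 1" using pr abs_Im_le_cmod[of "\<kappa> (z, cvec \<epsilon>)"] by linarith
    thus ?thesis unfolding d by (intro Ln_exp) (use pi_gt3 in linarith)+
  qed
  have simple: "simple_params G' (ball 0 \<rho>') V = V \<inter> {\<epsilon>. rsquarefree (cpoly \<iota> (cvec \<epsilon>))}"
  proof (intro set_eqI iffI)
    fix \<epsilon> assume "\<epsilon> \<in> simple_params G' (ball 0 \<rho>') V"
    hence V: "\<epsilon> \<in> V" and s: "\<And>z. norm z < \<rho>' \<Longrightarrow> G' \<epsilon> z = z \<Longrightarrow> zorder (\<lambda>w. G' \<epsilon> w - w) z = 1"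
      by (auto simp: simple_params_def)
    have "order z (cpoly \<iota> (cvec \<epsilon>)) = 1" if "poly (cpoly \<iota> (cvec \<epsilon>)) z = 0" for z
      using s[of z] zord[OF V that] fixed[OF V] roots[OF V that] that by simp
    hence "rsquarefree (cpoly \<iota> (cvec \<epsilon>))"
      unfolding rsquarefree_def using cpoly_neq_0[OF index] order_root by blast
    thus "\<epsilon> \<in> V \<inter> {\<epsilon>. rsquarefree (cpoly \<iota> (cvec \<epsilon>))}" using V by simp
  next
    fix \<epsilon> assume "\<epsilon> \<in> V \<inter> {\<epsilon>. rsquarefree (cpoly \<iota> (cvec \<epsilon>))}"
    hence V: "\<epsilon> \<in> V" and s: "rsquarefree (cpoly \<iota> (cvec \<epsilon>))" by auto
    have "zorder (\<lambda>w. G' \<epsilon> w - w) z = 1" if "norm z < \<rho>'" "G' \<epsilon> z = z" for z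
      using zord[OF V] fixed[OF V that(1)] that(2) rsquarefree_root_order[OF s _ cpoly_neq_0[OF index]] by simp
    thus "\<epsilon> \<in> simple_params G' (ball 0 \<rho>') V" using V by (simp add: simple_params_def)
  qed
  have ils: "inverse_log_sum (G' \<epsilon>) (ball 0 \<rho>') = \<beta> (cvec \<epsilon>)" if "\<epsilon> \<in> V" "rsquarefree (cpoly \<iota> (cvec \<epsilon>))" for \<epsilon>
  proof -
    have "{z. z \<in> ball 0 \<rho>' \<and> G' \<epsilon> z = z} = {z. poly (cpoly \<iota> (cvec \<epsilon>)) z = 0}"
      using fixed[OF that(1)] roots[OF that(1)] by auto
    hence "inverse_log_sum (G' \<epsilon>) (ball 0 \<rho>') = (\<Sum>z | poly (cpoly \<iota> (cvec \<epsilon>)) z = 0. 1 / Ln (deriv (G' \<epsilon>) z))"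
      by (simp only: inverse_log_sum_def)
    also have "\<dots> = (\<Sum>z | poly (cpoly \<iota> (cvec \<epsilon>)) z = 0. (1 + \<beta> (cvec \<epsilon>) * z ^ k) / poly (pderiv (cpoly \<iota> (cvec \<epsilon>))) z)"
      by (rule sum.cong) (use LnG[OF that(1)] in \<open>simp_all add: \<kappa>_def dP_def\<close>)
    also have "\<dots> = \<beta> (cvec \<epsilon>)"
      by (rule sum_interpolation_weights[OF that(2) degree_cpoly(2,1)[OF index] k])
    finally show ?thesis .
  qed
  \<comment> \<open>At a parameter with multiple fixed points the value is a limit along simple
    parameters; these accumulate there, and \<open>\<beta>\<close> is continuous.\<close>
  have b_eq: "b \<epsilon> = \<beta> (cvec \<epsilon>)" if V: "\<epsilon> \<in> V" for \<epsilon>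
  proof (cases "\<epsilon> \<in> simple_params G' (ball 0 \<rho>') V")
    case True
    thus ?thesis using ils[OF V] by (simp add: b_def b_fun_def simple)
  next
    case False
    let ?S = "simple_params G' (ball 0 \<rho>') V"
    have "\<epsilon> islimpt V \<inter> {\<epsilon>. rsquarefree (cpoly \<iota> (cvec \<epsilon>))}"
    proof (rule islimptI)
      fix T assume "\<epsilon> \<in> T" "open T"
      hence "\<epsilon> \<in> T \<inter> V" "open (T \<inter> V)" using V by (auto simp: V_def)
      with islimpt_rsquarefree_cpoly[OF index k, of \<epsilon>]
      obtain y where "y \<in> {\<epsilon>. rsquarefree (cpoly \<iota> (cvec \<epsilon>))}" "y \<in> T \<inter> V" "y \<noteq> \<epsilon>" by (rule islimptE)
      thus "\<exists>y\<in>V \<inter> {\<epsilon>. rsquarefree (cpoly \<iota> (cvec \<epsilon>))}. y \<in> T \<and> y \<noteq> \<epsilon>" by blast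
    qed
    hence "\<not> trivial_limit (at \<epsilon> within ?S)"
      by (simp add: trivial_limit_within simple)
    moreover have "((\<lambda>\<epsilon>'. inverse_log_sum (G' \<epsilon>') (ball 0 \<rho>')) \<longlongrightarrow> \<beta> (cvec \<epsilon>)) (at \<epsilon> within ?S)"
    proof (rule Lim_transform_eventually)
      have "hol \<beta> (cvec \<epsilon>)" using \<delta>1(2)[of "cvec \<epsilon>"] nV[OF V] \<delta> by auto
      hence "isCont (\<lambda>\<epsilon>. \<beta> (cvec \<epsilon>)) \<epsilon>"
        by (rule isCont_o2[OF linear_continuous_at[OF bounded_linear_cvec] hol_isCont])
      thus "((\<lambda>\<epsilon>. \<beta> (cvec \<epsilon>)) \<longlongrightarrow> \<beta> (cvec \<epsilon>)) (at \<epsilon> within ?S)"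
        unfolding isCont_def by (rule tendsto_within_subset) simp
      show "\<forall>\<^sub>F \<epsilon>' in at \<epsilon> within ?S. \<beta> (cvec \<epsilon>') = inverse_log_sum (G' \<epsilon>') (ball 0 \<rho>')"
        unfolding eventually_at_filter by (rule always_eventually) (use ils simple in auto)
    qed
    ultimately show ?thesis using False by (simp add: b_def b_fun_def tendsto_Lim)
  qed
  have concl: "(\<forall>j. real_analytic_on (\<lambda>\<epsilon>. coeff (Q' \<epsilon>) j) V) \<and> mix_analytic_on R' \<rho> V \<and>
       (\<forall>\<epsilon>\<in>V. F' \<epsilon> ` ball 0 \<rho>' \<subseteq> ball 0 \<rho>) \<and> (\<forall>\<epsilon>\<in>V. b \<epsilon> \<in> \<real>) \<and> real_analytic_on b V \<and>
       (\<forall>\<epsilon>\<in>V. \<exists>M. is_fixed_point_mset (G' \<epsilon>) (ball 0 \<rho>') M \<and> size M = k + 1 \<and>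
            (\<forall>Z\<in>#M. Ln (d_zbar (F' \<epsilon>) Z) = 1/2 * cnj (deriv (v \<epsilon>) Z)))"
  proof (intro conjI ballI allI)
    show "real_analytic_on (\<lambda>\<epsilon>. coeff (Q' \<epsilon>) j) V" for j
    proof (rule real_analytic_on_cvec[where F = "\<lambda>\<epsilon>. coeff (Q \<epsilon>) j"])
      fix \<epsilon> assume "\<epsilon> \<in> V"
      show "hol (\<lambda>\<epsilon>. coeff (Q \<epsilon>) j) (cvec \<epsilon>)"
      proof (cases "j \<le> k")
        case True
        thus ?thesis using \<delta>1(2)[of "cvec \<epsilon>"] nV[OF \<open>\<epsilon> \<in> V\<close>] \<delta> by auto
      next
        case False
        have "degree (Q e) < j" for e using dQ False by (meson le_less_trans not_le)
        hence "(\<lambda>\<epsilon>. coeff (Q \<epsilon>) j) = (\<lambda>\<epsilon>. 0)" by (simp add: coeff_eq_0)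
        thus ?thesis by (simp add: hol_const)
      qed
    qed (simp_all add: V_def Q'_def)
    show "mix_analytic_on R' \<rho> V"
      unfolding R'_def[abs_def] by (rule mix_analytic_onI) (use props in blast)
    show "F' \<epsilon> ` ball 0 \<rho>' \<subseteq> ball 0 \<rho>" if "\<epsilon> \<in> V" for \<epsilon>
      using \<rho>1(2)[of _ "cvec \<epsilon>"] nV[OF that] \<delta> \<rho>' by (auto simp: F'_eq)
    show "b \<epsilon> \<in> \<real>" if "\<epsilon> \<in> V" for \<epsilon>
    proof -
      have "\<beta> (cvec \<epsilon>) = cnj (\<beta> (cvec \<epsilon>))" using \<delta>1(2)[of "cvec \<epsilon>"] nV[OF that] \<delta> by auto
      thus ?thesis unfolding b_eq[OF that] by (metis Reals_cnj_iff)
    qed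
    show "real_analytic_on b V"
      by (rule real_analytic_on_cvec[where F = \<beta>]) (use \<delta>1(2) nV \<delta> b_eq in \<open>auto simp: V_def\<close>)
    fix \<epsilon> assume V: "\<epsilon> \<in> V"
    let ?p = "cpoly \<iota> (cvec \<epsilon>)"
    have p0: "?p \<noteq> 0" by (rule cpoly_neq_0[OF index])
    show "\<exists>M. is_fixed_point_mset (G' \<epsilon>) (ball 0 \<rho>') M \<and> size M = k + 1 \<and>
            (\<forall>Z\<in>#M. Ln (d_zbar (F' \<epsilon>) Z) = 1/2 * cnj (deriv (v \<epsilon>) Z))"
    \<comment> \<open>By \<open>zord\<close>, root multiplicities of the polynomial are the orders
      of \<open>G w - w\<close>.\<close>
    proof (intro exI[of _ "proots ?p"] conjI ballI)
      show "is_fixed_point_mset (G' \<epsilon>) (ball 0 \<rho>') (proots ?p)"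
        unfolding is_fixed_point_mset_def using p0 fixed[OF V] roots[OF V] zord[OF V] by auto
      show "size (proots ?p) = k + 1" by (simp add: size_proots_complex degree_cpoly(1)[OF index])
      fix Z assume "Z \<in># proots ?p"
      hence Z: "poly ?p Z = 0" using p0 by simp
      \<comment> \<open>\<open>d_zbar\<close> at \<open>Z\<close> is a holomorphic derivative at
        \<open>cnj Z\<close>, again a root as the coefficients are real; this is the origin of the
        conjugate in the conclusion.\<close>
      have cZ: "poly ?p (cnj Z) = 0" using cnj_poly_cpoly[of \<iota> "cvec \<epsilon>" Z] Z by simp
      have n: "norm (cnj Z) < \<rho>" using roots[OF V cZ] \<rho>' by simp
      note pr = props[OF n V]
      have cj: "\<kappa> (cnj Z, cvec \<epsilon>) = cnj (\<kappa> (Z, cvec \<epsilon>))"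
        using props[of Z \<epsilon>] n V by simp
      have "((\<lambda>z. F (z, cvec \<epsilon>)) has_field_derivative ddir F (cnj Z, cvec \<epsilon>) (1, 0)) (at (cnj Z))"
        by (rule cdiff_slice[OF hol_imp_cdiff]) (use pr in blast)
      hence "d_zbar (F' \<epsilon>) Z = ddir F (cnj Z, cvec \<epsilon>) (1, 0)"
        by (rule d_zbar_cnj) (simp add: F'_eq)
      also have "\<dots> = exp (\<kappa> (cnj Z, cvec \<epsilon>) / 2)" using pr cZ by (simp add: P_def)
      finally have d: "d_zbar (F' \<epsilon>) Z = exp (\<kappa> (cnj Z, cvec \<epsilon>) / 2)" .
      have "\<bar>Im (\<kappa> (cnj Z, cvec \<epsilon>))\<bar> < 1" using pr abs_Im_le_cmod[of "\<kappa> (cnj Z, cvec \<epsilon>)"] by linarith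
      hence "Ln (d_zbar (F' \<epsilon>) Z) = \<kappa> (cnj Z, cvec \<epsilon>) / 2"
        unfolding d by (intro Ln_exp) (use pi_gt3 in \<open>simp; linarith\<close>)+
      also have "\<dots> = 1 / 2 * cnj (\<kappa> (Z, cvec \<epsilon>))" by (simp add: cj)
      also have "\<kappa> (Z, cvec \<epsilon>) = deriv (v \<epsilon>) Z"
      proof -
        have den: "1 + \<beta> (cvec \<epsilon>) * Z ^ k \<noteq> 0" using props[of Z \<epsilon>] n V by simp
        obtain D where D: "((\<lambda>Z. 1 + \<beta> (cvec \<epsilon>) * Z ^ k) has_field_derivative D) (at Z)"
        proof
          show "((\<lambda>Z. 1 + \<beta> (cvec \<epsilon>) * Z ^ k) has_field_derivative \<beta> (cvec \<epsilon>) * (of_nat k * (1 * Z ^ (k - Suc 0)))) (at Z)"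
            by (auto intro!: derivative_eq_intros)
        qed
        have "((\<lambda>Z. poly ?p Z / (1 + \<beta> (cvec \<epsilon>) * Z ^ k)) has_field_derivative \<kappa> (Z, cvec \<epsilon>)) (at Z)"
          by (rule DERIV_cong[OF DERIV_divide[OF poly_DERIV D den]]) (use Z den in \<open>simp add: \<kappa>_def dP_def\<close>)
        thus ?thesis unfolding v_def[abs_def] P_poly_eq b_eq[OF V] by (intro DERIV_imp_deriv[symmetric])
      qed
      finally show "Ln (d_zbar (F' \<epsilon>) Z) = 1/2 * cnj (deriv (v \<epsilon>) Z)" .
    qed
  qed
  show ?thesis
    by (rule that[OF \<rho>'(1,2) \<delta>(1)])
      (use concl in \<open>unfold Let_def b_def v_def[abs_def] G'_def[abs_def] F'_def V_def Q'_def[abs_def] R'_def[abs_def]\<close>)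
qed

section \<open>Real-analytic vector-valued maps and genericity\<close>

lemma real_analytic_on_vecI:
  fixes f :: "'a::euclidean_space \<Rightarrow> real^'k::finite"
  assumes "\<And>i. real_analytic_on (\<lambda>x. complex_of_real (f x $ i)) U"
  shows "real_analytic_on f U"
proof -
  have "real_analytic_on (\<lambda>x. axis i (Re (complex_of_real (f x $ i))) :: real^'k) U" for i
    by (rule real_analytic_on_bounded_linear[OF _ assms, of "\<lambda>c. axis i (Re c)"])
      (intro bounded_linear_compose[OF bounded_linear_axis] bounded_linear_Re)
  hence "real_analytic_on (\<lambda>x. \<Sum>i\<in>UNIV. axis i (Re (complex_of_real (f x $ i))) :: real^'k) U"
    by (rule real_analytic_on_sum)
  moreover have "(\<Sum>i\<in>UNIV. axis i (Re (complex_of_real (f x $ i)))) = f x" for x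
    using vec_lambda_eq_sum_axis[of "\<lambda>i. f x $ i"] by simp
  ultimately show ?thesis by simp
qed

lemma real_analytic_on_PairI:
  fixes f :: "'a::euclidean_space \<Rightarrow> complex" and g :: "'a \<Rightarrow> real^'k::finite"
  assumes "real_analytic_on f U" "real_analytic_on g U"
  shows "real_analytic_on (\<lambda>x. (f x, g x)) U"
proof -
  have "real_analytic_on (\<lambda>x. (f x, 0 :: real^'k)) U"
    by (rule real_analytic_on_bounded_linear[OF _ assms(1), of "\<lambda>c. (c, 0)"])
      (intro bounded_linear_Pair bounded_linear_ident bounded_linear_zero)
  moreover have "real_analytic_on (\<lambda>x. (0 :: complex, g x)) U"
    by (rule real_analytic_on_bounded_linear[OF _ assms(2), of "\<lambda>c. (0, c)"])
      (intro bounded_linear_Pair bounded_linear_ident bounded_linear_zero)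
  ultimately have "real_analytic_on (\<lambda>x. (f x, 0) + (0, g x)) U" by (rule real_analytic_on_add)
  thus ?thesis by simp
qed

text \<open>Complexify each coordinate and restrict the complex derivative to real vectors. Applied
  to the inverse in the definition of genericity, it makes the chain rule available there.\<close>

lemma real_analytic_differentiable:
  fixes f :: "real^'k::finite \<Rightarrow> real^'k"
  assumes "real_analytic_on f U" "a \<in> U"
  obtains D where "(f has_derivative D) (at a)"
proof -
  have "\<exists>D. ((\<lambda>x. f x $ i) has_derivative D) (at a)" for i
  proof -
    have an: "real_analytic_on (\<lambda>x. complex_of_real (f x $ i)) U"
      by (rule real_analytic_on_bounded_linear[OF _ assms(1), of "\<lambda>y. complex_of_real (y $ i)"])
        (intro bounded_linear_compose[OF bounded_linear_of_real] bounded_linear_vec_nth)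
    define L where "L x b = (\<Sum>j\<in>UNIV. x $ j * complex_of_real (b $ j))" for x :: "complex^'k" and b :: "real^'k"
    have L1: "bounded_linear (\<lambda>x. L x b)" for b
      unfolding L_def by (intro bounded_linear_sum bounded_linear_mult_left[THEN bounded_linear_compose] bounded_linear_vec_nth)
    have L2: "L (cs c x) b = c * L x b" for b c x by (simp add: L_def sum_distrib_left mult_ac)
    have L3: "L (cvec y) b = of_real (y \<bullet> b)" for y b by (simp add: L_def inner_vec_def)
    have "\<exists>G s. s > 0 \<and> hol G 0 \<and> (\<forall>y. norm y < s \<longrightarrow> G (cvec y) = complex_of_real (f (a + y) $ i))"
    proof (rule real_analytic_imp_hol[OF an assms(2) L1 L2])
      fix G :: "complex^'k \<Rightarrow> complex" and s :: real
      assume "s > 0" "hol G 0" and G: "\<And>x y. (\<And>b. b \<in> Basis \<Longrightarrow> L x b = of_real (y \<bullet> b)) \<Longrightarrow> norm y < s \<Longrightarrow> G x = complex_of_real (f (a + y) $ i)"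
      moreover have "G (cvec y) = complex_of_real (f (a + y) $ i)" if "norm y < s" for y
        by (rule G[OF L3 that])
      ultimately show ?thesis by blast
    qed
    then obtain G s where G: "s > 0" "hol G 0" and Gc: "\<And>y. norm y < s \<Longrightarrow> G (cvec y) = complex_of_real (f (a + y) $ i)"
      by blast
    have "(G has_derivative ddir G 0) (at (cvec (a - a)))" using cdiff_has_derivative[OF hol_imp_cdiff[OF G(2)]] by simp
    moreover have "((\<lambda>x. cvec (x - a)) has_derivative (\<lambda>v. cvec (v - 0))) (at a)"
      by (intro bounded_linear.has_derivative[OF bounded_linear_cvec] has_derivative_diff has_derivative_ident has_derivative_const)
    ultimately have "((\<lambda>x. G (cvec (x - a))) has_derivative (\<lambda>v. ddir G 0 (cvec (v - 0)))) (at a)"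
      using has_derivative_compose[of "\<lambda>x. cvec (x - a)" "\<lambda>v. cvec (v - 0)" a UNIV G] by simp
    from bounded_linear.has_derivative[OF bounded_linear_Re this]
    have "((\<lambda>x. Re (G (cvec (x - a)))) has_derivative (\<lambda>v. Re (ddir G 0 (cvec (v - 0))))) (at a)" .
    hence "((\<lambda>x. f x $ i) has_derivative (\<lambda>v. Re (ddir G 0 (cvec (v - 0))))) (at a)"
    proof (rule has_derivative_transform_within_open[OF _ open_ball])
      show "a \<in> ball a s" using G by simp
      show "Re (G (cvec (x - a))) = f x $ i" if "x \<in> ball a s" for x
        using Gc[of "x - a"] that by (simp add: dist_norm norm_minus_commute)
    qed
    thus ?thesis by blast
  qed
  then obtain D where "\<And>i. ((\<lambda>x. f x $ i) has_derivative D i) (at a)" by metis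
  hence "((\<lambda>x. \<chi> i. f x $ i) has_derivative (\<lambda>v. \<chi> i. D i v)) (at a)" by (rule has_derivative_vec_lambda)
  thus ?thesis by (intro that) simp
qed

text \<open>The chain rule for the analytic inverse composed with the coefficient map shows that the
  real Jacobian is injective; \<open>\<alpha>\<close> expresses this Jacobian through holomorphic
  functions.\<close>

lemma generic_family_derivative:
  fixes a :: "nat \<Rightarrow> real^'k::finite \<Rightarrow> complex" and \<alpha> :: "nat \<Rightarrow> complex^'k \<Rightarrow> complex"
  assumes gen: "generic_family \<iota> a" and h: "\<And>i. hol (\<alpha> (\<iota> i)) 0"
    and eq: "\<forall>\<^sub>F \<eta> in nhds 0. \<forall>i. Re (a (\<iota> i) \<eta>) = Re (\<alpha> (\<iota> i) (cvec \<eta>))"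
    and w: "\<And>i. Re (ddir (\<alpha> (\<iota> i)) 0 (cvec w)) = 0"
  shows "w = 0"
proof -
  define A where "A \<eta> = (\<chi> i. Re (a (\<iota> i) \<eta>))" for \<eta>
  obtain U V where U: "0 \<in> U" and dif: "real_analytic_diffeo A U V"
    using gen unfolding generic_family_def A_def by blast
  hence oU: "open U" and bij: "bij_betw A U V" and an: "real_analytic_on (the_inv_into U A) V"
    by (auto simp: real_analytic_diffeo_def)
  have "A 0 \<in> V" using bij U by (auto simp: bij_betw_def)
  then obtain D where D: "(the_inv_into U A has_derivative D) (at (A 0))"
    using real_analytic_differentiable[OF an] by blast
  define A' where "A' v = (\<chi> i. Re (ddir (\<alpha> (\<iota> i)) 0 (cvec v)))" for v
  have d: "((\<lambda>\<eta>. \<chi> i. Re (\<alpha> (\<iota> i) (cvec \<eta>))) has_derivative A') (at 0)"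
    unfolding A'_def
  proof (rule has_derivative_vec_lambda, rule bounded_linear.has_derivative[OF bounded_linear_Re])
    fix i
    have "(\<alpha> (\<iota> i) has_derivative ddir (\<alpha> (\<iota> i)) 0) (at (cvec 0))"
      using cdiff_has_derivative[OF hol_imp_cdiff[OF h]] by simp
    from has_derivative_compose[OF bounded_linear_imp_has_derivative[OF bounded_linear_cvec] this]
    show "((\<lambda>\<eta>. \<alpha> (\<iota> i) (cvec \<eta>)) has_derivative (\<lambda>v. ddir (\<alpha> (\<iota> i)) 0 (cvec v))) (at 0)" by simp
  qed
  have dA: "(A has_derivative A') (at 0)"
  proof (rule has_derivative_transform_eventually[OF d])
    have e: "\<forall>\<^sub>F \<eta> in nhds 0. (\<chi> i. Re (\<alpha> (\<iota> i) (cvec \<eta>))) = A \<eta>"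
      using eq by eventually_elim (simp add: A_def)
    show "\<forall>\<^sub>F \<eta> in at 0. (\<chi> i. Re (\<alpha> (\<iota> i) (cvec \<eta>))) = A \<eta>"
      using e by (simp add: eventually_nhds_conv_at)
    show "(\<chi> i. Re (\<alpha> (\<iota> i) (cvec 0))) = A 0" using eventually_nhds_x_imp_x[OF e] .
  qed simp
  have "((\<lambda>\<eta>. the_inv_into U A (A \<eta>)) has_derivative (\<lambda>v. D (A' v))) (at 0)"
    by (rule has_derivative_compose[OF dA D])
  hence "((\<lambda>\<eta>. \<eta>) has_derivative (\<lambda>v. D (A' v))) (at 0)"
    by (rule has_derivative_transform_within_open[OF _ oU U])
      (use bij in \<open>auto simp: bij_betw_def the_inv_into_f_f\<close>)
  hence "(\<lambda>v. D (A' v)) = (\<lambda>v. v)" by (rule has_derivative_unique[OF _ has_derivative_ident])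
  hence "w = D (A' w)" by metis
  also have "A' w = 0" using w by (simp add: A'_def vec_eq_iff)
  also have "D 0 = 0" using linear_0[OF has_derivative_linear[OF D]] .
  finally show ?thesis .
qed

text \<open>For \<open>j < k\<close> the \<open>j\<close>-th Taylor coefficient of the sum of the
  two variations is twice the real part of the variation of \<open>a j\<close>; vanishing to order
  \<open>k\<close> makes all of these real parts zero.\<close>

lemma generic_nondegenerate:
  fixes g :: "complex \<times> (complex^'k::finite) \<Rightarrow> complex" and a :: "nat \<Rightarrow> real^'k \<Rightarrow> complex"
  assumes index: "bij_betw \<iota> (UNIV :: 'k set) {..<k}" and hg: "hol g (0, 0)" and gen: "generic_family \<iota> a"
    and expand: "\<forall>\<^sub>F \<eta> in nhds 0. (\<lambda>z. g (z, cvec \<eta>) - (z + (\<Sum>j=0..k+1. a j \<eta> * z ^ j) + 1/2 * z ^ (k+1))) \<in> bz (k + 2)"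
    and w: "(\<lambda>x. ddir g (x, 0) (0, cvec w) + ddir (cc g) (x, 0) (0, cvec w)) \<in> bz k"
  shows "w = 0"
proof -
  have \<iota>: "\<iota> i < k" for i using index by (auto simp: bij_betw_def)
  have hcg: "hol (cc g) (0, 0)" by (rule hol_cc) (use hg in simp)
  obtain d where d: "d > 0" "\<And>z \<eta>. norm z < d \<Longrightarrow> norm \<eta> < d \<Longrightarrow> hol g (z, \<eta>) \<and> hol (cc g) (z, \<eta>)"
    using eventually_nhds_Pair_norm[OF eventually_conj[OF hol_eventually[OF hg] hol_eventually[OF hcg]]] by blast
  define R where "R = d / 2"
  have R: "R > 0" "R < d" using d by (auto simp: R_def)
  \<comment> \<open>The coefficient 1 of the identity is removed, so that for \<open>j < k\<close>
    this extends \<open>a j\<close> to complex parameters.\<close>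
  define \<alpha> where "\<alpha> j \<eta> = cint R (\<lambda>s. g (s, \<eta>) / s ^ Suc j) - (if j = 1 then 1 else 0)" for j \<eta>
  have hK: "hol (\<lambda>q. g q / fst q ^ Suc j) (s, 0)" if "norm s = R" for s j
    by (intro hol_divide hol_power hol_fst') (use d(2)[of s 0] d(1) that R in auto)
  note hKc = hol_cint[where K = "\<lambda>q. g q / fst q ^ Suc j" for j, OF less_imp_le[OF R(1)] hK]
  have h\<alpha>: "hol (\<alpha> j) 0" for j
    unfolding \<alpha>_def using hKc(1)[of j] by (intro hol_diff hol_const) simp
  define h1 where "h1 x = ddir g (x, 0) (0, cvec w)" for x
  have h1: "hol h1 x" if "norm x < d" for x
    unfolding h1_def by (rule hol_slice1, rule hol_ddir) (use d(2)[of x 0] d(1) that in simp)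
  have d\<alpha>: "ddir (\<alpha> j) 0 (cvec w) = cint R (\<lambda>s. h1 s / s ^ Suc j)" for j
  proof -
    have "ddir (\<alpha> j) 0 (cvec w) = ddir (\<lambda>x. cint R (\<lambda>s. g (s, x) / s ^ Suc j)) 0 (cvec w) - ddir (\<lambda>x. if j = 1 then 1 else 0) 0 (cvec w)"
      unfolding \<alpha>_def by (rule ddir_diff_fun[OF hol_imp_cdiff[OF hKc(1)[of j, unfolded fst_conv]] hol_imp_cdiff[OF hol_const]])
    also have "ddir (\<lambda>x. if j = 1 then 1 else 0 :: complex) 0 (cvec w) = 0"
      by (rule fun_cong[OF ddir_eq[OF has_derivative_const]])
    also have "ddir (\<lambda>x. cint R (\<lambda>s. g (s, x) / s ^ Suc j)) 0 (cvec w) = cint R (\<lambda>s. ddir (\<lambda>q. g q / fst q ^ Suc j) (s, 0) (0, cvec w))"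
      using hKc(2)[of j "cvec w"] by simp
    also have "\<dots> = cint R (\<lambda>s. h1 s / s ^ Suc j)"
    proof (rule cint_cong)
      fix s :: complex assume s: "norm s = R"
      have "hol g (s, 0)" using d(2)[of s 0] d(1) s R by simp
      hence cg: "cdiff g ((s, 0) + cs 0 (0, cvec w))" using hol_imp_cdiff[of g "(s, 0)"] by simp
      have cK: "cdiff (\<lambda>q. g q / fst q ^ Suc j) ((s, 0) + cs 0 (0, cvec w))" using hol_imp_cdiff[OF hK[OF s]] by simp
      have 1: "((\<lambda>\<tau>. g ((s, 0) + cs \<tau> (0, cvec w)) / s ^ Suc j) has_field_derivative ddir (\<lambda>q. g q / fst q ^ Suc j) (s, 0) (0, cvec w)) (at 0)"
        using cdiff_line[OF cK] by simp
      have 2: "((\<lambda>\<tau>. g ((s, 0) + cs \<tau> (0, cvec w)) / s ^ Suc j) has_field_derivative h1 s / s ^ Suc j) (at 0)"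
        using DERIV_cdivide[OF cdiff_line[OF cg]] by (simp add: h1_def)
      show "ddir (\<lambda>q. g q / fst q ^ Suc j) (s, 0) (0, cvec w) = h1 s / s ^ Suc j" by (rule DERIV_unique[OF 1 2])
    qed (use R in simp)
    finally show ?thesis by simp
  qed
  show ?thesis
  proof (rule generic_family_derivative[OF gen h\<alpha>])
    have "\<forall>\<^sub>F \<eta> in nhds (0 :: real^'k). norm \<eta> < d" by (rule eventually_norm_less[OF d(1)])
    thus "\<forall>\<^sub>F \<eta> in nhds 0. \<forall>i. Re (a (\<iota> i) \<eta>) = Re (\<alpha> (\<iota> i) (cvec \<eta>))"
      using expand
    proof eventually_elim
      case (elim \<eta>)
      define p where "p = [:0, 1:] + (\<Sum>j=0..k+1. monom (a j \<eta>) j) + monom (1/2) (k + 1)"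
      have pz: "poly p z = z + (\<Sum>j=0..k+1. a j \<eta> * z ^ j) + 1/2 * z ^ (k+1)" for z
        unfolding p_def poly_add poly_sum poly_monom by simp
      show ?case
      proof
        fix i
        let ?j = "\<iota> i"
        have gh: "(\<lambda>z. g (z, cvec \<eta>)) holomorphic_on ball 0 d"
          by (rule holomorphic_onI_hol, rule hol_slice1) (use d(2) elim(1) in auto)
        have "cint R (\<lambda>s. (g (s, cvec \<eta>) - poly p s) / s ^ Suc ?j) = 0"
        proof (rule cint_coeff_zero[OF R])
          show "(\<lambda>z. g (z, cvec \<eta>) - poly p z) holomorphic_on ball 0 d" by (intro holomorphic_intros gh)
          show "(\<lambda>z. g (z, cvec \<eta>) - poly p z) \<in> bz (k + 2)" unfolding pz by (rule elim(2))
        qed (use \<iota>[of i] in simp)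
        also have "cint R (\<lambda>s. (g (s, cvec \<eta>) - poly p s) / s ^ Suc ?j)
            = cint R (\<lambda>s. g (s, cvec \<eta>) / s ^ Suc ?j) - cint R (\<lambda>s. poly p s / s ^ Suc ?j)"
          unfolding diff_divide_distrib
        proof (rule cint_diff)
          have "continuous_on (sphere 0 R) (\<lambda>z. g (z, cvec \<eta>))"
            using holomorphic_on_imp_continuous_on[OF gh] by (rule continuous_on_subset) (use R in auto)
          thus "continuous_on (sphere 0 R) (\<lambda>s. g (s, cvec \<eta>) / s ^ Suc ?j)"
            by (intro continuous_intros) (use R in auto)
          show "continuous_on (sphere 0 R) (\<lambda>s. poly p s / s ^ Suc ?j)"
            by (intro continuous_intros) (use R in auto)
        qed (use R in simp)
        finally have "cint R (\<lambda>s. g (s, cvec \<eta>) / s ^ Suc ?j) = coeff p ?j"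
          by (simp only: cint_poly_coeff[OF R(1)]) simp
        moreover have "coeff p ?j = (if ?j = 1 then 1 else 0) + a ?j \<eta>"
        proof -
          have "coeff [:0, 1 :: complex:] ?j = (if ?j = 1 then 1 else 0)" by (cases ?j) (auto simp: coeff_pCons split: nat.splits)
          moreover have "coeff (\<Sum>j=0..k+1. monom (a j \<eta>) j) ?j = a ?j \<eta>"
            using \<iota>[of i] unfolding coeff_sum coeff_monom by (subst sum.delta) auto
          ultimately show ?thesis using \<iota>[of i] unfolding p_def coeff_add coeff_monom by simp
        qed
        ultimately have "\<alpha> ?j (cvec \<eta>) = a ?j \<eta>" by (simp add: \<alpha>_def)
        thus "Re (a ?j \<eta>) = Re (\<alpha> ?j (cvec \<eta>))" by simp
      qed
    qed
  next
    fix i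
    let ?j = "\<iota> i"
    define h where "h x = h1 x + cnj (h1 (cnj x))" for x
    have ch1: "hol (\<lambda>x. cnj (h1 (cnj x))) x" if "norm x < d" for x
      using hol_cc[of h1 x] h1[of "cnj x"] that by (simp add: cc_def[abs_def])
    have hb: "h \<in> bz k"
    proof (rule bz_cong[OF w])
      have "\<forall>\<^sub>F z in nhds 0. norm (z :: complex) < d" by (rule eventually_norm_less[OF d(1)])
      thus "\<forall>\<^sub>F x in nhds 0. ddir g (x, 0) (0, cvec w) + ddir (cc g) (x, 0) (0, cvec w) = h x"
      proof eventually_elim
        case (elim x)
        have "hol g (cj (x, 0 :: complex^'k))" using d(2)[of "cnj x" 0] d(1) elim by simp
        hence "cdiff g (cj (x, 0 :: complex^'k))" by (rule hol_imp_cdiff)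
        from ddir_cc[OF this, of "(0, cvec w)"] show ?case by (simp add: h_def h1_def)
      qed
    qed
    have "h holomorphic_on ball 0 d"
      by (rule holomorphic_onI_hol) (use h1 ch1 in \<open>auto simp: h_def[abs_def] intro!: hol_add\<close>)
    from cint_coeff_zero[OF R this hb \<iota>[of i]]
    have "0 = cint R (\<lambda>s. h s / s ^ Suc ?j)" by simp
    also have "\<dots> = cint R (\<lambda>s. h1 s / s ^ Suc ?j + cnj (h1 (cnj s) / cnj s ^ Suc ?j))"
      by (rule cint_cong) (use R in \<open>auto simp: h_def add_divide_distrib\<close>)
    also have "\<dots> = cint R (\<lambda>s. h1 s / s ^ Suc ?j) + cint R (\<lambda>s. cnj (h1 (cnj s) / cnj s ^ Suc ?j))"
    proof -
      have c1: "continuous_on (sphere 0 R) h1" "continuous_on (sphere 0 R) (\<lambda>x. cnj (h1 (cnj x)))"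
        by (rule continuous_on_holI, use h1 ch1 R in simp)+
      have c2: "continuous_on (sphere 0 R) (\<lambda>s. h1 s / s ^ Suc ?j)"
        by (intro continuous_intros c1) (use R in auto)
      have "continuous_on (sphere 0 R) (\<lambda>s. cnj (h1 (cnj s)) / s ^ Suc ?j)"
        by (intro continuous_on_divide c1 continuous_intros) (use R in auto)
      hence c3: "continuous_on (sphere 0 R) (\<lambda>s. cnj (h1 (cnj s) / cnj s ^ Suc ?j))" by simp
      show ?thesis by (rule cint_add[OF less_imp_le[OF R(1)] c2 c3])
    qed
    also have "cint R (\<lambda>s. cnj (h1 (cnj s) / cnj s ^ Suc ?j)) = cnj (cint R (\<lambda>s. h1 s / s ^ Suc ?j))"
    proof (rule cint_cnj[of R "\<lambda>s. h1 s / s ^ Suc ?j"])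
      have "continuous_on (sphere 0 R) h1" by (rule continuous_on_holI, use h1 R in simp)
      thus "continuous_on (sphere 0 R) (\<lambda>s. h1 s / s ^ Suc ?j)"
        by (intro continuous_intros) (use R in auto)
    qed (use R in simp)
    finally have "0 = ddir (\<alpha> ?j) 0 (cvec w) + cnj (ddir (\<alpha> ?j) 0 (cvec w))" unfolding d\<alpha> .
    thus "Re (ddir (\<alpha> ?j) 0 (cvec w)) = 0" by (simp add: complex_eq_iff)
  qed
qed

section \<open>Assembly of the change of coordinate and parameters\<close>

lemma real_analytic_on_prod_cvec:
  fixes F :: "complex \<times> (complex^'k::finite) \<Rightarrow> complex"
  assumes "\<And>q. q \<in> U \<Longrightarrow> hol F (fst q, cvec (snd q))" "open U" "\<And>q. q \<in> U \<Longrightarrow> f q = F (fst q, cvec (snd q))"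
  shows "real_analytic_on f U"
proof (rule real_analytic_onI)
  show "bounded_linear (\<lambda>q :: complex \<times> (real^'k). (fst q, cvec (snd q)))"
    by (intro bounded_linear_Pair bounded_linear_fst bounded_linear_compose[OF bounded_linear_cvec] bounded_linear_snd)
  fix q assume q: "q \<in> U"
  have "\<forall>\<^sub>F x in nhds q. f x = F (fst x, cvec (snd x))"
    using eventually_nhds_in_open[OF assms(2) q] by eventually_elim (rule assms(3))
  thus "\<exists>F. hol F (fst q, cvec (snd q)) \<and> (\<forall>\<^sub>F x in nhds q. f x = F (fst x, cvec (snd x)))"
    using assms(1)[OF q] by blast
qed

text \<open>The inverse of the change is explicit: \<open>K\<close> recovers \<open>z\<close> and
  \<open>\<psi>\<close> recovers \<open>\<eta>\<close>. Both are holomorphic, so the inverse is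
  real-analytic once the image is known to be open.\<close>

lemma coordinate_change:
  fixes \<Phi> \<psi> :: "complex^'k::finite \<Rightarrow> complex^'k" and Kc H F :: "complex \<times> (complex^'k) \<Rightarrow> complex"
  assumes \<Phi>: "hol \<Phi> 0" "\<Phi> 0 = 0" and \<psi>: "hol \<psi> 0" "\<psi> 0 = 0" and \<psi>\<Phi>: "\<forall>\<^sub>F \<eta> in nhds 0. \<psi> (\<Phi> \<eta>) = \<eta>"
    and real: "\<forall>\<^sub>F \<eta> in nhds 0. \<Phi> (cj \<eta>) = cj (\<Phi> \<eta>)"
    and Kc: "hol Kc (0, 0)" and H: "hol H (0, 0)" "H (0, 0) = 0"
    and KH: "\<forall>\<^sub>F q in nhds (0, 0). cc Kc (H q, snd q) = fst q"
    and conj: "\<forall>\<^sub>F q in nhds (0, 0). H (g (Kc q, snd q), snd q) = F (fst q, \<Phi> (snd q))"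
    and s: "s > 0" and fg: "\<And>\<eta> z. norm \<eta> < s \<Longrightarrow> norm z < s \<Longrightarrow> f \<eta> z = g (cnj z, cvec \<eta>)"
    and \<rho>: "\<rho> > 0" and \<delta>: "\<delta> > 0"
  obtains h :: "real^'k \<Rightarrow> complex \<Rightarrow> complex" and \<phi> r \<delta>'
  where "mix_analytic_change h \<phi> r \<delta>'" "r \<le> s" "param_box \<delta>' \<subseteq> ball 0 s"
    "\<forall>\<eta>\<in>param_box \<delta>'. \<phi> \<eta> \<in> ball 0 \<delta> \<and> h \<eta> ` ball 0 r \<subseteq> ball 0 \<rho>"
    "\<forall>\<eta>\<in>param_box \<delta>'. \<forall>z\<in>ball 0 r. h \<eta> (f \<eta> z) = F (cnj (h \<eta> z), cvec (\<phi> \<eta>))"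
proof -
  define K where "K q = cc Kc (fst q, \<psi> (snd q))" for q
  have hK: "hol K (0, 0)"
  proof -
    have "hol (cc Kc) (0, 0)" by (rule hol_cc) (use Kc in simp)
    thus ?thesis unfolding K_def
      by - (rule hol_compose2[of "cc Kc"], simp add: \<psi>, intro hol_Pair hol_fst' hol_snd_arg \<psi>(1))
  qed
  have cont: "isCont (\<lambda>q. (H q, \<Phi> (snd q))) (0, 0)" by (intro hol_isCont hol_Pair H hol_snd_arg \<Phi>)
  have cont0: "(H (0, 0), \<Phi> (snd (0 :: complex, 0))) = (0, 0)" by (simp add: H \<Phi>)
  have ccont: "isCont (\<lambda>q. (cnj (H q), snd q)) (0, 0)"
    by (intro continuous_intros hol_isCont H)
  have ccont0: "(cnj (H (0, 0)), snd (0 :: complex, 0 :: complex^'k)) = (0, 0)" by (simp add: H)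
  have "\<forall>\<^sub>F q in nhds (0, 0). hol H q \<and> hol \<Phi> (snd q) \<and> hol K (H q, \<Phi> (snd q)) \<and> hol \<psi> (\<Phi> (snd q)) \<and>
      cc Kc (H q, snd q) = fst q \<and> \<psi> (\<Phi> (snd q)) = snd q \<and> \<Phi> (cj (snd q)) = cj (\<Phi> (snd q)) \<and>
      norm (H q) < \<rho> \<and> norm (\<Phi> (snd q)) < \<delta> \<and>
      H (g (Kc (cnj (H q), snd q), snd (cnj (H q), snd q)), snd (cnj (H q), snd q)) = F (fst (cnj (H q), snd q), \<Phi> (snd (cnj (H q), snd q)))"
  proof (intro eventually_conj)
    show "\<forall>\<^sub>F q in nhds (0, 0). hol H q" by (rule hol_eventually[OF H(1)])
    show "\<forall>\<^sub>F q in nhds (0 :: complex, 0). hol \<Phi> (snd q)" by (rule eventually_snd[OF hol_eventually[OF \<Phi>(1)]])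
    show "\<forall>\<^sub>F q in nhds (0, 0). hol K (H q, \<Phi> (snd q))"
      by (rule isCont_nhds_0[OF cont cont0 hol_eventually[OF hK]])
    show "\<forall>\<^sub>F q in nhds (0 :: complex, 0). hol \<psi> (\<Phi> (snd q))"
      by (rule eventually_snd[OF isCont_nhds_0[OF hol_isCont[OF \<Phi>(1)] \<Phi>(2) hol_eventually[OF \<psi>(1)]]])
    show "\<forall>\<^sub>F q in nhds (0 :: complex, 0). \<psi> (\<Phi> (snd q)) = snd q" by (rule eventually_snd[OF \<psi>\<Phi>])
    show "\<forall>\<^sub>F q in nhds (0 :: complex, 0). \<Phi> (cj (snd q)) = cj (\<Phi> (snd q))" by (rule eventually_snd[OF real])
    show "\<forall>\<^sub>F q in nhds (0, 0). norm (H q) < \<rho>"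
      by (rule isCont_eventually_norm_less[OF hol_isCont[OF H(1)]]) (simp add: H \<rho>)
    have "\<forall>\<^sub>F \<eta> in nhds 0. norm (\<Phi> \<eta>) < \<delta>"
      by (rule isCont_eventually_norm_less[OF hol_isCont[OF \<Phi>(1)]]) (simp add: \<Phi> \<delta>)
    thus "\<forall>\<^sub>F q in nhds (0 :: complex, 0). norm (\<Phi> (snd q)) < \<delta>" by (rule eventually_snd)
    show "\<forall>\<^sub>F q in nhds (0, 0). H (g (Kc (cnj (H q), snd q), snd (cnj (H q), snd q)), snd (cnj (H q), snd q)) = F (fst (cnj (H q), snd q), \<Phi> (snd (cnj (H q), snd q)))"
      by (rule isCont_nhds_0[OF ccont ccont0 conj])
  qed (rule KH)
  then obtain d where d: "d > 0" "\<And>z \<eta>. norm z < d \<Longrightarrow> norm \<eta> < d \<Longrightarrow>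
      hol H (z, \<eta>) \<and> hol \<Phi> \<eta> \<and> hol K (H (z, \<eta>), \<Phi> \<eta>) \<and> hol \<psi> (\<Phi> \<eta>) \<and>
      cc Kc (H (z, \<eta>), \<eta>) = z \<and> \<psi> (\<Phi> \<eta>) = \<eta> \<and> \<Phi> (cj \<eta>) = cj (\<Phi> \<eta>) \<and>
      norm (H (z, \<eta>)) < \<rho> \<and> norm (\<Phi> \<eta>) < \<delta> \<and> H (g (Kc (cnj (H (z, \<eta>)), \<eta>), \<eta>), \<eta>) = F (cnj (H (z, \<eta>)), \<Phi> \<eta>)"
    by (rule eventually_nhds_Pair_norm) auto
  define r where "r = min d s"
  have r: "r > 0" "r \<le> d" "r \<le> s" using d s by (auto simp: r_def)
  \<comment> \<open>In a box with half-sides \<open>r / (k + 1)\<close> the sum of the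
    \<open>k\<close> absolute coordinates stays below \<open>r\<close>, so estimates on balls
    apply.\<close>
  define \<delta>' :: "real^'k" where "\<delta>' = (\<chi> i. r / (real CARD('k) + 1))"
  have box: "norm \<eta> < r" if "\<eta> \<in> param_box \<delta>'" for \<eta>
  proof -
    have "norm \<eta> \<le> (\<Sum>i\<in>UNIV. \<bar>\<eta> $ i\<bar>)" by (rule norm_le_l1_cart)
    also have "\<dots> \<le> (\<Sum>i\<in>(UNIV :: 'k set). r / (real CARD('k) + 1))"
      by (rule sum_mono) (use that in \<open>auto simp: param_box_def \<delta>'_def intro: less_imp_le\<close>)
    also have "\<dots> < r" using r by (simp add: field_simps)
    finally show ?thesis .
  qed
  define h where "h \<eta> z = H (z, cvec \<eta>)" for \<eta> :: "real^'k" and z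
  define \<phi> where "\<phi> \<eta> = (\<chi> i. Re (\<Phi> (cvec \<eta>) $ i))" for \<eta> :: "real^'k"
  note props = d(2)[of _ "cvec \<eta>" for \<eta>]
  \<comment> \<open>\<open>\<phi>\<close> is defined by real parts; since \<open>\<Phi>\<close> is
    real at real parameters, nothing is lost.\<close>
  have \<phi>: "cvec (\<phi> \<eta>) = \<Phi> (cvec \<eta>)" if "\<eta> \<in> param_box \<delta>'" for \<eta>
  proof -
    have "\<Phi> (cvec \<eta>) = cj (\<Phi> (cvec \<eta>))" using props[of 0 \<eta>] box[OF that] r d(1) by simp
    hence "\<Phi> (cvec \<eta>) $ i = cnj (\<Phi> (cvec \<eta>) $ i)" for i using vec_nth_cj by (metis cj_complex)
    hence "Im (\<Phi> (cvec \<eta>) $ i) = 0" for i by (metis Reals_cnj_iff complex_is_Real_iff)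
    thus ?thesis by (simp add: vec_eq_iff \<phi>_def complex_eq_iff)
  qed
  have oB: "open (param_box \<delta>')"
  proof -
    have "\<bar>u\<bar> < w \<longleftrightarrow> - w < u \<and> u < w" for u w :: real by linarith
    hence "param_box \<delta>' = box (- \<delta>') \<delta>'" by (simp add: param_box_def set_eq_iff mem_box_cart)
    thus ?thesis by (simp add: open_box)
  qed
  have in_box: "norm z < d" "norm \<eta> < d" if "z \<in> ball 0 r" "\<eta> \<in> param_box \<delta>'" for z :: complex and \<eta>
    using that box[OF that(2)] r by auto
  have mix: "mix_analytic_on h r (param_box \<delta>')"
    unfolding h_def[abs_def] by (rule mix_analytic_onI) (use d(2) box r in force)
  have an\<phi>: "real_analytic_on \<phi> (param_box \<delta>')"
  proof (rule real_analytic_on_vecI)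
    fix i show "real_analytic_on (\<lambda>\<eta>. complex_of_real (\<phi> \<eta> $ i)) (param_box \<delta>')"
    proof (rule real_analytic_on_cvec[OF _ oB])
      fix \<eta> assume \<eta>: "\<eta> \<in> param_box \<delta>'"
      show "hol (\<lambda>\<eta>. \<Phi> \<eta> $ i) (cvec \<eta>)" using props[of 0 \<eta>] box[OF \<eta>] r d(1) by (intro hol_vec_nth) simp
      show "complex_of_real (\<phi> \<eta> $ i) = \<Phi> (cvec \<eta>) $ i" using arg_cong[OF \<phi>[OF \<eta>], of "\<lambda>x. x $ i"] by simp
    qed
  qed
  define \<Psi> where "\<Psi> = (\<lambda>(z, \<eta>). (h \<eta> z, \<phi> \<eta>))"
  define D where "D = ball (0 :: complex) r \<times> param_box \<delta>'"
  have oD: "open D" unfolding D_def by (intro open_Times open_ball oB)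
  have inv1: "K (fst (\<Psi> x), cvec (snd (\<Psi> x))) = fst x" and inv2: "\<psi> (cvec (snd (\<Psi> x))) = cvec (snd x)"
    and holK: "hol K (fst (\<Psi> x), cvec (snd (\<Psi> x)))" and hol\<psi>: "hol \<psi> (cvec (snd (\<Psi> x)))" if "x \<in> D" for x
    using that d(2)[of "fst x" "cvec (snd x)"] in_box[of "fst x" "snd x"]
    by (auto simp: D_def \<Psi>_def h_def \<phi> K_def case_prod_beta)
  have inj: "inj_on \<Psi> D"
  proof (rule inj_onI)
    fix x y assume xy: "x \<in> D" "y \<in> D" "\<Psi> x = \<Psi> y"
    have "fst x = fst y" using inv1[OF xy(1)] inv1[OF xy(2)] xy(3) by simp
    moreover have "cvec (snd x) = cvec (snd y)" using inv2[OF xy(1)] inv2[OF xy(2)] xy(3) by simp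
    hence "snd x = snd y" by (simp add: vec_eq_iff)
    ultimately show "x = y" by (simp add: prod_eq_iff)
  qed
  have contcvec: "isCont (\<lambda>x :: complex \<times> (real^'k). (fst x, cvec (snd x))) x" for x
    by (intro continuous_intros bounded_linear.isCont[OF bounded_linear_cvec])
  have contc: "isCont (\<lambda>x :: complex \<times> (real^'k). cvec (snd x)) x" for x
    by (intro continuous_intros bounded_linear.isCont[OF bounded_linear_cvec])
  have "continuous_on D \<Psi>"
  proof (rule continuous_at_imp_continuous_on, rule ballI)
    fix x assume x: "x \<in> D"
    have hx: "hol H (fst x, cvec (snd x))" "hol \<Phi> (cvec (snd x))"
      using x d(2)[of "fst x" "cvec (snd x)"] in_box[of "fst x" "snd x"] by (auto simp: D_def)
    have "isCont (\<lambda>x. H (fst x, cvec (snd x))) x" by (rule isCont_o2[OF contcvec hol_isCont[OF hx(1)]])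
    moreover have "isCont (\<lambda>x. \<phi> (snd x)) x"
      unfolding \<phi>_def isCont_def
      by (intro tendsto_vec_lambda tendsto_Re tendsto_vec_nth isCont_o2[OF contc hol_isCont[OF hx(2)], unfolded isCont_def])
    ultimately have "isCont (\<lambda>x. (H (fst x, cvec (snd x)), \<phi> (snd x))) x" by (intro continuous_intros)
    thus "isCont \<Psi> x" by (simp add: \<Psi>_def h_def case_prod_beta')
  qed
  \<comment> \<open>Openness of the image by invariance of domain; injectivity came from the
    explicit inverse.\<close>
  hence oI: "open (\<Psi> ` D)" by (rule invariance_of_domain[OF _ oD inj])
  have an\<Psi>: "real_analytic_on \<Psi> D"
  proof -
    have "real_analytic_on (\<lambda>x. \<phi> (snd x)) D"
    proof (rule real_analytic_on_vecI)
      fix i show "real_analytic_on (\<lambda>x. complex_of_real (\<phi> (snd x) $ i)) D"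
      proof (rule real_analytic_on_prod_cvec[OF _ oD])
        fix x assume x: "x \<in> D"
        hence b: "snd x \<in> param_box \<delta>'" by (auto simp: D_def)
        have "hol \<Phi> (cvec (snd x))" using props[of 0 "snd x"] box[OF b] r d(1) by simp
        thus "hol (\<lambda>q. \<Phi> (snd q) $ i) (fst x, cvec (snd x))" by (intro hol_vec_nth hol_snd_arg)
        show "complex_of_real (\<phi> (snd x) $ i) = \<Phi> (snd (fst x, cvec (snd x))) $ i"
          using arg_cong[OF \<phi>[OF b], of "\<lambda>x. x $ i"] by simp
      qed
    qed
    moreover have "real_analytic_on (\<lambda>x. h (snd x) (fst x)) D"
      using mix by (simp add: mix_analytic_on_def D_def case_prod_beta')
    ultimately have "real_analytic_on (\<lambda>x. (h (snd x) (fst x), \<phi> (snd x))) D" by (intro real_analytic_on_PairI)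
    thus ?thesis by (simp add: \<Psi>_def case_prod_beta')
  qed
  have an_inv: "real_analytic_on (the_inv_into D \<Psi>) (\<Psi> ` D)"
  proof -
    have "real_analytic_on (\<lambda>y. fst (the_inv_into D \<Psi> y)) (\<Psi> ` D)"
      by (rule real_analytic_on_prod_cvec[OF _ oI, of K]) (auto simp: the_inv_into_f_f[OF inj] inv1 holK)
    moreover have "real_analytic_on (\<lambda>y. snd (the_inv_into D \<Psi> y)) (\<Psi> ` D)"
    proof (rule real_analytic_on_vecI)
      fix i show "real_analytic_on (\<lambda>y. complex_of_real (snd (the_inv_into D \<Psi> y) $ i)) (\<Psi> ` D)"
      proof (rule real_analytic_on_prod_cvec[OF _ oI])
        fix y assume "y \<in> \<Psi> ` D"
        then obtain x where x: "x \<in> D" "y = \<Psi> x" by auto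
        show "hol (\<lambda>q. \<psi> (snd q) $ i) (fst y, cvec (snd y))"
          unfolding x(2) by (intro hol_vec_nth hol_snd_arg hol\<psi>[OF x(1)])
        show "complex_of_real (snd (the_inv_into D \<Psi> y) $ i) = \<psi> (snd (fst y, cvec (snd y))) $ i"
          by (simp add: x the_inv_into_f_f[OF inj] inv2)
      qed
    qed
    ultimately have "real_analytic_on (\<lambda>y. (fst (the_inv_into D \<Psi> y), snd (the_inv_into D \<Psi> y))) (\<Psi> ` D)"
      by (rule real_analytic_on_PairI)
    thus ?thesis by simp
  qed
  show ?thesis
  proof (rule that[of h \<phi> r \<delta>'])
    show "mix_analytic_change h \<phi> r \<delta>'"
      unfolding mix_analytic_change_def Let_def real_analytic_diffeo_def D_def[symmetric] \<Psi>_def[symmetric]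
      using r mix an\<phi> oD oI inj an\<Psi> an_inv
      by (auto simp: h_def H \<phi>_def \<Phi> \<delta>'_def vec_eq_iff inj_on_imp_bij_betw intro!: divide_pos_pos add_nonneg_pos)
    show "r \<le> s" by (rule r)
    show "param_box \<delta>' \<subseteq> ball 0 s" using box r by fastforce
    show "\<forall>\<eta>\<in>param_box \<delta>'. \<phi> \<eta> \<in> ball 0 \<delta> \<and> h \<eta> ` ball 0 r \<subseteq> ball 0 \<rho>"
    proof (intro ballI conjI)
      fix \<eta> assume \<eta>: "\<eta> \<in> param_box \<delta>'"
      have "norm (cvec (\<phi> \<eta>)) < \<delta>" unfolding \<phi>[OF \<eta>] using props[of 0 \<eta>] box[OF \<eta>] r d(1) by simp
      thus "\<phi> \<eta> \<in> ball 0 \<delta>" by simp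
      show "h \<eta> ` ball 0 r \<subseteq> ball 0 \<rho>" using d(2)[of _ "cvec \<eta>"] in_box[OF _ \<eta>] by (auto simp: h_def)
    qed
    show "\<forall>\<eta>\<in>param_box \<delta>'. \<forall>z\<in>ball 0 r. h \<eta> (f \<eta> z) = F (cnj (h \<eta> z), cvec (\<phi> \<eta>))"
    proof (intro ballI)
      fix \<eta> and z :: complex assume \<eta>: "\<eta> \<in> param_box \<delta>'" and z: "z \<in> ball 0 r"
      note p = d(2)[of z "cvec \<eta>"]
      have p: "cc Kc (H (z, cvec \<eta>), cvec \<eta>) = z"
        "H (g (Kc (cnj (H (z, cvec \<eta>)), cvec \<eta>), cvec \<eta>), cvec \<eta>) = F (cnj (H (z, cvec \<eta>)), \<Phi> (cvec \<eta>))"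
        using p in_box[OF z \<eta>] by auto
      \<comment> \<open>Read in the variable \<open>cnj (h \<eta> z)\<close>, the chart
        \<open>Kc\<close> returns \<open>cnj z\<close>, the argument at which \<open>g\<close>
        represents \<open>f\<close>.\<close>
      have "cnj (Kc (cnj (H (z, cvec \<eta>)), cvec \<eta>)) = z" using p(1) by (simp add: cc_def)
      hence "Kc (cnj (H (z, cvec \<eta>)), cvec \<eta>) = cnj z" by (metis complex_cnj_cnj)
      moreover have "f \<eta> z = g (cnj z, cvec \<eta>)" by (rule fg) (use box[OF \<eta>] z r in auto)
      ultimately show "h \<eta> (f \<eta> z) = F (cnj (h \<eta> z), cvec (\<phi> \<eta>))"
        using p(2) by (simp add: h_def \<phi>[OF \<eta>])
    qed
  qed
qed

text \<open>Substituting \<open>cnj w\<close> turns an antiholomorphic remainder into a holomorphic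
  germ, for which little-o improves by one order.\<close>

lemma bz_conj_small:
  fixes f h :: "complex \<Rightarrow> complex"
  assumes f: "f \<in> o[at 0](\<lambda>z. cnj z ^ n)" and h: "hol h 0" and eq: "\<forall>\<^sub>F w in nhds 0. h w = f (cnj w)"
  shows "h \<in> bz (Suc n)"
proof (rule bz_small[OF h])
  have lim: "filterlim cnj (at (0::complex)) (at 0)"
    unfolding filterlim_at using tendsto_cnj[OF tendsto_ident_at[of "0::complex" UNIV]]
    by (auto simp: eventually_at_filter)
  from landau_o.small.compose[OF f lim] have 1: "(\<lambda>w. f (cnj w)) \<in> o[at 0](\<lambda>w. w ^ n)" by simp
  have 2: "\<forall>\<^sub>F w in at 0. f (cnj w) = h w"
    using eq[unfolded eventually_nhds_conv_at, THEN conjunct1] by eventually_elim (rule sym)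
  show "h \<in> o[at 0](\<lambda>z. z ^ n)" by (rule landau_o.small.in_cong[THEN iffD1, OF 2 1])
qed

theorem theorem2p13:
  fixes k :: nat
    and \<iota> :: "'k::finite \<Rightarrow> nat"
    and f :: "real^'k \<Rightarrow> complex \<Rightarrow> complex"
    and a :: "nat \<Rightarrow> real^'k \<Rightarrow> complex"
    and b :: real
    and r :: real and U :: "(real^'k) set"
  assumes "k \<ge> 1" and "bij_betw \<iota> UNIV {..<k}"
    and "r > 0" and "open U" and "0 \<in> U"
    and "antiholomorphic_family f r U"
    and "\<And>\<eta>. \<eta> \<in> U \<Longrightarrow>
          (\<lambda>z. f \<eta> z - (cnj z + (\<Sum>j=0..k+1. a j \<eta> * cnj z ^ j) + 1/2 * cnj z ^ (k+1)))
            \<in> o[at 0](\<lambda>z. cnj z ^ (k+1))"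
    and "\<And>j. j \<le> k + 1 \<Longrightarrow> a j 0 = 0"
    and "(\<lambda>z. f 0 z - (cnj z + 1/2 * cnj z ^ (k+1)
                + of_real ((real k + 1) / 8 - b / 2) * cnj z ^ (2*k+1)))
            \<in> o[at 0](\<lambda>z. cnj z ^ (2*k+1))"
    and "generic_family \<iota> a"
  shows
    "\<exists>(H :: real^'k \<Rightarrow> complex \<Rightarrow> complex) (\<phi> :: real^'k \<Rightarrow> real^'k) r' \<delta>
      (Q :: real^'k \<Rightarrow> complex poly) (R :: real^'k \<Rightarrow> complex \<Rightarrow> complex) \<rho> V \<rho>'.
       let F = prepared_family \<iota> Q R;
           G = (\<lambda>\<epsilon>. F \<epsilon> \<circ> F \<epsilon>);
           \<beta> = b_fun G (ball 0 \<rho>') V;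
           v = (\<lambda>\<epsilon> Z. poly (P_poly \<iota> \<epsilon>) Z / (1 + \<beta> \<epsilon> * Z ^ k))
       in
         mix_analytic_change H \<phi> r' \<delta> \<and>
         r' \<le> r \<and> param_box \<delta> \<subseteq> U \<and>
         0 < \<rho>' \<and> \<rho>' \<le> \<rho> \<and> open V \<and> 0 \<in> V \<and>
         (\<forall>\<eta>\<in>param_box \<delta>. \<phi> \<eta> \<in> V \<and> H \<eta> ` ball 0 r' \<subseteq> ball 0 \<rho>) \<and>
         transforms_family H \<phi> r' \<delta> f F \<and>
         (\<forall>\<epsilon>\<in>V. degree (Q \<epsilon>) \<le> k) \<and>
         (\<forall>j. real_analytic_on (\<lambda>\<epsilon>. coeff (Q \<epsilon>) j) V) \<and>
         mix_analytic_on R \<rho> V \<and>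
         (\<forall>\<epsilon>\<in>V. F \<epsilon> ` ball 0 \<rho>' \<subseteq> ball 0 \<rho>) \<and>
         (\<forall>\<epsilon>\<in>V. \<beta> \<epsilon> \<in> \<real>) \<and> real_analytic_on \<beta> V \<and>
         (\<forall>\<epsilon>\<in>V. \<exists>M. is_fixed_point_mset (G \<epsilon>) (ball 0 \<rho>') M \<and> size M = k + 1 \<and>
            (\<forall>Z\<in>#M. Ln (d_zbar (F \<epsilon>) Z) = 1/2 * cnj (deriv (v \<epsilon>) Z)))"
proof -
  have "\<exists>g s. s > 0 \<and> s \<le> r \<and> ball 0 s \<subseteq> U \<and> hol g 0 \<and>
      (\<forall>\<eta> z. norm \<eta> < s \<longrightarrow> norm z < s \<longrightarrow> f \<eta> z = g (cnj z, cvec \<eta>))"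
  proof (rule antiholomorphic_family_hol[OF assms(6,3,4,5)])
    fix g s
    assume "s > 0" "s \<le> r" "ball 0 s \<subseteq> U" "hol g 0"
      and "\<And>\<eta> z. norm \<eta> < s \<Longrightarrow> norm z < s \<Longrightarrow> f \<eta> z = g (cnj z, cvec \<eta>)"
    thus ?thesis by (intro exI[of _ g] exI[of _ s] conjI allI impI)
  qed
  then obtain g s where s: "s > 0" "s \<le> r" "ball 0 s \<subseteq> U" and hg0: "hol g 0"
    and fg: "\<And>\<eta> z. norm \<eta> < s \<Longrightarrow> norm z < s \<Longrightarrow> f \<eta> z = g (cnj z, cvec \<eta>)"
    by (elim exE conjE) simp
  note index = assms(2) and k = assms(1)
  have hg: "hol g (0, 0)" using hg0 by (simp add: zero_prod_def)
  have f_cnj: "\<forall>\<^sub>F w in nhds 0. f \<eta> (cnj w) = g (w, cvec \<eta>)" if "norm \<eta> < s" for \<eta>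
    using eventually_norm_less[OF s(1), where 'a = complex] by eventually_elim (simp add: fg that)
  have gE: "(\<lambda>w. g (w, 0) - w - (w ^ (k + 1) / 2 + of_real ((real k + 1) / 8 - b / 2) * w ^ (2 * k + 1))) \<in> bz (2 * k + 2)"
  proof -
    have "(\<lambda>w. g (w, 0) - w - (w ^ (k + 1) / 2 + of_real ((real k + 1) / 8 - b / 2) * w ^ (2 * k + 1))) \<in> bz (Suc (2 * k + 1))"
    proof (rule bz_conj_small[OF assms(9)])
      show "hol (\<lambda>w. g (w, 0) - w - (w ^ (k + 1) / 2 + of_real ((real k + 1) / 8 - b / 2) * w ^ (2 * k + 1))) 0"
        by (intro hol_diff hol_slice1[OF hg] hol_add hol_mult hol_divide hol_power hol_const hol_ident) simp
      show "\<forall>\<^sub>F w in nhds 0. g (w, 0) - w - (w ^ (k + 1) / 2 + of_real ((real k + 1) / 8 - b / 2) * w ^ (2 * k + 1)) =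
        f 0 (cnj w) - (cnj (cnj w) + 1/2 * cnj (cnj w) ^ (k+1) + of_real ((real k + 1) / 8 - b / 2) * cnj (cnj w) ^ (2*k+1))"
        using f_cnj[of 0] s(1) by simp (auto elim!: eventually_mono simp: algebra_simps)
    qed
    thus ?thesis by simp
  qed
  have expand: "\<forall>\<^sub>F \<eta> in nhds 0. (\<lambda>z. g (z, cvec \<eta>) - (z + (\<Sum>j=0..k+1. a j \<eta> * z ^ j) + 1/2 * z ^ (k+1))) \<in> bz (k + 2)"
  proof -
    have "isCont (\<lambda>\<eta>. (0 :: complex, cvec \<eta>)) 0"
      by (intro continuous_intros bounded_linear.isCont[OF bounded_linear_cvec])
    from isCont_nhds_0[OF this _ hol_eventually[OF hg]]
    have "\<forall>\<^sub>F \<eta> in nhds 0. hol g (0, cvec \<eta>)" by simp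
    moreover have "\<forall>\<^sub>F \<eta> in nhds (0 :: real^'k). norm \<eta> < s" by (rule eventually_norm_less[OF s(1)])
    ultimately show ?thesis
    proof eventually_elim
      case (elim \<eta>)
      have "\<eta> \<in> U" using elim(2) s(3) by auto
      have "(\<lambda>z. g (z, cvec \<eta>) - (z + (\<Sum>j=0..k+1. a j \<eta> * z ^ j) + 1/2 * z ^ (k+1))) \<in> bz (Suc (k + 1))"
      proof (rule bz_conj_small[OF assms(7)[OF \<open>\<eta> \<in> U\<close>]])
        show "hol (\<lambda>z. g (z, cvec \<eta>) - (z + (\<Sum>j=0..k+1. a j \<eta> * z ^ j) + 1/2 * z ^ (k+1))) 0"
          by (intro hol_diff hol_slice1[OF elim(1)] hol_add hol_sum hol_mult hol_power hol_const hol_ident)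
        show "\<forall>\<^sub>F w in nhds 0. g (w, cvec \<eta>) - (w + (\<Sum>j=0..k+1. a j \<eta> * w ^ j) + 1/2 * w ^ (k+1)) =
          f \<eta> (cnj w) - (cnj (cnj w) + (\<Sum>j=0..k+1. a j \<eta> * cnj (cnj w) ^ j) + 1/2 * cnj (cnj w) ^ (k+1))"
          using f_cnj[OF elim(2)] by eventually_elim simp
      qed
      thus ?case by simp
    qed
  qed
  have gen: "w = 0" if "(\<lambda>x. ddir g (x, 0) (0, cvec w) + ddir (cc g) (x, 0) (0, cvec w)) \<in> bz k" for w
    by (rule generic_nondegenerate[OF index hg assms(10) expand that])
  obtain \<Phi> \<psi> \<beta> Kc H R Q where \<Phi>: "hol \<Phi> 0" "\<Phi> 0 = 0" and \<psi>: "hol \<psi> 0" "\<psi> 0 = 0"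
    and inv: "\<forall>\<^sub>F \<eta> in nhds 0. \<psi> (\<Phi> \<eta>) = \<eta>" "\<forall>\<^sub>F \<epsilon> in nhds 0. \<Phi> (\<psi> \<epsilon>) = \<epsilon>"
    and real: "\<forall>\<^sub>F \<eta> in nhds 0. \<Phi> (cj \<eta>) = cj (\<Phi> \<eta>)"
    and \<beta>: "hol \<beta> 0" "\<forall>\<^sub>F \<epsilon> in nhds 0. \<beta> (cj \<epsilon>) = cj (\<beta> \<epsilon>)"
    and Kc: "hol Kc (0, 0)" "Kc (0, 0) = 0" and H: "hol H (0, 0)" "H (0, 0) = 0"
    and KH: "\<forall>\<^sub>F q in nhds (0, 0). cc Kc (H q, snd q) = fst q" "\<forall>\<^sub>F q in nhds (0, 0). H (cc Kc q, snd q) = fst q"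
    and RQ: "hol R (0, 0)" "\<forall>j. hol (\<lambda>\<epsilon>. coeff (Q \<epsilon>) j) 0" "\<forall>\<epsilon>. degree (Q \<epsilon>) \<le> k" "poly (Q 0) 0 = 0"
    and conj: "\<forall>\<^sub>F q in nhds (0, 0). H (g (Kc q, snd q), snd q) = prepared_map \<iota> Q R (fst q, \<Phi> (snd q))"
    and dF: "\<forall>\<^sub>F q in nhds (0, 0). poly (cpoly \<iota> (snd q)) (fst q) = 0 \<longrightarrow> ddir (prepared_map \<iota> Q R) q (1, 0) =
        exp (poly (pderiv (cpoly \<iota> (snd q))) (fst q) / (1 + \<beta> (snd q) * fst q ^ k) / 2)"
    by (rule complex_normal_form[OF index k hg gE gen])
  let ?Q = "\<lambda>\<epsilon>. Q (cvec \<epsilon>)" and ?R = "\<lambda>\<epsilon> z. R (z, cvec \<epsilon>)"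
  obtain \<rho> \<rho>' \<delta> where \<rho>: "0 < \<rho>'" "\<rho>' \<le> \<rho>" and \<delta>: "0 < \<delta>"
    and main: "let Q' = ?Q; R' = ?R; F = prepared_family \<iota> Q' R'; V = ball 0 \<delta>;
         G = (\<lambda>\<epsilon>. F \<epsilon> \<circ> F \<epsilon>); b = b_fun G (ball 0 \<rho>') V; v = (\<lambda>\<epsilon> Z. poly (P_poly \<iota> \<epsilon>) Z / (1 + b \<epsilon> * Z ^ k)) in
       (\<forall>j. real_analytic_on (\<lambda>\<epsilon>. coeff (Q' \<epsilon>) j) V) \<and> mix_analytic_on R' \<rho> V \<and>
       (\<forall>\<epsilon>\<in>V. F \<epsilon> ` ball 0 \<rho>' \<subseteq> ball 0 \<rho>) \<and> (\<forall>\<epsilon>\<in>V. b \<epsilon> \<in> \<real>) \<and> real_analytic_on b V \<and>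
       (\<forall>\<epsilon>\<in>V. \<exists>M. is_fixed_point_mset (G \<epsilon>) (ball 0 \<rho>') M \<and> size M = k + 1 \<and>
            (\<forall>Z\<in>#M. Ln (d_zbar (F \<epsilon>) Z) = 1/2 * cnj (deriv (v \<epsilon>) Z)))"
    by (rule prepared_fixed_points[OF index k RQ \<beta> dF])
  have \<rho>0: "\<rho> > 0" using \<rho> by simp
  obtain h \<phi> r' \<delta>' where change: "mix_analytic_change h \<phi> r' \<delta>'" and r': "r' \<le> s" and box: "param_box \<delta>' \<subseteq> ball 0 s"
    and maps: "\<forall>\<eta>\<in>param_box \<delta>'. \<phi> \<eta> \<in> ball 0 \<delta> \<and> h \<eta> ` ball 0 r' \<subseteq> ball 0 \<rho>"
    and trans: "\<forall>\<eta>\<in>param_box \<delta>'. \<forall>z\<in>ball 0 r'. h \<eta> (f \<eta> z) = prepared_map \<iota> Q R (cnj (h \<eta> z), cvec (\<phi> \<eta>))"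
    by (rule coordinate_change[OF \<Phi> \<psi> inv(1) real Kc(1) H KH(1) conj s(1) fg \<rho>0 \<delta>])
  have tr: "transforms_family h \<phi> r' \<delta>' f (prepared_family \<iota> ?Q ?R)"
    using trans by (simp add: transforms_family_def prepared_family_def prepared_map_def P_poly_eq)
  have r'_le: "r' \<le> r" using r' s by simp
  have box_U: "param_box \<delta>' \<subseteq> U" using box s by blast
  have zero_in: "(0 :: real^'k) \<in> ball 0 \<delta>" using \<delta> by simp
  have degQ: "\<forall>\<epsilon>\<in>ball 0 \<delta>. degree (Q (cvec \<epsilon>)) \<le> k" using RQ(3) by blast
  note all = conjI[OF change conjI[OF r'_le conjI[OF box_U conjI[OF \<rho>(1) conjI[OF \<rho>(2) conjI[OF open_ball
    conjI[OF zero_in conjI[OF maps conjI[OF tr conjI[OF degQ main[unfolded Let_def]]]]]]]]]]]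
  show ?thesis
    unfolding Let_def
    by (rule exI[of _ h], rule exI[of _ \<phi>], rule exI[of _ r'], rule exI[of _ \<delta>'], rule exI[of _ ?Q], rule exI[of _ ?R],
        rule exI[of _ \<rho>], rule exI[of _ "ball 0 \<delta>"], rule exI[of _ \<rho>'], rule all)
qed

end
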